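(* Let $f$ be a positive integer with $f\not\equiv 2\bmod 4$. Then the sign-homology of $U(f)$ is canonically isomorphic, as a graded abelian group, to the Farrell-Tate homology $\hat H_*(\Gamma_f)$ of the subgroup $\Gamma_f\subset\mathbf{Q}^\times$ generated by $-1$ and the primes dividing $f$.
   Context: For a positive integer $f$, $U(f)$ (the universal level $f$ ordinary distribution) is the quotient of the free abelian group on symbols $[a]$, $a\in\frac1f\mathbf{Z}/\mathbf{Z}$, by the subgroup generated by the elements $[a]-\sum_{i=0}^{g-1}\left[\frac{a+i}{g}\right]$, where $g$ is a positive integer dividing $f$ and $a\in\frac gf\mathbf{Z}$. The group $G_\infty$ of order $2$ generated by complex conjugation acts on $U(f)$ by $[a]\mapsto[-a]$. The sign-homology of a $G_\infty$-module $M$ is the Tate homology of $G_\infty$ with coefficients in $M$, concretely the homology of the chain complex having $M$ in every degree $n\in\mathbf{Z}$ with differential from degree $n$ to $n-1$ equal to $1+\gamma_0$ for $n$ even and $1-\gamma_0$ for $n$ odd, where $\gamma_0$ is the generator. Farrell-Tate homology: let $\Gamma$ be a group of finite virtual cohomological dimension. A $\Gamma$-module is relatively projective if it is a direct summand of $\mathbf{Z}[\Gamma]\otimes_{\mathbf{Z}}N$ for some abelian group $N$. A resolution of a $\Gamma$-module $M$ (placed in degree $0$) is a chain map $P\to M$ of complexes of $\Gamma$-modules with $P$ concentrated in nonnegative degrees, each $P_n$ relatively projective, and mapping cone contractible as a complex of abelian groups. A completion of a complex $P$ of relatively projective modules is a chain map $\kappa:X\to P$ with all $X_n$ relatively projective,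 $X$ contractible as a complex of abelian groups, and $\kappa_n$ an isomorphism for $n\gg0$. Then $\hat H_*(\Gamma,M)$ is the homology of the $\Gamma$-coinvariants of a completion $X$ of a resolution of $M$, and $\hat H_*(\Gamma):=\hat H_*(\Gamma,\mathbf{Z})$ with trivial action on $\mathbf{Z}$. *)

theory Defs
  imports
    "HOL-Algebra.Free_Abelian_Groups"
    "HOL-Algebra.Sym_Groups"
    "HOL-Computational_Algebra.Primes"
begin

text \<open>Following \<^theory>\<open>HOL-Algebra.Free_Abelian_Groups\<close>, abelian groups are commutative
  groups in the sense of HOL-Algebra and are written multiplicatively; maps only matter on
  carriers.\<close>

section \<open>Modules over a group\<close>

record ('g, 'a) gmod = "'a monoid" +
  act :: "'g \<Rightarrow> 'a \<Rightarrow> 'a"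

definition with_action :: "('a, 'm) monoid_scheme \<Rightarrow> ('g \<Rightarrow> 'a \<Rightarrow> 'a) \<Rightarrow> ('g, 'a) gmod" where
  "with_action A \<alpha> = \<lparr>carrier = carrier A, monoid.mult = monoid.mult A, one = one A, act = \<alpha>\<rparr>"

locale gmodule = G: group G + M: comm_group M
  for G :: "'g monoid" and M :: "('g, 'a) gmod" +
  assumes act_hom: "g \<in> carrier G \<Longrightarrow> act M g \<in> hom M M"
    and act_one: "x \<in> carrier M \<Longrightarrow> act M \<one>\<^bsub>G\<^esub> x = x"
    and act_mult: "\<lbrakk>g \<in> carrier G; h \<in> carrier G; x \<in> carrier M\<rbrakk>
      \<Longrightarrow> act M (g \<otimes>\<^bsub>G\<^esub> h) x = act M g (act M h x)"

definition ghom :: "'g monoid \<Rightarrow> ('g, 'a) gmod \<Rightarrow> ('g, 'b) gmod \<Rightarrow> ('a \<Rightarrow> 'b) set" where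
  "ghom G M N = {h \<in> hom M N. \<forall>g\<in>carrier G. \<forall>x\<in>carrier M. h (act M g x) = act N g (h x)}"

definition giso :: "'g monoid \<Rightarrow> ('g, 'a) gmod \<Rightarrow> ('g, 'b) gmod \<Rightarrow> ('a \<Rightarrow> 'b) set" where
  "giso G M N = ghom G M N \<inter> iso M N"

definition trivial_gmod :: "('a, 'm) monoid_scheme \<Rightarrow> ('g, 'a) gmod" where
  "trivial_gmod A = with_action A (\<lambda>g x. x)"

definition gmod_prod :: "('g, 'a) gmod \<Rightarrow> ('g, 'b) gmod \<Rightarrow> ('g, 'a \<times> 'b) gmod" where
  "gmod_prod M N = with_action (M \<times>\<times> N) (\<lambda>g (x, y). (act M g x, act N g y))"

text \<open>\<open>\<int>[G] \<otimes>\<^sub>\<int> N\<close> is realised as the group of finitely supported functions \<open>G \<rightarrow> N\<close>: the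
  tensor \<open>h \<otimes> n\<close> is the function with value \<open>n\<close> at \<open>h\<close> and neutral elsewhere, so that \<open>g\<close>
  sends it to \<open>(g h) \<otimes> n\<close>.\<close>

definition induced_gmod :: "'g monoid \<Rightarrow> 'a monoid \<Rightarrow> ('g, 'g \<Rightarrow> 'a) gmod" where
  "induced_gmod G N = with_action (sum_group (carrier G) (\<lambda>_. N))
     (\<lambda>g x. \<lambda>h\<in>carrier G. x (inv\<^bsub>G\<^esub> g \<otimes>\<^bsub>G\<^esub> h))"

text \<open>The types chosen for \<open>N\<close> and the complement \<open>M'\<close> lose no generality: if \<open>M\<close> is a direct
  summand of \<open>\<int>[G] \<otimes> N\<close> for some \<open>N\<close> at all, then the action map \<open>\<int>[G] \<otimes> M \<rightarrow> M\<close> splits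
  equivariantly, so \<open>N\<close> may be taken to be the underlying group of \<open>M\<close>; and a complement is
  isomorphic to a submodule of \<open>\<int>[G] \<otimes> N\<close>.\<close>

definition relatively_projective :: "'g monoid \<Rightarrow> ('g, 'a) gmod \<Rightarrow> bool" where
  "relatively_projective G M \<longleftrightarrow> gmodule G M \<and>
     (\<exists>(N :: 'a monoid) (M' :: ('g, 'g \<Rightarrow> 'a) gmod). comm_group N \<and> gmodule G M' \<and>
        giso G (gmod_prod M M') (induced_gmod G N) \<noteq> {})"

section \<open>Chain complexes\<close>

text \<open>A complex is given by its terms \<open>C n\<close> and differentials \<open>d n : C n \<rightarrow> C (n - 1)\<close>.\<close>

definition contractible_ab :: "(int \<Rightarrow> ('a, 'm) monoid_scheme) \<Rightarrow> (int \<Rightarrow> 'a \<Rightarrow> 'a) \<Rightarrow> bool" where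
  "contractible_ab C d \<longleftrightarrow> (\<exists>s. \<forall>n. s n \<in> hom (C n) (C (n + 1)) \<and>
     (\<forall>x\<in>carrier (C n). d (n + 1) (s n x) \<otimes>\<^bsub>C n\<^esub> s (n - 1) (d n x) = x))"

definition cone_obj :: "(int \<Rightarrow> ('a, 'm) monoid_scheme) \<Rightarrow> (int \<Rightarrow> ('b, 'k) monoid_scheme)
    \<Rightarrow> int \<Rightarrow> ('a \<times> 'b) monoid" where
  "cone_obj C D n = C (n - 1) \<times>\<times> D n"

definition cone_bd :: "(int \<Rightarrow> ('a, 'm) monoid_scheme) \<Rightarrow> (int \<Rightarrow> 'a \<Rightarrow> 'a)
    \<Rightarrow> (int \<Rightarrow> ('b, 'k) monoid_scheme) \<Rightarrow> (int \<Rightarrow> 'b \<Rightarrow> 'b) \<Rightarrow> (int \<Rightarrow> 'a \<Rightarrow> 'b)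
    \<Rightarrow> int \<Rightarrow> 'a \<times> 'b \<Rightarrow> 'a \<times> 'b" where
  "cone_bd C c D d \<phi> n = (\<lambda>(x, y).
     (inv\<^bsub>C (n - 2)\<^esub> (c (n - 1) x), \<phi> (n - 1) x \<otimes>\<^bsub>D (n - 1)\<^esub> d n y))"

definition boundaries :: "(int \<Rightarrow> ('a, 'm) monoid_scheme) \<Rightarrow> (int \<Rightarrow> 'a \<Rightarrow> 'a) \<Rightarrow> int \<Rightarrow> 'a set" where
  "boundaries C d n = d (n + 1) ` carrier (C (n + 1))"

definition chain_homology :: "(int \<Rightarrow> ('a, 'm) monoid_scheme) \<Rightarrow> (int \<Rightarrow> 'a \<Rightarrow> 'a) \<Rightarrow> int \<Rightarrow> 'a set monoid"
  where "chain_homology C d n =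
    (C n)\<lparr>carrier := kernel (C n) (C (n - 1)) (d n)\<rparr> Mod boundaries C d n"

text \<open>The map of quotients induced by a homomorphism \<open>h\<close> to \<open>B\<close>, when the target is taken modulo
  the subgroup \<open>L\<close> and \<open>h\<close> maps the subgroup divided out in the source into \<open>L\<close>.\<close>

definition quot_map :: "('b, 'k) monoid_scheme \<Rightarrow> 'b set \<Rightarrow> ('a \<Rightarrow> 'b) \<Rightarrow> 'a set \<Rightarrow> 'b set" where
  "quot_map B L h c = L <#>\<^bsub>B\<^esub> (h ` c)"

record ('g, 'a) gcomplex =
  obj :: "int \<Rightarrow> ('g, 'a) gmod"
  bd :: "int \<Rightarrow> 'a \<Rightarrow> 'a"

definition is_gcomplex :: "'g monoid \<Rightarrow> ('g, 'a) gcomplex \<Rightarrow> bool" where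
  "is_gcomplex G C \<longleftrightarrow> (\<forall>n. gmodule G (obj C n) \<and> bd C n \<in> ghom G (obj C n) (obj C (n - 1)) \<and>
     (\<forall>x\<in>carrier (obj C n). bd C (n - 1) (bd C n x) = \<one>\<^bsub>obj C (n - 2)\<^esub>))"

definition gchain_map :: "'g monoid \<Rightarrow> ('g, 'a) gcomplex \<Rightarrow> ('g, 'b) gcomplex
    \<Rightarrow> (int \<Rightarrow> 'a \<Rightarrow> 'b) \<Rightarrow> bool" where
  "gchain_map G C D \<phi> \<longleftrightarrow> (\<forall>n. \<phi> n \<in> ghom G (obj C n) (obj D n) \<and>
     (\<forall>x\<in>carrier (obj C n). \<phi> (n - 1) (bd C n x) = bd D n (\<phi> n x)))"

definition in_degree_0 :: "('g, 'a) gmod \<Rightarrow> ('g, 'a) gcomplex" where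
  "in_degree_0 M = \<lparr>obj = (\<lambda>n. if n = 0 then M else M\<lparr>carrier := {\<one>\<^bsub>M\<^esub>}\<rparr>), bd = (\<lambda>n x. \<one>\<^bsub>M\<^esub>)\<rparr>"

section \<open>Farrell-Tate homology\<close>

definition resolution :: "'g monoid \<Rightarrow> ('g, 'm) gmod \<Rightarrow> ('g, 'p) gcomplex \<Rightarrow> (int \<Rightarrow> 'p \<Rightarrow> 'm) \<Rightarrow> bool"
  where "resolution G M P \<epsilon> \<longleftrightarrow> gmodule G M \<and> is_gcomplex G P \<and>
    (\<forall>n<0. carrier (obj P n) = {\<one>\<^bsub>obj P n\<^esub>}) \<and>
    (\<forall>n. relatively_projective G (obj P n)) \<and>
    gchain_map G P (in_degree_0 M) \<epsilon> \<and>
    contractible_ab (cone_obj (obj P) (obj (in_degree_0 M)))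
      (cone_bd (obj P) (bd P) (obj (in_degree_0 M)) (bd (in_degree_0 M)) \<epsilon>)"

definition completion :: "'g monoid \<Rightarrow> ('g, 'p) gcomplex \<Rightarrow> ('g, 'x) gcomplex \<Rightarrow> (int \<Rightarrow> 'x \<Rightarrow> 'p) \<Rightarrow> bool"
  where "completion G P X \<kappa> \<longleftrightarrow> is_gcomplex G X \<and>
    (\<forall>n. relatively_projective G (obj X n)) \<and>
    contractible_ab (obj X) (bd X) \<and>
    gchain_map G X P \<kappa> \<and>
    (\<exists>N. \<forall>n\<ge>N. \<kappa> n \<in> giso G (obj X n) (obj P n))"

definition completed_resolution :: "'g monoid \<Rightarrow> ('g, 'm) gmod \<Rightarrow> ('g, 'p) gcomplex \<Rightarrow> (int \<Rightarrow> 'p \<Rightarrow> 'm)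
    \<Rightarrow> ('g, 'x) gcomplex \<Rightarrow> (int \<Rightarrow> 'x \<Rightarrow> 'p) \<Rightarrow> bool" where
  "completed_resolution G M P \<epsilon> X \<kappa> \<longleftrightarrow> resolution G M P \<epsilon> \<and> completion G P X \<kappa>"

definition coinv_sub :: "'g monoid \<Rightarrow> ('g, 'a) gmod \<Rightarrow> 'a set" where
  "coinv_sub G M = generate M {act M g x \<otimes>\<^bsub>M\<^esub> inv\<^bsub>M\<^esub> x | g x. g \<in> carrier G \<and> x \<in> carrier M}"

definition coinvariants :: "'g monoid \<Rightarrow> ('g, 'a) gmod \<Rightarrow> 'a set monoid" where
  "coinvariants G M = M Mod coinv_sub G M"

definition coinv_obj :: "'g monoid \<Rightarrow> ('g, 'a) gcomplex \<Rightarrow> int \<Rightarrow> 'a set monoid" where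
  "coinv_obj G X n = coinvariants G (obj X n)"

definition coinv_bd :: "'g monoid \<Rightarrow> ('g, 'a) gcomplex \<Rightarrow> int \<Rightarrow> 'a set \<Rightarrow> 'a set" where
  "coinv_bd G X n = quot_map (obj X (n - 1)) (coinv_sub G (obj X (n - 1))) (bd X n)"

text \<open>If \<open>X\<close> is a completion of a resolution of \<open>M\<close>, then \<open>coinv_homology G X n\<close> is the
  Farrell-Tate homology group of \<open>G\<close> with coefficients in \<open>M\<close> in degree \<open>n\<close>, as computed by \<open>X\<close>.\<close>

definition coinv_homology :: "'g monoid \<Rightarrow> ('g, 'a) gcomplex \<Rightarrow> int \<Rightarrow> 'a set set monoid" where
  "coinv_homology G X = chain_homology (coinv_obj G X) (coinv_bd G X)"

definition coinv_homology_map :: "'g monoid \<Rightarrow> ('g, 'b) gcomplex \<Rightarrow> (int \<Rightarrow> 'a \<Rightarrow> 'b)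
    \<Rightarrow> int \<Rightarrow> 'a set set \<Rightarrow> 'b set set" where
  "coinv_homology_map G Y \<theta> n =
     quot_map (coinv_obj G Y n) (boundaries (coinv_obj G Y) (coinv_bd G Y) n)
       (quot_map (obj Y n) (coinv_sub G (obj Y n)) (\<theta> n))"

text \<open>Two completed resolutions of the same module are compared by a chain map \<open>\<phi>\<close> of resolutions
  over the identity of the module together with a chain map \<open>\<theta>\<close> of completions which lies over
  \<open>\<phi>\<close> in all sufficiently large degrees.  The maps induced by such \<open>\<theta>\<close> are the canonical
  identifications between the Farrell-Tate homology groups computed from different choices.\<close>

definition comparison :: "'g monoid \<Rightarrow> ('g, 'p) gcomplex \<Rightarrow> (int \<Rightarrow> 'p \<Rightarrow> 'm) \<Rightarrow> ('g, 'x) gcomplex \<Rightarrow> (int \<Rightarrow> 'x \<Rightarrow> 'p)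
    \<Rightarrow> ('g, 'q) gcomplex \<Rightarrow> (int \<Rightarrow> 'q \<Rightarrow> 'm) \<Rightarrow> ('g, 'y) gcomplex \<Rightarrow> (int \<Rightarrow> 'y \<Rightarrow> 'q)
    \<Rightarrow> (int \<Rightarrow> 'p \<Rightarrow> 'q) \<Rightarrow> (int \<Rightarrow> 'x \<Rightarrow> 'y) \<Rightarrow> bool" where
  "comparison G P \<epsilon> X \<kappa> Q \<epsilon>' Y \<kappa>' \<phi> \<theta> \<longleftrightarrow>
     gchain_map G P Q \<phi> \<and> (\<forall>n. \<forall>x\<in>carrier (obj P n). \<epsilon>' n (\<phi> n x) = \<epsilon> n x) \<and>
     gchain_map G X Y \<theta> \<and>
     (\<exists>N. \<forall>n\<ge>N. \<forall>x\<in>carrier (obj X n). \<kappa>' n (\<theta> n x) = \<phi> n (\<kappa> n x))"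

section \<open>Sign-homology\<close>

text \<open>The group generated by complex conjugation is \<^const>\<open>sign_img\<close>, with underlying set
  \<open>{1, -1}\<close> and \<open>-1\<close> in the role of complex conjugation.\<close>

definition sign_bd :: "(int, 'a) gmod \<Rightarrow> int \<Rightarrow> 'a \<Rightarrow> 'a" where
  "sign_bd M n x = (if even n then x \<otimes>\<^bsub>M\<^esub> act M (-1) x else x \<otimes>\<^bsub>M\<^esub> inv\<^bsub>M\<^esub> (act M (-1) x))"

definition sign_homology :: "(int, 'a) gmod \<Rightarrow> int \<Rightarrow> 'a set monoid" where
  "sign_homology M = chain_homology (\<lambda>_. M) (sign_bd M)"

section \<open>The universal ordinary distribution\<close>

definition qmodz :: "rat \<Rightarrow> rat set" where
  "qmodz a = (+) a ` \<int>"

definition dist_symbols :: "nat \<Rightarrow> rat set set" where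
  "dist_symbols f = {qmodz (of_int k / of_nat f) | k. True}"

definition dist_relations :: "nat \<Rightarrow> (rat set \<Rightarrow>\<^sub>0 int) set" where
  "dist_relations f =
     {frag_of (qmodz a) - (\<Sum>i<g. frag_of (qmodz ((a + of_nat i) / of_nat g))) | g a.
        g > 0 \<and> g dvd f \<and> (\<exists>k::int. a = of_int k * (of_nat g / of_nat f))}"

definition dist_relation_sub :: "nat \<Rightarrow> (rat set \<Rightarrow>\<^sub>0 int) set" where
  "dist_relation_sub f = generate (free_Abelian_group (dist_symbols f)) (dist_relations f)"

definition univ_dist :: "nat \<Rightarrow> (int, (rat set \<Rightarrow>\<^sub>0 int) set) gmod" where
  "univ_dist f = with_action (free_Abelian_group (dist_symbols f) Mod dist_relation_sub f)
     (\<lambda>\<sigma>. quot_map (free_Abelian_group (dist_symbols f)) (dist_relation_sub f)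
       (frag_extend (\<lambda>s. frag_of ((\<lambda>x. of_int \<sigma> * x) ` s))))"

section \<open>The group generated by \<open>-1\<close> and the primes dividing \<open>f\<close>\<close>

definition rat_mult_group :: "rat monoid" where
  "rat_mult_group = \<lparr>carrier = UNIV - {0}, monoid.mult = (*), one = 1\<rparr>"

definition Gamma_group :: "nat \<Rightarrow> rat monoid" where
  "Gamma_group f = subgroup_generated rat_mult_group
     (insert (-1) {of_nat p | p :: nat. Factorial_Ring.prime p \<and> p dvd f})"

end

theory Submission
  imports Defs "HOL-Library.Function_Algebras" "HOL-Number_Theory.Cong"
begin

text \<open>A group \<open>\<Gamma>\<close> generated by \<open>-1\<close> and primes \<open>p\<close> is the product of the group of order two and a free
  abelian group, so the total complex of the Tate complex of \<open>-1\<close> and the Koszul complex of the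
  operators \<open>1 - p\<close> on \<open>\<int>[\<Gamma>]\<close> is contractible, and its part of nonnegative Tate degree resolves \<open>\<int>\<close>.
  On coinvariants all operators \<open>1 - p\<close> become zero and \<open>-1\<close> acts trivially.

  On the other side, \<open>U(f)\<close> is resolved by a Koszul complex on free abelian groups of symbols whose
  operators are the distribution relations at the primes dividing \<open>f\<close>, and its sign-homology is the
  homology of the total complex with the Tate complex of complex conjugation.  The coefficient of
  the symbol \<open>[0]\<close> maps this complex onto the complex of coinvariants.  The kernel is acyclic, since
  conjugation permutes the symbols other than \<open>[0]\<close> and \<open>[1/2]\<close> freely, while \<open>[1/2]\<close> is cancelled
  by the relation at \<open>2\<close>; this is where \<open>f mod 4 \<noteq> 2\<close> enters.

  The identification is canonical because completed resolutions can be compared up to homotopy: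
  equivariant maps are the invariants of \<open>\<Gamma>\<close> on all homomorphisms, and exactness on invariants is
  obtained one generator of \<open>\<Gamma>\<close> at a time.\<close>

section \<open>Exactness on invariants\<close>

text \<open>The hard point is that the relation at one prime stays injective modulo the relations at
  the others. In terms of f-periodic functions the relation at p is \<open>x k - x (p * k)\<close>,
  for x supported on multiples of p; this support condition is why every component of the Koszul
  complex carries a level. In a fibre of multiplication by p exactly one residue has leading digit
  one with respect to the power of p in f, and eliminating it gives a normal form. Digit one is
  chosen rather than zero because 0 lies in its own fibre, so eliminating it would not terminate.
  The primes interfere, since multiplication by p moves the digits at other primes; a unit inverting
  p away from p corrects this.

  On the side of \<Gamma>, relative projectivity enters only through additive cut-offs to subsets of
  \<Gamma>. They make \<open>t - 1\<close> surjective on homomorphisms by sums that are finite at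
  each element, though not uniformly.

  The statement cannot quantify over types, so the canonical identification is a family over all
  completed resolutions on two given types, compatible with comparisons; a model on a concrete type
  shows separately that completed resolutions exist.\<close>

lemma (in comm_group) mult_inv_cancel_swap:
  assumes "a \<in> carrier G" "d \<in> carrier G" "b \<in> carrier G"
  shows "a \<otimes> inv (d \<otimes> (a \<otimes> inv b)) = b \<otimes> inv d"
proof -
  have "a \<otimes> inv (d \<otimes> (a \<otimes> inv b)) = a \<otimes> (inv d \<otimes> (inv a \<otimes> b))"
    using assms by (simp add: inv_mult)
  also have "\<dots> = (a \<otimes> inv a) \<otimes> (b \<otimes> inv d)"
    using assms by (simp only: m_ac m_closed inv_closed)
  finally show ?thesis using assms by simp
qed

text \<open>In additive terms: a primitive \<open>v0\<close> fixed by S misses being fixed by t by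
  the cocycle \<open>C t v0 - v0\<close>, which has an S-fixed primitive \<open>v1\<close>. Solving
  \<open>(C t - 1) w = v1\<close> among S-fixed elements and subtracting \<open>\<delta> w\<close>
  from \<open>v0\<close> repairs this. So \<open>solve\<close> expresses that each generator has no
  first cohomology on the invariants of the others.\<close>

lemma exact_on_invariants:
  fixes E :: "int \<Rightarrow> ('e, 'm) monoid_scheme" and C :: "'g \<Rightarrow> int \<Rightarrow> 'e \<Rightarrow> 'e"
  assumes E: "\<And>k. comm_group (E k)"
    and \<delta>: "\<And>k. \<delta> k \<in> hom (E k) (E (k + 1))"
    and \<delta>\<delta>: "\<And>k u. u \<in> carrier (E k) \<Longrightarrow> \<delta> (k + 1) (\<delta> k u) = \<one>\<^bsub>E (k + 1 + 1)\<^esub>"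
    and C: "\<And>t k. t \<in> T \<Longrightarrow> C t k \<in> hom (E k) (E k)"
    and C\<delta>: "\<And>t k u. \<lbrakk>t \<in> T; u \<in> carrier (E k)\<rbrakk> \<Longrightarrow> C t (k + 1) (\<delta> k u) = \<delta> k (C t k u)"
    and CC: "\<And>s t k u. \<lbrakk>s \<in> T; t \<in> T; u \<in> carrier (E k)\<rbrakk> \<Longrightarrow> C s k (C t k u) = C t k (C s k u)"
    and ex: "\<And>k u. \<lbrakk>u \<in> carrier (E (k + 1)); \<delta> (k + 1) u = \<one>\<^bsub>E (k + 1 + 1)\<^esub>\<rbrakk>
      \<Longrightarrow> \<exists>v\<in>carrier (E k). \<delta> k v = u"
    and solve: "\<And>t S k v. \<lbrakk>t \<in> T; S \<subseteq> T - {t}; v \<in> carrier (E k); \<forall>s\<in>S. C s k v = v\<rbrakk>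
      \<Longrightarrow> \<exists>w\<in>carrier (E k). (\<forall>s\<in>S. C s k w = w) \<and> C t k w = w \<otimes>\<^bsub>E k\<^esub> v"
    and "finite S" "S \<subseteq> T" "u \<in> carrier (E (k + 1))" "\<delta> (k + 1) u = \<one>\<^bsub>E (k + 1 + 1)\<^esub>"
      "\<forall>s\<in>S. C s (k + 1) u = u"
  shows "\<exists>v\<in>carrier (E k). \<delta> k v = u \<and> (\<forall>s\<in>S. C s k v = v)"
  using assms(9-)
proof (induction S arbitrary: k u rule: finite_induct)
  case empty
  then show ?case using ex by blast
next
  case (insert t S)
  interpret Ek: comm_group "E k" by (rule E)
  interpret Ek1: comm_group "E (k + 1)" by (rule E)
  interpret Ekm: comm_group "E (k - 1)" by (rule E)
  interpret d: group_hom "E k" "E (k + 1)" "\<delta> k"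
    using \<delta> by unfold_locales auto
  have t: "t \<in> T" and S: "S \<subseteq> T" and St: "S \<subseteq> T - {t}" using insert by auto
  obtain v0 where v0: "v0 \<in> carrier (E k)" "\<delta> k v0 = u" "\<forall>s\<in>S. C s k v0 = v0"
    using insert.IH[of u k] insert.prems by auto
  interpret c: group_hom "E k" "E k" "C t k"
    using C t by unfold_locales auto
  define u1 where "u1 = C t k v0 \<otimes>\<^bsub>E k\<^esub> inv\<^bsub>E k\<^esub> v0"
  have u1: "u1 \<in> carrier (E k)" using v0 by (simp add: u1_def)
  have Cv0: "\<delta> k (C t k v0) = u" using C\<delta>[OF t v0(1)] insert.prems v0 by auto
  have "\<delta> k u1 = \<one>\<^bsub>E (k + 1)\<^esub>"
    using v0 Cv0 by (simp add: u1_def) (metis Ek1.r_inv v0 d.hom_closed)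
  moreover have "\<forall>s\<in>S. C s k u1 = u1"
  proof
    fix s assume s: "s \<in> S"
    interpret cs: group_hom "E k" "E k" "C s k"
      using C s S by unfold_locales auto
    show "C s k u1 = u1"
      using CC[of s t v0 k] s S t v0 by (auto simp: u1_def)
  qed
  \<comment> \<open>The induction hypothesis is used a second time, one degree lower, which is why k
    is generalized and the complex is indexed by all integers.\<close>
  ultimately obtain v1 where v1: "v1 \<in> carrier (E (k - 1))" "\<delta> (k - 1) v1 = u1" "\<forall>s\<in>S. C s (k - 1) v1 = v1"
    using insert.IH[of u1 "k - 1"] u1 S by auto
  obtain w where w: "w \<in> carrier (E (k - 1))" "\<forall>s\<in>S. C s (k - 1) w = w" "C t (k - 1) w = w \<otimes>\<^bsub>E (k - 1)\<^esub> v1"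
    using solve[OF t St v1(1) v1(3)] by blast
  have dh: "\<delta> (k - 1) \<in> hom (E (k - 1)) (E k)" using \<delta>[of "k - 1"] by simp
  interpret d1: group_hom "E (k - 1)" "E k" "\<delta> (k - 1)"
    using dh by unfold_locales auto
  have Cd: "C s k (\<delta> (k - 1) w) = \<delta> (k - 1) (C s (k - 1) w)" if "s \<in> T" for s
    using C\<delta>[OF that, of w "k - 1"] w by simp
  define v where "v = v0 \<otimes>\<^bsub>E k\<^esub> inv\<^bsub>E k\<^esub> (\<delta> (k - 1) w)"
  have "v \<in> carrier (E k)" using v0 w by (simp add: v_def)
  moreover have "\<delta> k v = u"
    using \<delta>\<delta>[of w "k - 1"] v0 w insert.prems by (simp add: v_def)
  moreover have "C t k v = v"
  proof -
    have "C t k v = C t k v0 \<otimes>\<^bsub>E k\<^esub> inv\<^bsub>E k\<^esub> (\<delta> (k - 1) w \<otimes>\<^bsub>E k\<^esub> u1)"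
      using v0 w v1 Cd[OF t] by (simp add: v_def)
    also have "\<dots> = v"
      using Ek.mult_inv_cancel_swap[of "C t k v0" "\<delta> (k - 1) w" v0] v0 w by (simp add: v_def u1_def)
    finally show ?thesis .
  qed
  moreover have "C s k v = v" if s: "s \<in> S" for s
  proof -
    interpret cs: group_hom "E k" "E k" "C s k"
      using C s S by unfold_locales auto
    show ?thesis using v0 w Cd s S by (auto simp: v_def)
  qed
  ultimately show ?case by auto
qed

text \<open>The equation of \<open>solve\<close> has no solution in general for an involution, so T
  is handled first and c by averaging. The operator \<open>e\<close> plays the role of one half:
  \<open>e + c e\<close> is the identity on c-fixed elements. As \<open>e\<close> commutes with
  \<delta>, the norm of \<open>e v0\<close> is still a primitive of u, and it is fixed by c.\<close>

lemma exact_on_invariants_involution: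
  fixes E :: "int \<Rightarrow> ('e, 'm) monoid_scheme"
  assumes E: "\<And>k. comm_group (E k)"
    and \<delta>: "\<And>k. \<delta> k \<in> hom (E k) (E (k + 1))"
    and \<delta>\<delta>: "\<And>k u. u \<in> carrier (E k) \<Longrightarrow> \<delta> (k + 1) (\<delta> k u) = \<one>\<^bsub>E (k + 1 + 1)\<^esub>"
    and C: "\<And>t k. t \<in> insert c T \<Longrightarrow> C t k \<in> hom (E k) (E k)"
    and C\<delta>: "\<And>t k u. \<lbrakk>t \<in> insert c T; u \<in> carrier (E k)\<rbrakk> \<Longrightarrow> C t (k + 1) (\<delta> k u) = \<delta> k (C t k u)"
    and CC: "\<And>s t k u. \<lbrakk>s \<in> insert c T; t \<in> insert c T; u \<in> carrier (E k)\<rbrakk> \<Longrightarrow> C s k (C t k u) = C t k (C s k u)"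
    and ex: "\<And>k u. \<lbrakk>u \<in> carrier (E (k + 1)); \<delta> (k + 1) u = \<one>\<^bsub>E (k + 1 + 1)\<^esub>\<rbrakk>
      \<Longrightarrow> \<exists>v\<in>carrier (E k). \<delta> k v = u"
    and solve: "\<And>t S k v. \<lbrakk>t \<in> T; S \<subseteq> T - {t}; v \<in> carrier (E k); \<forall>s\<in>S. C s k v = v\<rbrakk>
      \<Longrightarrow> \<exists>w\<in>carrier (E k). (\<forall>s\<in>S. C s k w = w) \<and> C t k w = w \<otimes>\<^bsub>E k\<^esub> v"
    and inv: "\<And>k u. u \<in> carrier (E k) \<Longrightarrow> C c k (C c k u) = u"
    and e: "\<And>k. e k \<in> hom (E k) (E k)"
    and e\<delta>: "\<And>k u. u \<in> carrier (E k) \<Longrightarrow> e (k + 1) (\<delta> k u) = \<delta> k (e k u)"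
    and eC: "\<And>t k u. \<lbrakk>t \<in> T; u \<in> carrier (E k)\<rbrakk> \<Longrightarrow> C t k (e k u) = e k (C t k u)"
    and ee: "\<And>k u. \<lbrakk>u \<in> carrier (E k); C c k u = u\<rbrakk> \<Longrightarrow> e k u \<otimes>\<^bsub>E k\<^esub> C c k (e k u) = u"
    and T: "finite T" and u: "u \<in> carrier (E (k + 1))" "\<delta> (k + 1) u = \<one>\<^bsub>E (k + 1 + 1)\<^esub>"
      "\<forall>s\<in>insert c T. C s (k + 1) u = u"
  shows "\<exists>v\<in>carrier (E k). \<delta> k v = u \<and> (\<forall>s\<in>insert c T. C s k v = v)"
proof -
  have "\<exists>v\<in>carrier (E k). \<delta> k v = u \<and> (\<forall>s\<in>T. C s k v = v)"
    by (rule exact_on_invariants[where E = E and \<delta> = \<delta> and T = T and C = C])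
      (use assms in \<open>auto simp del: One_nat_def\<close>)
  then obtain v0 where v0: "v0 \<in> carrier (E k)" "\<delta> k v0 = u" "\<forall>s\<in>T. C s k v0 = v0" by blast
  interpret Ek: comm_group "E k" by (rule E)
  interpret Ek1: comm_group "E (k + 1)" by (rule E)
  interpret d: group_hom "E k" "E (k + 1)" "\<delta> k"
    using \<delta> by unfold_locales auto
  interpret cc: group_hom "E k" "E k" "C c k" using C by unfold_locales auto
  interpret ek: group_hom "E k" "E k" "e k" using e by unfold_locales auto
  define v where "v = e k v0 \<otimes>\<^bsub>E k\<^esub> C c k (e k v0)"
  have "v \<in> carrier (E k)" using v0 by (simp add: v_def)
  moreover have "\<delta> k v = u"
  proof -
    have "\<delta> k v = e (k + 1) u \<otimes>\<^bsub>E (k + 1)\<^esub> C c (k + 1) (e (k + 1) u)"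
      using v0 C\<delta>[of c "e k v0" k] e\<delta>[of v0 k] by (simp add: v_def)
    thus ?thesis using ee u by simp
  qed
  moreover have "C c k v = v"
    using v0 inv[of "e k v0" k] by (simp add: v_def Ek.m_comm)
  moreover have "C s k v = v" if s: "s \<in> T" for s
  proof -
    interpret cs: group_hom "E k" "E k" "C s k"
      using C s by unfold_locales auto
    show ?thesis using v0 s eC[OF s v0(1)] CC[of s c "e k v0" k] by (auto simp: v_def)
  qed
  ultimately show ?thesis by auto
qed

section \<open>Groups of homomorphisms\<close>

text \<open>Extensionality makes equality in this group the same as equality on
  \<open>carrier M\<close>, so that invariance can be stated as an equation.\<close>

definition hom_group :: "('a, 'm) monoid_scheme \<Rightarrow> ('b, 'n) monoid_scheme \<Rightarrow> ('a \<Rightarrow> 'b) monoid" where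
  "hom_group M N = \<lparr>carrier = hom M N \<inter> extensional (carrier M),
     monoid.mult = (\<lambda>u v. \<lambda>x\<in>carrier M. u x \<otimes>\<^bsub>N\<^esub> v x), one = (\<lambda>x\<in>carrier M. \<one>\<^bsub>N\<^esub>)\<rparr>"

lemma restrict_in_hom: "group M \<Longrightarrow> u \<in> hom M N \<Longrightarrow> (\<lambda>x\<in>carrier M. u x) \<in> hom M N"
  by (auto simp: hom_def Pi_def group.is_monoid monoid.m_closed)

lemma hom_group_closed: "u \<in> carrier (hom_group M N) \<Longrightarrow> x \<in> carrier M \<Longrightarrow> u x \<in> carrier N"
  by (auto simp: hom_group_def hom_def)

lemma comm_group_hom_group:
  assumes "group M" "comm_group N"
  shows "comm_group (hom_group M N)"
proof -
  interpret M: group M by fact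
  interpret N: comm_group N by fact
  note cl = hom_group_closed[unfolded hom_group_def, simplified]
  show ?thesis
  proof (rule comm_groupI)
    fix x y assume "x \<in> carrier (hom_group M N)" "y \<in> carrier (hom_group M N)"
    then show "x \<otimes>\<^bsub>hom_group M N\<^esub> y \<in> carrier (hom_group M N)"
      by (auto simp: hom_group_def intro!: restrict_in_hom N.hom_group_mult assms)
  next
    show "\<one>\<^bsub>hom_group M N\<^esub> \<in> carrier (hom_group M N)"
      by (auto simp: hom_group_def hom_def)
  next
    fix x y z assume "x \<in> carrier (hom_group M N)" "y \<in> carrier (hom_group M N)" "z \<in> carrier (hom_group M N)"
    then show "x \<otimes>\<^bsub>hom_group M N\<^esub> y \<otimes>\<^bsub>hom_group M N\<^esub> z = x \<otimes>\<^bsub>hom_group M N\<^esub> (y \<otimes>\<^bsub>hom_group M N\<^esub> z)"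
      by (auto simp: hom_group_def N.m_assoc cl intro!: restrict_ext)
  next
    fix x y assume "x \<in> carrier (hom_group M N)" "y \<in> carrier (hom_group M N)"
    then show "x \<otimes>\<^bsub>hom_group M N\<^esub> y = y \<otimes>\<^bsub>hom_group M N\<^esub> x"
      by (auto simp: hom_group_def N.m_comm cl intro!: restrict_ext)
  next
    fix x assume "x \<in> carrier (hom_group M N)"
    then show "\<one>\<^bsub>hom_group M N\<^esub> \<otimes>\<^bsub>hom_group M N\<^esub> x = x"
      by (auto simp: hom_group_def cl fun_eq_iff extensional_def)
  next
    fix x assume x: "x \<in> carrier (hom_group M N)"
    have "(\<lambda>a. inv\<^bsub>N\<^esub> (x a)) \<in> hom M N"
      using x by (auto simp: hom_group_def hom_def Pi_def N.inv_mult)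
    hence "(\<lambda>a\<in>carrier M. inv\<^bsub>N\<^esub> (x a)) \<in> carrier (hom_group M N)"
      by (auto simp: hom_group_def intro!: restrict_in_hom assms)
    moreover have "(\<lambda>a\<in>carrier M. inv\<^bsub>N\<^esub> (x a)) \<otimes>\<^bsub>hom_group M N\<^esub> x = \<one>\<^bsub>hom_group M N\<^esub>"
      using x by (auto simp: hom_group_def cl intro!: restrict_ext N.l_inv)
    ultimately show "\<exists>y\<in>carrier (hom_group M N). y \<otimes>\<^bsub>hom_group M N\<^esub> x = \<one>\<^bsub>hom_group M N\<^esub>"
      by blast
  qed
qed

lemma hom_group_eqI:
  "\<lbrakk>u \<in> carrier (hom_group M N); v \<in> carrier (hom_group M N); \<And>x. x \<in> carrier M \<Longrightarrow> u x = v x\<rbrakk> \<Longrightarrow> u = v"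
  by (auto simp: hom_group_def intro: extensionalityI)

section \<open>Projections of relatively projective modules\<close>

text \<open>All that is used of relative projectivity: additive cut-offs \<open>\<pi> Z\<close> to
  subsets Z of the group, with splitting along complementary subsets, translation by group elements,
  and finite support of each element. They need not be idempotent, so they pass to direct
  summands.\<close>

definition proj_family :: "'g monoid \<Rightarrow> ('g, 'a) gmod \<Rightarrow> ('g set \<Rightarrow> 'a \<Rightarrow> 'a) \<Rightarrow> bool" where
  "proj_family G M \<pi> \<longleftrightarrow> (\<forall>Z. \<pi> Z \<in> hom M M) \<and>
     (\<forall>Z W x. Z \<inter> W = {} \<and> Z \<union> W = carrier G \<and> x \<in> carrier M \<longrightarrow> \<pi> Z x \<otimes>\<^bsub>M\<^esub> \<pi> W x = x) \<and>
     (\<forall>Z g x. g \<in> carrier G \<and> x \<in> carrier M \<longrightarrow>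
        \<pi> Z (act M g x) = act M g (\<pi> {h \<in> carrier G. g \<otimes>\<^bsub>G\<^esub> h \<in> Z} x)) \<and>
     (\<forall>x\<in>carrier M. \<exists>F. finite F \<and> (\<forall>Z. Z \<inter> F = {} \<longrightarrow> \<pi> Z x = \<one>\<^bsub>M\<^esub>))"

lemma proj_familyD:
  assumes "proj_family G M \<pi>"
  shows "Z \<inter> W = {} \<and> Z \<union> W = carrier G \<and> x \<in> carrier M \<Longrightarrow> \<pi> Z x \<otimes>\<^bsub>M\<^esub> \<pi> W x = x"
    and "g \<in> carrier G \<and> x \<in> carrier M \<Longrightarrow> \<pi> Z (act M g x) = act M g (\<pi> {h \<in> carrier G. g \<otimes>\<^bsub>G\<^esub> h \<in> Z} x)"
    and "x \<in> carrier M \<Longrightarrow> \<exists>F. finite F \<and> (\<forall>Z. Z \<inter> F = {} \<longrightarrow> \<pi> Z x = \<one>\<^bsub>M\<^esub>)"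
  using assms unfolding proj_family_def by (elim conjE, simp only: simp_thms)+

lemma gmod_simps [simp]:
  "carrier (with_action A \<alpha>) = carrier A" "monoid.mult (with_action A \<alpha>) = monoid.mult A"
  "one (with_action A \<alpha>) = one A" "act (with_action A \<alpha>) = \<alpha>"
  by (simp_all add: with_action_def)

lemma inv_with_action [simp]: "m_inv (with_action A \<alpha>) = m_inv A"
  by (simp add: m_inv_def fun_eq_iff)

lemma hom_with_action [simp]: "hom (with_action A \<alpha>) B = hom A B" "hom B (with_action A \<alpha>) = hom B A"
  by (simp_all add: hom_def)

lemma comm_group_cong:
  fixes A :: "('a, 'm) monoid_scheme" and B :: "('a, 'n) monoid_scheme"
  assumes "comm_group A" and [simp]: "carrier B = carrier A" "monoid.mult B = monoid.mult A" "one B = one A"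
  shows "comm_group B"
  by (rule comm_groupI) (use comm_groupE[OF assms(1)] in simp_all)

lemma comm_group_with_action [simp]: "comm_group (with_action A \<alpha>) = comm_group A"
  using comm_group_cong[of A "with_action A \<alpha>"] comm_group_cong[of "with_action A \<alpha>" A] by auto

lemma proj_family_induced:
  fixes G :: "'g monoid" and N :: "'a monoid"
  assumes "group G" "comm_group N"
  shows "proj_family G (induced_gmod G N) (\<lambda>Z x. \<lambda>h\<in>carrier G. if h \<in> Z then x h else \<one>\<^bsub>N\<^esub>)"
proof -
  interpret G: group G by fact
  interpret N: comm_group N by fact
  note cs = carrier_sum_group[of "carrier G" "\<lambda>_. N", OF N.is_group]
  have car: "(\<lambda>h\<in>carrier G. if h \<in> Z then x h else \<one>\<^bsub>N\<^esub>) \<in> carrier (sum_group (carrier G) (\<lambda>_. N))"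
    if "x \<in> carrier (sum_group (carrier G) (\<lambda>_. N))" for Z x
  proof -
    have "{i \<in> carrier G. (if i \<in> Z then x i else \<one>\<^bsub>N\<^esub>) \<noteq> \<one>\<^bsub>N\<^esub>} \<subseteq> {i \<in> carrier G. x i \<noteq> \<one>\<^bsub>N\<^esub>}" by auto
    moreover have "finite {i \<in> carrier G. x i \<noteq> \<one>\<^bsub>N\<^esub>}" using that by (simp add: cs)
    ultimately have "finite {i \<in> carrier G. (if i \<in> Z then x i else \<one>\<^bsub>N\<^esub>) \<noteq> \<one>\<^bsub>N\<^esub>}" by (rule finite_subset)
    with that show ?thesis
      by (auto simp: cs PiE_def Pi_def cong: conj_cong)
  qed
  have "(\<lambda>x. \<lambda>h\<in>carrier G. if h \<in> Z then x h else \<one>\<^bsub>N\<^esub>) \<in> hom (induced_gmod G N) (induced_gmod G N)" for Z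
    unfolding induced_gmod_def
    by (auto simp: car intro!: homI restrict_ext)
  moreover have "(\<lambda>h\<in>carrier G. if h \<in> Z then x h else \<one>\<^bsub>N\<^esub>) \<otimes>\<^bsub>induced_gmod G N\<^esub> (\<lambda>h\<in>carrier G. if h \<in> W then x h else \<one>\<^bsub>N\<^esub>) = x"
    if "Z \<inter> W = {}" "Z \<union> W = carrier G" "x \<in> carrier (induced_gmod G N)" for Z W x
    using that by (auto simp: induced_gmod_def cs PiE_def Pi_def extensional_def fun_eq_iff)
  moreover have "\<exists>F. finite F \<and> (\<forall>Z. Z \<inter> F = {} \<longrightarrow> (\<lambda>h\<in>carrier G. if h \<in> Z then x h else \<one>\<^bsub>N\<^esub>) = \<one>\<^bsub>induced_gmod G N\<^esub>)"
    if "x \<in> carrier (induced_gmod G N)" for x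
    using that by (intro exI[of _ "{h \<in> carrier G. x h \<noteq> \<one>\<^bsub>N\<^esub>}"])
      (auto simp: induced_gmod_def cs intro!: restrict_ext)
  ultimately show ?thesis
    unfolding proj_family_def
    by (auto simp: induced_gmod_def G.m_assoc[symmetric] intro!: restrict_ext)
qed

text \<open>The cut-offs of the large module are conjugated by the inclusion and the retraction; as
  these are additive and equivariant with composite the identity of M, each of the four clauses
  survives.\<close>

lemma proj_family_retract:
  assumes \<rho>: "proj_family G I \<rho>" and i: "i \<in> ghom G M I" and r: "r \<in> ghom G I M"
    and ri: "\<And>x. x \<in> carrier M \<Longrightarrow> r (i x) = x" and I: "gmodule G I" and M: "gmodule G M"
  shows "proj_family G M (\<lambda>Z x. r (\<rho> Z (i x)))"
proof -
  interpret I: gmodule G I by fact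
  interpret M: gmodule G M by fact
  have hr: "r \<in> hom I M" and hi: "i \<in> hom M I" using i r by (auto simp: ghom_def)
  have h\<rho>: "\<rho> Z \<in> hom I I" for Z using \<rho> by (auto simp: proj_family_def)
  have ic: "i x \<in> carrier I" if "x \<in> carrier M" for x using hi that by (auto simp: hom_def)
  have \<rho>c: "\<rho> Z x \<in> carrier I" if "x \<in> carrier I" for Z x using h\<rho> that by (auto simp: hom_def)
  have 1: "(\<lambda>x. r (\<rho> Z (i x))) \<in> hom M M" for Z
    using hr hi h\<rho>[of Z] by (auto simp: hom_def Pi_def)
  have 2: "r (\<rho> Z (i x)) \<otimes>\<^bsub>M\<^esub> r (\<rho> W (i x)) = x" if "Z \<inter> W = {} \<and> Z \<union> W = carrier G \<and> x \<in> carrier M" for Z W x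
  proof -
    have "r (\<rho> Z (i x)) \<otimes>\<^bsub>M\<^esub> r (\<rho> W (i x)) = r (\<rho> Z (i x) \<otimes>\<^bsub>I\<^esub> \<rho> W (i x))"
      using hom_mult[OF hr] that ic \<rho>c by simp
    also have "\<rho> Z (i x) \<otimes>\<^bsub>I\<^esub> \<rho> W (i x) = i x"
      using proj_familyD(1)[OF \<rho>, of Z W "i x"] that ic by simp
    finally show ?thesis using ri that by simp
  qed
  have 3: "r (\<rho> Z (i (act M g x))) = act M g (r (\<rho> {h \<in> carrier G. g \<otimes>\<^bsub>G\<^esub> h \<in> Z} (i x)))"
    if "g \<in> carrier G \<and> x \<in> carrier M" for Z g x
  proof -
    have "i (act M g x) = act I g (i x)" using i that by (auto simp: ghom_def)
    moreover have "\<rho> Z (act I g (i x)) = act I g (\<rho> {h \<in> carrier G. g \<otimes>\<^bsub>G\<^esub> h \<in> Z} (i x))"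
      using proj_familyD(2)[OF \<rho>, of g "i x" Z] that ic by simp
    ultimately show ?thesis using r that ic \<rho>c by (auto simp: ghom_def)
  qed
  have r1: "r \<one>\<^bsub>I\<^esub> = \<one>\<^bsub>M\<^esub>" using hom_one[OF hr I.M.is_group M.M.is_group] .
  have 4: "\<exists>F. finite F \<and> (\<forall>Z. Z \<inter> F = {} \<longrightarrow> r (\<rho> Z (i x)) = \<one>\<^bsub>M\<^esub>)" if x: "x \<in> carrier M" for x
  proof -
    obtain F where "finite F" "\<forall>Z. Z \<inter> F = {} \<longrightarrow> \<rho> Z (i x) = \<one>\<^bsub>I\<^esub>"
      using proj_familyD(3)[OF \<rho> ic[OF x]]
      by (elim exE conjE)
    thus ?thesis using r1 by auto
  qed
  show ?thesis unfolding proj_family_def using 1 2 3 4 by (intro conjI allI impI ballI) assumption+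
qed

lemma gmodule_induced:
  fixes G :: "'g monoid" and N :: "'a monoid"
  assumes "group G" "comm_group N"
  shows "gmodule G (induced_gmod G N)"
proof -
  interpret G: group G by fact
  interpret N: comm_group N by fact
  note cs = carrier_sum_group[of "carrier G" "\<lambda>_. N", OF N.is_group]
  interpret S: group "sum_group (carrier G) (\<lambda>_. N)" by (rule sum_group) (rule N.is_group)
  have cg: "comm_group (sum_group (carrier G) (\<lambda>_. N))"
    by (rule S.group_comm_groupI)
      (auto simp: cs PiE_def Pi_def N.m_comm intro!: restrict_ext)
  have car: "(\<lambda>h\<in>carrier G. x (inv\<^bsub>G\<^esub> g \<otimes>\<^bsub>G\<^esub> h)) \<in> carrier (sum_group (carrier G) (\<lambda>_. N))"
    if g: "g \<in> carrier G" and x: "x \<in> carrier (sum_group (carrier G) (\<lambda>_. N))" for g x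
  proof -
    have "{h \<in> carrier G. x (inv\<^bsub>G\<^esub> g \<otimes>\<^bsub>G\<^esub> h) \<noteq> \<one>\<^bsub>N\<^esub>} \<subseteq> (\<lambda>h. g \<otimes>\<^bsub>G\<^esub> h) ` {h \<in> carrier G. x h \<noteq> \<one>\<^bsub>N\<^esub>}"
    proof
      fix h assume h: "h \<in> {h \<in> carrier G. x (inv\<^bsub>G\<^esub> g \<otimes>\<^bsub>G\<^esub> h) \<noteq> \<one>\<^bsub>N\<^esub>}"
      hence "h = g \<otimes>\<^bsub>G\<^esub> (inv\<^bsub>G\<^esub> g \<otimes>\<^bsub>G\<^esub> h)" using g by (simp add: G.m_assoc[symmetric])
      thus "h \<in> (\<lambda>h. g \<otimes>\<^bsub>G\<^esub> h) ` {h \<in> carrier G. x h \<noteq> \<one>\<^bsub>N\<^esub>}" using h g by blast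
    qed
    moreover have "finite {h \<in> carrier G. x h \<noteq> \<one>\<^bsub>N\<^esub>}" using x by (simp add: cs)
    ultimately have "finite {h \<in> carrier G. x (inv\<^bsub>G\<^esub> g \<otimes>\<^bsub>G\<^esub> h) \<noteq> \<one>\<^bsub>N\<^esub>}"
      by (meson finite_imageI finite_subset)
    with x g show ?thesis
      by (auto simp: cs PiE_def Pi_def cong: conj_cong)
  qed
  have "comm_group (induced_gmod G N)" using cg by (simp add: induced_gmod_def)
  then show ?thesis
  proof (intro gmodule.intro gmodule_axioms.intro)
    show "group G" by fact
  next
    fix g assume g: "g \<in> carrier G"
    show "act (induced_gmod G N) g \<in> hom (induced_gmod G N) (induced_gmod G N)"
      using g car by (auto simp: induced_gmod_def intro!: homI restrict_ext)
  next
    fix x assume x: "x \<in> carrier (induced_gmod G N)"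
    thus "act (induced_gmod G N) \<one>\<^bsub>G\<^esub> x = x"
      by (auto simp: induced_gmod_def cs PiE_def extensional_def fun_eq_iff)
  next
    fix g h x assume *: "g \<in> carrier G" "h \<in> carrier G" "x \<in> carrier (induced_gmod G N)"
    thus "act (induced_gmod G N) (g \<otimes>\<^bsub>G\<^esub> h) x = act (induced_gmod G N) g (act (induced_gmod G N) h x)"
      by (auto simp: induced_gmod_def G.inv_mult_group G.m_assoc intro!: restrict_ext)
  qed
qed

lemma relatively_projective_proj_family:
  assumes "relatively_projective G M"
  shows "\<exists>\<pi>. proj_family G M \<pi>"
proof -
  obtain N :: "'b monoid" and M' :: "('a, 'a \<Rightarrow> 'b) gmod" and \<phi>
    where N: "comm_group N" and M': "gmodule G M'"
      and \<phi>: "\<phi> \<in> giso G (gmod_prod M M') (induced_gmod G N)" and M: "gmodule G M"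
    using assms unfolding relatively_projective_def by blast
  interpret M: gmodule G M by fact
  interpret M': gmodule G M' by fact
  have I: "gmodule G (induced_gmod G N)" by (rule gmodule_induced) (rule M.G.is_group, rule N)
  interpret I: gmodule G "induced_gmod G N" by fact
  have \<phi>h: "\<phi> \<in> hom (M \<times>\<times> M') (induced_gmod G N)" and bij: "bij_betw \<phi> (carrier M \<times> carrier M') (carrier (induced_gmod G N))"
    and \<phi>g: "\<And>g x y. \<lbrakk>g \<in> carrier G; x \<in> carrier M; y \<in> carrier M'\<rbrakk> \<Longrightarrow> \<phi> (act M g x, act M' g y) = act (induced_gmod G N) g (\<phi> (x, y))"
    using \<phi> by (auto simp: giso_def ghom_def iso_def gmod_prod_def)
  define \<psi> where "\<psi> = inv_into (carrier M \<times> carrier M') \<phi>"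
  have \<psi>c: "\<psi> z \<in> carrier M \<times> carrier M'" "\<phi> (\<psi> z) = z" if "z \<in> carrier (induced_gmod G N)" for z
    using bij that unfolding \<psi>_def bij_betw_def by (metis inv_into_into, metis f_inv_into_f)
  have \<psi>\<phi>: "\<psi> (\<phi> z) = z" if "z \<in> carrier M \<times> carrier M'" for z
    using bij that unfolding \<psi>_def bij_betw_def by simp
  have "group (M \<times>\<times> M')" by (rule DirProd_group) (rule M.M.is_group, rule M'.M.is_group)
  hence \<psi>h: "\<psi> \<in> hom (induced_gmod G N) (M \<times>\<times> M')"
    using group.iso_set_sym[of "M \<times>\<times> M'" \<phi> "induced_gmod G N"] \<phi>h bij
    by (auto simp: iso_def \<psi>_def)
  have \<psi>g: "\<psi> (act (induced_gmod G N) g z) = (act M g (fst (\<psi> z)), act M' g (snd (\<psi> z)))"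
    if "g \<in> carrier G" "z \<in> carrier (induced_gmod G N)" for g z
  proof -
    have "act (induced_gmod G N) g z = \<phi> (act M g (fst (\<psi> z)), act M' g (snd (\<psi> z)))"
      using \<phi>g[of g "fst (\<psi> z)" "snd (\<psi> z)"] that \<psi>c[OF that(2)] by auto
    moreover have "(act M g (fst (\<psi> z)), act M' g (snd (\<psi> z))) \<in> carrier M \<times> carrier M'"
      using \<psi>c[OF that(2)] hom_in_carrier[OF M.act_hom[OF that(1)]] hom_in_carrier[OF M'.act_hom[OF that(1)]]
      by (auto simp: mem_Times_iff)
    ultimately show ?thesis using \<psi>\<phi> by simp
  qed
  have a1: "act M' g \<one>\<^bsub>M'\<^esub> = \<one>\<^bsub>M'\<^esub>" if "g \<in> carrier G" for g
    using hom_one[OF M'.act_hom[OF that] M'.M.is_group M'.M.is_group] .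
  have i: "(\<lambda>x. \<phi> (x, \<one>\<^bsub>M'\<^esub>)) \<in> ghom G M (induced_gmod G N)"
  proof -
    have "(\<lambda>x. \<phi> (x, \<one>\<^bsub>M'\<^esub>)) \<in> hom M (induced_gmod G N)"
    proof (rule homI)
      fix x y assume "x \<in> carrier M" "y \<in> carrier M"
      thus "\<phi> (x \<otimes>\<^bsub>M\<^esub> y, \<one>\<^bsub>M'\<^esub>) = \<phi> (x, \<one>\<^bsub>M'\<^esub>) \<otimes>\<^bsub>induced_gmod G N\<^esub> \<phi> (y, \<one>\<^bsub>M'\<^esub>)"
        using hom_mult[OF \<phi>h, of "(x, \<one>\<^bsub>M'\<^esub>)" "(y, \<one>\<^bsub>M'\<^esub>)"] by simp
    qed (use hom_in_carrier[OF \<phi>h] in auto)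
    thus ?thesis using \<phi>g[of _ _ "\<one>\<^bsub>M'\<^esub>"] a1 by (auto simp: ghom_def)
  qed
  have r: "(\<lambda>z. fst (\<psi> z)) \<in> ghom G (induced_gmod G N) M"
  proof -
    have "(\<lambda>z. fst (\<psi> z)) \<in> hom (induced_gmod G N) M"
    proof (rule homI)
      fix x y assume *: "x \<in> carrier (induced_gmod G N)" "y \<in> carrier (induced_gmod G N)"
      thus "fst (\<psi> (x \<otimes>\<^bsub>induced_gmod G N\<^esub> y)) = fst (\<psi> x) \<otimes>\<^bsub>M\<^esub> fst (\<psi> y)"
        using hom_mult[OF \<psi>h *] by (simp add: mult_DirProd')
    qed (use \<psi>c in \<open>auto simp: mem_Times_iff\<close>)
    thus ?thesis using \<psi>g by (auto simp: ghom_def)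
  qed
  show ?thesis
    using proj_family_retract[OF proj_family_induced[OF M.G.is_group N] i r _ I M] \<psi>\<phi> by auto
qed

section \<open>Lifting and extending equivariant maps\<close>

text \<open>In additive terms the solution is minus the sum over l \<ge> 0 of
  \<open>\<sigma>^l v \<alpha> \<tau>^l\<close>, and applying \<open>\<sigma> _ \<tau>\<close>
  shifts the sum by one term. Only finitely many terms are nonzero at a given x. Because the
  solution is given by a formula, whatever commutes with the data commutes with it; the last clause
  keeps invariance under the other generators.\<close>

lemma telescoping_solution:
  fixes M :: "('a, 'm) monoid_scheme" and N :: "('b, 'n) monoid_scheme"
  assumes "comm_group M" "comm_group N"
    and \<alpha>: "\<alpha> \<in> hom M M" and \<tau>: "\<tau> \<in> hom M M" and \<sigma>: "\<sigma> \<in> hom N N" and v: "v \<in> hom M N"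
    and fin: "\<And>x. x \<in> carrier M \<Longrightarrow> \<exists>L. \<forall>l\<ge>L. \<alpha> ((\<tau> ^^ l) x) = \<one>\<^bsub>M\<^esub>"
  shows "\<exists>w\<in>hom M N. (\<forall>x\<in>carrier M. \<sigma> (w (\<tau> x)) = w x \<otimes>\<^bsub>N\<^esub> v (\<alpha> x)) \<and>
    (\<forall>f\<in>hom M M. \<forall>g\<in>hom N N. (\<forall>x\<in>carrier M. f (\<tau> x) = \<tau> (f x)) \<and> (\<forall>x\<in>carrier M. f (\<alpha> x) = \<alpha> (f x)) \<and>
       (\<forall>y\<in>carrier N. g (\<sigma> y) = \<sigma> (g y)) \<and> (\<forall>x\<in>carrier M. g (v x) = v (f x)) \<longrightarrow>
       (\<forall>x\<in>carrier M. g (w x) = w (f x)))"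
proof -
  interpret M: comm_group M by fact
  interpret N: comm_group N by fact
  interpret a: group_hom M M \<alpha> using \<alpha> by unfold_locales auto
  interpret t: group_hom M M \<tau> using \<tau> by unfold_locales auto
  interpret s: group_hom N N \<sigma> using \<sigma> by unfold_locales auto
  interpret v: group_hom M N v using v by unfold_locales auto
  define F where "F = rec_nat (\<lambda>x. \<one>\<^bsub>N\<^esub>) (\<lambda>L Fl x. v (\<alpha> x) \<otimes>\<^bsub>N\<^esub> \<sigma> (Fl (\<tau> x)))"
  have F0: "F 0 x = \<one>\<^bsub>N\<^esub>" and FS: "F (Suc L) x = v (\<alpha> x) \<otimes>\<^bsub>N\<^esub> \<sigma> (F L (\<tau> x))" for L x
    by (simp_all add: F_def)
  have Fc: "F L x \<in> carrier N" if "x \<in> carrier M" for L x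
    using that by (induction L arbitrary: x) (simp_all add: F0 FS)
  have Fm: "F L (x \<otimes>\<^bsub>M\<^esub> y) = F L x \<otimes>\<^bsub>N\<^esub> F L y" if "x \<in> carrier M" "y \<in> carrier M" for L x y
    using that by (induction L arbitrary: x y) (simp_all add: F0 FS Fc N.m_ac)
  define good where "good x L \<longleftrightarrow> (\<forall>l\<ge>L. \<alpha> ((\<tau> ^^ l) x) = \<one>\<^bsub>M\<^esub>)" for x L
  have good_mono: "good x L \<Longrightarrow> L \<le> L' \<Longrightarrow> good x L'" for x L L' by (auto simp: good_def)
  have gt: "good (\<tau> x) L" if "good x (Suc L)" for x L
    unfolding good_def
  proof (intro allI impI)
    fix l assume "L \<le> l"
    hence "\<alpha> ((\<tau> ^^ Suc l) x) = \<one>\<^bsub>M\<^esub>" using that by (auto simp only: good_def)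
    thus "\<alpha> ((\<tau> ^^ l) (\<tau> x)) = \<one>\<^bsub>M\<^esub>" by (simp add: funpow_swap1)
  qed
  have stab: "F (L + k) x = F L x" if "x \<in> carrier M" "good x L" for L k x
    using that
  proof (induction L arbitrary: x k)
    case 0
    have "F k x = \<one>\<^bsub>N\<^esub>" using 0
    proof (induction k arbitrary: x)
      case (Suc k)
      have "\<alpha> x = \<one>\<^bsub>M\<^esub>" using Suc.prems by (auto simp: good_def dest: spec[of _ 0])
      moreover have "F k (\<tau> x) = \<one>\<^bsub>N\<^esub>"
        using Suc.IH[of "\<tau> x"] Suc.prems gt[of x 0] good_mono[of x 0 1] by simp
      ultimately show ?case by (simp add: FS)
    qed (simp add: F0)
    then show ?case by (simp add: F0)
  next
    case (Suc L)
    then show ?case using gt by (simp add: FS)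
  qed
  \<comment> \<open>The number of terms depends on x; by \<open>stab\<close> any sufficiently large
    number gives the same value, so additivity can be checked at a common bound.\<close>
  define w where "w x = inv\<^bsub>N\<^esub> (F (LEAST L. good x L) x)" for x
  have w: "w x = inv\<^bsub>N\<^esub> (F L x)" if "x \<in> carrier M" "good x L" for x L
  proof -
    have "good x (LEAST L. good x L)" using that(2) by (rule LeastI)
    moreover have "(LEAST L. good x L) \<le> L" using that(2) by (rule Least_le)
    ultimately show ?thesis using stab[OF that(1), of "LEAST L. good x L" "L - (LEAST L. good x L)"]
      by (simp add: w_def)
  qed
  have ex: "\<exists>L. good x L" if "x \<in> carrier M" for x using fin[OF that] by (simp add: good_def)
  have pc: "(\<tau> ^^ l) x \<in> carrier M" if "x \<in> carrier M" for l x
    using that by (induction l) simp_all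
  have pm: "(\<tau> ^^ l) (x \<otimes>\<^bsub>M\<^esub> y) = (\<tau> ^^ l) x \<otimes>\<^bsub>M\<^esub> (\<tau> ^^ l) y" if "x \<in> carrier M" "y \<in> carrier M" for l x y
    using that pc by (induction l) simp_all
  have "w \<in> hom M N"
  proof (rule homI)
    fix x assume x: "x \<in> carrier M"
    obtain L where "good x L" using ex[OF x] ..
    thus "w x \<in> carrier N" using w x Fc by simp
  next
    fix x y assume xy: "x \<in> carrier M" "y \<in> carrier M"
    obtain L1 where L1: "good x L1" using ex[OF xy(1)] ..
    obtain L2 where L2: "good y L2" using ex[OF xy(2)] ..
    have g: "good x (max L1 L2)" "good y (max L1 L2)" using good_mono L1 L2 by auto
    hence "good (x \<otimes>\<^bsub>M\<^esub> y) (max L1 L2)" using xy pc by (simp add: good_def pm)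
    thus "w (x \<otimes>\<^bsub>M\<^esub> y) = w x \<otimes>\<^bsub>N\<^esub> w y" using xy g w Fm Fc by (simp add: N.inv_mult)
  qed
  moreover have "\<sigma> (w (\<tau> x)) = w x \<otimes>\<^bsub>N\<^esub> v (\<alpha> x)" if x: "x \<in> carrier M" for x
  proof -
    obtain L where L: "good x (Suc L)" using ex[OF x] good_mono[of x _ "Suc _"] by (metis le_SucI le_refl)
    have "w x \<otimes>\<^bsub>N\<^esub> v (\<alpha> x) = inv\<^bsub>N\<^esub> (v (\<alpha> x) \<otimes>\<^bsub>N\<^esub> \<sigma> (F L (\<tau> x))) \<otimes>\<^bsub>N\<^esub> v (\<alpha> x)"
      using w[OF x L] by (simp add: FS)
    also have "\<dots> = inv\<^bsub>N\<^esub> (\<sigma> (F L (\<tau> x)))"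
      using x Fc[of "\<tau> x" L] by (simp add: N.inv_mult_group N.m_assoc)
    also have "\<dots> = \<sigma> (w (\<tau> x))" using w[OF _ gt[OF L]] x Fc[of "\<tau> x" L] by simp
    finally show ?thesis by simp
  qed
  moreover have "g (w x) = w (f x)"
    if f: "f \<in> hom M M" and g: "g \<in> hom N N" and ft: "\<forall>x\<in>carrier M. f (\<tau> x) = \<tau> (f x)"
      and fa: "\<forall>x\<in>carrier M. f (\<alpha> x) = \<alpha> (f x)" and gs: "\<forall>y\<in>carrier N. g (\<sigma> y) = \<sigma> (g y)"
      and gv: "\<forall>x\<in>carrier M. g (v x) = v (f x)" and x: "x \<in> carrier M" for f g x
  proof -
    interpret f: group_hom M M f using f by unfold_locales auto
    interpret g: group_hom N N g using g by unfold_locales auto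
    have gF: "g (F L x) = F L (f x)" if "x \<in> carrier M" for L x
      using that by (induction L arbitrary: x) (simp_all add: F0 FS Fc gs gv fa ft)
    have fp: "f ((\<tau> ^^ l) x) = (\<tau> ^^ l) (f x)" for l
      using x pc by (induction l) (simp_all add: ft)
    obtain L where L: "good x L" using ex[OF x] ..
    have "good (f x) L" unfolding good_def
    proof (intro allI impI)
      fix l assume "L \<le> l"
      hence "\<alpha> ((\<tau> ^^ l) x) = \<one>\<^bsub>M\<^esub>" using L by (simp add: good_def)
      hence "f (\<alpha> ((\<tau> ^^ l) x)) = \<one>\<^bsub>M\<^esub>" by simp
      thus "\<alpha> ((\<tau> ^^ l) (f x)) = \<one>\<^bsub>M\<^esub>" using fa pc[OF x] fp by simp
    qed
    thus ?thesis using w[OF x L] w[of "f x" L] x gF[OF x] Fc[OF x] by simp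
  qed
  ultimately show ?thesis by (intro bexI[of _ w]) (simp, blast)
qed

text \<open>Translation moves the threshold: cutting \<open>a^l x\<close> off at
  \<open>b > 0\<close> is \<open>a^l\<close> applied to the cut-off of x at \<open>b > l\<close>,
  and b is bounded on the finite support of x.\<close>

lemma proj_family_eventually_trivial:
  fixes b :: "'g \<Rightarrow> int"
  assumes \<pi>: "proj_family G X \<pi>" and X: "gmodule G X" and a: "a \<in> carrier G"
    and b: "\<And>h. h \<in> carrier G \<Longrightarrow> b (a \<otimes>\<^bsub>G\<^esub> h) = b h - 1" and x: "x \<in> carrier X"
  shows "\<exists>L. \<forall>l\<ge>L. \<pi> {h \<in> carrier G. b h > 0} ((act X a ^^ l) x) = \<one>\<^bsub>X\<^esub>"
proof -
  interpret X: gmodule G X by fact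
  interpret ah: group_hom X X "act X a" using X.act_hom[OF a] by unfold_locales auto
  have pc: "(act X a ^^ l) x \<in> carrier X" for l
    using x by (induction l) simp_all
  have sh: "\<pi> {h \<in> carrier G. b h > m} (act X a y) = act X a (\<pi> {h \<in> carrier G. b h > m + 1} y)"
    if "y \<in> carrier X" for m y
  proof -
    have "{h \<in> carrier G. a \<otimes>\<^bsub>G\<^esub> h \<in> {h \<in> carrier G. b h > m}} = {h \<in> carrier G. b h > m + 1}"
      using a b by auto
    thus ?thesis
      using proj_familyD(2)[OF \<pi>, of a y] a that by simp
  qed
  have sl: "\<pi> {h \<in> carrier G. b h > m} ((act X a ^^ l) x) = (act X a ^^ l) (\<pi> {h \<in> carrier G. b h > m + int l} x)" for l m
  proof (induction l arbitrary: m)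
    case (Suc l)
    have eq: "m + 1 + int l = m + int (Suc l)" by simp
    show ?case using sh[OF pc, of m l] Suc.IH[of "m + 1", unfolded eq] by (simp del: of_nat_Suc)
  qed simp
  obtain F where F: "finite F" "\<And>Z. Z \<inter> F = {} \<Longrightarrow> \<pi> Z x = \<one>\<^bsub>X\<^esub>"
    using proj_familyD(3)[OF \<pi> x]
    by (elim exE conjE) simp
  obtain L :: int where L: "\<forall>y\<in>b ` F. y \<le> L"
    using F(1) by (meson finite_imageI finite_has_maximal2 Max_ge)
  have "\<pi> {h \<in> carrier G. b h > 0} ((act X a ^^ l) x) = \<one>\<^bsub>X\<^esub>" if l: "nat L \<le> l" for l
  proof -
    have "{h \<in> carrier G. b h > int l} \<inter> F = {}" using L l by fastforce
    hence "\<pi> {h \<in> carrier G. b h > int l} x = \<one>\<^bsub>X\<^esub>" by (rule F(2))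
    moreover have "(act X a ^^ l) \<one>\<^bsub>X\<^esub> = \<one>\<^bsub>X\<^esub>" by (induction l) simp_all
    ultimately show ?thesis by (simp add: sl)
  qed
  thus ?thesis by blast
qed

context gmodule begin

lemma act_closed [simp]: "g \<in> carrier G \<Longrightarrow> x \<in> carrier M \<Longrightarrow> act M g x \<in> carrier M"
  using hom_in_carrier[OF act_hom] by blast

lemma act_m: "g \<in> carrier G \<Longrightarrow> x \<in> carrier M \<Longrightarrow> y \<in> carrier M \<Longrightarrow>
    act M g (x \<otimes>\<^bsub>M\<^esub> y) = act M g x \<otimes>\<^bsub>M\<^esub> act M g y"
  using hom_mult[OF act_hom] by blast

lemma act_neutral [simp]: "g \<in> carrier G \<Longrightarrow> act M g \<one>\<^bsub>M\<^esub> = \<one>\<^bsub>M\<^esub>"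
  using hom_one[OF act_hom M.is_group M.is_group] by blast

lemma act_minv: "g \<in> carrier G \<Longrightarrow> x \<in> carrier M \<Longrightarrow> act M g (inv\<^bsub>M\<^esub> x) = inv\<^bsub>M\<^esub> (act M g x)"
  using group_hom.hom_inv[OF group_hom.intro[OF M.is_group M.is_group group_hom_axioms.intro[OF act_hom]]] by blast

lemma act_inv_cancel [simp]: "g \<in> carrier G \<Longrightarrow> x \<in> carrier M \<Longrightarrow> act M g (act M (inv\<^bsub>G\<^esub> g) x) = x"
  "g \<in> carrier G \<Longrightarrow> x \<in> carrier M \<Longrightarrow> act M (inv\<^bsub>G\<^esub> g) (act M g x) = x"
  by (simp_all add: act_mult[symmetric] act_one)

end

text \<open>The action of t on homomorphisms by conjugation. Its fixed points are the maps commuting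
  with t, which turns equivariance into invariance.\<close>

definition conj_act :: "'g monoid \<Rightarrow> ('g, 'a) gmod \<Rightarrow> ('g, 'b) gmod \<Rightarrow> 'g \<Rightarrow> ('a \<Rightarrow> 'b) \<Rightarrow> 'a \<Rightarrow> 'b" where
  "conj_act G M N t u = (\<lambda>x\<in>carrier M. act N t (u (act M (inv\<^bsub>G\<^esub> t) x)))"

lemma hom_group_iff: "u \<in> carrier (hom_group M N) \<longleftrightarrow> u \<in> hom M N \<and> u \<in> extensional (carrier M)"
  by (auto simp: hom_group_def)

lemma conj_act_closed:
  assumes "gmodule G M" "gmodule G N" "t \<in> carrier G" "u \<in> carrier (hom_group M N)"
  shows "conj_act G M N t u \<in> carrier (hom_group M N)"
proof -
  interpret M: gmodule G M by fact
  interpret N: gmodule G N by fact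
  have u: "u \<in> hom M N" using assms by (simp add: hom_group_iff)
  have "(\<lambda>x. act N t (u (act M (inv\<^bsub>G\<^esub> t) x))) \<in> hom M N"
    using assms(3) u by (intro homI) (simp_all add: hom_in_carrier[OF u] M.act_m N.act_m hom_mult[OF u])
  thus ?thesis by (simp add: conj_act_def hom_group_iff restrict_in_hom[OF M.M.is_group])
qed

lemma conj_act_fixed_iff:
  assumes "gmodule G M" "gmodule G N" "t \<in> carrier G" "u \<in> carrier (hom_group M N)"
  shows "conj_act G M N t u = u \<longleftrightarrow> (\<forall>x\<in>carrier M. u (act M t x) = act N t (u x))"
proof -
  interpret M: gmodule G M by fact
  interpret N: gmodule G N by fact
  have u: "u \<in> hom M N" using assms by (simp add: hom_group_iff)
  show ?thesis
  proof
    assume eq: "conj_act G M N t u = u"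
    show "\<forall>x\<in>carrier M. u (act M t x) = act N t (u x)"
    proof
      fix x assume x: "x \<in> carrier M"
      have "u (act M t x) = conj_act G M N t u (act M t x)" using eq by simp
      also have "\<dots> = act N t (u x)" using x assms(3) by (simp add: conj_act_def)
      finally show "u (act M t x) = act N t (u x)" .
    qed
  next
    assume eq: "\<forall>x\<in>carrier M. u (act M t x) = act N t (u x)"
    show "conj_act G M N t u = u"
    proof (rule hom_group_eqI[OF conj_act_closed[OF assms] assms(4)])
      fix x assume x: "x \<in> carrier M"
      show "conj_act G M N t u x = u x"
        using eq[rule_format, of "act M (inv\<^bsub>G\<^esub> t) x"] x assms(3) by (simp add: conj_act_def)
    qed
  qed
qed

lemma conj_act_hom:
  assumes "gmodule G M" "gmodule G N" "t \<in> carrier G"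
  shows "conj_act G M N t \<in> hom (hom_group M N) (hom_group M N)"
proof (rule homI)
  interpret M: gmodule G M by fact
  interpret N: gmodule G N by fact
  fix u v assume uv: "u \<in> carrier (hom_group M N)" "v \<in> carrier (hom_group M N)"
  show "conj_act G M N t (u \<otimes>\<^bsub>hom_group M N\<^esub> v) = conj_act G M N t u \<otimes>\<^bsub>hom_group M N\<^esub> conj_act G M N t v"
    using hom_group_closed[OF uv(1)] hom_group_closed[OF uv(2)] assms(3)
    by (auto simp: conj_act_def hom_group_def N.act_m intro!: restrict_ext)
qed (rule conj_act_closed[OF assms])

lemma conj_act_commute:
  assumes "comm_group G" "gmodule G M" "gmodule G N" "s \<in> carrier G" "t \<in> carrier G" "u \<in> carrier (hom_group M N)"
  shows "conj_act G M N s (conj_act G M N t u) = conj_act G M N t (conj_act G M N s u)"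
proof -
  interpret G: comm_group G by fact
  interpret M: gmodule G M by fact
  interpret N: gmodule G N by fact
  show ?thesis
    using assms hom_group_closed[OF assms(6)]
    by (auto simp: conj_act_def G.m_comm M.act_mult[symmetric] N.act_mult[symmetric] intro!: restrict_ext)
qed

text \<open>The group \<open>\<Gamma>\<^sub>f\<close>, seen as the product of the group of order two generated by \<open>c\<close> and a free
  abelian group with basis \<open>T\<close>; \<open>v t\<close> is the exponent of \<open>t\<close> and \<open>Pos\<close> selects one element of
  each coset of \<open>{1, c}\<close>.\<close>

locale signed_free_abelian = comm_group G for G :: "'g monoid" (structure) +
  fixes T :: "'g set" and c :: 'g and v :: "'g \<Rightarrow> 'g \<Rightarrow> int" and Pos :: "'g set"
  assumes finT: "finite T" and T: "T \<subseteq> carrier G" and c: "c \<in> carrier G" and cc: "c \<otimes> c = \<one>"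
    and gen: "generate G (insert c T) = carrier G"
    and v_mult: "\<lbrakk>t \<in> T; g \<in> carrier G; h \<in> carrier G\<rbrakk> \<Longrightarrow> v t (g \<otimes> h) = v t g + v t h"
    and v_T: "\<lbrakk>s \<in> T; t \<in> T\<rbrakk> \<Longrightarrow> v t s = (if s = t then 1 else 0)"
    and Pos_c: "g \<in> carrier G \<Longrightarrow> c \<otimes> g \<in> Pos \<longleftrightarrow> g \<notin> Pos"
    and Pos_T: "\<lbrakk>t \<in> T; g \<in> carrier G\<rbrakk> \<Longrightarrow> t \<otimes> g \<in> Pos \<longleftrightarrow> g \<in> Pos"
begin

lemma inv_c [simp]: "inv c = c"
  using c cc inv_equality by blast

lemma ghomI_generators:
  assumes M: "gmodule G M" and N: "gmodule G N" and u: "u \<in> hom M N"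
    and eq: "\<And>s x. s \<in> insert c T \<Longrightarrow> x \<in> carrier M \<Longrightarrow> u (act M s x) = act N s (u x)"
  shows "u \<in> ghom G M N"
proof -
  interpret M: gmodule G M by fact
  interpret N: gmodule G N by fact
  note uc = hom_in_carrier[OF u]
  have "u (act M g x) = act N g (u x)" if "g \<in> generate G (insert c T)" "x \<in> carrier M" for g x
    using that
  proof (induction arbitrary: x rule: generate.induct)
    case one
    then show ?case by (simp add: M.act_one N.act_one uc)
  next
    case (incl h)
    then show ?case using eq by blast
  next
    case (inv h)
    hence h: "h \<in> carrier G" using c T by auto
    have "u x = u (act M h (act M (inv h) x))" using h inv by simp
    also have "\<dots> = act N h (u (act M (inv h) x))" using eq[OF inv.hyps, of "act M (inv h) x"] inv.prems h by simp
    finally have "act N (inv h) (u x) = act N (inv h) (act N h (u (act M (inv h) x)))" by simp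
    thus ?case using h inv.prems by (simp add: uc)
  next
    case (eng h1 h2)
    hence h: "h1 \<in> carrier G" "h2 \<in> carrier G" using gen by auto
    then show ?case using eng by (simp add: M.act_mult N.act_mult uc)
  qed
  thus ?thesis using u gen by (auto simp: ghom_def)
qed

text \<open>u is split into its restrictions to positive and to nonpositive exponents of t. The
  equation is solved for the first part by summing over powers in one direction and for the second
  part in the other, so that both sums are finite at each element.\<close>

lemma conj_act_equation_solvable:
  assumes X: "gmodule G X" and N: "gmodule G N" and \<pi>: "proj_family G X \<pi>"
    and t: "t \<in> T" and S: "S \<subseteq> T - {t}" and u: "u \<in> carrier (hom_group X N)"
    and uS: "\<forall>s\<in>S. conj_act G X N s u = u"
  shows "\<exists>w\<in>carrier (hom_group X N). (\<forall>s\<in>S. conj_act G X N s w = w) \<and>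
    conj_act G X N t w = w \<otimes>\<^bsub>hom_group X N\<^esub> u"
proof -
  interpret X: gmodule G X by fact
  interpret N: gmodule G N by fact
  have tG: "t \<in> carrier G" and SG: "s \<in> S \<Longrightarrow> s \<in> carrier G" for s using t S T by auto
  have uh: "u \<in> hom X N" using u by (simp add: hom_group_iff)
  have uSx: "act N s (u x) = u (act X s x)" if "s \<in> S" "x \<in> carrier X" for s x
    using uS conj_act_fixed_iff[OF X N SG[OF that(1)] u] that by auto
  have \<pi>h: "\<pi> Z \<in> hom X X" for Z using \<pi> by (auto simp: proj_family_def)
  have inv_t: "v t (inv t) = -1"
    using v_mult[OF t tG, of "inv t"] v_mult[OF t, of \<one> \<one>] v_T[OF t t] tG by simp
  have vs: "v t (s \<otimes> h) = v t h" if "s \<in> S" "h \<in> carrier G" for s h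
    using v_mult[OF t SG[OF that(1)] that(2)] v_T[of s t] that S t by (auto simp: subset_iff)
  \<comment> \<open>Both halves are written as "an integer function is positive" for a function that
    drops by one under \<open>inv t\<close> and under t respectively, the form needed for
    \<open>proj_family_eventually_trivial\<close>.\<close>
  define Zp where "Zp = {h \<in> carrier G. v t h > 0}"
  define Zm where "Zm = {h \<in> carrier G. 1 - v t h > 0}"
  have com: "act X s (\<pi> Z x) = \<pi> Z (act X s x)" if "s \<in> S" "x \<in> carrier X" "Z = Zp \<or> Z = Zm" for s x Z
  proof -
    have "{h \<in> carrier G. s \<otimes> h \<in> Z} = Z" using that(3) vs[OF that(1)] SG[OF that(1)]
      by (auto simp: Zp_def Zm_def)
    thus ?thesis
      using proj_familyD(2)[OF \<pi>, of s x Z] SG that by simp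
  qed
  have comact: "act X s (act X h x) = act X h (act X s x)" if "s \<in> S" "h \<in> carrier G" "x \<in> carrier X" for s h x
    using SG[OF that(1)] that by (simp add: X.act_mult[symmetric] m_comm)
  have comactN: "act N s (act N h x) = act N h (act N s x)" if "s \<in> S" "h \<in> carrier G" "x \<in> carrier N" for s h x
    using SG[OF that(1)] that by (simp add: N.act_mult[symmetric] m_comm)
  obtain w1 where w1: "w1 \<in> hom X N"
      "\<And>x. x \<in> carrier X \<Longrightarrow> act N t (w1 (act X (inv t) x)) = w1 x \<otimes>\<^bsub>N\<^esub> u (\<pi> Zp x)"
      "\<And>s x. s \<in> S \<Longrightarrow> x \<in> carrier X \<Longrightarrow> act N s (w1 x) = w1 (act X s x)"
  proof -
    have "\<exists>w\<in>hom X N. (\<forall>x\<in>carrier X. act N t (w (act X (inv t) x)) = w x \<otimes>\<^bsub>N\<^esub> u (\<pi> Zp x)) \<and>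
      (\<forall>f\<in>hom X X. \<forall>g\<in>hom N N. (\<forall>x\<in>carrier X. f (act X (inv t) x) = act X (inv t) (f x)) \<and>
         (\<forall>x\<in>carrier X. f (\<pi> Zp x) = \<pi> Zp (f x)) \<and>
         (\<forall>y\<in>carrier N. g (act N t y) = act N t (g y)) \<and> (\<forall>x\<in>carrier X. g (u x) = u (f x)) \<longrightarrow>
         (\<forall>x\<in>carrier X. g (w x) = w (f x)))"
    proof (rule telescoping_solution[OF X.M.comm_group_axioms N.M.comm_group_axioms \<pi>h X.act_hom N.act_hom uh])
      fix x assume "x \<in> carrier X"
      thus "\<exists>L. \<forall>l\<ge>L. \<pi> Zp ((act X (inv t) ^^ l) x) = \<one>\<^bsub>X\<^esub>"
        unfolding Zp_def
        by (intro proj_family_eventually_trivial[OF \<pi> X]) (use tG t inv_t in \<open>auto simp: v_mult\<close>)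
    qed (use tG in auto)
    then obtain w where w: "w \<in> hom X N" and w2: "\<forall>x\<in>carrier X. act N t (w (act X (inv t) x)) = w x \<otimes>\<^bsub>N\<^esub> u (\<pi> Zp x)"
      and w3: "\<forall>f\<in>hom X X. \<forall>g\<in>hom N N. (\<forall>x\<in>carrier X. f (act X (inv t) x) = act X (inv t) (f x)) \<and>
         (\<forall>x\<in>carrier X. f (\<pi> Zp x) = \<pi> Zp (f x)) \<and>
         (\<forall>y\<in>carrier N. g (act N t y) = act N t (g y)) \<and> (\<forall>x\<in>carrier X. g (u x) = u (f x)) \<longrightarrow>
         (\<forall>x\<in>carrier X. g (w x) = w (f x))" by (elim bexE conjE)
    have "act N s (w x) = w (act X s x)" if s: "s \<in> S" and x: "x \<in> carrier X" for s x
      by (rule w3[rule_format, OF X.act_hom[OF SG[OF s]] N.act_hom[OF SG[OF s]] _ x])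
        (use tG in \<open>auto intro!: comact[OF s] comactN[OF s] com[OF s] uSx[OF s]\<close>)
    with w w2 show thesis by (intro that) auto
  qed
  obtain w2 where w2: "w2 \<in> hom X N"
      "\<And>x. x \<in> carrier X \<Longrightarrow> act N (inv t) (w2 (act X t x)) = w2 x \<otimes>\<^bsub>N\<^esub> u (\<pi> Zm x)"
      "\<And>s x. s \<in> S \<Longrightarrow> x \<in> carrier X \<Longrightarrow> act N s (w2 x) = w2 (act X s x)"
  proof -
    have "\<exists>w\<in>hom X N. (\<forall>x\<in>carrier X. act N (inv t) (w (act X t x)) = w x \<otimes>\<^bsub>N\<^esub> u (\<pi> Zm x)) \<and>
      (\<forall>f\<in>hom X X. \<forall>g\<in>hom N N. (\<forall>x\<in>carrier X. f (act X t x) = act X t (f x)) \<and>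
         (\<forall>x\<in>carrier X. f (\<pi> Zm x) = \<pi> Zm (f x)) \<and>
         (\<forall>y\<in>carrier N. g (act N (inv t) y) = act N (inv t) (g y)) \<and> (\<forall>x\<in>carrier X. g (u x) = u (f x)) \<longrightarrow>
         (\<forall>x\<in>carrier X. g (w x) = w (f x)))"
    proof (rule telescoping_solution[OF X.M.comm_group_axioms N.M.comm_group_axioms \<pi>h X.act_hom N.act_hom uh])
      fix x assume "x \<in> carrier X"
      thus "\<exists>L. \<forall>l\<ge>L. \<pi> Zm ((act X t ^^ l) x) = \<one>\<^bsub>X\<^esub>"
        unfolding Zm_def
        by (intro proj_family_eventually_trivial[OF \<pi> X]) (use tG t v_T[OF t t] in \<open>auto simp: v_mult\<close>)
    qed (use tG in auto)
    then obtain w where w: "w \<in> hom X N" and w2: "\<forall>x\<in>carrier X. act N (inv t) (w (act X t x)) = w x \<otimes>\<^bsub>N\<^esub> u (\<pi> Zm x)"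
      and w3: "\<forall>f\<in>hom X X. \<forall>g\<in>hom N N. (\<forall>x\<in>carrier X. f (act X t x) = act X t (f x)) \<and>
         (\<forall>x\<in>carrier X. f (\<pi> Zm x) = \<pi> Zm (f x)) \<and>
         (\<forall>y\<in>carrier N. g (act N (inv t) y) = act N (inv t) (g y)) \<and> (\<forall>x\<in>carrier X. g (u x) = u (f x)) \<longrightarrow>
         (\<forall>x\<in>carrier X. g (w x) = w (f x))" by (elim bexE conjE)
    have "act N s (w x) = w (act X s x)" if s: "s \<in> S" and x: "x \<in> carrier X" for s x
      by (rule w3[rule_format, OF X.act_hom[OF SG[OF s]] N.act_hom[OF SG[OF s]] _ x])
        (use tG in \<open>auto intro!: comact[OF s] comactN[OF s] com[OF s] uSx[OF s]\<close>)
    with w w2 show thesis by (intro that) auto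
  qed
  note w1c = hom_in_carrier[OF w1(1)] and w2c = hom_in_carrier[OF w2(1)] and \<pi>c = hom_in_carrier[OF \<pi>h] and uc = hom_in_carrier[OF uh]
  \<comment> \<open>\<open>w2\<close> solves the equation for \<open>inv t\<close> in place of t;
    minus its conjugate under \<open>inv t\<close> solves the equation for t with the same
    right-hand side.\<close>
  define w3 where "w3 x = inv\<^bsub>N\<^esub> (act N (inv t) (w2 (act X t x)))" for x
  have w3c: "w3 x \<in> carrier N" if "x \<in> carrier X" for x using that tG w2c by (simp add: w3_def)
  have w3h: "w3 \<in> hom X N"
    using tG by (intro homI w3c) (simp_all add: w3_def X.act_m hom_mult[OF w2(1)] N.act_m w2c N.M.inv_mult)
  have w3e: "act N t (w3 (act X (inv t) x)) = w3 x \<otimes>\<^bsub>N\<^esub> u (\<pi> Zm x)" if x: "x \<in> carrier X" for x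
  proof -
    have "act N t (w3 (act X (inv t) x)) = inv\<^bsub>N\<^esub> (w2 x)" using x tG by (simp add: w3_def N.act_minv w2c)
    moreover have "w3 x \<otimes>\<^bsub>N\<^esub> u (\<pi> Zm x) = inv\<^bsub>N\<^esub> (w2 x) \<otimes>\<^bsub>N\<^esub> (inv\<^bsub>N\<^esub> (u (\<pi> Zm x)) \<otimes>\<^bsub>N\<^esub> u (\<pi> Zm x))"
      unfolding w3_def w2(2)[OF x] using x by (simp add: N.M.inv_mult w2c uc \<pi>c N.M.m_assoc)
    ultimately show ?thesis using x by (simp add: w2c uc \<pi>c)
  qed
  have w3S: "act N s (w3 x) = w3 (act X s x)" if s: "s \<in> S" and x: "x \<in> carrier X" for s x
    using s x tG SG[OF s] by (simp add: w3_def N.act_minv w2c comactN[OF s, of "inv t"] w2(3)[OF s] comact[OF s, of t])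
  define w where "w = (\<lambda>x\<in>carrier X. w1 x \<otimes>\<^bsub>N\<^esub> w3 x)"
  have wc: "w \<in> carrier (hom_group X N)"
    unfolding w_def hom_group_iff using restrict_in_hom[OF X.M.is_group N.M.hom_group_mult[OF w1(1) w3h]] by simp
  have "conj_act G X N s w = w" if s: "s \<in> S" for s
    unfolding conj_act_fixed_iff[OF X N SG[OF s] wc]
    using s SG[OF s] by (simp add: w_def N.act_m w1c w3c w1(3) w3S)
  moreover have "conj_act G X N t w = w \<otimes>\<^bsub>hom_group X N\<^esub> u"
  proof -
    have "act N t (w (act X (inv t) x)) = w x \<otimes>\<^bsub>N\<^esub> u x" if x: "x \<in> carrier X" for x
    proof -
      have "Zp \<inter> Zm = {} \<and> Zp \<union> Zm = carrier G \<and> x \<in> carrier X" using x by (auto simp: Zp_def Zm_def)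
      hence "\<pi> Zp x \<otimes>\<^bsub>X\<^esub> \<pi> Zm x = x"
        by (rule proj_familyD(1)[OF \<pi>])
      hence "u x = u (\<pi> Zp x) \<otimes>\<^bsub>N\<^esub> u (\<pi> Zm x)" using x hom_mult[OF uh \<pi>c \<pi>c] by metis
      moreover have "act N t (w (act X (inv t) x)) = (w1 x \<otimes>\<^bsub>N\<^esub> u (\<pi> Zp x)) \<otimes>\<^bsub>N\<^esub> (w3 x \<otimes>\<^bsub>N\<^esub> u (\<pi> Zm x))"
        using x tG w1(2)[OF x] w3e[OF x] by (simp add: w_def N.act_m w1c w3c)
      ultimately show ?thesis using x by (simp add: w_def w1c w3c uc \<pi>c N.M.m_ac)
    qed
    thus ?thesis by (auto simp: conj_act_def hom_group_def intro!: restrict_ext)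
  qed
  ultimately show ?thesis using wc by blast
qed


lemma proj_family_Pos:
  assumes "proj_family G M \<pi>" "t \<in> carrier G" "x \<in> carrier M"
  shows "\<pi> {h \<in> carrier G. h \<in> Pos} (act M t x) = act M t (\<pi> {h \<in> carrier G. t \<otimes> h \<in> Pos} x)"
proof -
  have "{h \<in> carrier G. t \<otimes> h \<in> {h \<in> carrier G. h \<in> Pos}} = {h \<in> carrier G. t \<otimes> h \<in> Pos}" using assms(2) by auto
  thus ?thesis using proj_familyD(2)[OF assms(1), of t x "{h \<in> carrier G. h \<in> Pos}"] assms by simp
qed

text \<open>The functor \<open>Hom(P, -)\<close> is exact on a contractible complex, and the maps commuting with
  \<open>T\<close> and \<open>c\<close> are the invariants of the conjugation action.\<close>

lemma equivariant_lift:
  fixes P :: "('g, 'p) gmod" and C :: "('g, 'q) gcomplex"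
  assumes P: "relatively_projective G P" and C: "is_gcomplex G C" and con: "contractible_ab (obj C) (bd C)"
    and g: "g \<in> ghom G P (obj C n)" and dg: "\<And>x. x \<in> carrier P \<Longrightarrow> bd C n (g x) = \<one>\<^bsub>obj C (n - 1)\<^esub>"
  shows "\<exists>g'\<in>ghom G P (obj C (n + 1)). \<forall>x\<in>carrier P. bd C (n + 1) (g' x) = g x"
proof -
  let ?A = "\<lambda>k. conj_act G P (obj C (- k))"
  obtain \<pi> where \<pi>: "proj_family G P \<pi>" using relatively_projective_proj_family[OF P] ..
  have PM: "gmodule G P" using P by (simp add: relatively_projective_def)
  have CM: "gmodule G (obj C k)" for k using C by (simp add: is_gcomplex_def)
  interpret P: gmodule G P by (rule PM)
  have bh: "bd C k \<in> hom (obj C k) (obj C (k - 1))" and bg: "bd C k \<in> ghom G (obj C k) (obj C (k - 1))" for k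
    using C by (auto simp: is_gcomplex_def ghom_def)
  have bb: "bd C (k - 1) (bd C k x) = \<one>\<^bsub>obj C (k - 2)\<^esub>" if "x \<in> carrier (obj C k)" for x k
    using C that by (simp add: is_gcomplex_def)
  have \<pi>h: "\<pi> Z \<in> hom P P" for Z using \<pi> by (auto simp: proj_family_def)
  note \<pi>c = hom_in_carrier[OF \<pi>h] and bc = hom_in_carrier[OF bh]
  obtain s where s: "\<And>k. s k \<in> hom (obj C k) (obj C (k + 1))"
    and ds: "\<And>k x. x \<in> carrier (obj C k) \<Longrightarrow> bd C (k + 1) (s k x) \<otimes>\<^bsub>obj C k\<^esub> s (k - 1) (bd C k x) = x"
    using con unfolding contractible_ab_def by blast
  have ds': "bd C k (s (k - 1) x) \<otimes>\<^bsub>obj C (k - 1)\<^esub> s (k - 2) (bd C (k - 1) x) = x"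
    if "x \<in> carrier (obj C (k - 1))" for k x using ds[OF that] by simp
  have Tc: "t \<in> insert c T \<Longrightarrow> t \<in> carrier G" for t using T c by auto
  \<comment> \<open>The sign turns the chain complex into a cochain complex, as
    \<open>exact_on_invariants_involution\<close> expects.\<close>
  define E where "E k = hom_group P (obj C (- k))" for k
  define \<delta> where "\<delta> k u = (\<lambda>x\<in>carrier P. bd C (- k) (u x))" for k u
  \<comment> \<open>The cut-off acts on the source P while \<delta> acts on the target, so the two
    commute; it commutes with T because multiplication by T preserves \<open>Pos\<close>.\<close>
  define e where "e k u = (\<lambda>x\<in>carrier P. u (\<pi> {h \<in> carrier G. h \<in> Pos} x))" for k :: int and u :: "'p \<Rightarrow> 'q"
  have Euc: "u x \<in> carrier (obj C (- k))" if "u \<in> carrier (E k)" "x \<in> carrier P" for u x k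
    using hom_group_closed that by (auto simp: E_def)
  have Eh: "u \<in> hom P (obj C (- k))" if "u \<in> carrier (E k)" for u k
    using that by (simp add: E_def hom_group_iff)
  have EI: "(\<lambda>x\<in>carrier P. f x) \<in> carrier (E k)" if "f \<in> hom P (obj C (- k))" for f k
    using restrict_in_hom[OF P.M.is_group that] by (simp add: E_def hom_group_iff)
  have \<delta>c: "\<delta> k u \<in> carrier (E (k + 1))" if "u \<in> carrier (E k)" for k u
    unfolding \<delta>_def using Group.hom_compose[OF Eh[OF that] bh[of "- k"]] by (intro EI) (simp add: o_def)
  have ec: "e k u \<in> carrier (E k)" if "u \<in> carrier (E k)" for k u
    unfolding e_def using Group.hom_compose[OF \<pi>h Eh[OF that]] by (intro EI) (simp add: o_def)
  note posc = proj_family_Pos[OF \<pi>]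
  have "\<exists>v\<in>carrier (E (- n - 1)). \<delta> (- n - 1) v = (\<lambda>x\<in>carrier P. g x) \<and>
      (\<forall>s\<in>insert c T. conj_act G P (obj C (- (- n - 1))) s v = v)"
  proof (rule exact_on_invariants_involution[where E = E and \<delta> = \<delta> and e = e and
        C = "\<lambda>t k. ?A k t"])
    show "comm_group (E k)" for k
      unfolding E_def using comm_group_hom_group[OF P.M.is_group] gmodule.axioms(2)[OF CM] by blast
    show "\<delta> k \<in> hom (E k) (E (k + 1))" for k
    proof (rule homI)
      fix u w assume "u \<in> carrier (E k)" "w \<in> carrier (E k)"
      thus "\<delta> k (u \<otimes>\<^bsub>E k\<^esub> w) = \<delta> k u \<otimes>\<^bsub>E (k + 1)\<^esub> \<delta> k w"
        using hom_mult[OF bh[of "- k"]] Euc by (auto simp: \<delta>_def E_def hom_group_def intro!: restrict_ext)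
    qed (rule \<delta>c)
    show "\<delta> (k + 1) (\<delta> k u) = \<one>\<^bsub>E (k + 1 + 1)\<^esub>" if "u \<in> carrier (E k)" for k u
      using bb[of _ "- k"] Euc[OF that]
      by (auto simp: \<delta>_def E_def hom_group_def intro!: restrict_ext arg_cong[where f = "\<lambda>j. \<one>\<^bsub>obj C j\<^esub>"])
    show "?A k t \<in> hom (E k) (E k)" if "t \<in> insert c T" for t k
      unfolding E_def by (rule conj_act_hom[OF PM CM Tc[OF that]])
    show "conj_act G P (obj C (- (k + 1))) t (\<delta> k u) = \<delta> k (?A k t u)"
      if "t \<in> insert c T" "u \<in> carrier (E k)" for t k u
      using bg[of "- k"] Euc[OF that(2)] Tc[OF that(1)]
      by (auto simp: \<delta>_def conj_act_def ghom_def intro!: restrict_ext)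
    show "?A k t (?A k t' u) = ?A k t' (?A k t u)"
      if "t \<in> insert c T" "t' \<in> insert c T" "u \<in> carrier (E k)" for t t' k u
      by (rule conj_act_commute[OF comm_group_axioms PM CM Tc[OF that(1)] Tc[OF that(2)] that(3)[unfolded E_def]])
    \<comment> \<open>The contraction \<open>s\<close> is only additive, so at this stage it yields
      a primitive among all homomorphisms, not an equivariant one.\<close>
    show "\<exists>v\<in>carrier (E k). \<delta> k v = u" if u: "u \<in> carrier (E (k + 1))" "\<delta> (k + 1) u = \<one>\<^bsub>E (k + 1 + 1)\<^esub>" for k u
    proof
      show "(\<lambda>x\<in>carrier P. s (- k - 1) (u x)) \<in> carrier (E k)"
        using Group.hom_compose[OF Eh[OF u(1)], of "s (- k - 1)" "obj C (- k)"] s[of "- k - 1"] by (intro EI) (simp add: o_def)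
      show "\<delta> k (\<lambda>x\<in>carrier P. s (- k - 1) (u x)) = u"
      proof (rule hom_group_eqI)
        show "u \<in> carrier (hom_group P (obj C (- (k + 1))))" using u by (simp add: E_def)
        show "\<delta> k (\<lambda>x\<in>carrier P. s (- k - 1) (u x)) \<in> carrier (hom_group P (obj C (- (k + 1))))"
          using \<delta>c \<open>(\<lambda>x\<in>carrier P. s (- k - 1) (u x)) \<in> carrier (E k)\<close> by (simp add: E_def)
        fix x assume x: "x \<in> carrier P"
        interpret Ck: gmodule G "obj C (- k - 1)" by (rule CM)
        interpret Ck2: gmodule G "obj C (- k - 2)" by (rule CM)
        have uc: "u x \<in> carrier (obj C (- k - 1))" using Euc[OF u(1) x] by simp
        have "bd C (- k - 1) (u x) = \<one>\<^bsub>obj C (- k - 2)\<^esub>"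
        proof -
          have "- (k + 1 + 1) = - k - 2" by simp
          hence "\<delta> (k + 1) u x = \<one>\<^bsub>obj C (- k - 2)\<^esub>"
            using fun_cong[OF u(2), of x] x by (simp only: E_def hom_group_def monoid.simps restrict_apply' simp_thms)
          thus ?thesis using x by (simp add: \<delta>_def)
        qed
        moreover have "s (- k - 2) \<one>\<^bsub>obj C (- k - 2)\<^esub> = \<one>\<^bsub>obj C (- k - 1)\<^esub>"
        proof -
          have "- k - 2 + 1 = - k - 1" by simp
          hence "s (- k - 2) \<in> hom (obj C (- k - 2)) (obj C (- k - 1))" using s[of "- k - 2"] by (simp only:)
          thus ?thesis by (rule hom_one[OF _ Ck2.M.is_group Ck.M.is_group])
        qed
        moreover have "bd C (- k) (s (- k - 1) (u x)) \<in> carrier (obj C (- k - 1))"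
          using bc[of "s (- k - 1) (u x)" "- k"] hom_in_carrier[OF s[of "- k - 1"] uc] by simp
        ultimately show "\<delta> k (\<lambda>x\<in>carrier P. s (- k - 1) (u x)) x = u x"
          using ds'[OF uc] x by (simp add: \<delta>_def)
      qed
    qed
    show "\<exists>w\<in>carrier (E k). (\<forall>s\<in>S. ?A k s w = w) \<and>
        ?A k t w = w \<otimes>\<^bsub>E k\<^esub> u"
      if "t \<in> T" "S \<subseteq> T - {t}" "u \<in> carrier (E k)" "\<forall>s\<in>S. ?A k s u = u" for t S k u
      unfolding E_def by (rule conj_act_equation_solvable[OF PM CM \<pi> that(1,2) that(3)[unfolded E_def] that(4)])
    show "?A k c (?A k c u) = u" if "u \<in> carrier (E k)" for k u
    proof -
      interpret Ck: gmodule G "obj C (- k)" by (rule CM)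
      have "?A k c (?A k c u) x = u x" if "x \<in> carrier P" for x
        using that c Euc[OF \<open>u \<in> carrier (E k)\<close>]
        by (simp add: conj_act_def P.act_mult[symmetric] Ck.act_mult[symmetric] cc P.act_one Ck.act_one)
      thus ?thesis
        using that conj_act_closed[OF PM CM c] by (intro hom_group_eqI[of _ P "obj C (- k)"]) (auto simp: E_def)
    qed
    show "e k \<in> hom (E k) (E k)" for k
    proof (rule homI)
      fix u w assume "u \<in> carrier (E k)" "w \<in> carrier (E k)"
      thus "e k (u \<otimes>\<^bsub>E k\<^esub> w) = e k u \<otimes>\<^bsub>E k\<^esub> e k w"
        using \<pi>c by (auto simp: e_def E_def hom_group_def intro!: restrict_ext)
    qed (rule ec)
    show "e (k + 1) (\<delta> k u) = \<delta> k (e k u)" if "u \<in> carrier (E k)" for k u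
      using \<pi>c by (auto simp: e_def \<delta>_def intro!: restrict_ext)
    show "?A k t (e k u) = e k (?A k t u)"
      if "t \<in> T" "u \<in> carrier (E k)" for t k u
    proof -
      have tG: "t \<in> carrier G" using that T by auto
      have "{h \<in> carrier G. inv t \<otimes> h \<in> Pos} = {h \<in> carrier G. h \<in> Pos}"
      proof -
        have "inv t \<otimes> h \<in> Pos \<longleftrightarrow> h \<in> Pos" if "h \<in> carrier G" for h
          using Pos_T[OF \<open>t \<in> T\<close>, of "inv t \<otimes> h"] tG that m_assoc[of t "inv t" h] by simp
        thus ?thesis by auto
      qed
      thus ?thesis
        using \<pi>c posc[of "inv t"] tG by (auto simp: e_def conj_act_def intro!: restrict_ext)
    qed
    show "e k u \<otimes>\<^bsub>E k\<^esub> ?A k c (e k u) = u"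
      if u: "u \<in> carrier (E k)" "?A k c u = u" for k u
    proof -
      interpret Ek: comm_group "E k"
        unfolding E_def using comm_group_hom_group[OF P.M.is_group] gmodule.axioms(2)[OF CM] by blast
      interpret Ck: gmodule G "obj C (- k)" by (rule CM)
      have uc: "u (act P c x) = act (obj C (- k)) c (u x)" if "x \<in> carrier P" for x
        using conj_act_fixed_iff[OF PM CM c u(1)[unfolded E_def]] u(2) that by auto
      have cpc: "?A k c (e k u) \<in> carrier (E k)"
        using conj_act_closed[OF PM CM c] ec[OF u(1)] by (simp add: E_def)
      have "(e k u \<otimes>\<^bsub>E k\<^esub> ?A k c (e k u)) x = u x" if x: "x \<in> carrier P" for x
      proof -
        let ?Z = "{h \<in> carrier G. h \<in> Pos}" and ?W = "{h \<in> carrier G. c \<otimes> h \<in> Pos}"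
        have "act (obj C (- k)) c (e k u (act P c x)) = act (obj C (- k)) c (u (act P c (\<pi> ?W x)))"
          using x c posc[of c x] by (simp add: e_def)
        also have "\<dots> = u (\<pi> ?W x)"
          using uc[OF \<pi>c[OF x]] Euc[OF u(1) \<pi>c[OF x]] c by (simp add: Ck.act_mult[symmetric] cc Ck.act_one)
        finally have 1: "act (obj C (- k)) c (e k u (act P c x)) = u (\<pi> ?W x)" .
        have "?Z \<inter> ?W = {} \<and> ?Z \<union> ?W = carrier G \<and> x \<in> carrier P" using Pos_c x by auto
        hence "\<pi> ?Z x \<otimes>\<^bsub>P\<^esub> \<pi> ?W x = x"
          by (rule proj_familyD(1)[OF \<pi>])
        hence "u (\<pi> ?Z x) \<otimes>\<^bsub>obj C (- k)\<^esub> u (\<pi> ?W x) = u x" using x hom_mult[OF Eh[OF u(1)] \<pi>c \<pi>c] by metis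
        thus ?thesis using 1 x c by (simp add: E_def hom_group_def conj_act_def e_def)
      qed
      thus ?thesis using u(1) Ek.m_closed[OF ec[OF u(1)] cpc]
        by (intro hom_group_eqI[of _ P "obj C (- k)"]) (auto simp: E_def)
    qed
    have gh: "g \<in> hom P (obj C n)" using g by (simp add: ghom_def)
    show gE: "(\<lambda>x\<in>carrier P. g x) \<in> carrier (E (- n - 1 + 1))"
      using EI[of g "- n"] gh by simp
    show "\<delta> (- n - 1 + 1) (\<lambda>x\<in>carrier P. g x) = \<one>\<^bsub>E (- n - 1 + 1 + 1)\<^esub>"
      using dg by (auto simp: \<delta>_def E_def hom_group_def intro!: restrict_ext)
    show "\<forall>s\<in>insert c T. conj_act G P (obj C (- (- n - 1 + 1))) s (\<lambda>x\<in>carrier P. g x) = (\<lambda>x\<in>carrier P. g x)"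
    proof
      fix s assume s: "s \<in> insert c T"
      show "conj_act G P (obj C (- (- n - 1 + 1))) s (\<lambda>x\<in>carrier P. g x) = (\<lambda>x\<in>carrier P. g x)"
        unfolding conj_act_fixed_iff[OF PM CM Tc[OF s] gE[unfolded E_def]]
        using g Tc[OF s] by (auto simp: ghom_def)
    qed
  qed (rule finT)
  then obtain w where w: "w \<in> carrier (E (- n - 1))" "\<delta> (- n - 1) w = (\<lambda>x\<in>carrier P. g x)"
      "\<And>s. s \<in> insert c T \<Longrightarrow> conj_act G P (obj C (- (- n - 1))) s w = w" by blast
  have "w \<in> ghom G P (obj C (n + 1))"
  proof (rule ghomI_generators[OF PM CM])
    show "w \<in> hom P (obj C (n + 1))" using Eh[OF w(1)] by (simp add: add.commute)
    fix s x assume s: "s \<in> insert c T" and x: "x \<in> carrier P"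
    show "w (act P s x) = act (obj C (n + 1)) s (w x)"
      using w(3)[OF s, unfolded conj_act_fixed_iff[OF PM CM Tc[OF s] w(1)[unfolded E_def]]] x by (simp add: add.commute)
  qed
  moreover have "\<forall>x\<in>carrier P. bd C (n + 1) (w x) = g x"
    using fun_cong[OF w(2)] by (auto simp: \<delta>_def add.commute restrict_def split: if_splits) metis
  ultimately show ?thesis by blast
qed

text \<open>Dual to \<open>equivariant_lift\<close>, with \<open>Hom(-, M)\<close> in place of
  \<open>Hom(P, -)\<close>. The telescoping uses cut-offs of the terms of X, chosen separately in
  each degree. The half operator for c has to commute with precomposition by the differential, so it
  uses cut-offs of the target M; hence both X and M are relatively projective.\<close>

lemma equivariant_extension:
  fixes X :: "('g, 'p) gcomplex" and M :: "('g, 'q) gmod"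
  assumes M: "relatively_projective G M" and X: "is_gcomplex G X" and con: "contractible_ab (obj X) (bd X)"
    and rel: "\<And>k. relatively_projective G (obj X k)"
    and g: "g \<in> ghom G (obj X n) M" and gd: "\<And>x. x \<in> carrier (obj X (n + 1)) \<Longrightarrow> g (bd X (n + 1) x) = \<one>\<^bsub>M\<^esub>"
  shows "\<exists>g'\<in>ghom G (obj X (n - 1)) M. \<forall>x\<in>carrier (obj X n). g' (bd X n x) = g x"
proof -
  let ?A = "\<lambda>k. conj_act G (obj X k) M"
  obtain \<pi> where \<pi>: "proj_family G M \<pi>" using relatively_projective_proj_family[OF M] ..
  have MM: "gmodule G M" using M by (simp add: relatively_projective_def)
  have XM: "gmodule G (obj X k)" for k using X by (simp add: is_gcomplex_def)
  have XG: "group (obj X k)" for k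
    using XM[of k] by (simp add: gmodule_def comm_group_def)
  interpret M: gmodule G M by (rule MM)
  have bh: "bd X k \<in> hom (obj X k) (obj X (k - 1))" and bg: "bd X k \<in> ghom G (obj X k) (obj X (k - 1))" for k
    using X by (auto simp: is_gcomplex_def ghom_def)
  have bh1: "bd X (k + 1) \<in> hom (obj X (k + 1)) (obj X k)" for k using bh[of "k + 1"] by simp
  have bb: "bd X (k - 1) (bd X k x) = \<one>\<^bsub>obj X (k - 2)\<^esub>" if "x \<in> carrier (obj X k)" for x k
    using X that by (simp add: is_gcomplex_def)
  have bb': "bd X k (bd X (k + 1) x) = \<one>\<^bsub>obj X (k - 1)\<^esub>" if "x \<in> carrier (obj X (k + 1))" for x k
    using bb[OF that] by simp
  have \<pi>h: "\<pi> Z \<in> hom M M" for Z using \<pi> by (auto simp: proj_family_def)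
  note \<pi>c = hom_in_carrier[OF \<pi>h] and bc = hom_in_carrier[OF bh] and bc1 = hom_in_carrier[OF bh1]
  obtain s where s: "\<And>k. s k \<in> hom (obj X k) (obj X (k + 1))"
    and ds: "\<And>k x. x \<in> carrier (obj X k) \<Longrightarrow> bd X (k + 1) (s k x) \<otimes>\<^bsub>obj X k\<^esub> s (k - 1) (bd X k x) = x"
    using con unfolding contractible_ab_def by blast
  have Tc: "t \<in> insert c T \<Longrightarrow> t \<in> carrier G" for t using T c by auto
  define E where "E k = hom_group (obj X k) M" for k
  define \<delta> where "\<delta> k u = (\<lambda>x\<in>carrier (obj X (k + 1)). u (bd X (k + 1) x))" for k and u :: "'p \<Rightarrow> 'q"
  define e where "e k u = (\<lambda>x\<in>carrier (obj X k). \<pi> {h \<in> carrier G. h \<in> Pos} (u x))" for k :: int and u :: "'p \<Rightarrow> 'q"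
  have Euc: "u x \<in> carrier M" if "u \<in> carrier (E k)" "x \<in> carrier (obj X k)" for u x k
    using hom_group_closed that by (auto simp: E_def)
  have Eh: "u \<in> hom (obj X k) M" if "u \<in> carrier (E k)" for u k
    using that by (simp add: E_def hom_group_iff)
  have EI: "(\<lambda>x\<in>carrier (obj X k). f x) \<in> carrier (E k)" if "f \<in> hom (obj X k) M" for f k
    using restrict_in_hom[OF XG that] by (simp add: E_def hom_group_iff)
  have \<delta>c: "\<delta> k u \<in> carrier (E (k + 1))" if "u \<in> carrier (E k)" for k u
    unfolding \<delta>_def using Group.hom_compose[OF bh1 Eh[OF that]] by (intro EI) (simp add: o_def)
  have ec: "e k u \<in> carrier (E k)" if "u \<in> carrier (E k)" for k u
    unfolding e_def using Group.hom_compose[OF Eh[OF that] \<pi>h] by (intro EI) (simp add: o_def)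
  note posc = proj_family_Pos[OF \<pi>]
  have Xact: "act (obj X k) t x \<in> carrier (obj X k)" if "t \<in> carrier G" "x \<in> carrier (obj X k)" for t x k
    using gmodule.act_closed[OF XM that] .
  have "\<exists>v\<in>carrier (E (n - 1)). \<delta> (n - 1) v = (\<lambda>x\<in>carrier (obj X n). g x) \<and>
      (\<forall>s\<in>insert c T. conj_act G (obj X (n - 1)) M s v = v)"
  proof (rule exact_on_invariants_involution[where E = E and \<delta> = \<delta> and e = e and
        C = "\<lambda>t k. ?A k t"])
    show "comm_group (E k)" for k
      unfolding E_def using comm_group_hom_group[OF XG M.M.comm_group_axioms] .
    show "\<delta> k \<in> hom (E k) (E (k + 1))" for k
    proof (rule homI)
      fix u w assume "u \<in> carrier (E k)" "w \<in> carrier (E k)"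
      thus "\<delta> k (u \<otimes>\<^bsub>E k\<^esub> w) = \<delta> k u \<otimes>\<^bsub>E (k + 1)\<^esub> \<delta> k w"
        using bc1[of _ k] by (auto simp: \<delta>_def E_def hom_group_def intro!: restrict_ext)
    qed (rule \<delta>c)
    show "\<delta> (k + 1) (\<delta> k u) = \<one>\<^bsub>E (k + 1 + 1)\<^esub>" if "u \<in> carrier (E k)" for k u
    proof -
      have "u \<one>\<^bsub>obj X k\<^esub> = \<one>\<^bsub>M\<^esub>" using hom_one[OF Eh[OF that] XG M.M.is_group] .
      thus ?thesis
        using bb'[of _ "k + 1"] bc1[of _ "k + 1"] by (auto simp: \<delta>_def E_def hom_group_def intro!: restrict_ext)
    qed
    show "?A k t \<in> hom (E k) (E k)" if "t \<in> insert c T" for t k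
      unfolding E_def by (rule conj_act_hom[OF XM MM Tc[OF that]])
    show "conj_act G (obj X (k + 1)) M t (\<delta> k u) = \<delta> k (?A k t u)"
      if "t \<in> insert c T" "u \<in> carrier (E k)" for t k u
      using bg[of "k + 1"] bc1[of _ k] Tc[OF that(1)] Xact
      by (auto simp: \<delta>_def conj_act_def ghom_def intro!: restrict_ext)
    show "?A k t (?A k t' u) = ?A k t' (?A k t u)"
      if "t \<in> insert c T" "t' \<in> insert c T" "u \<in> carrier (E k)" for t t' k u
      by (rule conj_act_commute[OF comm_group_axioms XM MM Tc[OF that(1)] Tc[OF that(2)] that(3)[unfolded E_def]])
    show "\<exists>v\<in>carrier (E k). \<delta> k v = u" if u: "u \<in> carrier (E (k + 1))" "\<delta> (k + 1) u = \<one>\<^bsub>E (k + 1 + 1)\<^esub>" for k u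
    proof
      show vE: "(\<lambda>x\<in>carrier (obj X k). u (s k x)) \<in> carrier (E k)"
        using Group.hom_compose[OF s Eh[OF u(1)]] by (intro EI) (simp add: o_def)
      show "\<delta> k (\<lambda>x\<in>carrier (obj X k). u (s k x)) = u"
      proof (rule hom_group_eqI[OF \<delta>c[OF vE, unfolded E_def] u(1)[unfolded E_def]])
        fix x assume x: "x \<in> carrier (obj X (k + 1))"
        have sx: "s (k + 1) x \<in> carrier (obj X (k + 1 + 1))" using hom_in_carrier[OF s x] .
        have "u (bd X (k + 1 + 1) (s (k + 1) x)) = \<one>\<^bsub>M\<^esub>"
          using fun_cong[OF u(2), of "s (k + 1) x"] sx by (simp add: \<delta>_def E_def hom_group_def)
        moreover have "u (bd X (k + 1 + 1) (s (k + 1) x)) \<otimes>\<^bsub>M\<^esub> u (s k (bd X (k + 1) x)) = u x"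
          using ds[OF x] hom_mult[OF Eh[OF u(1)] bc1[OF sx] hom_in_carrier[OF s bc1[OF x]]] by simp
        moreover have "u (s k (bd X (k + 1) x)) \<in> carrier M"
          using Euc[OF u(1) hom_in_carrier[OF s bc1[OF x]]] .
        ultimately show "\<delta> k (\<lambda>x\<in>carrier (obj X k). u (s k x)) x = u x"
          using x bc1[OF x] by (simp add: \<delta>_def)
      qed
    qed
    show "\<exists>w\<in>carrier (E k). (\<forall>s\<in>S. ?A k s w = w) \<and>
        ?A k t w = w \<otimes>\<^bsub>E k\<^esub> u"
      if "t \<in> T" "S \<subseteq> T - {t}" "u \<in> carrier (E k)" "\<forall>s\<in>S. ?A k s u = u" for t S k u
    proof -
      obtain \<rho> where \<rho>: "proj_family G (obj X k) \<rho>" using relatively_projective_proj_family[OF rel] ..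
      show ?thesis
        unfolding E_def by (rule conj_act_equation_solvable[OF XM MM \<rho> that(1,2) that(3)[unfolded E_def] that(4)])
    qed
    show "?A k c (?A k c u) = u" if "u \<in> carrier (E k)" for k u
    proof -
      interpret Xk: gmodule G "obj X k" by (rule XM)
      have "?A k c (?A k c u) x = u x" if "x \<in> carrier (obj X k)" for x
        using that c Euc[OF \<open>u \<in> carrier (E k)\<close>]
        by (simp add: conj_act_def Xk.act_mult[symmetric] M.act_mult[symmetric] cc Xk.act_one M.act_one)
      thus ?thesis
        using that conj_act_closed[OF XM MM c] by (intro hom_group_eqI[of _ "obj X k" M]) (auto simp: E_def)
    qed
    show "e k \<in> hom (E k) (E k)" for k
    proof (rule homI)
      fix u w assume "u \<in> carrier (E k)" "w \<in> carrier (E k)"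
      thus "e k (u \<otimes>\<^bsub>E k\<^esub> w) = e k u \<otimes>\<^bsub>E k\<^esub> e k w"
        using hom_mult[OF \<pi>h] Euc by (auto simp: e_def E_def hom_group_def intro!: restrict_ext)
    qed (rule ec)
    show "e (k + 1) (\<delta> k u) = \<delta> k (e k u)" if "u \<in> carrier (E k)" for k u
      using bc1 by (auto simp: e_def \<delta>_def intro!: restrict_ext)
    show "?A k t (e k u) = e k (?A k t u)"
      if "t \<in> T" "u \<in> carrier (E k)" for t k u
    proof -
      have tG: "t \<in> carrier G" using that T by auto
      have "{h \<in> carrier G. t \<otimes> h \<in> Pos} = {h \<in> carrier G. h \<in> Pos}"
        using Pos_T[OF that(1)] by auto
      thus ?thesis
        using posc[of t] tG Xact Euc[OF that(2)] by (auto simp: e_def conj_act_def intro!: restrict_ext)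
    qed
    show "e k u \<otimes>\<^bsub>E k\<^esub> ?A k c (e k u) = u"
      if u: "u \<in> carrier (E k)" "?A k c u = u" for k u
    proof -
      interpret Ek: comm_group "E k"
        unfolding E_def using comm_group_hom_group[OF XG M.M.comm_group_axioms] .
      have uc: "u (act (obj X k) c x) = act M c (u x)" if "x \<in> carrier (obj X k)" for x
        using conj_act_fixed_iff[OF XM MM c u(1)[unfolded E_def]] u(2) that by auto
      have cpc: "?A k c (e k u) \<in> carrier (E k)"
        using conj_act_closed[OF XM MM c] ec[OF u(1)] by (simp add: E_def)
      have "(e k u \<otimes>\<^bsub>E k\<^esub> ?A k c (e k u)) x = u x" if x: "x \<in> carrier (obj X k)" for x
      proof -
        let ?Z = "{h \<in> carrier G. h \<in> Pos}" and ?W = "{h \<in> carrier G. c \<otimes> h \<in> Pos}"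
        have "act M c (e k u (act (obj X k) c x)) = act M c (act M c (\<pi> ?W (u x)))"
          using x c posc[OF c Euc[OF u(1) x]] Xact by (simp add: e_def uc)
        also have "\<dots> = \<pi> ?W (u x)"
          using \<pi>c[OF Euc[OF u(1) x]] c by (simp add: M.act_mult[symmetric] cc M.act_one)
        finally have 1: "act M c (e k u (act (obj X k) c x)) = \<pi> ?W (u x)" .
        have "?Z \<inter> ?W = {} \<and> ?Z \<union> ?W = carrier G \<and> u x \<in> carrier M" using Pos_c Euc[OF u(1) x] by auto
        hence "\<pi> ?Z (u x) \<otimes>\<^bsub>M\<^esub> \<pi> ?W (u x) = u x"
          by (rule proj_familyD(1)[OF \<pi>])
        thus ?thesis using 1 x c by (simp add: E_def hom_group_def conj_act_def e_def)
      qed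
      thus ?thesis using u(1) Ek.m_closed[OF ec[OF u(1)] cpc]
        by (intro hom_group_eqI[of _ "obj X k" M]) (auto simp: E_def)
    qed
    have gh: "g \<in> hom (obj X n) M" using g by (simp add: ghom_def)
    show gE: "(\<lambda>x\<in>carrier (obj X n). g x) \<in> carrier (E (n - 1 + 1))"
      using EI[of g n] gh by simp
    show "\<delta> (n - 1 + 1) (\<lambda>x\<in>carrier (obj X n). g x) = \<one>\<^bsub>E (n - 1 + 1 + 1)\<^esub>"
      using gd bc1 by (auto simp: \<delta>_def E_def hom_group_def intro!: restrict_ext)
    show "\<forall>s\<in>insert c T. conj_act G (obj X (n - 1 + 1)) M s (\<lambda>x\<in>carrier (obj X n). g x) = (\<lambda>x\<in>carrier (obj X n). g x)"
    proof
      fix s assume s: "s \<in> insert c T"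
      show "conj_act G (obj X (n - 1 + 1)) M s (\<lambda>x\<in>carrier (obj X n). g x) = (\<lambda>x\<in>carrier (obj X n). g x)"
        unfolding conj_act_fixed_iff[OF XM MM Tc[OF s] gE[unfolded E_def]]
        using g Tc[OF s] Xact by (auto simp: ghom_def)
    qed
  qed (rule finT)
  then obtain w where w: "w \<in> carrier (E (n - 1))" "\<delta> (n - 1) w = (\<lambda>x\<in>carrier (obj X n). g x)"
      "\<And>s. s \<in> insert c T \<Longrightarrow> conj_act G (obj X (n - 1)) M s w = w" by blast
  have "w \<in> ghom G (obj X (n - 1)) M"
  proof (rule ghomI_generators[OF XM MM])
    show "w \<in> hom (obj X (n - 1)) M" using Eh[OF w(1)] by simp
    fix s x assume s: "s \<in> insert c T" and x: "x \<in> carrier (obj X (n - 1))"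
    show "w (act (obj X (n - 1)) s x) = act M s (w x)"
      using w(3)[OF s, unfolded conj_act_fixed_iff[OF XM MM Tc[OF s] w(1)[unfolded E_def]]] x by simp
  qed
  moreover have "\<forall>x\<in>carrier (obj X n). w (bd X n x) = g x"
    using fun_cong[OF w(2)] by (auto simp: \<delta>_def restrict_def split: if_splits) (metis)
  ultimately show ?thesis by blast
qed

end

section \<open>Equivariant chain maps\<close>

lemma ghom_closed: "f \<in> ghom G M N \<Longrightarrow> x \<in> carrier M \<Longrightarrow> f x \<in> carrier N"
  by (auto simp: ghom_def hom_in_carrier)

lemma ghom_mult: "f \<in> ghom G M N \<Longrightarrow> x \<in> carrier M \<Longrightarrow> y \<in> carrier M \<Longrightarrow> f (x \<otimes>\<^bsub>M\<^esub> y) = f x \<otimes>\<^bsub>N\<^esub> f y"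
  by (auto simp: ghom_def hom_mult)

lemma ghom_act: "f \<in> ghom G M N \<Longrightarrow> g \<in> carrier G \<Longrightarrow> x \<in> carrier M \<Longrightarrow> f (act M g x) = act N g (f x)"
  by (auto simp: ghom_def)

lemma ghom_group_hom:
  assumes "gmodule G M" "gmodule G N" "f \<in> ghom G M N"
  shows "group_hom M N f"
proof -
  interpret M: gmodule G M by fact
  interpret N: gmodule G N by fact
  show ?thesis using assms(3) by unfold_locales (simp add: ghom_def)
qed

lemma ghom_neutral: "gmodule G M \<Longrightarrow> gmodule G N \<Longrightarrow> f \<in> ghom G M N \<Longrightarrow> f \<one>\<^bsub>M\<^esub> = \<one>\<^bsub>N\<^esub>"
  by (rule group_hom.hom_one[OF ghom_group_hom])

lemma ghom_minv: "gmodule G M \<Longrightarrow> gmodule G N \<Longrightarrow> f \<in> ghom G M N \<Longrightarrow> x \<in> carrier M \<Longrightarrow> f (inv\<^bsub>M\<^esub> x) = inv\<^bsub>N\<^esub> (f x)"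
  by (rule group_hom.hom_inv[OF ghom_group_hom])

lemma ghom_comp: "f \<in> ghom G M N \<Longrightarrow> h \<in> ghom G N K \<Longrightarrow> (\<lambda>x. h (f x)) \<in> ghom G M K"
  by (auto simp: ghom_def hom_def Pi_def)

lemma ghom_const_one: "gmodule G N \<Longrightarrow> (\<lambda>x. \<one>\<^bsub>N\<^esub>) \<in> ghom G M N"
proof -
  assume "gmodule G N"
  then interpret N: gmodule G N .
  show ?thesis by (simp add: ghom_def hom_def)
qed

lemma ghom_minv_comp:
  assumes "gmodule G N" "f \<in> ghom G M N"
  shows "(\<lambda>x. inv\<^bsub>N\<^esub> (f x)) \<in> ghom G M N"
proof -
  interpret N: gmodule G N by fact
  show ?thesis
    unfolding ghom_def
    by (auto intro!: homI simp: ghom_closed[OF assms(2)] ghom_mult[OF assms(2)] ghom_act[OF assms(2)] N.act_minv N.M.inv_mult)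
qed

lemma ghom_diff:
  assumes "gmodule G N" "f \<in> ghom G M N" "h \<in> ghom G M N"
  shows "(\<lambda>x. f x \<otimes>\<^bsub>N\<^esub> inv\<^bsub>N\<^esub> (h x)) \<in> ghom G M N"
proof -
  interpret N: gmodule G N by fact
  note h' = ghom_minv_comp[OF assms(1,3)]
  have hc: "h x \<in> carrier N" if "x \<in> carrier M" for x using ghom_closed[OF assms(3) that] .
  show ?thesis
    unfolding ghom_def
    using N.M.hom_group_mult[of f M "\<lambda>x. inv\<^bsub>N\<^esub> (h x)"] assms h'
    by (auto simp: ghom_closed[OF assms(2)] hc ghom_act[OF assms(2)] ghom_act[OF assms(3)] N.act_minv N.act_m)
      (auto simp: ghom_def)
qed

lemma giso_inverse:
  assumes M: "gmodule G M" and N: "gmodule G N" and f: "f \<in> giso G M N"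
  shows "inv_into (carrier M) f \<in> ghom G N M"
    and "\<And>y. y \<in> carrier N \<Longrightarrow> f (inv_into (carrier M) f y) = y"
    and "\<And>x. x \<in> carrier M \<Longrightarrow> inv_into (carrier M) f (f x) = x"
proof -
  interpret M: gmodule G M by fact
  interpret N: gmodule G N by fact
  have fg: "f \<in> ghom G M N" and fi: "f \<in> iso M N" and bij: "bij_betw f (carrier M) (carrier N)"
    using f by (auto simp: giso_def iso_def)
  show 1: "f (inv_into (carrier M) f y) = y" if "y \<in> carrier N" for y
    using bij that unfolding bij_betw_def by (metis f_inv_into_f)
  show 2: "inv_into (carrier M) f (f x) = x" if "x \<in> carrier M" for x
    using bij that unfolding bij_betw_def by simp
  have c: "inv_into (carrier M) f y \<in> carrier M" if "y \<in> carrier N" for y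
    using bij that unfolding bij_betw_def by (metis inv_into_into)
  have "inv_into (carrier M) f \<in> hom N M"
    using M.M.iso_set_sym[OF fi] by (simp add: iso_def)
  moreover have "inv_into (carrier M) f (act N g y) = act M g (inv_into (carrier M) f y)"
    if g: "g \<in> carrier G" and y: "y \<in> carrier N" for g y
  proof -
    have "act N g y = f (act M g (inv_into (carrier M) f y))"
      using ghom_act[OF fg g c[OF y]] 1[OF y] by simp
    thus ?thesis using 2 g c[OF y] by simp
  qed
  ultimately show "inv_into (carrier M) f \<in> ghom G N M" by (simp add: ghom_def)
qed

lemma gcomplexD:
  assumes "is_gcomplex G C"
  shows "gmodule G (obj C n)" "bd C n \<in> ghom G (obj C n) (obj C (n - 1))"
    "bd C (n + 1) \<in> ghom G (obj C (n + 1)) (obj C n)"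
    "x \<in> carrier (obj C n) \<Longrightarrow> bd C (n - 1) (bd C n x) = \<one>\<^bsub>obj C (n - 2)\<^esub>"
    "x \<in> carrier (obj C (n + 1)) \<Longrightarrow> bd C n (bd C (n + 1) x) = \<one>\<^bsub>obj C (n - 1)\<^esub>"
proof -
  note * = assms[unfolded is_gcomplex_def, rule_format]
  show "gmodule G (obj C n)" "bd C n \<in> ghom G (obj C n) (obj C (n - 1))"
    "x \<in> carrier (obj C n) \<Longrightarrow> bd C (n - 1) (bd C n x) = \<one>\<^bsub>obj C (n - 2)\<^esub>" using *[of n] by auto
  show "bd C (n + 1) \<in> ghom G (obj C (n + 1)) (obj C n)"
    "x \<in> carrier (obj C (n + 1)) \<Longrightarrow> bd C n (bd C (n + 1) x) = \<one>\<^bsub>obj C (n - 1)\<^esub>" using *[of "n + 1"] by auto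
qed

lemma gchain_mapD:
  assumes "gchain_map G C D \<phi>"
  shows "\<phi> n \<in> ghom G (obj C n) (obj D n)"
    "x \<in> carrier (obj C n) \<Longrightarrow> \<phi> (n - 1) (bd C n x) = bd D n (\<phi> n x)"
    "x \<in> carrier (obj C (n + 1)) \<Longrightarrow> \<phi> n (bd C (n + 1) x) = bd D (n + 1) (\<phi> (n + 1) x)"
  using assms[unfolded gchain_map_def, rule_format, of n] assms[unfolded gchain_map_def, rule_format, of "n + 1"] by auto

lemma gchain_map_comp: "gchain_map G C D \<phi> \<Longrightarrow> gchain_map G D E \<psi> \<Longrightarrow> gchain_map G C E (\<lambda>n x. \<psi> n (\<phi> n x))"
  unfolding gchain_map_def using ghom_comp ghom_closed by fastforce

lemma gchain_map_id: "gchain_map G C C (\<lambda>n x. x)"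
  by (auto simp: gchain_map_def ghom_def hom_def)

lemma gchain_map_diff:
  assumes "is_gcomplex G C" "is_gcomplex G D" "gchain_map G C D \<phi>" "gchain_map G C D \<psi>"
  shows "gchain_map G C D (\<lambda>n x. \<phi> n x \<otimes>\<^bsub>obj D n\<^esub> inv\<^bsub>obj D n\<^esub> (\<psi> n x))"
  unfolding gchain_map_def
proof (intro allI conjI ballI)
  fix n
  note D = gcomplexD[OF assms(2)] and \<phi> = gchain_mapD[OF assms(3)] and \<psi> = gchain_mapD[OF assms(4)]
  show "(\<lambda>x. \<phi> n x \<otimes>\<^bsub>obj D n\<^esub> inv\<^bsub>obj D n\<^esub> (\<psi> n x)) \<in> ghom G (obj C n) (obj D n)"
    by (intro ghom_diff D \<phi> \<psi>)
  fix x assume x: "x \<in> carrier (obj C n)"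
  interpret Dn: gmodule G "obj D n" by (rule D)
  show "\<phi> (n - 1) (bd C n x) \<otimes>\<^bsub>obj D (n - 1)\<^esub> inv\<^bsub>obj D (n - 1)\<^esub> (\<psi> (n - 1) (bd C n x)) =
    bd D n (\<phi> n x \<otimes>\<^bsub>obj D n\<^esub> inv\<^bsub>obj D n\<^esub> (\<psi> n x))"
    using x ghom_closed[OF \<phi>(1) x] ghom_closed[OF \<psi>(1) x]
    by (simp add: \<phi>(2) \<psi>(2) ghom_mult[OF D(2)] ghom_minv[OF D(1) D(1) D(2)])
qed

text \<open>Dependent choice along degrees: A is the condition that lets the construction continue,
  R the equation linking two consecutive maps.\<close>

lemma int_upward_choice:
  fixes N :: int
  assumes "A N b0" and step: "\<And>n b. N \<le> n \<Longrightarrow> A n b \<Longrightarrow> \<exists>b'. A (n + 1) b' \<and> R n b b'"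
  shows "\<exists>f. f N = b0 \<and> (\<forall>n\<ge>N. A n (f n) \<and> R n (f n) (f (n + 1)))"
proof -
  have "\<exists>f. \<forall>k. (A (N + int k) (f k) \<and> (k = 0 \<longrightarrow> f k = b0)) \<and> R (N + int k) (f k) (f (Suc k))"
  proof (rule dependent_nat_choice)
    show "\<exists>x. A (N + int 0) x \<and> (0 = 0 \<longrightarrow> x = b0)" using assms(1) by auto
    fix x and k assume "A (N + int k) x \<and> (k = 0 \<longrightarrow> x = b0)"
    with step[of "N + int k" x] obtain b' where "A (N + int k + 1) b'" "R (N + int k) x b'" by auto
    thus "\<exists>y. (A (N + int (Suc k)) y \<and> (Suc k = 0 \<longrightarrow> y = b0)) \<and> R (N + int k) x y"
      by (intro exI[of _ b']) (simp add: ac_simps)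
  qed
  then obtain f where f: "\<And>k. A (N + int k) (f k)" "f 0 = b0" "\<And>k. R (N + int k) (f k) (f (Suc k))" by blast
  have "A n (f (nat (n - N))) \<and> R n (f (nat (n - N))) (f (nat (n + 1 - N)))" if "n \<ge> N" for n
  proof -
    have "nat (n + 1 - N) = Suc (nat (n - N))" and "N + int (nat (n - N)) = n" using that by auto
    thus ?thesis using f(1)[of "nat (n - N)"] f(3)[of "nat (n - N)"] by simp
  qed
  thus ?thesis using f(2) by (intro exI[of _ "\<lambda>n. f (nat (n - N))"]) simp
qed

lemma int_downward_choice:
  fixes N :: int
  assumes "A N b0" and step: "\<And>n b. n \<le> N \<Longrightarrow> A n b \<Longrightarrow> \<exists>b'. A (n - 1) b' \<and> R n b b'"
  shows "\<exists>f. f N = b0 \<and> (\<forall>n\<le>N. A n (f n) \<and> R n (f n) (f (n - 1)))"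
proof -
  have "\<exists>f. f (- N) = b0 \<and> (\<forall>n\<ge>- N. A (- n) (f n) \<and> R (- n) (f n) (f (n + 1)))"
    by (rule int_upward_choice) (use assms step[of "- _"] in \<open>auto simp: minus_le_iff\<close>)
  then obtain f where f: "f (- N) = b0" "\<And>n. n \<ge> - N \<Longrightarrow> A (- n) (f n) \<and> R (- n) (f n) (f (n + 1))" by blast
  have "A n (f (- n)) \<and> R n (f (- n)) (f (- (n - 1)))" if "n \<le> N" for n
    using f(2)[of "- n"] that by simp
  thus ?thesis using f(1) by (intro exI[of _ "\<lambda>n. f (- n)"]) simp
qed

section \<open>Comparison of completed resolutions\<close>

lemma in_degree_0_simps [simp]:
  "carrier (obj (in_degree_0 M) n) = (if n = 0 then carrier M else {\<one>\<^bsub>M\<^esub>})"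
  "monoid.mult (obj (in_degree_0 M) n) = monoid.mult M"
  "one (obj (in_degree_0 M) n) = \<one>\<^bsub>M\<^esub>"
  "act (obj (in_degree_0 M) n) = act M"
  "bd (in_degree_0 M) n x = \<one>\<^bsub>M\<^esub>"
  by (auto simp: in_degree_0_def)

lemma gmodule_in_degree_0:
  assumes "gmodule G M"
  shows "gmodule G (obj (in_degree_0 M) n)"
proof -
  interpret M: gmodule G M by fact
  have "comm_group (obj (in_degree_0 M) n)"
    by (rule comm_groupI) (auto simp: M.M.m_ac intro: M.M.l_inv_ex split: if_splits)
  then show ?thesis
    by (intro gmodule.intro gmodule_axioms.intro M.G.is_group)
      (auto simp: M.act_m M.act_one M.act_mult hom_def split: if_splits)
qed

text \<open>The contractibility of the cone in \<open>resolution\<close> is a statement about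
  groups; here the cone is given its module structure, so that \<open>equivariant_lift\<close>
  applies to it.\<close>

definition cone_complex :: "('g, 'p) gcomplex \<Rightarrow> ('g, 'm) gcomplex \<Rightarrow> (int \<Rightarrow> 'p \<Rightarrow> 'm) \<Rightarrow> ('g, 'p \<times> 'm) gcomplex" where
  "cone_complex P D \<epsilon> = \<lparr>obj = (\<lambda>n. gmod_prod (obj P (n - 1)) (obj D n)),
     bd = cone_bd (obj P) (bd P) (obj D) (bd D) \<epsilon>\<rparr>"

lemma gmodule_gmod_prod:
  assumes "gmodule G M" "gmodule G N"
  shows "gmodule G (gmod_prod M N)"
proof -
  interpret M: gmodule G M by fact
  interpret N: gmodule G N by fact
  interpret MN: group "M \<times>\<times> N" by (rule DirProd_group[OF M.M.is_group N.M.is_group])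
  have "comm_group (M \<times>\<times> N)"
    by (rule MN.group_comm_groupI) (auto simp: M.M.m_comm N.M.m_comm)
  then show ?thesis
    by (intro gmodule.intro gmodule_axioms.intro M.G.is_group)
      (auto simp: gmod_prod_def M.act_m N.act_m M.act_one N.act_one M.act_mult N.act_mult intro!: homI)
qed

lemma gmod_prod_simps [simp]:
  "carrier (gmod_prod M N) = carrier M \<times> carrier N"
  "(x, y) \<otimes>\<^bsub>gmod_prod M N\<^esub> (x', y') = (x \<otimes>\<^bsub>M\<^esub> x', y \<otimes>\<^bsub>N\<^esub> y')"
  "\<one>\<^bsub>gmod_prod M N\<^esub> = (\<one>\<^bsub>M\<^esub>, \<one>\<^bsub>N\<^esub>)"
  "act (gmod_prod M N) g (x, y) = (act M g x, act N g y)"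
  by (simp_all add: gmod_prod_def)

lemma resolution_cone:
  assumes "resolution G M Q \<epsilon>"
  shows "is_gcomplex G (cone_complex Q (in_degree_0 M) \<epsilon>)"
    and "contractible_ab (obj (cone_complex Q (in_degree_0 M) \<epsilon>)) (bd (cone_complex Q (in_degree_0 M) \<epsilon>))"
proof -
  let ?K = "cone_complex Q (in_degree_0 M) \<epsilon>"
  have M: "gmodule G M" and Q: "is_gcomplex G Q" and \<epsilon>: "gchain_map G Q (in_degree_0 M) \<epsilon>"
    and con: "contractible_ab (cone_obj (obj Q) (obj (in_degree_0 M)))
      (cone_bd (obj Q) (bd Q) (obj (in_degree_0 M)) (bd (in_degree_0 M)) \<epsilon>)"
    using assms by (auto simp: resolution_def)
  interpret M: gmodule G M by (rule M)
  note Qs = gcomplexD[OF Q] and \<epsilon>s = gchain_mapD[OF \<epsilon>] and D = gmodule_in_degree_0[OF M]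
  show "contractible_ab (obj ?K) (bd ?K)"
    using con unfolding contractible_ab_def
    by (simp add: cone_complex_def gmod_prod_def cone_obj_def del: in_degree_0_simps)
  show "is_gcomplex G ?K"
    unfolding is_gcomplex_def
  proof (intro allI conjI ballI)
    fix n
    interpret Q1: gmodule G "obj Q (n - 1)" by (rule Qs)
    interpret Q2: gmodule G "obj Q (n - 2)" by (rule Qs)
    interpret Q3: gmodule G "obj Q (n - 3)" by (rule Qs)
    have d1: "bd Q (n - 1) \<in> ghom G (obj Q (n - 1)) (obj Q (n - 2))" using Qs(2)[of "n - 1"] by simp
    have d2: "bd Q (n - 2) \<in> ghom G (obj Q (n - 2)) (obj Q (n - 3))" using Qs(2)[of "n - 2"] by simp
    have eM: "\<epsilon> k x \<in> carrier M" if "x \<in> carrier (obj Q k)" for k x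
      using ghom_closed[OF \<epsilon>s(1)[of k] that] by (auto split: if_splits)
    have ec: "\<epsilon> k x = \<one>\<^bsub>M\<^esub>" if "x \<in> carrier (obj Q k)" "k \<noteq> 0" for k x
      using ghom_closed[OF \<epsilon>s(1)[of k] that(1)] that(2) by simp
    show "gmodule G (obj ?K n)"
      by (simp add: cone_complex_def gmodule_gmod_prod Qs D)
    show "bd ?K n \<in> ghom G (obj ?K n)
        (obj ?K (n - 1))"
      unfolding ghom_def
    proof (intro CollectI conjI ballI homI)
      fix z assume "z \<in> carrier (obj ?K n)"
      then obtain x y where z: "z = (x, y)" "x \<in> carrier (obj Q (n - 1))" "y \<in> carrier (obj (in_degree_0 M) n)"
        by (auto simp: cone_complex_def)
      thus "bd ?K n z \<in> carrier (obj ?K (n - 1))"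
        using ghom_closed[OF d1] eM ec by (auto simp: cone_complex_def cone_bd_def)
      fix z' assume "z' \<in> carrier (obj ?K n)"
      then obtain x' y' where z': "z' = (x', y')" "x' \<in> carrier (obj Q (n - 1))" "y' \<in> carrier (obj (in_degree_0 M) n)"
        by (auto simp: cone_complex_def)
      show "bd ?K n (z \<otimes>\<^bsub>obj ?K n\<^esub> z') =
        bd ?K n z \<otimes>\<^bsub>obj ?K (n - 1)\<^esub>
        bd ?K n z'"
        using z z' ghom_closed[OF d1] eM ghom_mult[OF d1] ghom_mult[OF \<epsilon>s(1)[of "n - 1"]]
        by (simp add: cone_complex_def cone_bd_def Q2.M.inv_mult)
    next
      fix g z assume g: "g \<in> carrier G" and "z \<in> carrier (obj ?K n)"
      then obtain x y where z: "z = (x, y)" "x \<in> carrier (obj Q (n - 1))" "y \<in> carrier (obj (in_degree_0 M) n)"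
        by (auto simp: cone_complex_def)
      show "bd ?K n (act (obj ?K n) g z) =
        act (obj ?K (n - 1)) g (bd ?K n z)"
        using z g ghom_closed[OF d1] eM ghom_act[OF d1] ghom_act[OF \<epsilon>s(1)[of "n - 1"]]
        by (simp add: cone_complex_def cone_bd_def Q2.act_minv M.act_m)
    qed
    fix z assume "z \<in> carrier (obj ?K n)"
    then obtain x y where z: "z = (x, y)" "x \<in> carrier (obj Q (n - 1))" "y \<in> carrier (obj (in_degree_0 M) n)"
      by (auto simp: cone_complex_def)
    have "bd Q (n - 2) (inv\<^bsub>obj Q (n - 2)\<^esub> (bd Q (n - 1) x)) = \<one>\<^bsub>obj Q (n - 3)\<^esub>"
      using ghom_minv[OF Qs(1) Qs(1) d2 ghom_closed[OF d1 z(2)]] Qs(4)[OF z(2)] by simp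
    moreover have "\<epsilon> (n - 2) (inv\<^bsub>obj Q (n - 2)\<^esub> (bd Q (n - 1) x)) = \<one>\<^bsub>M\<^esub>"
    proof -
      have "\<epsilon> (n - 2) (bd Q (n - 1) x) = \<one>\<^bsub>M\<^esub>" using \<epsilon>s(2)[OF z(2)] by simp
      moreover have "\<epsilon> (n - 2) \<in> hom (obj Q (n - 2)) M"
        using \<epsilon>s(1)[of "n - 2"] eM by (auto simp: ghom_def hom_def)
      ultimately show ?thesis
        using group_hom.hom_inv[OF group_hom.intro[OF Q2.M.is_group M.M.is_group group_hom_axioms.intro] ghom_closed[OF d1 z(2)], of "\<epsilon> (n - 2)"]
        by simp
    qed
    ultimately show "bd ?K (n - 1) (bd ?K n z) =
        \<one>\<^bsub>obj ?K (n - 2)\<^esub>"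
      using z by (simp add: cone_complex_def cone_bd_def)
  qed
qed

section \<open>Chain maps and homotopies between resolutions\<close>

context signed_free_abelian begin

text \<open>The two conditions on g say that \<open>(g x, 1)\<close> is a cycle of the cone in
  degree n + 1, so it lifts by contractibility of the cone. The sign in the cone differential is
  undone by inverting the first coordinate of the lift.\<close>

lemma resolution_lift:
  assumes Q: "resolution G M Q \<epsilon>" and P: "relatively_projective G P"
    and g: "g \<in> ghom G P (obj Q n)" and dg: "\<And>x. x \<in> carrier P \<Longrightarrow> bd Q n (g x) = \<one>\<^bsub>obj Q (n - 1)\<^esub>"
    and eg: "\<And>x. x \<in> carrier P \<Longrightarrow> \<epsilon> n (g x) = \<one>\<^bsub>M\<^esub>"
  shows "\<exists>g'\<in>ghom G P (obj Q (n + 1)). \<forall>x\<in>carrier P. bd Q (n + 1) (g' x) = g x"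
proof -
  let ?C = "cone_complex Q (in_degree_0 M) \<epsilon>"
  have Qc: "is_gcomplex G Q" and M: "gmodule G M" using Q by (auto simp: resolution_def)
  note Qs = gcomplexD[OF Qc]
  interpret M: gmodule G M by (rule M)
  interpret Qn: gmodule G "obj Q n" by (rule Qs)
  interpret Qn1: gmodule G "obj Q (n - 1)" by (rule Qs)
  have "\<exists>g'\<in>ghom G P (obj ?C (n + 1 + 1)). \<forall>x\<in>carrier P. bd ?C (n + 1 + 1) (g' x) = (g x, \<one>\<^bsub>M\<^esub>)"
  proof (rule equivariant_lift[OF P resolution_cone[OF Q]])
    show "(\<lambda>x. (g x, \<one>\<^bsub>M\<^esub>)) \<in> ghom G P (obj ?C (n + 1))"
      using g unfolding ghom_def by (auto simp: cone_complex_def hom_def Pi_def)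
    fix x assume x: "x \<in> carrier P"
    show "bd ?C (n + 1) (g x, \<one>\<^bsub>M\<^esub>) = \<one>\<^bsub>obj ?C (n + 1 - 1)\<^esub>"
      using dg[OF x] eg[OF x] by (simp add: cone_complex_def cone_bd_def)
  qed
  then obtain g' where g': "g' \<in> ghom G P (obj ?C (n + 1 + 1))"
    "\<And>x. x \<in> carrier P \<Longrightarrow> bd ?C (n + 1 + 1) (g' x) = (g x, \<one>\<^bsub>M\<^esub>)" by blast
  have g1: "(\<lambda>x. fst (g' x)) \<in> ghom G P (obj Q (n + 1))"
  proof -
    have "fst \<in> ghom G (obj ?C (n + 1 + 1)) (obj Q (n + 1))"
      by (auto simp: ghom_def cone_complex_def hom_def add.commute)
    thus ?thesis using ghom_comp[OF g'(1)] by blast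
  qed
  show ?thesis
  proof (intro bexI ballI)
    show "(\<lambda>x. inv\<^bsub>obj Q (n + 1)\<^esub> (fst (g' x))) \<in> ghom G P (obj Q (n + 1))"
      by (rule ghom_minv_comp[OF Qs(1) g1])
    fix x assume x: "x \<in> carrier P"
    obtain a b where ab: "g' x = (a, b)" by fastforce
    have a: "a \<in> carrier (obj Q (n + 1))" using ghom_closed[OF g1 x] ab by simp
    have "inv\<^bsub>obj Q n\<^esub> (bd Q (n + 1) a) = g x"
      using g'(2)[OF x] by (simp add: ab cone_complex_def cone_bd_def add.commute)
    thus "bd Q (n + 1) (inv\<^bsub>obj Q (n + 1)\<^esub> (fst (g' x))) = g x"
      using ghom_minv[OF Qs(1) Qs(1) Qs(3) a] ab by simp
  qed
qed

text \<open>In degree 0 of the cone every pair \<open>(1, m)\<close> is a cycle, so lifting it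
  produces a preimage of m under the augmentation, equivariantly in the parameter.\<close>

lemma augmentation_lift:
  assumes Q: "resolution G M Q \<epsilon>" and P: "relatively_projective G P" and g: "g \<in> ghom G P M"
  shows "\<exists>g'\<in>ghom G P (obj Q 0). \<forall>x\<in>carrier P. \<epsilon> 0 (g' x) = g x"
proof -
  let ?C = "cone_complex Q (in_degree_0 M) \<epsilon>"
  have Qc: "is_gcomplex G Q" and M: "gmodule G M" and \<epsilon>: "gchain_map G Q (in_degree_0 M) \<epsilon>" using Q by (auto simp: resolution_def)
  note Qs = gcomplexD[OF Qc] and \<epsilon>s = gchain_mapD[OF \<epsilon>]
  interpret M: gmodule G M by (rule M)
  interpret Q1: gmodule G "obj Q (- 1)" by (rule Qs)
  interpret Q2: gmodule G "obj Q (- 2)" by (rule Qs)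
  have "\<exists>g'\<in>ghom G P (obj ?C (0 + 1)). \<forall>x\<in>carrier P. bd ?C (0 + 1) (g' x) = (\<one>\<^bsub>obj Q (- 1)\<^esub>, g x)"
  proof (rule equivariant_lift[OF P resolution_cone[OF Q]])
    show "(\<lambda>x. (\<one>\<^bsub>obj Q (- 1)\<^esub>, g x)) \<in> ghom G P (obj ?C 0)"
      using g unfolding ghom_def by (auto simp: cone_complex_def hom_def Pi_def)
    fix x assume x: "x \<in> carrier P"
    have "\<epsilon> (- 1) \<one>\<^bsub>obj Q (- 1)\<^esub> = \<one>\<^bsub>M\<^esub>"
      using ghom_closed[OF \<epsilon>s(1)[of "- 1"]] Q1.M.one_closed by simp
    moreover have "bd Q (- 1) \<one>\<^bsub>obj Q (- 1)\<^esub> = \<one>\<^bsub>obj Q (- 2)\<^esub>"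
      using ghom_neutral[OF Qs(1) Qs(1) Qs(2)[of "- 1"]] by simp
    ultimately show "bd ?C 0 (\<one>\<^bsub>obj Q (- 1)\<^esub>, g x) = \<one>\<^bsub>obj ?C (0 - 1)\<^esub>"
      by (simp add: cone_complex_def cone_bd_def)
  qed
  then obtain g' where g': "g' \<in> ghom G P (obj ?C (0 + 1))"
    "\<And>x. x \<in> carrier P \<Longrightarrow> bd ?C (0 + 1) (g' x) = (\<one>\<^bsub>obj Q (- 1)\<^esub>, g x)" by blast
  have g1: "(\<lambda>x. fst (g' x)) \<in> ghom G P (obj Q 0)"
  proof -
    have "fst \<in> ghom G (obj ?C (0 + 1)) (obj Q 0)"
      by (auto simp: ghom_def cone_complex_def hom_def)
    thus ?thesis using ghom_comp[OF g'(1)] by blast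
  qed
  moreover have "\<epsilon> 0 (fst (g' x)) = g x" if x: "x \<in> carrier P" for x
  proof -
    obtain a b where ab: "g' x = (a, b)" by fastforce
    have "a \<in> carrier (obj Q 0)" using ghom_closed[OF g1 x] ab by simp
    hence "\<epsilon> 0 a \<in> carrier M" using ghom_closed[OF \<epsilon>s(1)[of 0]] by simp
    thus ?thesis using g'(2)[OF x] by (simp add: ab cone_complex_def cone_bd_def)
  qed
  ultimately show ?thesis by (intro bexI[of _ "\<lambda>x. fst (g' x)"] ballI)
qed

lemma resolution_map_exists:
  assumes P: "resolution G M P \<epsilon>" and Q: "resolution G M Q \<epsilon>'"
  shows "\<exists>\<phi>. gchain_map G P Q \<phi> \<and> (\<forall>n. \<forall>x\<in>carrier (obj P n). \<epsilon>' n (\<phi> n x) = \<epsilon> n x)"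
proof -
  have Pc: "is_gcomplex G P" and M: "gmodule G M" and \<epsilon>: "gchain_map G P (in_degree_0 M) \<epsilon>"
    and P0: "\<And>n. n < 0 \<Longrightarrow> carrier (obj P n) = {\<one>\<^bsub>obj P n\<^esub>}" and Pr: "\<And>n. relatively_projective G (obj P n)"
    using P by (auto simp: resolution_def)
  have Qc: "is_gcomplex G Q" and \<epsilon>': "gchain_map G Q (in_degree_0 M) \<epsilon>'"
    and Q0: "\<And>n. n < 0 \<Longrightarrow> carrier (obj Q n) = {\<one>\<^bsub>obj Q n\<^esub>}"
    using Q by (auto simp: resolution_def)
  note Ps = gcomplexD[OF Pc] and Qs = gcomplexD[OF Qc] and \<epsilon>s = gchain_mapD[OF \<epsilon>] and \<epsilon>'s = gchain_mapD[OF \<epsilon>']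
  have e1: "\<epsilon>' n y = \<one>\<^bsub>M\<^esub>" if "y \<in> carrier (obj Q n)" "n \<noteq> 0" for n y
    using ghom_closed[OF \<epsilon>'s(1) that(1)] that(2) by simp
  have e2: "\<epsilon> n y = \<one>\<^bsub>M\<^esub>" if "y \<in> carrier (obj P n)" "n \<noteq> 0" for n y
    using ghom_closed[OF \<epsilon>s(1) that(1)] that(2) by simp
  have ed: "\<epsilon> n (bd P (n + 1) x) = \<one>\<^bsub>M\<^esub>" if "x \<in> carrier (obj P (n + 1))" for n x
    using \<epsilon>s(3)[OF that] by simp
  have "\<epsilon> 0 \<in> ghom G (obj P 0) M" using \<epsilon>s(1)[of 0] by (simp add: in_degree_0_def)
  then obtain b0 where b0: "b0 \<in> ghom G (obj P 0) (obj Q 0)" "\<And>x. x \<in> carrier (obj P 0) \<Longrightarrow> \<epsilon>' 0 (b0 x) = \<epsilon> 0 x"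
    using augmentation_lift[OF Q Pr] by blast
  \<comment> \<open>Precisely the condition under which \<open>resolution_lift\<close> applies to b
    composed with the differential. In degree 0 it follows from compatibility with the
    augmentations, in higher degrees from the chain map equation.\<close>
  define A where "A n b \<longleftrightarrow> b \<in> ghom G (obj P n) (obj Q n) \<and> (\<forall>x\<in>carrier (obj P (n + 1)).
      bd Q n (b (bd P (n + 1) x)) = \<one>\<^bsub>obj Q (n - 1)\<^esub> \<and> \<epsilon>' n (b (bd P (n + 1) x)) = \<one>\<^bsub>M\<^esub>)" for n b
  define R where "R n b b' \<longleftrightarrow> (\<forall>x\<in>carrier (obj P (n + 1)). bd Q (n + 1) (b' x) = b (bd P (n + 1) x))" for n b b'
  have "\<exists>f. f 0 = b0 \<and> (\<forall>n\<ge>0. A n (f n) \<and> R n (f n) (f (n + 1)))"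
  proof (rule int_upward_choice)
    show "A 0 b0" unfolding A_def
    proof (intro conjI ballI b0(1))
      fix x assume x: "x \<in> carrier (obj P (0 + 1))"
      have dx: "bd P (0 + 1) x \<in> carrier (obj P 0)" by (rule ghom_closed[OF Ps(3) x])
      show "bd Q 0 (b0 (bd P (0 + 1) x)) = \<one>\<^bsub>obj Q (0 - 1)\<^esub>"
        using ghom_closed[OF Qs(2) ghom_closed[OF b0(1) dx]] Q0[of "0 - 1"] by simp
      show "\<epsilon>' 0 (b0 (bd P (0 + 1) x)) = \<one>\<^bsub>M\<^esub>" using b0(2)[OF dx] ed[OF x] by simp
    qed
    fix n :: int and b assume n: "0 \<le> n" and A: "A n b"
    have bg: "b \<in> ghom G (obj P n) (obj Q n)" using A by (simp add: A_def)
    have "(\<lambda>x. b (bd P (n + 1) x)) \<in> ghom G (obj P (n + 1)) (obj Q n)"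
      by (rule ghom_comp[OF Ps(3) bg])
    then obtain b' where b': "b' \<in> ghom G (obj P (n + 1)) (obj Q (n + 1))"
      "\<And>x. x \<in> carrier (obj P (n + 1)) \<Longrightarrow> bd Q (n + 1) (b' x) = b (bd P (n + 1) x)"
      using resolution_lift[OF Q Pr, of "\<lambda>x. b (bd P (n + 1) x)" "n + 1" n] A by (auto simp: A_def)
    have "A (n + 1) b'" unfolding A_def
    proof (intro conjI ballI b'(1))
      fix x assume x: "x \<in> carrier (obj P (n + 1 + 1))"
      have dx: "bd P (n + 1 + 1) x \<in> carrier (obj P (n + 1))" by (rule ghom_closed[OF Ps(3) x])
      show "bd Q (n + 1) (b' (bd P (n + 1 + 1) x)) = \<one>\<^bsub>obj Q (n + 1 - 1)\<^esub>"
        using b'(2)[OF dx] Ps(5)[OF x] ghom_neutral[OF Ps(1) Qs(1) bg] by simp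
      show "\<epsilon>' (n + 1) (b' (bd P (n + 1 + 1) x)) = \<one>\<^bsub>M\<^esub>"
        using e1[OF ghom_closed[OF b'(1) dx]] n by simp
    qed
    thus "\<exists>b'. A (n + 1) b' \<and> R n b b'" using b'(2) by (auto simp: R_def)
  qed
  then obtain f where f: "f 0 = b0" "\<And>n. n \<ge> 0 \<Longrightarrow> A n (f n)" "\<And>n. n \<ge> 0 \<Longrightarrow> R n (f n) (f (n + 1))" by blast
  define \<phi> where "\<phi> n = (if n \<ge> 0 then f n else (\<lambda>x. \<one>\<^bsub>obj Q n\<^esub>))" for n
  have \<phi>g: "\<phi> n \<in> ghom G (obj P n) (obj Q n)" for n
    using f(2)[of n] ghom_const_one[OF Qs(1)] by (auto simp: \<phi>_def A_def)
  have "gchain_map G P Q \<phi>"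
    unfolding gchain_map_def
  proof (intro allI conjI ballI \<phi>g)
    fix n x assume x: "x \<in> carrier (obj P n)"
    have c: "\<phi> (n - 1) (bd P n x) \<in> carrier (obj Q (n - 1))" "bd Q n (\<phi> n x) \<in> carrier (obj Q (n - 1))"
      using ghom_closed[OF \<phi>g ghom_closed[OF Ps(2) x]] ghom_closed[OF Qs(2) ghom_closed[OF \<phi>g x]] by auto
    show "\<phi> (n - 1) (bd P n x) = bd Q n (\<phi> n x)"
    proof (cases "n \<ge> 1")
      case True
      thus ?thesis using f(3)[of "n - 1"] x by (simp add: R_def \<phi>_def)
    next
      case False
      thus ?thesis using c Q0[of "n - 1"] by simp
    qed
  qed
  moreover have "\<epsilon>' n (\<phi> n x) = \<epsilon> n x" if "x \<in> carrier (obj P n)" for n x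
    using e1[OF ghom_closed[OF \<phi>g that]] e2[OF that] b0(2) that f(1) by (cases "n = 0") (simp_all add: \<phi>_def)
  ultimately show ?thesis by blast
qed

text \<open>The uniqueness half of the comparison theorem, stated for maps killed by the
  augmentation, because the difference of two maps over the identity is of that kind.\<close>

lemma resolution_map_homotopy:
  assumes P: "resolution G M P \<epsilon>" and Q: "resolution G M Q \<epsilon>'"
    and \<phi>: "gchain_map G P Q \<phi>" and e\<phi>: "\<And>n x. x \<in> carrier (obj P n) \<Longrightarrow> \<epsilon>' n (\<phi> n x) = \<one>\<^bsub>M\<^esub>"
  shows "\<exists>h. \<forall>n. h n \<in> ghom G (obj P n) (obj Q (n + 1)) \<and>
     (\<forall>x\<in>carrier (obj P n). \<phi> n x = bd Q (n + 1) (h n x) \<otimes>\<^bsub>obj Q n\<^esub> h (n - 1) (bd P n x))"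
proof -
  have Pc: "is_gcomplex G P" and M: "gmodule G M"
    and P0: "\<And>n. n < 0 \<Longrightarrow> carrier (obj P n) = {\<one>\<^bsub>obj P n\<^esub>}" and Pr: "\<And>n. relatively_projective G (obj P n)"
    using P by (auto simp: resolution_def)
  have Qc: "is_gcomplex G Q" and \<epsilon>': "gchain_map G Q (in_degree_0 M) \<epsilon>'"
    and Q0: "\<And>n. n < 0 \<Longrightarrow> carrier (obj Q n) = {\<one>\<^bsub>obj Q n\<^esub>}"
    using Q by (auto simp: resolution_def)
  note Ps = gcomplexD[OF Pc] and Qs = gcomplexD[OF Qc] and \<epsilon>'s = gchain_mapD[OF \<epsilon>'] and \<phi>s = gchain_mapD[OF \<phi>]
  have e1: "\<epsilon>' n y = \<one>\<^bsub>M\<^esub>" if "y \<in> carrier (obj Q n)" "n \<noteq> 0" for n y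
    using ghom_closed[OF \<epsilon>'s(1) that(1)] that(2) by simp
  \<comment> \<open>The part of \<phi> in degree n + 1 not accounted for by a homotopy b in degree
    n; the next homotopy is a lift of it along the differential.\<close>
  define g where "g n b x = \<phi> (n + 1) x \<otimes>\<^bsub>obj Q (n + 1)\<^esub> inv\<^bsub>obj Q (n + 1)\<^esub> (b (bd P (n + 1) x))" for n b x
  define A where "A n b \<longleftrightarrow> b \<in> ghom G (obj P n) (obj Q (n + 1)) \<and> (\<forall>x\<in>carrier (obj P (n + 1)).
      bd Q (n + 1) (g n b x) = \<one>\<^bsub>obj Q n\<^esub> \<and> \<epsilon>' (n + 1) (g n b x) = \<one>\<^bsub>M\<^esub>)" for n b
  define R where "R n b b' \<longleftrightarrow> (\<forall>x\<in>carrier (obj P (n + 1)). bd Q (n + 1 + 1) (b' x) = g n b x)" for n b b'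
  have gg: "g n b \<in> ghom G (obj P (n + 1)) (obj Q (n + 1))" if "b \<in> ghom G (obj P n) (obj Q (n + 1))" for n b
  proof -
    have "(\<lambda>x. \<phi> (n + 1) x \<otimes>\<^bsub>obj Q (n + 1)\<^esub> inv\<^bsub>obj Q (n + 1)\<^esub> (b (bd P (n + 1) x))) \<in> ghom G (obj P (n + 1)) (obj Q (n + 1))"
      by (rule ghom_diff[OF Qs(1) \<phi>s(1) ghom_comp[OF Ps(3) that]])
    thus ?thesis by (simp add: g_def[abs_def])
  qed
  have "\<exists>f. f (- 1) = (\<lambda>x. \<one>\<^bsub>obj Q 0\<^esub>) \<and> (\<forall>n\<ge>- 1. A n (f n) \<and> R n (f n) (f (n + 1)))"
  proof (rule int_upward_choice)
    have b: "(\<lambda>x. \<one>\<^bsub>obj Q 0\<^esub>) \<in> ghom G (obj P (- 1)) (obj Q (- 1 + 1))"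
      using ghom_const_one[OF Qs(1)[of 0]] by simp
    show "A (- 1) (\<lambda>x. \<one>\<^bsub>obj Q 0\<^esub>)"
      unfolding A_def
    proof (intro conjI ballI b)
      fix x assume x: "x \<in> carrier (obj P (- 1 + 1))"
      interpret Q00: gmodule G "obj Q 0" by (rule Qs)
      have gx: "g (- 1) (\<lambda>x. \<one>\<^bsub>obj Q 0\<^esub>) x = \<phi> 0 x"
        using ghom_closed[OF \<phi>s(1)] x by (simp add: g_def)
      show "bd Q (- 1 + 1) (g (- 1) (\<lambda>x. \<one>\<^bsub>obj Q 0\<^esub>) x) = \<one>\<^bsub>obj Q (- 1)\<^esub>"
        using ghom_closed[OF Qs(2)[of 0] ghom_closed[OF \<phi>s(1)[of 0]]] x Q0[of "- 1"] by (simp add: gx)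
      show "\<epsilon>' (- 1 + 1) (g (- 1) (\<lambda>x. \<one>\<^bsub>obj Q 0\<^esub>) x) = \<one>\<^bsub>M\<^esub>"
        using e\<phi> x by (simp add: gx)
    qed
    fix n :: int and b assume n: "- 1 \<le> n" and A: "A n b"
    have bg: "b \<in> ghom G (obj P n) (obj Q (n + 1))" using A by (simp add: A_def)
    obtain b' where b': "b' \<in> ghom G (obj P (n + 1)) (obj Q (n + 1 + 1))"
      "\<And>x. x \<in> carrier (obj P (n + 1)) \<Longrightarrow> bd Q (n + 1 + 1) (b' x) = g n b x"
      using resolution_lift[OF Q Pr gg[OF bg]] A by (auto simp: A_def)
    have "A (n + 1) b'" unfolding A_def
    proof (intro conjI ballI b'(1))
      fix x assume x: "x \<in> carrier (obj P (n + 1 + 1))"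
      interpret Q1: gmodule G "obj Q (n + 1)" by (rule Qs)
      interpret Q2: gmodule G "obj Q (n + 1 + 1)" by (rule Qs)
      have dx: "bd P (n + 1 + 1) x \<in> carrier (obj P (n + 1))" by (rule ghom_closed[OF Ps(3) x])
      have gx: "g (n + 1) b' x \<in> carrier (obj Q (n + 1 + 1))" by (rule ghom_closed[OF gg[OF b'(1)] x])
      have px: "\<phi> (n + 1) (bd P (n + 1 + 1) x) \<in> carrier (obj Q (n + 1))" by (rule ghom_closed[OF \<phi>s(1) dx])
      have "bd Q (n + 1 + 1) (g (n + 1) b' x) =
        bd Q (n + 1 + 1) (\<phi> (n + 1 + 1) x) \<otimes>\<^bsub>obj Q (n + 1)\<^esub> inv\<^bsub>obj Q (n + 1)\<^esub> (g n b (bd P (n + 1 + 1) x))"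
        using ghom_mult[OF Qs(3)[of "n + 1"] ghom_closed[OF \<phi>s(1) x] Q2.M.inv_closed[OF ghom_closed[OF b'(1) dx]]] b'(2)[OF dx]
          ghom_minv[OF Qs(1) Qs(1) Qs(3)[of "n + 1"] ghom_closed[OF b'(1) dx]] by (simp add: g_def)
      also have "g n b (bd P (n + 1 + 1) x) = \<phi> (n + 1) (bd P (n + 1 + 1) x)"
        using Ps(5)[OF x] ghom_neutral[OF Ps(1) Qs(1) bg] px by (simp add: g_def)
      finally show "bd Q (n + 1 + 1) (g (n + 1) b' x) = \<one>\<^bsub>obj Q (n + 1)\<^esub>"
        using \<phi>s(3)[OF x] px by (metis Q1.M.r_inv)
      show "\<epsilon>' (n + 1 + 1) (g (n + 1) b' x) = \<one>\<^bsub>M\<^esub>" using e1[OF gx] n by simp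
    qed
    thus "\<exists>b'. A (n + 1) b' \<and> R n b b'" using b'(2) by (auto simp: R_def)
  qed
  then obtain f where f: "f (- 1) = (\<lambda>x. \<one>\<^bsub>obj Q 0\<^esub>)" "\<And>n. n \<ge> - 1 \<Longrightarrow> A n (f n)" "\<And>n. n \<ge> - 1 \<Longrightarrow> R n (f n) (f (n + 1))" by blast
  define h where "h n = (if n \<ge> - 1 then f n else (\<lambda>x. \<one>\<^bsub>obj Q (n + 1)\<^esub>))" for n
  have hg: "h n \<in> ghom G (obj P n) (obj Q (n + 1))" for n
    using f(2)[of n] ghom_const_one[OF Qs(1)] by (auto simp: h_def A_def)
  have "\<phi> n x = bd Q (n + 1) (h n x) \<otimes>\<^bsub>obj Q n\<^esub> h (n - 1) (bd P n x)" if x: "x \<in> carrier (obj P n)" for n x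
  proof -
    interpret Qn: gmodule G "obj Q n" by (rule Qs)
    have c: "\<phi> n x \<in> carrier (obj Q n)" "bd Q (n + 1) (h n x) \<in> carrier (obj Q n)" "h (n - 1) (bd P n x) \<in> carrier (obj Q n)"
      using ghom_closed[OF \<phi>s(1) x] ghom_closed[OF Qs(3) ghom_closed[OF hg x]]
        ghom_closed[OF hg ghom_closed[OF Ps(2) x]] by auto
    show ?thesis
    proof (cases "n \<ge> 0")
      case True
      have "bd Q (n + 1) (h n x) = \<phi> n x \<otimes>\<^bsub>obj Q n\<^esub> inv\<^bsub>obj Q n\<^esub> (h (n - 1) (bd P n x))"
        using f(3)[of "n - 1"] True x by (simp add: R_def h_def g_def)
      thus ?thesis using c by (simp add: Qn.M.m_assoc)
    next
      case False
      hence "carrier (obj Q n) = {\<one>\<^bsub>obj Q n\<^esub>}" using Q0 by simp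
      thus ?thesis using c Qn.M.m_closed by (metis singletonD)
    qed
  qed
  thus ?thesis using hg by blast
qed

end

section \<open>Chain maps and homotopies between completions\<close>

context signed_free_abelian begin

text \<open>In the degrees where \<kappa>' is invertible the map is forced to be the inverse of
  \<kappa>' composed with \<phi> and \<kappa>. It is continued downwards: X is contractible with
  relatively projective terms, so a map out of X that kills incoming boundaries factors through the
  outgoing differential.\<close>

lemma completion_map_exists:
  assumes X: "completion G P X \<kappa>" and Y: "completion G Q Y \<kappa>'"
    and Pc: "is_gcomplex G P" and Qc: "is_gcomplex G Q" and \<phi>: "gchain_map G P Q \<phi>"
  shows "\<exists>\<theta>. gchain_map G X Y \<theta> \<and> (\<exists>N. \<forall>n\<ge>N. \<forall>x\<in>carrier (obj X n). \<kappa>' n (\<theta> n x) = \<phi> n (\<kappa> n x))"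
proof -
  have Xc: "is_gcomplex G X" and Xr: "\<And>n. relatively_projective G (obj X n)"
    and Xcon: "contractible_ab (obj X) (bd X)" and \<kappa>: "gchain_map G X P \<kappa>"
    using X by (auto simp: completion_def)
  have Yc: "is_gcomplex G Y" and Yr: "\<And>n. relatively_projective G (obj Y n)"
    and \<kappa>': "gchain_map G Y Q \<kappa>'"
    using Y by (auto simp: completion_def)
  obtain N' where N': "\<And>n. n \<ge> N' \<Longrightarrow> \<kappa>' n \<in> giso G (obj Y n) (obj Q n)"
    using Y unfolding completion_def by blast
  define N where "N = N'"
  note Xs = gcomplexD[OF Xc] and Ys = gcomplexD[OF Yc] and Ps = gcomplexD[OF Pc] and Qs = gcomplexD[OF Qc]
    and \<kappa>s = gchain_mapD[OF \<kappa>] and \<kappa>'s = gchain_mapD[OF \<kappa>'] and \<phi>s = gchain_mapD[OF \<phi>]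
  define j where "j n = inv_into (carrier (obj Y n)) (\<kappa>' n)" for n
  have j: "j n \<in> ghom G (obj Q n) (obj Y n)" "y \<in> carrier (obj Q n) \<Longrightarrow> \<kappa>' n (j n y) = y"
    "x \<in> carrier (obj Y n) \<Longrightarrow> j n (\<kappa>' n x) = x" if "n \<ge> N" for n x y
    using giso_inverse[OF Ys(1) Qs(1) N'[of n]] that by (auto simp: N_def j_def)
  define t where "t n x = j n (\<phi> n (\<kappa> n x))" for n x
  have pk: "(\<lambda>x. \<phi> n (\<kappa> n x)) \<in> ghom G (obj X n) (obj Q n)" for n
    by (rule ghom_comp[OF \<kappa>s(1) \<phi>s(1)])
  have tg: "t n \<in> ghom G (obj X n) (obj Y n)" if "n \<ge> N" for n
    using ghom_comp[OF pk j(1)[OF that]] by (simp add: t_def[abs_def])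
  have tk: "\<kappa>' n (t n x) = \<phi> n (\<kappa> n x)" if "n \<ge> N" "x \<in> carrier (obj X n)" for n x
    using j(2)[OF that(1) ghom_closed[OF pk that(2)]] by (simp add: t_def)
  have td: "t n (bd X (n + 1) x) = bd Y (n + 1) (t (n + 1) x)" if n: "n \<ge> N" and x: "x \<in> carrier (obj X (n + 1))" for n x
  proof -
    have dx: "bd X (n + 1) x \<in> carrier (obj X n)" by (rule ghom_closed[OF Xs(3) x])
    have tx: "t (n + 1) x \<in> carrier (obj Y (n + 1))" using ghom_closed[OF tg x] n by simp
    have "\<kappa>' n (bd Y (n + 1) (t (n + 1) x)) = bd Q (n + 1) (\<phi> (n + 1) (\<kappa> (n + 1) x))"
      using \<kappa>'s(3)[OF tx] tk[of "n + 1" x] n x by simp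
    also have "\<dots> = \<phi> n (\<kappa> n (bd X (n + 1) x))"
      using \<phi>s(3)[OF ghom_closed[OF \<kappa>s(1) x]] \<kappa>s(3)[OF x] by simp
    finally have "j n (\<kappa>' n (bd Y (n + 1) (t (n + 1) x))) = t n (bd X (n + 1) x)" by (simp add: t_def)
    thus ?thesis using j(3)[OF n ghom_closed[OF Ys(3) tx]] by simp
  qed
  \<comment> \<open>The condition that b followed by the differential of Y kills boundaries of X, so
    that it factors through \<open>bd X n\<close> and gives the map in degree n - 1.\<close>
  define A where "A n b \<longleftrightarrow> b \<in> ghom G (obj X n) (obj Y n) \<and>
      (\<forall>x\<in>carrier (obj X (n + 1)). bd Y n (b (bd X (n + 1) x)) = \<one>\<^bsub>obj Y (n - 1)\<^esub>)" for n b
  define R where "R n b b' \<longleftrightarrow> (\<forall>x\<in>carrier (obj X n). b' (bd X n x) = bd Y n (b x))" for n b b'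
  have "\<exists>f. f N = t N \<and> (\<forall>n\<le>N. A n (f n) \<and> R n (f n) (f (n - 1)))"
  proof (rule int_downward_choice)
    show "A N (t N)" unfolding A_def
    proof (intro conjI ballI tg)
      fix x assume x: "x \<in> carrier (obj X (N + 1))"
      show "bd Y N (t N (bd X (N + 1) x)) = \<one>\<^bsub>obj Y (N - 1)\<^esub>"
        using td[OF _ x] Ys(5)[OF ghom_closed[OF tg x]] by simp
    qed simp
    fix n b assume A: "A n b"
    have bg: "b \<in> ghom G (obj X n) (obj Y n)" using A by (simp add: A_def)
    have g: "(\<lambda>x. bd Y n (b x)) \<in> ghom G (obj X n) (obj Y (n - 1))" by (rule ghom_comp[OF bg Ys(2)])
    obtain b' where b': "b' \<in> ghom G (obj X (n - 1)) (obj Y (n - 1))"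
      "\<And>x. x \<in> carrier (obj X n) \<Longrightarrow> b' (bd X n x) = bd Y n (b x)"
      using equivariant_extension[OF Yr Xc Xcon Xr g] A by (auto simp: A_def)
    have "A (n - 1) b'" unfolding A_def
    proof (intro conjI ballI b'(1))
      fix x assume "x \<in> carrier (obj X (n - 1 + 1))"
      hence x: "x \<in> carrier (obj X n)" by simp
      show "bd Y (n - 1) (b' (bd X (n - 1 + 1) x)) = \<one>\<^bsub>obj Y (n - 1 - 1)\<^esub>"
        using b'(2)[OF x] Ys(4)[OF ghom_closed[OF bg x]] by simp
    qed
    thus "\<exists>b'. A (n - 1) b' \<and> R n b b'" using b'(2) by (auto simp: R_def)
  qed
  then obtain f where f: "f N = t N" "\<And>n. n \<le> N \<Longrightarrow> A n (f n)" "\<And>n. n \<le> N \<Longrightarrow> R n (f n) (f (n - 1))" by blast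
  define \<theta> where "\<theta> n = (if n \<le> N then f n else t n)" for n
  have \<theta>t: "\<theta> n = t n" if "n \<ge> N" for n using that f(1) by (cases "n = N") (auto simp: \<theta>_def)
  have "gchain_map G X Y \<theta>"
    unfolding gchain_map_def
  proof (intro allI conjI ballI)
    fix n
    show "\<theta> n \<in> ghom G (obj X n) (obj Y n)"
      using f(2)[of n] tg[of n] by (cases "n \<le> N") (auto simp: \<theta>_def A_def)
    fix x assume x: "x \<in> carrier (obj X n)"
    show "\<theta> (n - 1) (bd X n x) = bd Y n (\<theta> n x)"
    proof (cases "n \<le> N")
      case True
      thus ?thesis using f(3)[of n] x by (simp add: R_def \<theta>_def)
    next
      case False
      thus ?thesis using td[of "n - 1" x] x \<theta>t[of n] \<theta>t[of "n - 1"] by simp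
    qed
  qed
  moreover have "\<forall>n\<ge>N. \<forall>x\<in>carrier (obj X n). \<kappa>' n (\<theta> n x) = \<phi> n (\<kappa> n x)"
    using \<theta>t tk by simp
  ultimately show ?thesis by blast
qed

text \<open>In high degrees the homotopy h of the resolutions is transported through \<kappa> and
  the inverse of \<kappa>'; below, the same downward extension applies. Here \<psi> stands for the
  difference of two maps of resolutions and \<theta> for that of the maps of completions over
  them.\<close>

lemma completion_map_homotopy:
  assumes X: "completion G P X \<kappa>" and Y: "completion G Q Y \<kappa>'"
    and Pc: "is_gcomplex G P" and Qc: "is_gcomplex G Q" and \<theta>: "gchain_map G X Y \<theta>"
    and h: "\<And>n. h n \<in> ghom G (obj P n) (obj Q (n + 1))"
    and dh: "\<And>n x. x \<in> carrier (obj P n) \<Longrightarrow> \<psi> n x = bd Q (n + 1) (h n x) \<otimes>\<^bsub>obj Q n\<^esub> h (n - 1) (bd P n x)"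
    and lies: "\<And>n x. n \<ge> N1 \<Longrightarrow> x \<in> carrier (obj X n) \<Longrightarrow> \<kappa>' n (\<theta> n x) = \<psi> n (\<kappa> n x)"
  shows "\<exists>k. \<forall>n. k n \<in> ghom G (obj X n) (obj Y (n + 1)) \<and>
     (\<forall>x\<in>carrier (obj X n). \<theta> n x = bd Y (n + 1) (k n x) \<otimes>\<^bsub>obj Y n\<^esub> k (n - 1) (bd X n x))"
proof -
  have Xc: "is_gcomplex G X" and Xr: "\<And>n. relatively_projective G (obj X n)"
    and Xcon: "contractible_ab (obj X) (bd X)" and \<kappa>: "gchain_map G X P \<kappa>"
    using X by (auto simp: completion_def)
  have Yc: "is_gcomplex G Y" and Yr: "\<And>n. relatively_projective G (obj Y n)"
    and \<kappa>': "gchain_map G Y Q \<kappa>'"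
    using Y by (auto simp: completion_def)
  obtain N' where N': "\<And>n. n \<ge> N' \<Longrightarrow> \<kappa>' n \<in> giso G (obj Y n) (obj Q n)"
    using Y unfolding completion_def by blast
  define N where "N = max N1 N'"
  note Xs = gcomplexD[OF Xc] and Ys = gcomplexD[OF Yc] and Ps = gcomplexD[OF Pc] and Qs = gcomplexD[OF Qc]
    and \<kappa>s = gchain_mapD[OF \<kappa>] and \<kappa>'s = gchain_mapD[OF \<kappa>'] and \<theta>s = gchain_mapD[OF \<theta>]
  define j where "j n = inv_into (carrier (obj Y n)) (\<kappa>' n)" for n
  have j: "j n \<in> ghom G (obj Q n) (obj Y n)" "y \<in> carrier (obj Q n) \<Longrightarrow> \<kappa>' n (j n y) = y"
    "x \<in> carrier (obj Y n) \<Longrightarrow> j n (\<kappa>' n x) = x" if "n \<ge> N" for n x y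
    using giso_inverse[OF Ys(1) Qs(1) N'[of n]] that by (auto simp: N_def j_def)
  define t where "t n x = j (n + 1) (h n (\<kappa> n x))" for n x
  have pk: "(\<lambda>x. h n (\<kappa> n x)) \<in> ghom G (obj X n) (obj Q (n + 1))" for n
    by (rule ghom_comp[OF \<kappa>s(1) h])
  have tg: "t n \<in> ghom G (obj X n) (obj Y (n + 1))" if "n \<ge> N" for n
    using ghom_comp[OF pk j(1)[of "n + 1"]] that by (simp add: t_def[abs_def])
  have tk: "\<kappa>' (n + 1) (t n x) = h n (\<kappa> n x)" if "n \<ge> N" "x \<in> carrier (obj X n)" for n x
    using j(2)[OF _ ghom_closed[OF pk that(2)]] that(1) by (simp add: t_def)
  have td: "\<theta> (n + 1) x = bd Y (n + 1 + 1) (t (n + 1) x) \<otimes>\<^bsub>obj Y (n + 1)\<^esub> t n (bd X (n + 1) x)"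
    if n: "n \<ge> N" and x: "x \<in> carrier (obj X (n + 1))" for n x
  proof -
    interpret Y1: gmodule G "obj Y (n + 1)" by (rule Ys)
    have dx: "bd X (n + 1) x \<in> carrier (obj X n)" by (rule ghom_closed[OF Xs(3) x])
    have tx: "t (n + 1) x \<in> carrier (obj Y (n + 1 + 1))" using ghom_closed[OF tg x] n by simp
    have tdx: "t n (bd X (n + 1) x) \<in> carrier (obj Y (n + 1))" using ghom_closed[OF tg dx] n by simp
    have dt: "bd Y (n + 1 + 1) (t (n + 1) x) \<in> carrier (obj Y (n + 1))" by (rule ghom_closed[OF Ys(3) tx])
    have "\<kappa>' (n + 1) (bd Y (n + 1 + 1) (t (n + 1) x) \<otimes>\<^bsub>obj Y (n + 1)\<^esub> t n (bd X (n + 1) x))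
        = bd Q (n + 1 + 1) (h (n + 1) (\<kappa> (n + 1) x)) \<otimes>\<^bsub>obj Q (n + 1)\<^esub> h n (\<kappa> n (bd X (n + 1) x))"
      using ghom_mult[OF \<kappa>'s(1) dt tdx] \<kappa>'s(3)[OF tx] tk[of "n + 1" x] tk[OF n dx] n x by simp
    also have "\<dots> = \<psi> (n + 1) (\<kappa> (n + 1) x)"
      using dh[OF ghom_closed[OF \<kappa>s(1) x]] \<kappa>s(3)[OF x] by simp
    also have "\<dots> = \<kappa>' (n + 1) (\<theta> (n + 1) x)" using lies[of "n + 1" x] n x by (simp add: N_def)
    finally have "j (n + 1) (\<kappa>' (n + 1) (bd Y (n + 1 + 1) (t (n + 1) x) \<otimes>\<^bsub>obj Y (n + 1)\<^esub> t n (bd X (n + 1) x))) = j (n + 1) (\<kappa>' (n + 1) (\<theta> (n + 1) x))" by simp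
    moreover have "N \<le> n + 1" using n by simp
    ultimately show ?thesis
      using j(3)[of "n + 1"] Y1.M.m_closed[OF dt tdx] ghom_closed[OF \<theta>s(1) x] by metis
  qed
  \<comment> \<open>\<theta> minus the differential of b has to kill boundaries; then it factors
    through \<open>bd X n\<close>, and the factor is the homotopy in degree n - 1.\<close>
  define A where "A n b \<longleftrightarrow> b \<in> ghom G (obj X n) (obj Y (n + 1)) \<and>
      (\<forall>x\<in>carrier (obj X (n + 1)). \<theta> n (bd X (n + 1) x) = bd Y (n + 1) (b (bd X (n + 1) x)))" for n b
  define R where "R n b b' \<longleftrightarrow> (\<forall>x\<in>carrier (obj X n). \<theta> n x = bd Y (n + 1) (b x) \<otimes>\<^bsub>obj Y n\<^esub> b' (bd X n x))" for n b b'
  have "\<exists>f. f N = t N \<and> (\<forall>n\<le>N. A n (f n) \<and> R n (f n) (f (n - 1)))"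
  proof (rule int_downward_choice)
    show "A N (t N)" unfolding A_def
    proof (intro conjI ballI tg)
      fix x assume x: "x \<in> carrier (obj X (N + 1))"
      interpret Y0: gmodule G "obj Y N" by (rule Ys)
      have dx: "bd X (N + 1) x \<in> carrier (obj X N)" by (rule ghom_closed[OF Xs(3) x])
      have tdx: "t N (bd X (N + 1) x) \<in> carrier (obj Y (N + 1))" using ghom_closed[OF tg dx] by simp
      have tx: "t (N + 1) x \<in> carrier (obj Y (N + 1 + 1))" using ghom_closed[OF tg x] by simp
      have "\<theta> N (bd X (N + 1) x) = bd Y (N + 1) (\<theta> (N + 1) x)" by (rule \<theta>s(3)[OF x])
      also have "\<dots> = bd Y (N + 1) (bd Y (N + 1 + 1) (t (N + 1) x)) \<otimes>\<^bsub>obj Y N\<^esub> bd Y (N + 1) (t N (bd X (N + 1) x))"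
        using td[OF _ x] ghom_mult[OF Ys(3) ghom_closed[OF Ys(3) tx] tdx] by simp
      also have "\<dots> = bd Y (N + 1) (t N (bd X (N + 1) x))"
        using Ys(5)[OF tx] ghom_closed[OF Ys(3) tdx] by simp
      finally show "\<theta> N (bd X (N + 1) x) = bd Y (N + 1) (t N (bd X (N + 1) x))" .
    qed simp
    fix n b assume A: "A n b"
    have bg: "b \<in> ghom G (obj X n) (obj Y (n + 1))" using A by (simp add: A_def)
    interpret Yn: gmodule G "obj Y n" by (rule Ys)
    have g: "(\<lambda>x. \<theta> n x \<otimes>\<^bsub>obj Y n\<^esub> inv\<^bsub>obj Y n\<^esub> (bd Y (n + 1) (b x))) \<in> ghom G (obj X n) (obj Y n)"
      by (rule ghom_diff[OF Ys(1) \<theta>s(1) ghom_comp[OF bg Ys(3)]])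
    have gd: "\<theta> n (bd X (n + 1) x) \<otimes>\<^bsub>obj Y n\<^esub> inv\<^bsub>obj Y n\<^esub> (bd Y (n + 1) (b (bd X (n + 1) x))) = \<one>\<^bsub>obj Y n\<^esub>"
      if x: "x \<in> carrier (obj X (n + 1))" for x
    proof -
      have "bd Y (n + 1) (b (bd X (n + 1) x)) \<in> carrier (obj Y n)"
        using ghom_closed[OF Ys(3) ghom_closed[OF bg ghom_closed[OF Xs(3) x]]] .
      thus ?thesis using A x by (simp add: A_def)
    qed
    obtain b' where b': "b' \<in> ghom G (obj X (n - 1)) (obj Y n)"
      "\<And>x. x \<in> carrier (obj X n) \<Longrightarrow> b' (bd X n x) = \<theta> n x \<otimes>\<^bsub>obj Y n\<^esub> inv\<^bsub>obj Y n\<^esub> (bd Y (n + 1) (b x))"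
      using equivariant_extension[OF Yr Xc Xcon Xr g gd] by auto
    have R: "\<theta> n x = bd Y (n + 1) (b x) \<otimes>\<^bsub>obj Y n\<^esub> b' (bd X n x)" if x: "x \<in> carrier (obj X n)" for x
    proof -
      have 1: "bd Y (n + 1) (b x) \<in> carrier (obj Y n)" using ghom_closed[OF Ys(3) ghom_closed[OF bg x]] .
      have 2: "\<theta> n x \<in> carrier (obj Y n)" using ghom_closed[OF \<theta>s(1) x] .
      have "bd Y (n + 1) (b x) \<otimes>\<^bsub>obj Y n\<^esub> b' (bd X n x) = \<theta> n x \<otimes>\<^bsub>obj Y n\<^esub> (bd Y (n + 1) (b x) \<otimes>\<^bsub>obj Y n\<^esub> inv\<^bsub>obj Y n\<^esub> (bd Y (n + 1) (b x)))"
        unfolding b'(2)[OF x] using 1 2 by (simp only: Yn.M.m_ac Yn.M.inv_closed Yn.M.m_closed)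
      thus ?thesis using 1 2 by simp
    qed
    have "A (n - 1) b'" unfolding A_def
    proof (intro conjI ballI)
      show "b' \<in> ghom G (obj X (n - 1)) (obj Y (n - 1 + 1))" using b'(1) by simp
      fix x assume "x \<in> carrier (obj X (n - 1 + 1))"
      hence x: "x \<in> carrier (obj X n)" by simp
      interpret Ym: gmodule G "obj Y (n - 1)" by (rule Ys)
      have bx: "b x \<in> carrier (obj Y (n + 1))" using ghom_closed[OF bg x] .
      have b'x: "b' (bd X n x) \<in> carrier (obj Y n)" using ghom_closed[OF b'(1) ghom_closed[OF Xs(2) x]] .
      have "\<theta> (n - 1) (bd X n x) = bd Y n (bd Y (n + 1) (b x) \<otimes>\<^bsub>obj Y n\<^esub> b' (bd X n x))"
        using \<theta>s(2)[OF x] R[OF x] by simp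
      also have "\<dots> = bd Y n (b' (bd X n x))"
        using ghom_mult[OF Ys(2) ghom_closed[OF Ys(3) bx] b'x] Ys(5)[OF bx] ghom_closed[OF Ys(2) b'x] by simp
      finally show "\<theta> (n - 1) (bd X (n - 1 + 1) x) = bd Y (n - 1 + 1) (b' (bd X (n - 1 + 1) x))" by simp
    qed
    thus "\<exists>b'. A (n - 1) b' \<and> R n b b'" using R by (auto simp: R_def)
  qed
  then obtain f where f: "f N = t N" "\<And>n. n \<le> N \<Longrightarrow> A n (f n)" "\<And>n. n \<le> N \<Longrightarrow> R n (f n) (f (n - 1))" by blast
  define k where "k n = (if n \<le> N then f n else t n)" for n
  have kt: "k n = t n" if "n \<ge> N" for n using that f(1) by (cases "n = N") (auto simp: k_def)
  have "k n \<in> ghom G (obj X n) (obj Y (n + 1))" for n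
    using f(2)[of n] tg[of n] by (cases "n \<le> N") (auto simp: k_def A_def)
  moreover have "\<theta> n x = bd Y (n + 1) (k n x) \<otimes>\<^bsub>obj Y n\<^esub> k (n - 1) (bd X n x)" if x: "x \<in> carrier (obj X n)" for n x
  proof (cases "n \<le> N")
    case True
    thus ?thesis using f(3)[of n] x by (simp add: R_def k_def)
  next
    case False
    thus ?thesis using td[of "n - 1" x] x kt[of n] kt[of "n - 1"] by simp
  qed
  ultimately show ?thesis by blast
qed

end

section \<open>Maps on homology of coinvariants\<close>

text \<open>\<open>quot_map\<close> is a product of sets; on a coset of K the image of K is absorbed
  by L, so a single coset of L remains.\<close>

lemma quot_map_coset:
  assumes "group A" "group B" "h \<in> hom A B" "subgroup K A" "subgroup L B" "h ` K \<subseteq> L" "x \<in> carrier A"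
  shows "quot_map B L h (K #>\<^bsub>A\<^esub> x) = L #>\<^bsub>B\<^esub> h x"
proof -
  interpret A: group A by fact
  interpret B: group B by fact
  interpret K: subgroup K A by fact
  interpret L: subgroup L B by fact
  interpret h: group_hom A B h using assms(3) by unfold_locales
  show ?thesis
  proof
    show "quot_map B L h (K #>\<^bsub>A\<^esub> x) \<subseteq> L #>\<^bsub>B\<^esub> h x"
    proof
      fix z assume "z \<in> quot_map B L h (K #>\<^bsub>A\<^esub> x)"
      then obtain l k where lk: "l \<in> L" "k \<in> K" "z = l \<otimes>\<^bsub>B\<^esub> h (k \<otimes>\<^bsub>A\<^esub> x)"
        by (auto simp: quot_map_def set_mult_def r_coset_def)
      have "z = (l \<otimes>\<^bsub>B\<^esub> h k) \<otimes>\<^bsub>B\<^esub> h x" using lk assms(7) by (simp add: B.m_assoc)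
      moreover have "l \<otimes>\<^bsub>B\<^esub> h k \<in> L" using lk assms(6) by auto
      ultimately show "z \<in> L #>\<^bsub>B\<^esub> h x" by (auto simp: r_coset_def)
    qed
    show "L #>\<^bsub>B\<^esub> h x \<subseteq> quot_map B L h (K #>\<^bsub>A\<^esub> x)"
      using A.rcos_self[OF assms(7) assms(4)] by (force simp: quot_map_def set_mult_def r_coset_def)
  qed
qed

lemma quot_map_hom:
  assumes "comm_group A" "comm_group B" "h \<in> hom A B" "subgroup K A" "subgroup L B" "h ` K \<subseteq> L"
  shows "quot_map B L h \<in> hom (A Mod K) (B Mod L)"
proof -
  interpret A: comm_group A by fact
  interpret B: comm_group B by fact
  interpret K: normal K A using A.subgroup_imp_normal assms(4) by blast
  interpret L: normal L B using B.subgroup_imp_normal assms(5) by blast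
  note q = quot_map_coset[OF A.is_group B.is_group assms(3-6)]
  have hc: "h x \<in> carrier B" if "x \<in> carrier A" for x using hom_in_carrier[OF assms(3) that] .
  show ?thesis
  proof (rule homI)
    fix c assume "c \<in> carrier (A Mod K)"
    then show "quot_map B L h c \<in> carrier (B Mod L)"
      using q hc by (auto simp: FactGroup_def RCOSETS_def)
  next
    fix c d assume "c \<in> carrier (A Mod K)" "d \<in> carrier (A Mod K)"
    then obtain x y where "x \<in> carrier A" "y \<in> carrier A" "c = K #>\<^bsub>A\<^esub> x" "d = K #>\<^bsub>A\<^esub> y"
      by (auto simp: FactGroup_def RCOSETS_def)
    thus "quot_map B L h (c \<otimes>\<^bsub>A Mod K\<^esub> d) = quot_map B L h c \<otimes>\<^bsub>B Mod L\<^esub> quot_map B L h d"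
      using hc by (simp add: FactGroup_def K.rcos_sum L.rcos_sum q hom_mult[OF assms(3)])
  qed
qed

lemma (in comm_group) coset_eqI:
  assumes "subgroup H G" "x \<in> carrier G" "y \<in> carrier G" "h \<in> H" "x = y \<otimes> h"
  shows "H #> x = H #> y"
proof -
  interpret H: subgroup H G by fact
  have "x = h \<otimes> y" using assms by (simp add: m_comm)
  hence "x \<in> H #> y" using assms by (auto simp: r_coset_def)
  thus ?thesis using repr_independence[OF _ assms(3,1)] by simp
qed

lemma subgroup_coinv_sub:
  assumes "gmodule G M"
  shows "subgroup (coinv_sub G M) M"
proof -
  interpret M: gmodule G M by fact
  show ?thesis unfolding coinv_sub_def
    by (rule M.M.generate_is_subgroup) auto
qed

lemma ghom_coinv_sub:
  assumes M: "gmodule G M" and N: "gmodule G N" and f: "f \<in> ghom G M N"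
  shows "f ` coinv_sub G M \<subseteq> coinv_sub G N"
proof -
  interpret M: gmodule G M by fact
  interpret N: gmodule G N by fact
  interpret f: group_hom M N f by (rule ghom_group_hom[OF M N f])
  have "f y \<in> coinv_sub G N" if "y \<in> coinv_sub G M" for y
    using that unfolding coinv_sub_def
  proof (induction rule: generate.induct)
    case one
    then show ?case by (simp add: generate.one)
  next
    case (incl h)
    then obtain g x where "h = act M g x \<otimes>\<^bsub>M\<^esub> inv\<^bsub>M\<^esub> x" "g \<in> carrier G" "x \<in> carrier M" by blast
    then show ?case using f by (intro generate.incl CollectI exI[of _ g] exI[of _ "f x"]) (simp add: ghom_act)
  next
    case (inv h)
    then obtain g x where gx: "h = act M g x \<otimes>\<^bsub>M\<^esub> inv\<^bsub>M\<^esub> x" "g \<in> carrier G" "x \<in> carrier M" by blast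
    hence "f (inv\<^bsub>M\<^esub> h) = inv\<^bsub>N\<^esub> (act N g (f x) \<otimes>\<^bsub>N\<^esub> inv\<^bsub>N\<^esub> (f x))" using f by (simp add: ghom_act)
    moreover have "inv\<^bsub>N\<^esub> (act N g (f x) \<otimes>\<^bsub>N\<^esub> inv\<^bsub>N\<^esub> (f x)) \<in>
      generate N {act N g x \<otimes>\<^bsub>N\<^esub> inv\<^bsub>N\<^esub> x | g x. g \<in> carrier G \<and> x \<in> carrier N}"
      using gx by (intro generate.inv CollectI exI[of _ g] exI[of _ "f x"]) simp
    ultimately show ?case by simp
  next
    case (eng h1 h2)
    have "h1 \<in> carrier M" "h2 \<in> carrier M"
      using eng.hyps subgroup.subset[OF subgroup_coinv_sub[OF M]] by (auto simp: coinv_sub_def)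
    then show ?case using eng.IH by (simp add: generate.eng)
  qed
  thus ?thesis by blast
qed

text \<open>The coset of cosets represented by x. It is an element of the homology when
  \<open>bd X n x\<close> lies in \<open>coinv_sub\<close>, which is weaker than x being a cycle of
  X.\<close>

definition coinv_class :: "'g monoid \<Rightarrow> ('g, 'a) gcomplex \<Rightarrow> int \<Rightarrow> 'a \<Rightarrow> 'a set set" where
  "coinv_class G X n x = boundaries (coinv_obj G X) (coinv_bd G X) n #>\<^bsub>coinv_obj G X n\<^esub>
     (coinv_sub G (obj X n) #>\<^bsub>obj X n\<^esub> x)"

locale gcomplex = fixes G :: "'g monoid" and X :: "('g, 'a) gcomplex"
  assumes complex: "is_gcomplex G X"
begin

lemmas Xs = gcomplexD[OF complex]

abbreviation "L n \<equiv> coinv_sub G (obj X n)"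

lemma comm: "comm_group (obj X n)" using Xs(1)[of n] by (simp add: gmodule_def)

lemma L: "subgroup (L n) (obj X n)" by (rule subgroup_coinv_sub[OF Xs(1)])

lemma comm_coinv: "comm_group (coinv_obj G X n)"
  unfolding coinv_obj_def coinvariants_def by (rule comm_group.abelian_FactGroup[OF comm L])

lemma coinv_bd_coset: "x \<in> carrier (obj X n) \<Longrightarrow> coinv_bd G X n (L n #>\<^bsub>obj X n\<^esub> x) = L (n - 1) #>\<^bsub>obj X (n - 1)\<^esub> bd X n x"
  unfolding coinv_bd_def
  by (rule quot_map_coset[OF _ _ _ L L ghom_coinv_sub[OF Xs(1) Xs(1) Xs(2)]])
    (use comm Xs(2)[of n] in \<open>auto simp: comm_group_def ghom_def\<close>)

lemma coinv_bd_hom: "coinv_bd G X n \<in> hom (coinv_obj G X n) (coinv_obj G X (n - 1))"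
  unfolding coinv_bd_def coinv_obj_def coinvariants_def
  by (rule quot_map_hom[OF comm comm _ L L ghom_coinv_sub[OF Xs(1) Xs(1) Xs(2)]])
    (use Xs(2)[of n] in \<open>auto simp: ghom_def\<close>)

lemma carrier_coinv_obj: "carrier (coinv_obj G X n) = {L n #>\<^bsub>obj X n\<^esub> x | x. x \<in> carrier (obj X n)}"
  by (auto simp: coinv_obj_def coinvariants_def FactGroup_def RCOSETS_def)

lemma one_coinv_obj: "\<one>\<^bsub>coinv_obj G X n\<^esub> = L n"
  by (simp add: coinv_obj_def coinvariants_def FactGroup_def)

lemma mult_coinv_obj: "x \<in> carrier (obj X n) \<Longrightarrow> y \<in> carrier (obj X n) \<Longrightarrow>
    (L n #>\<^bsub>obj X n\<^esub> x) \<otimes>\<^bsub>coinv_obj G X n\<^esub> (L n #>\<^bsub>obj X n\<^esub> y) = L n #>\<^bsub>obj X n\<^esub> (x \<otimes>\<^bsub>obj X n\<^esub> y)"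
  using normal.rcos_sum[OF comm_group.subgroup_imp_normal[OF comm L]]
  by (simp add: coinv_obj_def coinvariants_def FactGroup_def)

lemma coset_eq_L: "x \<in> carrier (obj X n) \<Longrightarrow> L n #>\<^bsub>obj X n\<^esub> x = L n \<longleftrightarrow> x \<in> L n"
  using group.coset_join2[OF _ _ L, of n x] group.rcos_self[OF _ _ L, of n x] comm[of n] by (auto simp: comm_group_def)

abbreviation "B n \<equiv> boundaries (coinv_obj G X) (coinv_bd G X) n"

lemma B_eq: "B n = {L n #>\<^bsub>obj X n\<^esub> bd X (n + 1) w | w. w \<in> carrier (obj X (n + 1))}"
  using coinv_bd_coset[of _ "n + 1"] unfolding boundaries_def carrier_coinv_obj by force

lemma B: "subgroup (B n) (coinv_obj G X n)"
proof -
  have "coinv_bd G X (n + 1) \<in> hom (coinv_obj G X (n + 1)) (coinv_obj G X n)" using coinv_bd_hom[of "n + 1"] by simp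
  hence "group_hom (coinv_obj G X (n + 1)) (coinv_obj G X n) (coinv_bd G X (n + 1))"
    using comm_coinv by (auto simp: comm_group_def group_hom_def group_hom_axioms_def)
  thus ?thesis unfolding boundaries_def by (rule group_hom.img_is_subgroup)
qed

lemma kernel_eq: "kernel (coinv_obj G X n) (coinv_obj G X (n - 1)) (coinv_bd G X n) =
    {L n #>\<^bsub>obj X n\<^esub> x | x. x \<in> carrier (obj X n) \<and> bd X n x \<in> L (n - 1)}"
proof -
  have "L (n - 1) #>\<^bsub>obj X (n - 1)\<^esub> bd X n x = L (n - 1) \<longleftrightarrow> bd X n x \<in> L (n - 1)"
    if "x \<in> carrier (obj X n)" for x
    by (rule coset_eq_L[OF ghom_closed[OF Xs(2) that]])
  thus ?thesis
    unfolding kernel_def carrier_coinv_obj one_coinv_obj using coinv_bd_coset by fastforce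
qed

lemma carrier_homology: "carrier (coinv_homology G X n) =
    {coinv_class G X n x | x. x \<in> carrier (obj X n) \<and> bd X n x \<in> L (n - 1)}"
  unfolding coinv_homology_def chain_homology_def FactGroup_def RCOSETS_def kernel_eq
  by (auto simp: coinv_class_def r_coset_def)

lemma coset_in: "x \<in> carrier (obj X n) \<Longrightarrow> L n #>\<^bsub>obj X n\<^esub> x \<in> carrier (coinv_obj G X n)"
  by (auto simp: carrier_coinv_obj)

lemma mult_homology:
  assumes "x \<in> carrier (obj X n)" "y \<in> carrier (obj X n)"
  shows "coinv_class G X n x \<otimes>\<^bsub>coinv_homology G X n\<^esub> coinv_class G X n y = coinv_class G X n (x \<otimes>\<^bsub>obj X n\<^esub> y)"
proof -
  have "coinv_class G X n x \<otimes>\<^bsub>coinv_homology G X n\<^esub> coinv_class G X n y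
     = coinv_class G X n x <#>\<^bsub>coinv_obj G X n\<^esub> coinv_class G X n y"
    by (simp add: coinv_homology_def chain_homology_def FactGroup_def set_mult_def)
  thus ?thesis
    using normal.rcos_sum[OF comm_group.subgroup_imp_normal[OF comm_coinv B] coset_in[OF assms(1)] coset_in[OF assms(2)]]
    by (simp add: coinv_class_def mult_coinv_obj[OF assms])
qed

text \<open>Two representatives may differ by a boundary and by an element that dies in the
  coinvariants; both kinds occur when a homotopy is applied to a cycle of coinvariants.\<close>

lemma class_eqI:
  assumes "x \<in> carrier (obj X n)" "y \<in> carrier (obj X n)" "w \<in> carrier (obj X (n + 1))" "s \<in> L n"
    "x = y \<otimes>\<^bsub>obj X n\<^esub> (bd X (n + 1) w \<otimes>\<^bsub>obj X n\<^esub> s)"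
  shows "coinv_class G X n x = coinv_class G X n y"
proof -
  interpret M: comm_group "obj X n" by (rule comm)
  interpret Ln: subgroup "L n" "obj X n" by (rule L)
  have dw: "bd X (n + 1) w \<in> carrier (obj X n)" by (rule ghom_closed[OF Xs(3) assms(3)])
  have "L n #>\<^bsub>obj X n\<^esub> x = L n #>\<^bsub>obj X n\<^esub> (y \<otimes>\<^bsub>obj X n\<^esub> bd X (n + 1) w)"
    by (rule M.coset_eqI[OF L assms(1) _ assms(4)]) (use assms dw in \<open>auto simp: M.m_assoc\<close>)
  also have "\<dots> = (L n #>\<^bsub>obj X n\<^esub> y) \<otimes>\<^bsub>coinv_obj G X n\<^esub> (L n #>\<^bsub>obj X n\<^esub> bd X (n + 1) w)"
    by (rule mult_coinv_obj[symmetric, OF assms(2) dw])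
  finally show ?thesis unfolding coinv_class_def
    by (intro comm_group.coset_eqI[OF comm_coinv B coset_in coset_in]) (use assms B_eq in auto)
qed

end

lemma coinv_homology_map_class:
  assumes "is_gcomplex G X" "is_gcomplex G Y" and \<theta>: "gchain_map G X Y \<theta>" and x: "x \<in> carrier (obj X n)"
  shows "coinv_homology_map G Y \<theta> n (coinv_class G X n x) = coinv_class G Y n (\<theta> n x)"
proof -
  interpret X: gcomplex G X by unfold_locales fact
  interpret Y: gcomplex G Y by unfold_locales fact
  note \<theta>s = gchain_mapD[OF \<theta>]
  note sub = ghom_coinv_sub[OF X.Xs(1) Y.Xs(1) \<theta>s(1)]
  have hom: "\<theta> n \<in> hom (obj X n) (obj Y n)" using \<theta>s(1) by (simp add: ghom_def)
  have gX: "group (obj X n)" and gY: "group (obj Y n)" using X.comm Y.comm by (auto simp: comm_group_def)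
  have q: "quot_map (obj Y n) (Y.L n) (\<theta> n) (X.L n #>\<^bsub>obj X n\<^esub> x) = Y.L n #>\<^bsub>obj Y n\<^esub> \<theta> n x" if "x \<in> carrier (obj X n)" for x
    by (rule quot_map_coset[OF gX gY hom X.L Y.L sub that])
  have "quot_map (obj Y n) (Y.L n) (\<theta> n) ` X.B n \<subseteq> Y.B n"
  proof
    fix b assume "b \<in> quot_map (obj Y n) (Y.L n) (\<theta> n) ` X.B n"
    then obtain w where w: "w \<in> carrier (obj X (n + 1))"
      "b = quot_map (obj Y n) (Y.L n) (\<theta> n) (X.L n #>\<^bsub>obj X n\<^esub> bd X (n + 1) w)"
      unfolding X.B_eq by blast
    hence "b = Y.L n #>\<^bsub>obj Y n\<^esub> bd Y (n + 1) (\<theta> (n + 1) w)"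
      using q[OF ghom_closed[OF X.Xs(3) w(1)]] \<theta>s(3)[OF w(1)] by simp
    thus "b \<in> Y.B n" unfolding Y.B_eq using ghom_closed[OF \<theta>s(1) w(1)] by blast
  qed
  moreover have "quot_map (obj Y n) (Y.L n) (\<theta> n) \<in> hom (coinv_obj G X n) (coinv_obj G Y n)"
    unfolding coinv_obj_def coinvariants_def
    by (rule quot_map_hom[OF X.comm Y.comm hom X.L Y.L sub])
  moreover have "group (coinv_obj G X n)" "group (coinv_obj G Y n)"
    using X.comm_coinv Y.comm_coinv by (auto simp: comm_group_def)
  ultimately show ?thesis
    unfolding coinv_homology_map_def coinv_class_def
    using quot_map_coset[OF _ _ _ X.B Y.B _ X.coset_in[OF x]] q[OF x] by simp
qed

lemma coinv_homology_map_hom: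
  assumes Xc: "is_gcomplex G X" and Yc: "is_gcomplex G Y" and \<theta>: "gchain_map G X Y \<theta>"
  shows "coinv_homology_map G Y \<theta> n \<in> hom (coinv_homology G X n) (coinv_homology G Y n)"
proof -
  interpret X: gcomplex G X by unfold_locales fact
  interpret Y: gcomplex G Y by unfold_locales fact
  note \<theta>s = gchain_mapD[OF \<theta>] and m = coinv_homology_map_class[OF assms]
  show ?thesis
  proof (rule homI)
    fix c assume "c \<in> carrier (coinv_homology G X n)"
    then obtain x where x: "c = coinv_class G X n x" "x \<in> carrier (obj X n)" "bd X n x \<in> X.L (n - 1)"
      unfolding X.carrier_homology by blast
    have "bd Y n (\<theta> n x) \<in> Y.L (n - 1)"
      using \<theta>s(2)[OF x(2)] ghom_coinv_sub[OF X.Xs(1) Y.Xs(1) \<theta>s(1)[of "n - 1"]] x(3) by (metis image_subset_iff)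
    thus "coinv_homology_map G Y \<theta> n c \<in> carrier (coinv_homology G Y n)"
      unfolding Y.carrier_homology using x m ghom_closed[OF \<theta>s(1) x(2)] by blast
  next
    fix c d assume "c \<in> carrier (coinv_homology G X n)" "d \<in> carrier (coinv_homology G X n)"
    then obtain x y where x: "c = coinv_class G X n x" "x \<in> carrier (obj X n)"
      and y: "d = coinv_class G X n y" "y \<in> carrier (obj X n)"
      unfolding X.carrier_homology by blast
    have "x \<otimes>\<^bsub>obj X n\<^esub> y \<in> carrier (obj X n)"
      using X.comm[of n] x y by (simp add: comm_group_def group_def monoid.m_closed)
    thus "coinv_homology_map G Y \<theta> n (c \<otimes>\<^bsub>coinv_homology G X n\<^esub> d) =
      coinv_homology_map G Y \<theta> n c \<otimes>\<^bsub>coinv_homology G Y n\<^esub> coinv_homology_map G Y \<theta> n d"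
      using x y ghom_closed[OF \<theta>s(1)] by (simp add: X.mult_homology Y.mult_homology m ghom_mult[OF \<theta>s(1)])
  qed
qed

lemma coinv_homology_map_comp:
  assumes X: "is_gcomplex G X" and Y: "is_gcomplex G Y" and Z: "is_gcomplex G Z"
    and \<theta>: "gchain_map G X Y \<theta>" "gchain_map G Y Z \<theta>'" and cl: "cl \<in> carrier (coinv_homology G X n)"
  shows "coinv_homology_map G Z \<theta>' n (coinv_homology_map G Y \<theta> n cl) = coinv_homology_map G Z (\<lambda>n x. \<theta>' n (\<theta> n x)) n cl"
proof -
  interpret X: gcomplex G X by unfold_locales fact
  obtain x where x: "cl = coinv_class G X n x" "x \<in> carrier (obj X n)"
    using cl unfolding X.carrier_homology by blast
  have "\<theta> n x \<in> carrier (obj Y n)" by (rule ghom_closed[OF gchain_mapD(1)[OF \<theta>(1)] x(2)])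
  thus ?thesis
    using x coinv_homology_map_class[OF X Y \<theta>(1)] coinv_homology_map_class[OF Y Z \<theta>(2)]
      coinv_homology_map_class[OF X Z gchain_map_comp[OF \<theta>]] by simp
qed

section \<open>Comparisons induce canonical isomorphisms on homology\<close>

context signed_free_abelian begin

lemma comparison_exists:
  assumes 1: "completed_resolution G M P \<epsilon> X \<kappa>" and 2: "completed_resolution G M Q \<epsilon>' Y \<kappa>'"
  shows "\<exists>\<phi> \<theta>. comparison G P \<epsilon> X \<kappa> Q \<epsilon>' Y \<kappa>' \<phi> \<theta>"
proof -
  have P: "resolution G M P \<epsilon>" "completion G P X \<kappa>" and Q: "resolution G M Q \<epsilon>'" "completion G Q Y \<kappa>'"
    using 1 2 by (auto simp: completed_resolution_def)
  have c: "is_gcomplex G P" "is_gcomplex G Q" using P Q by (auto simp: resolution_def)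
  obtain \<phi> where \<phi>: "gchain_map G P Q \<phi>" "\<forall>n. \<forall>x\<in>carrier (obj P n). \<epsilon>' n (\<phi> n x) = \<epsilon> n x"
    using resolution_map_exists[OF P(1) Q(1)] by blast
  obtain \<theta> where "gchain_map G X Y \<theta>" "\<exists>N. \<forall>n\<ge>N. \<forall>x\<in>carrier (obj X n). \<kappa>' n (\<theta> n x) = \<phi> n (\<kappa> n x)"
    using completion_map_exists[OF P(2) Q(2) c \<phi>(1)] by blast
  thus ?thesis using \<phi> unfolding comparison_def by blast
qed

text \<open>The difference of the two maps of resolutions is killed by the augmentation, hence
  null-homotopic. The difference of the maps of completions lies over it in high degrees, hence is
  null-homotopic as well, by an equivariant homotopy.\<close>

lemma comparison_homology_unique:
  assumes 1: "completed_resolution G M P \<epsilon> X \<kappa>" and 2: "completed_resolution G M Q \<epsilon>' Y \<kappa>'"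
    and c1: "comparison G P \<epsilon> X \<kappa> Q \<epsilon>' Y \<kappa>' \<phi>1 \<theta>1" and c2: "comparison G P \<epsilon> X \<kappa> Q \<epsilon>' Y \<kappa>' \<phi>2 \<theta>2"
    and cl: "cl \<in> carrier (coinv_homology G X n)"
  shows "coinv_homology_map G Y \<theta>1 n cl = coinv_homology_map G Y \<theta>2 n cl"
proof -
  have P: "resolution G M P \<epsilon>" "completion G P X \<kappa>" and Q: "resolution G M Q \<epsilon>'" "completion G Q Y \<kappa>'"
    using 1 2 by (auto simp: completed_resolution_def)
  have c: "is_gcomplex G P" "is_gcomplex G Q" and Xc: "is_gcomplex G X" and Yc: "is_gcomplex G Y"
    and M: "gmodule G M" and \<epsilon>': "gchain_map G Q (in_degree_0 M) \<epsilon>'" and \<kappa>: "gchain_map G X P \<kappa>" and \<kappa>': "gchain_map G Y Q \<kappa>'"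
    using P Q by (auto simp: resolution_def completion_def)
  have \<phi>: "gchain_map G P Q \<phi>1" "gchain_map G P Q \<phi>2" and \<theta>: "gchain_map G X Y \<theta>1" "gchain_map G X Y \<theta>2"
    and e: "\<And>n x. x \<in> carrier (obj P n) \<Longrightarrow> \<epsilon>' n (\<phi>1 n x) = \<epsilon> n x" "\<And>n x. x \<in> carrier (obj P n) \<Longrightarrow> \<epsilon>' n (\<phi>2 n x) = \<epsilon> n x"
    using c1 c2 by (auto simp: comparison_def)
  obtain N1 where N1: "\<And>n x. n \<ge> N1 \<Longrightarrow> x \<in> carrier (obj X n) \<Longrightarrow> \<kappa>' n (\<theta>1 n x) = \<phi>1 n (\<kappa> n x)"
    using c1 unfolding comparison_def by blast
  obtain N2 where N2: "\<And>n x. n \<ge> N2 \<Longrightarrow> x \<in> carrier (obj X n) \<Longrightarrow> \<kappa>' n (\<theta>2 n x) = \<phi>2 n (\<kappa> n x)"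
    using c2 unfolding comparison_def by blast
  interpret X: gcomplex G X by unfold_locales fact
  interpret Y: gcomplex G Y by unfold_locales fact
  note Qs = gcomplexD[OF c(2)]
  define \<phi> where "\<phi> n x = \<phi>1 n x \<otimes>\<^bsub>obj Q n\<^esub> inv\<^bsub>obj Q n\<^esub> (\<phi>2 n x)" for n x
  define \<theta> where "\<theta> n x = \<theta>1 n x \<otimes>\<^bsub>obj Y n\<^esub> inv\<^bsub>obj Y n\<^esub> (\<theta>2 n x)" for n x
  have \<phi>c: "gchain_map G P Q \<phi>" using gchain_map_diff[OF c \<phi>] by (simp add: \<phi>_def[abs_def])
  have \<theta>c: "gchain_map G X Y \<theta>" using gchain_map_diff[OF Xc Yc \<theta>] by (simp add: \<theta>_def[abs_def])
  have e\<phi>: "\<epsilon>' n (\<phi> n x) = \<one>\<^bsub>M\<^esub>" if x: "x \<in> carrier (obj P n)" for n x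
  proof -
    note D = gmodule_in_degree_0[OF M]
    interpret Dn: gmodule G "obj (in_degree_0 M) n" by (rule D)
    interpret Qn: gmodule G "obj Q n" by (rule Qs)
    note p1 = ghom_closed[OF gchain_mapD(1)[OF \<phi>(1)] x] and p2 = ghom_closed[OF gchain_mapD(1)[OF \<phi>(2)] x]
    have "\<epsilon>' n (\<phi> n x) = \<epsilon>' n (\<phi>1 n x) \<otimes>\<^bsub>obj (in_degree_0 M) n\<^esub> inv\<^bsub>obj (in_degree_0 M) n\<^esub> (\<epsilon>' n (\<phi>2 n x))"
      using ghom_mult[OF gchain_mapD(1)[OF \<epsilon>'] p1 Qn.M.inv_closed[OF p2]]
        ghom_minv[OF Qs(1) D gchain_mapD(1)[OF \<epsilon>'] p2] by (simp add: \<phi>_def)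
    also have "\<dots> = \<one>\<^bsub>obj (in_degree_0 M) n\<^esub>"
      using Dn.M.r_inv[OF ghom_closed[OF gchain_mapD(1)[OF \<epsilon>'] p1]] e x by simp
    finally show ?thesis by simp
  qed
  obtain h where h: "\<And>n. h n \<in> ghom G (obj P n) (obj Q (n + 1))"
    "\<And>n x. x \<in> carrier (obj P n) \<Longrightarrow> \<phi> n x = bd Q (n + 1) (h n x) \<otimes>\<^bsub>obj Q n\<^esub> h (n - 1) (bd P n x)"
    using resolution_map_homotopy[OF P(1) Q(1) \<phi>c e\<phi>] by blast
  have lies: "\<kappa>' n (\<theta> n x) = \<phi> n (\<kappa> n x)" if n: "n \<ge> max N1 N2" and x: "x \<in> carrier (obj X n)" for n x
  proof -
    interpret Yn: gmodule G "obj Y n" by (rule Y.Xs)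
    note p1 = ghom_closed[OF gchain_mapD(1)[OF \<theta>(1)] x] and p2 = ghom_closed[OF gchain_mapD(1)[OF \<theta>(2)] x]
    show ?thesis
      using ghom_mult[OF gchain_mapD(1)[OF \<kappa>'] p1 Yn.M.inv_closed[OF p2]]
        ghom_minv[OF Y.Xs(1) Qs(1) gchain_mapD(1)[OF \<kappa>'] p2] N1[of n x] N2[of n x] n x by (simp add: \<phi>_def \<theta>_def)
  qed
  obtain k where k: "\<And>n. k n \<in> ghom G (obj X n) (obj Y (n + 1))"
    "\<And>n x. x \<in> carrier (obj X n) \<Longrightarrow> \<theta> n x = bd Y (n + 1) (k n x) \<otimes>\<^bsub>obj Y n\<^esub> k (n - 1) (bd X n x)"
    using completion_map_homotopy[OF P(2) Q(2) c \<theta>c h lies] by blast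
  obtain x where x: "cl = coinv_class G X n x" "x \<in> carrier (obj X n)" "bd X n x \<in> X.L (n - 1)"
    using cl unfolding X.carrier_homology by blast
  interpret Yn: gmodule G "obj Y n" by (rule Y.Xs)
  note p1 = ghom_closed[OF gchain_mapD(1)[OF \<theta>(1)] x(2)] and p2 = ghom_closed[OF gchain_mapD(1)[OF \<theta>(2)] x(2)]
  have kn: "k (n - 1) \<in> ghom G (obj X (n - 1)) (obj Y n)" using k(1)[of "n - 1"] by simp
  have "coinv_class G Y n (\<theta>1 n x) = coinv_class G Y n (\<theta>2 n x)"
  proof (rule Y.class_eqI[OF p1 p2])
    show "k n x \<in> carrier (obj Y (n + 1))" by (rule ghom_closed[OF k(1) x(2)])
    \<comment> \<open>The element x is a cycle only after passing to coinvariants; equivariance of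
      the homotopy puts this term into \<open>coinv_sub\<close>.\<close>
    show "k (n - 1) (bd X n x) \<in> Y.L n"
      using ghom_coinv_sub[OF X.Xs(1) Y.Xs(1) kn] x(3) by auto
    have "\<theta>1 n x = \<theta>2 n x \<otimes>\<^bsub>obj Y n\<^esub> \<theta> n x"
      using p1 p2 by (simp add: \<theta>_def Yn.M.m_lcomm[of "\<theta>2 n x"])
    thus "\<theta>1 n x = \<theta>2 n x \<otimes>\<^bsub>obj Y n\<^esub> (bd Y (n + 1) (k n x) \<otimes>\<^bsub>obj Y n\<^esub> k (n - 1) (bd X n x))"
      using k(2)[OF x(2)] by simp
  qed
  thus ?thesis using x coinv_homology_map_class[OF Xc Yc] \<theta> by simp
qed

lemma comparison_comp:
  assumes 1: "comparison G P \<epsilon> X \<kappa> Q \<epsilon>' Y \<kappa>' \<phi> \<theta>" and 2: "comparison G Q \<epsilon>' Y \<kappa>' R \<epsilon>'' Z \<kappa>'' \<phi>' \<theta>'"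
    and \<kappa>: "gchain_map G X P \<kappa>"
  shows "comparison G P \<epsilon> X \<kappa> R \<epsilon>'' Z \<kappa>'' (\<lambda>n x. \<phi>' n (\<phi> n x)) (\<lambda>n x. \<theta>' n (\<theta> n x))"
proof -
  obtain N1 where N1: "\<And>n x. n \<ge> N1 \<Longrightarrow> x \<in> carrier (obj X n) \<Longrightarrow> \<kappa>' n (\<theta> n x) = \<phi> n (\<kappa> n x)"
    using 1 unfolding comparison_def by blast
  obtain N2 where N2: "\<And>n x. n \<ge> N2 \<Longrightarrow> x \<in> carrier (obj Y n) \<Longrightarrow> \<kappa>'' n (\<theta>' n x) = \<phi>' n (\<kappa>' n x)"
    using 2 unfolding comparison_def by blast
  have c: "gchain_map G P Q \<phi>" "gchain_map G X Y \<theta>" "gchain_map G Q R \<phi>'" "gchain_map G Y Z \<theta>'"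
    using 1 2 by (auto simp: comparison_def)
  have "\<forall>n\<ge>max N1 N2. \<forall>x\<in>carrier (obj X n). \<kappa>'' n (\<theta>' n (\<theta> n x)) = \<phi>' n (\<phi> n (\<kappa> n x))"
    using N1 N2 ghom_closed[OF gchain_mapD(1)[OF c(2)]] by simp
  moreover have "\<forall>n. \<forall>x\<in>carrier (obj P n). \<epsilon>'' n (\<phi>' n (\<phi> n x)) = \<epsilon> n x"
    using 1 2 ghom_closed[OF gchain_mapD(1)[OF c(1)]] by (simp add: comparison_def)
  ultimately show ?thesis
    unfolding comparison_def using gchain_map_comp[OF c(1,3)] gchain_map_comp[OF c(2,4)] by blast
qed

lemma comparison_id: "comparison G P \<epsilon> X \<kappa> P \<epsilon> X \<kappa> (\<lambda>n x. x) (\<lambda>n x. x)"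
  by (simp add: comparison_def gchain_map_id)

text \<open>The composite and the identity are both comparisons of a completed resolution with
  itself, so they agree on homology by uniqueness.\<close>

lemma comparison_homology_inverse:
  assumes 1: "completed_resolution G M P \<epsilon> X \<kappa>" and 2: "completed_resolution G M Q \<epsilon>' Y \<kappa>'"
    and c1: "comparison G P \<epsilon> X \<kappa> Q \<epsilon>' Y \<kappa>' \<phi> \<theta>" and c2: "comparison G Q \<epsilon>' Y \<kappa>' P \<epsilon> X \<kappa> \<phi>' \<theta>'"
    and cl: "cl \<in> carrier (coinv_homology G X n)"
  shows "coinv_homology_map G X \<theta>' n (coinv_homology_map G Y \<theta> n cl) = cl"
proof -
  have Xc: "is_gcomplex G X" and Yc: "is_gcomplex G Y" and \<kappa>: "gchain_map G X P \<kappa>"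
    using 1 2 by (auto simp: completed_resolution_def completion_def)
  have \<theta>: "gchain_map G X Y \<theta>" "gchain_map G Y X \<theta>'" using c1 c2 by (auto simp: comparison_def)
  interpret X: gcomplex G X by unfold_locales fact
  obtain x where x: "cl = coinv_class G X n x" "x \<in> carrier (obj X n)"
    using cl unfolding X.carrier_homology by blast
  have "coinv_homology_map G X \<theta>' n (coinv_homology_map G Y \<theta> n cl) = coinv_homology_map G X (\<lambda>n x. \<theta>' n (\<theta> n x)) n cl"
    by (rule coinv_homology_map_comp[OF Xc Yc Xc \<theta> cl])
  also have "\<dots> = coinv_homology_map G X (\<lambda>n x. x) n cl"
    by (rule comparison_homology_unique[OF 1 1 comparison_comp[OF c1 c2 \<kappa>] comparison_id cl])
  also have "\<dots> = cl" using x coinv_homology_map_class[OF Xc Xc gchain_map_id] by simp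
  finally show ?thesis .
qed

lemma comparison_homology_iso:
  assumes 1: "completed_resolution G M P \<epsilon> X \<kappa>" and 2: "completed_resolution G M Q \<epsilon>' Y \<kappa>'"
    and c1: "comparison G P \<epsilon> X \<kappa> Q \<epsilon>' Y \<kappa>' \<phi> \<theta>"
  shows "coinv_homology_map G Y \<theta> n \<in> iso (coinv_homology G X n) (coinv_homology G Y n)"
proof -
  have Xc: "is_gcomplex G X" and Yc: "is_gcomplex G Y"
    using 1 2 by (auto simp: completed_resolution_def completion_def)
  obtain \<phi>' \<theta>' where c2: "comparison G Q \<epsilon>' Y \<kappa>' P \<epsilon> X \<kappa> \<phi>' \<theta>'" using comparison_exists[OF 2 1] by blast
  have \<theta>: "gchain_map G X Y \<theta>" "gchain_map G Y X \<theta>'" using c1 c2 by (auto simp: comparison_def)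
  note h1 = coinv_homology_map_hom[OF Xc Yc \<theta>(1), of n] and h2 = coinv_homology_map_hom[OF Yc Xc \<theta>(2), of n]
  have "bij_betw (coinv_homology_map G Y \<theta> n) (carrier (coinv_homology G X n)) (carrier (coinv_homology G Y n))"
    by (rule bij_betwI[where g = "coinv_homology_map G X \<theta>' n"])
      (use h1 h2 comparison_homology_inverse[OF 1 2 c1 c2] comparison_homology_inverse[OF 2 1 c2 c1] in \<open>auto simp: hom_def\<close>)
  thus ?thesis using h1 by (simp add: iso_def)
qed

end

section \<open>Surjective chain maps with acyclic kernel\<close>

lemma comm_group_imp_comm_group_subgroup:
  assumes "comm_group A" "subgroup K A"
  shows "comm_group (A\<lparr>carrier := K\<rparr>)"
proof -
  interpret A: comm_group A by fact
  interpret K: group "A\<lparr>carrier := K\<rparr>" by (rule A.subgroup_imp_group[OF assms(2)])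
  show ?thesis
    by (rule K.group_comm_groupI) (use subgroup.mem_carrier[OF assms(2)] A.m_comm in auto)
qed

text \<open>This is what the long exact homology sequence gives for an acyclic kernel, proved by
  direct chasing: cycles of C map onto the homology of C', and the kernel of that map is exactly the
  boundaries.\<close>

lemma chain_homology_iso_of_acyclic_kernel:
  fixes C :: "int \<Rightarrow> ('a, 'm) monoid_scheme" and C' :: "int \<Rightarrow> ('b, 'k) monoid_scheme"
  assumes C: "\<And>n. comm_group (C n)" and C': "\<And>n. comm_group (C' n)"
    and d: "\<And>n. d n \<in> hom (C n) (C (n - 1))" and d': "\<And>n. d' n \<in> hom (C' n) (C' (n - 1))"
    and dd: "\<And>n x. x \<in> carrier (C n) \<Longrightarrow> d (n - 1) (d n x) = \<one>\<^bsub>C (n - 2)\<^esub>"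
    and dd': "\<And>n x. x \<in> carrier (C' n) \<Longrightarrow> d' (n - 1) (d' n x) = \<one>\<^bsub>C' (n - 2)\<^esub>"
    and h: "\<And>n. h n \<in> hom (C n) (C' n)"
    and hd: "\<And>n x. x \<in> carrier (C n) \<Longrightarrow> h (n - 1) (d n x) = d' n (h n x)"
    and surj: "\<And>n. h n ` carrier (C n) = carrier (C' n)"
    and acyclic: "\<And>n x. \<lbrakk>x \<in> carrier (C n); d n x = \<one>\<^bsub>C (n - 1)\<^esub>; h n x = \<one>\<^bsub>C' n\<^esub>\<rbrakk>
      \<Longrightarrow> \<exists>y\<in>carrier (C (n + 1)). d (n + 1) y = x \<and> h (n + 1) y = \<one>\<^bsub>C' (n + 1)\<^esub>"
  shows "chain_homology C d n \<cong> chain_homology C' d' n"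
proof -
  have Cg: "group (C n)" and Cg': "group (C' n)" for n using C C' by (auto simp: comm_group_def)
  have dg: "group_hom (C n) (C (n - 1)) (d n)" and dg': "group_hom (C' n) (C' (n - 1)) (d' n)"
    and hg: "group_hom (C n) (C' n) (h n)" for n
    using Cg Cg' d d' h by (auto simp: group_hom_def group_hom_axioms_def)
  have dg1: "group_hom (C (n + 1)) (C n) (d (n + 1))" and dg1': "group_hom (C' (n + 1)) (C' n) (d' (n + 1))" for n
    using dg[of "n + 1"] dg'[of "n + 1"] by auto
  interpret dn: group_hom "C n" "C (n - 1)" "d n" by (rule dg)
  interpret dn': group_hom "C' n" "C' (n - 1)" "d' n" by (rule dg')
  interpret d1: group_hom "C (n + 1)" "C n" "d (n + 1)" by (rule dg1)
  interpret d1': group_hom "C' (n + 1)" "C' n" "d' (n + 1)" by (rule dg1')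
  interpret hn: group_hom "C n" "C' n" "h n" by (rule hg)
  interpret h1: group_hom "C (n + 1)" "C' (n + 1)" "h (n + 1)" by (rule hg)
  define Z where "Z = kernel (C n) (C (n - 1)) (d n)"
  define Z' where "Z' = kernel (C' n) (C' (n - 1)) (d' n)"
  have Z: "subgroup Z (C n)" and Z': "subgroup Z' (C' n)"
    unfolding Z_def Z'_def by (rule dn.subgroup_kernel, rule dn'.subgroup_kernel)
  let ?B = "boundaries C d n" and ?B' = "boundaries C' d' n"
  let ?G = "(C n)\<lparr>carrier := Z\<rparr>" and ?G' = "(C' n)\<lparr>carrier := Z'\<rparr>"
  have B': "subgroup ?B' (C' n)" unfolding boundaries_def by (rule d1'.img_is_subgroup)
  have B'Z: "?B' \<subseteq> Z'"
    unfolding boundaries_def Z'_def kernel_def using dd'[of _ "n + 1"] by auto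
  have sB': "subgroup ?B' ?G'" by (rule dn'.G.subgroup_incl[OF B' Z' B'Z])
  interpret G: comm_group ?G by (rule comm_group_imp_comm_group_subgroup[OF C Z])
  interpret G': comm_group ?G' by (rule comm_group_imp_comm_group_subgroup[OF C' Z'])
  interpret nB: normal ?B' ?G' by (rule G'.subgroup_imp_normal[OF sB'])
  have hZ: "h n z \<in> Z'" if "z \<in> Z" for z
    using that hd[of z n] group_hom.hom_one[OF hg[of "n - 1"]] by (auto simp: Z_def Z'_def kernel_def)
  define q where "q z = ?B' #>\<^bsub>C' n\<^esub> h n z" for z
  have hh: "h n \<in> hom ?G ?G'"
    using hZ subgroup.mem_carrier[OF Z] by (auto intro!: homI)
  have "(\<lambda>a. ?B' #>\<^bsub>?G'\<^esub> a) \<in> hom ?G' (?G' Mod ?B')" by (rule nB.r_coset_hom_Mod)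
  hence "(\<lambda>a. ?B' #>\<^bsub>?G'\<^esub> a) \<circ> h n \<in> hom ?G (?G' Mod ?B')" by (rule Group.hom_compose[OF hh])
  moreover have "(\<lambda>a. ?B' #>\<^bsub>?G'\<^esub> a) \<circ> h n = q" by (simp add: fun_eq_iff q_def r_coset_def)
  ultimately have qh: "q \<in> hom ?G (?G' Mod ?B')" by simp
  interpret q: group_hom ?G "?G' Mod ?B'" q
    by (rule group_hom.intro[OF G.is_group nB.factorgroup_is_group group_hom_axioms.intro[OF qh]])
  have "q ` carrier ?G = carrier (?G' Mod ?B')"
  proof
    show "q ` carrier ?G \<subseteq> carrier (?G' Mod ?B')" using qh by (auto simp: hom_def)
    show "carrier (?G' Mod ?B') \<subseteq> q ` carrier ?G"
    proof
      fix c assume "c \<in> carrier (?G' Mod ?B')"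
      then obtain z' where z': "z' \<in> Z'" "c = ?B' #>\<^bsub>C' n\<^esub> z'"
        by (auto simp: FactGroup_def RCOSETS_def r_coset_def)
      then obtain x where x: "x \<in> carrier (C n)" "h n x = z'"
        using surj[of n] unfolding Z'_def kernel_def by (metis (mono_tags, lifting) imageE mem_Collect_eq)
      \<comment> \<open>The lift x of a cycle need not be a cycle, but its boundary is a cycle of
        the kernel complex and so bounds some y there; x minus y is a cycle with the same
        image.\<close>
      have hd1: "h (n - 1) (d n x) = \<one>\<^bsub>C' (n - 1)\<^esub>" using hd[OF x(1)] x(2) z'(1) by (simp add: Z'_def kernel_def)
      have "d (n - 1) (d n x) = \<one>\<^bsub>C (n - 1 - 1)\<^esub>" using dd[OF x(1)] by simp
      then obtain y where y: "y \<in> carrier (C n)" "d n y = d n x" "h n y = \<one>\<^bsub>C' n\<^esub>"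
        using acyclic[OF hom_in_carrier[OF d x(1)] _ hd1] by auto
      have "x \<otimes>\<^bsub>C n\<^esub> inv\<^bsub>C n\<^esub> y \<in> Z" using x y by (simp add: Z_def kernel_def)
      moreover have "h n (x \<otimes>\<^bsub>C n\<^esub> inv\<^bsub>C n\<^esub> y) = z'" using x y hn.hom_closed[OF x(1)] by simp
      ultimately show "c \<in> q ` carrier ?G" using z' by (intro image_eqI[of _ _ "x \<otimes>\<^bsub>C n\<^esub> inv\<^bsub>C n\<^esub> y"]) (auto simp: q_def)
    qed
  qed
  hence iso: "?G Mod (kernel ?G (?G' Mod ?B') q) \<cong> ?G' Mod ?B'" by (rule q.FactGroup_iso)
  have "kernel ?G (?G' Mod ?B') q = ?B"
  proof
    show "kernel ?G (?G' Mod ?B') q \<subseteq> ?B"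
    proof
      fix z assume "z \<in> kernel ?G (?G' Mod ?B') q"
      hence z: "z \<in> carrier (C n)" "d n z = \<one>\<^bsub>C (n - 1)\<^esub>" "?B' #>\<^bsub>C' n\<^esub> h n z = ?B'"
        by (auto simp: kernel_def q_def FactGroup_def Z_def)
      have "h n z \<in> ?B'" using dn'.G.rcos_self[OF _ B', of "h n z"] z by auto
      then obtain y' where y': "y' \<in> carrier (C' (n + 1))" "h n z = d' (n + 1) y'" by (auto simp: boundaries_def)
      then obtain y where y: "y \<in> carrier (C (n + 1))" "h (n + 1) y = y'" using surj[of "n + 1"] by (metis imageE)
      have hy: "h n (d (n + 1) y) = h n z" using hd[OF y(1)] y y' by simp
      have ddy: "d n (d (n + 1) y) = \<one>\<^bsub>C (n - 1)\<^esub>" using dd[OF y(1)] by simp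
      \<comment> \<open>After subtracting the boundary of a lift of y', the cycle z lies in the
        kernel complex and therefore bounds.\<close>
      let ?w = "z \<otimes>\<^bsub>C n\<^esub> inv\<^bsub>C n\<^esub> (d (n + 1) y)"
      have "?w \<in> carrier (C n)" "d n ?w = \<one>\<^bsub>C (n - 1)\<^esub>" "h n ?w = \<one>\<^bsub>C' n\<^esub>"
        using z y ddy hy by simp_all
      then obtain k where k: "k \<in> carrier (C (n + 1))" "d (n + 1) k = ?w" using acyclic by blast
      have "d (n + 1) (k \<otimes>\<^bsub>C (n + 1)\<^esub> y) = z" using k y z by (simp add: dn.G.m_assoc)
      moreover have "k \<otimes>\<^bsub>C (n + 1)\<^esub> y \<in> carrier (C (n + 1))" using k y by simp
      ultimately show "z \<in> ?B" unfolding boundaries_def by blast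
    qed
    show "?B \<subseteq> kernel ?G (?G' Mod ?B') q"
    proof
      fix z assume "z \<in> ?B"
      then obtain y where y: "y \<in> carrier (C (n + 1))" "z = d (n + 1) y" by (auto simp: boundaries_def)
      have "z \<in> Z" using dd[OF y(1)] y by (simp add: Z_def kernel_def)
      moreover have "h n z \<in> ?B'" using hd[OF y(1)] y unfolding boundaries_def by auto
      hence "?B' #>\<^bsub>C' n\<^esub> h n z = ?B'"
        using subgroup.mem_carrier[OF B'] by (intro dn'.H.coset_join2 dn'.G.coset_join2 B') auto
      ultimately show "z \<in> kernel ?G (?G' Mod ?B') q" by (simp add: kernel_def q_def FactGroup_def)
    qed
  qed
  thus ?thesis using iso by (simp add: chain_homology_def Z_def Z'_def)
qed

section \<open>Koszul complexes over the Tate complex\<close>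

text \<open>For operators \<open>r p\<close> commuting with each other and with an involution \<open>\<gamma>\<close>, this is the
  differential of the total complex of the Tate complex of \<open>\<gamma>\<close> and the Koszul complex of the
  operators \<open>r p\<close>.  A bit list selects a subset of \<open>ps\<close>; the component of a chain of degree \<open>n\<close> at a
  subset of size \<open>k\<close> lies in Tate degree \<open>n - k\<close>.\<close>

definition tate_bd :: "('v \<Rightarrow> 'v) \<Rightarrow> int \<Rightarrow> 'v \<Rightarrow> 'v::ab_group_add" where
  "tate_bd \<gamma> n v = (if even n then v + \<gamma> v else v - \<gamma> v)"

fun koszul_bd :: "('v \<Rightarrow> 'v) \<Rightarrow> (nat \<Rightarrow> 'v \<Rightarrow> 'v) \<Rightarrow> nat list \<Rightarrow> int \<Rightarrow> (bool list \<Rightarrow> 'v) \<Rightarrow> bool list \<Rightarrow> 'v::ab_group_add" where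
  "koszul_bd \<gamma> r [] n x [] = tate_bd \<gamma> n (x [])"
| "koszul_bd \<gamma> r (p # ps) n x (False # b) = koszul_bd \<gamma> r ps n (\<lambda>b. x (False # b)) b + r p (x (True # b))"
| "koszul_bd \<gamma> r (p # ps) n x (True # b) = - koszul_bd \<gamma> r ps (n - 1) (\<lambda>b. x (True # b)) b"
| "koszul_bd \<gamma> r _ n x _ = 0"

text \<open>A g is the coefficient group at level g, and the component at a subset with product q
  lies in A (g * q). This is forced by operators \<open>r p\<close> that are defined only from level
  g * p to level g. Components at lists of the wrong length are zero, so that a chain is determined
  by its relevant components.\<close>

fun koszul_chains :: "(nat \<Rightarrow> 'v set) \<Rightarrow> nat list \<Rightarrow> nat \<Rightarrow> (bool list \<Rightarrow> 'v::ab_group_add) set" where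
  "koszul_chains A [] g = {x. x [] \<in> A g \<and> (\<forall>b. b \<noteq> [] \<longrightarrow> x b = 0)}"
| "koszul_chains A (p # ps) g = {x. x [] = 0 \<and> (\<lambda>b. x (False # b)) \<in> koszul_chains A ps g \<and> (\<lambda>b. x (True # b)) \<in> koszul_chains A ps (g * p)}"

definition chain_cons :: "(bool list \<Rightarrow> 'v) \<Rightarrow> (bool list \<Rightarrow> 'v) \<Rightarrow> bool list \<Rightarrow> 'v::zero" where
  "chain_cons x0 x1 b = (case b of [] \<Rightarrow> 0 | c # b \<Rightarrow> if c then x1 b else x0 b)"

lemma chain_cons_simps [simp]: "chain_cons x0 x1 [] = 0" "chain_cons x0 x1 (False # b) = x0 b"
  "chain_cons x0 x1 (True # b) = x1 b"
  by (simp_all add: chain_cons_def)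

lemma all_bits: "(\<forall>b. P b) \<longleftrightarrow> P [] \<and> (\<forall>b. P (False # b)) \<and> (\<forall>b. P (True # b))"
  for P :: "bool list \<Rightarrow> bool"
proof (intro iffI conjI allI; (elim conjE)?)
  fix b assume "P []" "\<forall>b. P (False # b)" "\<forall>b. P (True # b)"
  thus "P b" by (cases b; cases "hd b") auto
qed auto

lemma bits_eqI:
  assumes "x [] = y []" "\<And>b. x (False # b) = y (False # b)" "\<And>b. x (True # b) = y (True # b)"
  shows "x = y"
proof
  fix b :: "bool list"
  show "x b = y b" using assms by (cases b; cases "hd b") auto
qed

locale koszul =
  fixes \<gamma> :: "'v \<Rightarrow> 'v::ab_group_add" and r :: "nat \<Rightarrow> 'v \<Rightarrow> 'v"
  assumes \<gamma>_add: "\<gamma> (x + y) = \<gamma> x + \<gamma> y" and r_add: "r p (x + y) = r p x + r p y"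
    and \<gamma>\<gamma>: "\<gamma> (\<gamma> x) = x" and r_\<gamma>: "r p (\<gamma> x) = \<gamma> (r p x)" and rr: "r p (r q x) = r q (r p x)"
begin

abbreviation "D \<equiv> koszul_bd \<gamma> r"

lemma \<gamma>_0 [simp]: "\<gamma> 0 = 0" using \<gamma>_add[of 0 0] by simp
lemma r_0 [simp]: "r p 0 = 0" using r_add[of p 0 0] by simp
lemma \<gamma>_minus [simp]: "\<gamma> (- x) = - \<gamma> x" using \<gamma>_add[of x "- x"] by (simp add: eq_neg_iff_add_eq_0 add.commute)
lemma r_minus [simp]: "r p (- x) = - r p x" using r_add[of p x "- x"] by (simp add: eq_neg_iff_add_eq_0 add.commute)
lemma \<gamma>_diff: "\<gamma> (x - y) = \<gamma> x - \<gamma> y" using \<gamma>_add[of x "- y"] by simp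
lemma r_diff: "r p (x - y) = r p x - r p y" using r_add[of p x "- y"] by simp

lemma D_add: "D ps n (\<lambda>b. x b + y b) b = D ps n x b + D ps n y b"
proof (induction ps arbitrary: n x y b)
  case Nil
  then show ?case by (cases b) (auto simp: tate_bd_def \<gamma>_add algebra_simps)
next
  case (Cons p ps)
  then show ?case
    by (cases b; cases "hd b") (auto simp: r_add algebra_simps)
qed

lemma D_0 [simp]: "D ps n (\<lambda>b. 0) b = 0"
  using D_add[of ps n "\<lambda>b. 0" "\<lambda>b. 0" b] by simp

lemma D_minus: "D ps n (\<lambda>b. - x b) b = - D ps n x b"
  using D_add[of ps n x "\<lambda>b. - x b" b] by (simp add: eq_neg_iff_add_eq_0 add.commute)

lemma D_diff: "D ps n (\<lambda>b. x b - y b) b = D ps n x b - D ps n y b"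
  using D_add[of ps n x "\<lambda>b. - y b" b] by (simp add: D_minus)

lemma D_r: "D ps n (\<lambda>b. r q (x b)) b = r q (D ps n x b)"
proof (induction ps arbitrary: n x b)
  case Nil
  then show ?case by (cases b) (auto simp: tate_bd_def r_add r_diff r_\<gamma>)
next
  case (Cons p ps)
  then show ?case
    by (cases b; cases "hd b") (auto simp: r_add rr)
qed

lemma DD: "D ps (n - 1) (D ps n x) b = 0"
proof (induction ps arbitrary: n x b)
  case Nil
  then show ?case by (cases b) (auto simp: tate_bd_def \<gamma>_add \<gamma>_diff \<gamma>\<gamma>)
next
  case (Cons p ps)
  have "D ps (n - 1) (\<lambda>b. D ps n (\<lambda>b. x (False # b)) b + r p (x (True # b))) b
     = r p (D ps (n - 1) (\<lambda>b. x (True # b)) b)" for b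
    by (simp add: D_add Cons.IH[of n] D_r)
  moreover have "D ps (n - 1 - 1) (\<lambda>b. - D ps (n - 1) (\<lambda>b. x (True # b)) b) b = 0" for b
    using Cons.IH[of "n - 1"] by (simp add: D_minus)
  ultimately show ?case by (cases b; cases "hd b") auto
qed

lemma DD1: "D ps n (D ps (n + 1) x) b = 0"
  using DD[of ps "n + 1"] by simp

end

locale koszul_levels = koszul \<gamma> r for \<gamma> :: "'v \<Rightarrow> 'v::ab_group_add" and r +
  fixes A :: "nat \<Rightarrow> 'v set" and R :: "nat set"
  assumes A_0: "0 \<in> A g" and A_add: "x \<in> A g \<Longrightarrow> y \<in> A g \<Longrightarrow> x + y \<in> A g" and A_minus: "x \<in> A g \<Longrightarrow> - x \<in> A g"
    and A_\<gamma>: "x \<in> A g \<Longrightarrow> \<gamma> x \<in> A g"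
    and A_r: "p \<in> R \<Longrightarrow> x \<in> A (g * p) \<Longrightarrow> r p x \<in> A g"
begin

lemma A_diff: "x \<in> A g \<Longrightarrow> y \<in> A g \<Longrightarrow> x - y \<in> A g"
  using A_add[of x g "- y"] A_minus by simp

lemma chains_0: "(\<lambda>b. 0) \<in> koszul_chains A ps g"
  by (induction ps arbitrary: g) (auto simp: A_0)

lemma chains_add: "x \<in> koszul_chains A ps g \<Longrightarrow> y \<in> koszul_chains A ps g \<Longrightarrow> (\<lambda>b. x b + y b) \<in> koszul_chains A ps g"
  by (induction ps arbitrary: g x y) (auto simp: A_add)

lemma chains_minus: "x \<in> koszul_chains A ps g \<Longrightarrow> (\<lambda>b. - x b) \<in> koszul_chains A ps g"
  by (induction ps arbitrary: g x) (auto simp: A_minus)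

lemma chains_diff: "x \<in> koszul_chains A ps g \<Longrightarrow> y \<in> koszul_chains A ps g \<Longrightarrow> (\<lambda>b. x b - y b) \<in> koszul_chains A ps g"
  using chains_add[of x ps g "\<lambda>b. - y b"] chains_minus by simp

lemma chains_r: "p \<in> R \<Longrightarrow> x \<in> koszul_chains A ps (g * p) \<Longrightarrow> (\<lambda>b. r p (x b)) \<in> koszul_chains A ps g"
proof (induction ps arbitrary: g x)
  case (Cons q ps)
  have "g * p * q = g * q * p" by simp
  with Cons show ?case by auto
qed (auto simp: A_r)

lemma chains_D: "set ps \<subseteq> R \<Longrightarrow> x \<in> koszul_chains A ps g \<Longrightarrow> D ps n x \<in> koszul_chains A ps g"
proof (induction ps arbitrary: g x n)
  case Nil
  then show ?case by (auto simp: tate_bd_def A_add A_diff A_\<gamma> neq_Nil_conv)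
next
  case (Cons p ps)
  have "(\<lambda>b. D ps n (\<lambda>b. x (False # b)) b + r p (x (True # b))) \<in> koszul_chains A ps g"
    using Cons.prems Cons.IH by (intro chains_add chains_r) auto
  moreover have "(\<lambda>b. - D ps (n - 1) (\<lambda>b. x (True # b)) b) \<in> koszul_chains A ps (g * p)"
    using Cons.prems Cons.IH by (intro chains_minus) auto
  ultimately show ?case by simp
qed

definition acyclic :: "nat list \<Rightarrow> nat \<Rightarrow> bool" where
  "acyclic ps g \<longleftrightarrow> (\<forall>n. \<forall>x\<in>koszul_chains A ps g. (\<forall>b. D ps n x b = 0) \<longrightarrow> (\<exists>z\<in>koszul_chains A ps g. D ps (n + 1) z = x))"

text \<open>The complex for p # ps is the mapping cone of \<open>r p\<close>, from the complex at
  level g * p to the one at level g; a cone of acyclic complexes is acyclic.\<close>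

lemma acyclic_Cons:
  assumes "acyclic ps g" "acyclic ps (g * p)" "p \<in> R"
  shows "acyclic (p # ps) g"
  unfolding acyclic_def
proof (intro allI ballI impI)
  fix n x assume x: "x \<in> koszul_chains A (p # ps) g" and Dx: "\<forall>b. D (p # ps) n x b = 0"
  define x0 where "x0 = (\<lambda>b. x (False # b))"
  define x1 where "x1 = (\<lambda>b. x (True # b))"
  have c: "x0 \<in> koszul_chains A ps g" "x1 \<in> koszul_chains A ps (g * p)" "x [] = 0" using x by (auto simp: x0_def x1_def)
  have D0: "D ps n x0 b + r p (x1 b) = 0" and D1: "D ps (n - 1) x1 b = 0" for b
    using Dx[rule_format, of "False # b"] Dx[rule_format, of "True # b"] by (simp_all add: x0_def x1_def)
  obtain z1 where z1: "z1 \<in> koszul_chains A ps (g * p)" "D ps n z1 = x1"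
    using assms(2) c(2) D1 unfolding acyclic_def by (metis diff_add_cancel)
  have "D ps n (\<lambda>b. x0 b + r p (z1 b)) b = 0" for b
    using D0 by (simp add: D_add D_r z1(2))
  moreover have "(\<lambda>b. x0 b + r p (z1 b)) \<in> koszul_chains A ps g"
    using c z1 assms(3) by (intro chains_add chains_r)
  ultimately obtain z0 where z0: "z0 \<in> koszul_chains A ps g" "D ps (n + 1) z0 = (\<lambda>b. x0 b + r p (z1 b))"
    using assms(1) unfolding acyclic_def by blast
  show "\<exists>z\<in>koszul_chains A (p # ps) g. D (p # ps) (n + 1) z = x"
  proof
    show "chain_cons z0 (\<lambda>b. - z1 b) \<in> koszul_chains A (p # ps) g" using z0 z1 by (simp add: chains_minus)
    show "D (p # ps) (n + 1) (chain_cons z0 (\<lambda>b. - z1 b)) = x"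
      by (rule bits_eqI) (simp_all add: c z0 z1 D_minus, simp_all add: x0_def x1_def)
  qed
qed

definition chain_group :: "nat list \<Rightarrow> nat \<Rightarrow> (bool list \<Rightarrow> 'v) monoid" where
  "chain_group ps g = \<lparr>carrier = koszul_chains A ps g, monoid.mult = (\<lambda>x y b. x b + y b), one = (\<lambda>b. 0)\<rparr>"

lemma chain_group_simps [simp]: "carrier (chain_group ps g) = koszul_chains A ps g"
  "x \<otimes>\<^bsub>chain_group ps g\<^esub> y = (\<lambda>b. x b + y b)" "\<one>\<^bsub>chain_group ps g\<^esub> = (\<lambda>b. 0)"
  by (simp_all add: chain_group_def)

lemma comm_group_chain_group: "comm_group (chain_group ps g)"
proof (rule comm_groupI)
  fix x assume "x \<in> carrier (chain_group ps g)"
  thus "\<exists>y\<in>carrier (chain_group ps g). y \<otimes>\<^bsub>chain_group ps g\<^esub> x = \<one>\<^bsub>chain_group ps g\<^esub>"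
    by (intro bexI[of _ "\<lambda>b. - x b"]) (auto simp: chains_minus)
qed (auto simp: chains_add chains_0 algebra_simps)

lemma D_hom: "set ps \<subseteq> R \<Longrightarrow> D ps n \<in> hom (chain_group ps g) (chain_group ps g)"
  by (intro homI) (auto simp: chains_D D_add fun_eq_iff)

end

text \<open>The map h is known to be additive only within a single level, while the differential
  adds terms from different components; \<open>in_A1\<close> supplies a common level for the two
  terms.\<close>

lemma koszul_bd_natural:
  assumes V: "x \<in> koszul_chains A ps g" "set ps \<subseteq> R" and k: "koszul_levels \<gamma> r A R" and k': "koszul \<gamma>' r'"
    and h_add: "\<And>g x y. x \<in> A g \<Longrightarrow> y \<in> A g \<Longrightarrow> h (x + y) = h x + h y"
    and h_\<gamma>: "\<And>g x. x \<in> A g \<Longrightarrow> h (\<gamma> x) = \<gamma>' (h x)"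
    and h_r: "\<And>g p x. p \<in> R \<Longrightarrow> x \<in> A (g * p) \<Longrightarrow> h (r p x) = r' p (h x)"
  shows "koszul_bd \<gamma>' r' ps n (\<lambda>b. h (x b)) b = h (koszul_bd \<gamma> r ps n x b)"
proof -
  interpret koszul_levels \<gamma> r A R by fact
  interpret K': koszul \<gamma>' r' by fact
  have h_0: "h 0 = 0" using h_add[OF A_0 A_0] by simp
  have h_minus: "h (- x) = - h x" if "x \<in> A g" for x g
    using h_add[OF that A_minus[OF that]] h_0 by (simp add: eq_neg_iff_add_eq_0 add.commute)
  have h_diff: "h (x - y) = h x - h y" if "x \<in> A g" "y \<in> A g" for x y g
    using h_add[OF that(1) A_minus[OF that(2)]] h_minus[OF that(2)] by simp
  have in_A: "\<exists>g. x b \<in> A g" if "x \<in> koszul_chains A ps g" for x ps g b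
    using that
  proof (induction ps arbitrary: x g b)
    case Nil
    then show ?case by (cases "b = []") (auto intro: A_0)
  next
    case (Cons p ps)
    show ?case
    proof (cases b)
      case Nil
      thus ?thesis using Cons.prems A_0 by auto
    next
      case b: (Cons c b')
      show ?thesis
        using Cons.IH[of "\<lambda>b. x (True # b)" "g * p" b'] Cons.IH[of "\<lambda>b. x (False # b)" g b'] Cons.prems b
        by (cases c) auto
    qed
  qed
  have in_A1: "\<exists>g'. x b \<in> A (g' * p)  \<and> y b \<in> A g'" if "x \<in> koszul_chains A ps (g * p)" "y \<in> koszul_chains A ps g" for x y ps g p b
    using that
  proof (induction ps arbitrary: x y g b)
    case Nil
    then show ?case by (cases "b = []") (auto intro: A_0)
  next
    case (Cons q ps)
    have e: "g * p * q = g * q * p" by simp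
    show ?case
    proof (cases b)
      case Nil
      thus ?thesis using Cons.prems A_0 by auto
    next
      case b: (Cons c b')
      show ?thesis
      proof (cases c)
        case True
        show ?thesis using Cons.IH[of "\<lambda>b. x (True # b)" "g * q" "\<lambda>b. y (True # b)" b'] Cons.prems b True by (simp add: e)
      next
        case False
        show ?thesis using Cons.IH[of "\<lambda>b. x (False # b)" g "\<lambda>b. y (False # b)" b'] Cons.prems b False by simp
      qed
    qed
  qed
  show ?thesis using V
  proof (induction ps arbitrary: n x b g)
    case Nil
    then show ?case by (cases b) (auto simp: tate_bd_def h_add A_\<gamma> h_diff h_\<gamma> h_0)
  next
    case (Cons p ps)
    show ?case
    proof (cases b)
      case Nil
      thus ?thesis by (simp add: h_0)
    next
      case b: (Cons c b')
      show ?thesis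
      proof (cases c)
        case True
        obtain g' where "D ps (n - 1) (\<lambda>b. x (True # b)) b' \<in> A g'"
          using in_A[OF chains_D[of ps "\<lambda>b. x (True # b)" "g * p" "n - 1"]] Cons.prems by auto
        thus ?thesis using Cons.IH[of "\<lambda>b. x (True # b)" "g * p" "n - 1" b'] Cons.prems b True by (simp add: h_minus)
      next
        case False
        obtain g' where g': "x (True # b') \<in> A (g' * p)" "D ps n (\<lambda>b. x (False # b)) b' \<in> A g'"
          using in_A1[of "\<lambda>b. x (True # b)" ps g p "D ps n (\<lambda>b. x (False # b))" b'] chains_D[of ps "\<lambda>b. x (False # b)" g n] Cons.prems by auto
        have "h (D ps n (\<lambda>b. x (False # b)) b' + r p (x (True # b'))) = h (D ps n (\<lambda>b. x (False # b)) b') + h (r p (x (True # b')))"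
          using g' Cons.prems by (intro h_add[of _ g']) (auto intro: A_r)
        also have "h (r p (x (True # b'))) = r' p (h (x (True # b')))" using g' Cons.prems by (intro h_r) auto
        finally show ?thesis using Cons.IH[of "\<lambda>b. x (False # b)" g n b'] Cons.prems b False by simp
      qed
    qed
  qed
qed

lemma chains_map:
  assumes "x \<in> koszul_chains A ps g" "\<And>g v. v \<in> A g \<Longrightarrow> h v \<in> A' g" "h 0 = 0"
  shows "(\<lambda>b. h (x b)) \<in> koszul_chains A' ps g"
  using assms(1) by (induction ps arbitrary: x g) (auto simp: assms(2,3))

section \<open>Leading digits modulo the prime powers dividing the level\<close>

text \<open>Let e be the multiplicity of p in f. The condition says that k modulo p^e, written with
  e digits in base p, has leading digit 1. Residues with the same product by p modulo f run through
  all leading digits, so each such fibre has exactly one member of this kind.\<close>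

definition digit_one :: "int \<Rightarrow> int \<Rightarrow> int \<Rightarrow> bool" where
  "digit_one f p k \<longleftrightarrow> p ^ (multiplicity p f - 1) \<le> k mod p ^ multiplicity p f \<and>
     k mod p ^ multiplicity p f < 2 * p ^ (multiplicity p f - 1)"

text \<open>A lexicographic order coded in one number: a larger gcd with f always lowers the weight,
  and at equal gcd the number of primes with leading digit one decides. The factor exceeds every
  such count by at least one.\<close>

definition digit_weight :: "int \<Rightarrow> int \<Rightarrow> nat" where
  "digit_weight f k = nat (f - gcd k f) * (card (prime_factors f) + 1) + card {q \<in> prime_factors f. digit_one f q k}"

lemma digit_one_cong: "[k = b] (mod p ^ multiplicity p f) \<Longrightarrow> digit_one f p k = digit_one f p b"
  by (simp add: digit_one_def cong_def)

context
  fixes f :: int assumes f: "f > 0"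
begin

lemma digit_one_cong': "[k = b] (mod f) \<Longrightarrow> digit_one f p k = digit_one f p b"
  by (rule digit_one_cong) (rule cong_dvd_modulus[OF _ multiplicity_dvd])

lemma digit_weight_cong: "[k = b] (mod f) \<Longrightarrow> digit_weight f k = digit_weight f b"
proof -
  assume kb: "[k = b] (mod f)"
  hence "gcd k f = gcd b f" by (rule cong_gcd_eq)
  moreover have "digit_one f q k = digit_one f q b" for q using digit_one_cong'[OF kb] .
  ultimately show ?thesis by (simp add: digit_weight_def)
qed

lemma prime_factor_decompose:
  assumes p: "p \<in> prime_factors f"
  obtains f' where "f = p * (p ^ (multiplicity p f - 1) * f')" "coprime (p ^ multiplicity p f) f'"
    "multiplicity p f > 0" "p > 1" "prime p" "f' > 0" "p ^ multiplicity p f = p * p ^ (multiplicity p f - 1)"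
proof -
  have pp: "prime p" and pd: "p dvd f" using p by (auto simp: in_prime_factors_iff)
  have p1: "p > 1" using prime_gt_1_int[OF pp] .
  have m: "multiplicity p f > 0" using prime_multiplicity_gt_zero_iff[OF prime_imp_prime_elem[OF pp], of f] pd f by simp
  obtain f' where f': "f = p ^ multiplicity p f * f'" "\<not> p dvd f'"
    using multiplicity_decompose'[of f p] f p1 by (metis less_irrefl not_prime_unit pp)
  have e: "p ^ multiplicity p f = p * p ^ (multiplicity p f - 1)"
    using m by (metis Suc_diff_1 power_Suc)
  have "coprime p f'" using prime_imp_coprime[OF pp f'(2)] .
  hence "coprime (p ^ multiplicity p f) f'" by (simp add: coprime_power_left_iff)
  moreover have "f = p * (p ^ (multiplicity p f - 1) * f')" using f'(1) e by (simp add: mult.assoc)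
  moreover have "f' > 0" using f'(1) f p1 by (metis zero_less_mult_pos zero_less_power order_less_trans zero_less_one)
  ultimately show thesis using that m p1 pp e by blast
qed

text \<open>A leading digit one prevents the full power of p in f from dividing b, so p still
  divides f / gcd b f. A leading digit zero would not ensure this.\<close>

lemma gcd_dvd_of_digit_one:
  assumes p: "p \<in> prime_factors f" and d: "digit_one f p b"
  shows "gcd b f dvd f div p" "p * gcd b f dvd f"
proof -
  obtain f' where f': "f = p * (p ^ (multiplicity p f - 1) * f')" "coprime (p ^ multiplicity p f) f'"
    "multiplicity p f > 0" "p > 1" "prime p" "f' > 0" "p ^ multiplicity p f = p * p ^ (multiplicity p f - 1)"
    by (rule prime_factor_decompose[OF p])
  have "b mod p ^ multiplicity p f \<ge> p ^ (multiplicity p f - 1)" using d by (simp add: digit_one_def)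
  hence "b mod p ^ multiplicity p f \<noteq> 0" using f'(4) by (metis not_one_le_zero int_one_le_iff_zero_less zero_less_power order_less_trans zero_less_one linorder_not_less)
  hence nd: "\<not> p ^ multiplicity p f dvd b" by auto
  obtain t where t: "f = gcd b f * t" by (meson dvdE gcd_dvd2)
  have "p dvd t"
  proof (rule ccontr)
    assume "\<not> p dvd t"
    hence "coprime p t" using prime_imp_coprime f'(5) by blast
    hence "coprime (p ^ multiplicity p f) t" by simp
    moreover have "p ^ multiplicity p f dvd gcd b f * t" using t multiplicity_dvd by metis
    ultimately have "p ^ multiplicity p f dvd gcd b f" by (simp add: coprime_dvd_mult_left_iff)
    thus False using nd by simp
  qed
  then obtain t' where "t = p * t'" ..
  hence ft: "f = p * (gcd b f * t')" using t by (simp add: ac_simps)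
  thus "p * gcd b f dvd f" by (metis dvd_def mult.assoc)
  have "f div p = gcd b f * t'" using ft f'(4) by (metis nonzero_mult_div_cancel_left not_one_less_zero)
  thus "gcd b f dvd f div p" by simp
qed

text \<open>Multiplication by p multiplies the gcd with f by at least p, since p * gcd b f still
  divides f.\<close>

lemma digit_weight_mult_less:
  assumes p: "p \<in> prime_factors f" and d: "digit_one f p b"
  shows "digit_weight f (p * b) < digit_weight f b"
proof -
  have "p * gcd b f dvd gcd (p * b) f" using gcd_dvd_of_digit_one(2)[OF assms] by simp
  moreover have "gcd (p * b) f > 0" using f by simp
  ultimately have "p * gcd b f \<le> gcd (p * b) f" by (rule zdvd_imp_le)
  moreover have "p > 1" using p by (auto simp: in_prime_factors_iff prime_gt_1_int)
  moreover have "gcd b f > 0" using f by simp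
  moreover have "gcd b f * 1 < gcd b f * p" using calculation by (intro mult_strict_left_mono) auto
  ultimately have "gcd b f < gcd (p * b) f" by (simp only: mult_1_right mult.commute[of "gcd b f" p])
  moreover have "gcd (p * b) f \<le> f" using f by (simp add: zdvd_imp_le)
  ultimately have "nat (f - gcd (p * b) f) + 1 \<le> nat (f - gcd b f)" by linarith
  hence "(nat (f - gcd (p * b) f) + 1) * (card (prime_factors f) + 1) \<le> nat (f - gcd b f) * (card (prime_factors f) + 1)"
    by (rule mult_le_mono1)
  moreover have "card {q \<in> prime_factors f. digit_one f q (p * b)} \<le> card (prime_factors f)"
    by (intro card_mono) auto
  ultimately show ?thesis unfolding digit_weight_def by simp
qed

text \<open>The other members k of the fibre through b differ from b by a multiple of f / p. Hence
  the gcd does not drop, the digits at primes other than p are unchanged, and the digit at p is no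
  longer one.\<close>

lemma digit_weight_less:
  assumes p: "p \<in> prime_factors f" and d: "digit_one f p b" and c: "[p * k = p * b] (mod f)" and n: "\<not> [k = b] (mod f)"
  shows "digit_weight f k < digit_weight f b"
proof -
  obtain f' where f': "f = p * (p ^ (multiplicity p f - 1) * f')" "coprime (p ^ multiplicity p f) f'"
    "multiplicity p f > 0" "p > 1" "prime p" "f' > 0" "p ^ multiplicity p f = p * p ^ (multiplicity p f - 1)"
    by (rule prime_factor_decompose[OF p])
  have fp: "f div p = p ^ (multiplicity p f - 1) * f'"
    using f'(1,4) by (metis nonzero_mult_div_cancel_left not_one_less_zero)
  have "f dvd p * (k - b)" using c by (simp add: cong_iff_dvd_diff algebra_simps)
  hence "p * (p ^ (multiplicity p f - 1) * f') dvd p * (k - b)" using f'(1) by simp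
  hence kb: "p ^ (multiplicity p f - 1) * f' dvd k - b" using f'(4) by (metis dvd_mult_cancel_left not_one_less_zero)
  have "gcd b f dvd k - b" using gcd_dvd_of_digit_one(1)[OF p d] kb fp by (metis dvd_trans)
  moreover have "gcd b f dvd b" by simp
  ultimately have "gcd b f dvd k" by (metis diff_add_cancel dvd_add)
  hence "gcd b f dvd gcd k f" by simp
  moreover have "gcd k f > 0" using f by simp
  ultimately have le: "gcd b f \<le> gcd k f" by (rule zdvd_imp_le)
  have gf: "gcd k f \<le> f" using f by (simp add: zdvd_imp_le)
  have fin: "finite {q \<in> prime_factors f. digit_one f q b}" by simp
  have same: "digit_one f q k = digit_one f q b" if q: "q \<in> prime_factors f" "q \<noteq> p" for q
  proof (rule digit_one_cong)
    have "coprime (q ^ multiplicity q f) p"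
      using q p primes_coprime[of q p] by (simp add: in_prime_factors_iff)
    moreover have "q ^ multiplicity q f dvd p * (p ^ (multiplicity p f - 1) * f')"
      using f'(1) multiplicity_dvd[of q f] by simp
    ultimately have "q ^ multiplicity q f dvd p ^ (multiplicity p f - 1) * f'"
      by (simp add: coprime_dvd_mult_right_iff)
    thus "[k = b] (mod q ^ multiplicity q f)" using kb by (meson cong_iff_dvd_diff dvd_trans)
  qed
  have nk: "\<not> digit_one f p k"
  proof
    assume dk: "digit_one f p k"
    let ?P = "p ^ (multiplicity p f - 1)" and ?E = "p ^ multiplicity p f"
    have "k mod ?P = b mod ?P" using dvd_mult_left[OF kb] by (simp add: mod_eq_dvd_iff)
    moreover have PE: "?P dvd ?E" using f'(7) by simp
    ultimately have "(k mod ?E) mod ?P = (b mod ?E) mod ?P" by (simp only: mod_mod_cancel[OF PE])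
    hence "?P dvd k mod ?E - b mod ?E" by (simp only: mod_eq_dvd_iff)
    \<comment> \<open>Both residues lie in the half-open interval from P to 2 P and agree modulo P,
      so they are equal.\<close>
    moreover have "\<bar>k mod ?E - b mod ?E\<bar> < ?P" using d dk by (auto simp: digit_one_def)
    ultimately have "k mod ?E - b mod ?E = 0" 
      using dvd_imp_le_int[of "k mod ?E - b mod ?E" ?P] by fastforce
    hence "?E dvd k - b" by (simp add: mod_eq_dvd_iff)
    moreover have "f' dvd k - b" using kb by (meson dvd_mult_right)
    ultimately have "?E * f' dvd k - b" using divides_mult[of ?E "k - b" f'] f'(2) by blast
    moreover have "?E * f' = f" using f'(1,7) by (simp add: mult.assoc)
    ultimately show False using n by (simp add: cong_iff_dvd_diff)
  qed
  have "{q \<in> prime_factors f. digit_one f q k} \<subset> {q \<in> prime_factors f. digit_one f q b}"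
  proof
    show "{q \<in> prime_factors f. digit_one f q k} \<subseteq> {q \<in> prime_factors f. digit_one f q b}"
      using same nk by auto
    show "{q \<in> prime_factors f. digit_one f q k} \<noteq> {q \<in> prime_factors f. digit_one f q b}"
      using nk d p by blast
  qed
  hence "card {q \<in> prime_factors f. digit_one f q k} < card {q \<in> prime_factors f. digit_one f q b}"
    by (rule psubset_card_mono[OF fin])
  moreover have "nat (f - gcd k f) * (card (prime_factors f) + 1) \<le> nat (f - gcd b f) * (card (prime_factors f) + 1)"
    using le by (intro mult_le_mono1) auto
  ultimately show ?thesis unfolding digit_weight_def by simp
qed

lemma digit_one_lift:
  assumes p: "p \<in> prime_factors f" and c: "p dvd c"
  obtains b where "[p * b = c] (mod f)" "digit_one f p b"
proof -
  obtain f' where f': "f = p * (p ^ (multiplicity p f - 1) * f')" "coprime (p ^ multiplicity p f) f'"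
    "multiplicity p f > 0" "p > 1" "prime p" "f' > 0" "p ^ multiplicity p f = p * p ^ (multiplicity p f - 1)"
    by (rule prime_factor_decompose[OF p])
  let ?P = "p ^ (multiplicity p f - 1)" and ?E = "p ^ multiplicity p f"
  obtain k where k: "c = p * k" using c ..
  obtain b where b: "[b = k mod ?P + ?P] (mod ?E)" "[b = k] (mod f')"
    using binary_chinese_remainder_int[OF f'(2)] by blast
  have P: "?P > 0" using f'(4) by simp
  have kP: "0 \<le> k mod ?P" "k mod ?P < ?P" using P by auto
  have "2 * ?P \<le> ?E" using f'(4,7) P by simp
  hence "(k mod ?P + ?P) mod ?E = k mod ?P + ?P" using kP by (intro mod_pos_pos_trivial) auto
  hence "b mod ?E = k mod ?P + ?P" using b(1) by (simp add: cong_def)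
  hence "digit_one f p b" using kP by (simp add: digit_one_def)
  moreover have "[p * b = c] (mod f)"
  proof -
    have "?P dvd ?E" using f'(7) by simp
    hence "[b = k mod ?P + ?P] (mod ?P)" using b(1) by (rule cong_dvd_modulus[rotated])
    hence "[b = k] (mod ?P)" by (simp add: cong_def)
    moreover have "coprime ?P f'" using f'(2,7) by (metis coprime_mult_left_iff)
    ultimately have "?P * f' dvd b - k" using divides_mult[of ?P "b - k" f'] b(2) by (simp add: cong_iff_dvd_diff)
    hence "p * (?P * f') dvd p * (b - k)" by simp
    thus ?thesis using f'(1) k by (simp add: cong_iff_dvd_diff algebra_simps)
  qed
  ultimately show thesis using that by blast
qed

text \<open>By the Chinese remainder theorem u can be 1 modulo the power of p and an inverse of p
  modulo the rest of f. Multiplying by u then cancels the effect of multiplication by p on the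
  digits at the other primes.\<close>

lemma unit_inverting_prime:
  assumes p: "p \<in> prime_factors f"
  obtains u v where "[u * v = 1] (mod f)"
    "\<And>q k. q \<in> prime_factors f \<Longrightarrow> q \<noteq> p \<Longrightarrow> digit_one f q (u * (p * k)) = digit_one f q k"
proof -
  obtain f' where f': "f = p * (p ^ (multiplicity p f - 1) * f')" "coprime (p ^ multiplicity p f) f'"
    "multiplicity p f > 0" "p > 1" "prime p" "f' > 0" "p ^ multiplicity p f = p * p ^ (multiplicity p f - 1)"
    by (rule prime_factor_decompose[OF p])
  have fe: "f = p ^ multiplicity p f * f'" using f'(1,7) by (simp add: mult.assoc)
  have "coprime p f'" using f'(2,7) by (metis coprime_mult_left_iff)
  then obtain w where w: "[p * w = 1] (mod f')" using cong_solve_coprime_int by blast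
  obtain u where u: "[u = 1] (mod p ^ multiplicity p f)" "[u = w] (mod f')"
    using binary_chinese_remainder_int[OF f'(2)] by blast
  have "[u * p = w * p] (mod f')" using u(2) cong_refl by (rule cong_mult)
  hence up: "[u * p = 1] (mod f')" using w by (metis cong_trans mult.commute)
  have "coprime u f'" using up by (metis cong_imp_coprime cong_sym coprime_1_left coprime_mult_left_iff)
  moreover have "coprime u (p ^ multiplicity p f)" using u(1) by (metis cong_imp_coprime cong_sym coprime_1_left)
  ultimately have "coprime u f" using fe by (metis coprime_mult_right_iff)
  then obtain v where v: "[u * v = 1] (mod f)" using cong_solve_coprime_int by blast
  have "digit_one f q (u * (p * k)) = digit_one f q k" if q: "q \<in> prime_factors f" "q \<noteq> p" for q k
  proof (rule digit_one_cong)
    have "coprime (q ^ multiplicity q f) (p ^ multiplicity p f)"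
      using q p primes_coprime[of q p] by (simp add: in_prime_factors_iff)
    moreover have "q ^ multiplicity q f dvd p ^ multiplicity p f * f'"
      using fe multiplicity_dvd[of q f] by simp
    ultimately have "q ^ multiplicity q f dvd f'"
      by (simp add: coprime_dvd_mult_right_iff)
    hence "[u * p = 1] (mod q ^ multiplicity q f)" using up by (rule cong_dvd_modulus[rotated])
    hence "[u * p * k = 1 * k] (mod q ^ multiplicity q f)" by (rule cong_mult) simp
    thus "[u * (p * k) = k] (mod q ^ multiplicity q f)" by (simp add: mult.assoc)
  qed
  thus thesis using that v by blast
qed

end

section \<open>Distribution relations as periodic functions\<close>

text \<open>A function x stands for the sum of \<open>x k\<close> times the symbol k / f over
  residues k; level g keeps the symbols lying in (g/f)Z, to which the relation at g applies.\<close>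

definition per_funs :: "int \<Rightarrow> nat \<Rightarrow> (int \<Rightarrow> int) set" where
  "per_funs f g = {x. (\<forall>k. x (k + f) = x k) \<and> (\<forall>k. x k \<noteq> 0 \<longrightarrow> int g dvd k)}"

definition refl_fun :: "(int \<Rightarrow> int) \<Rightarrow> int \<Rightarrow> int" where "refl_fun x k = x (- k)"

text \<open>The function k \<mapsto> \<open>x (p * k)\<close> spreads the value at a residue c over
  the fibre of c under multiplication by p. On the delta function of c this gives the distribution
  relation at p for the symbol c / f.\<close>

definition dist_rel :: "nat \<Rightarrow> (int \<Rightarrow> int) \<Rightarrow> int \<Rightarrow> int" where "dist_rel p x k = x k - x (int p * k)"

definition delta :: "int \<Rightarrow> int \<Rightarrow> int \<Rightarrow> int" where "delta f c k = (if [k = c] (mod f) then 1 else 0)"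

interpretation dist: koszul refl_fun dist_rel
  by unfold_locales (auto simp: refl_fun_def dist_rel_def fun_eq_iff algebra_simps)

lemma per_funs_cong:
  assumes "x \<in> per_funs f g" "[a = b] (mod f)"
  shows "x a = x b"
proof -
  have per: "x (k + f) = x k" for k using assms(1) by (simp add: per_funs_def)
  have n: "x (k + int n * f) = x k" for k n
  proof (induction n)
    case (Suc n)
    have "x (k + int (Suc n) * f) = x ((k + int n * f) + f)" by (simp add: algebra_simps)
    thus ?case using per Suc by simp
  qed simp
  obtain m where m: "a = b + m * f" using assms(2) by (metis cong_iff_lin mult.commute cong_sym)
  show ?thesis
  proof (cases "m \<ge> 0")
    case True
    thus ?thesis using n[of b "nat m"] m by simp
  next
    case False
    thus ?thesis using n[of a "nat (- m)"] m by simp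
  qed
qed

lemma per_funs_support: "x \<in> per_funs f g \<Longrightarrow> x k \<noteq> 0 \<Longrightarrow> int g dvd k"
  by (simp add: per_funs_def)

lemma per_funs_0: "0 \<in> per_funs f g" by (simp add: per_funs_def)

lemma per_funs_add: "x \<in> per_funs f g \<Longrightarrow> y \<in> per_funs f g \<Longrightarrow> x + y \<in> per_funs f g"
  unfolding per_funs_def by (auto, metis add_0)

lemma per_funs_minus: "x \<in> per_funs f g \<Longrightarrow> - x \<in> per_funs f g"
  unfolding per_funs_def by auto

lemma per_funs_diff: "x \<in> per_funs f g \<Longrightarrow> y \<in> per_funs f g \<Longrightarrow> x - y \<in> per_funs f g"
  using per_funs_add[of x f g "- y"] per_funs_minus by simp

lemma per_funs_scale: "x \<in> per_funs f g \<Longrightarrow> (\<lambda>k. m * x k) \<in> per_funs f g"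
  unfolding per_funs_def by auto

lemma per_funs_refl: "x \<in> per_funs f g \<Longrightarrow> refl_fun x \<in> per_funs f g"
proof -
  assume x: "x \<in> per_funs f g"
  have "x (- (k + f)) = x (- k)" for k by (rule per_funs_cong[OF x]) (simp add: cong_iff_dvd_diff)
  moreover have "int g dvd k" if "x (- k) \<noteq> 0" for k using per_funs_support[OF x that] by simp
  ultimately show ?thesis by (simp add: per_funs_def refl_fun_def)
qed

lemma per_funs_shift:
  assumes "p > 0" "x \<in> per_funs f (g * p)"
  shows "(\<lambda>k. x (int p * k)) \<in> per_funs f g"
proof -
  have "x (int p * (k + f)) = x (int p * k)" for k
    by (rule per_funs_cong[OF assms(2)]) (simp add: cong_iff_dvd_diff algebra_simps)
  moreover have "int g dvd k" if "x (int p * k) \<noteq> 0" for k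
    using per_funs_support[OF assms(2) that] assms(1) by simp
  ultimately show ?thesis by (simp add: per_funs_def)
qed

lemma per_funs_mono: "x \<in> per_funs f (g * p) \<Longrightarrow> x \<in> per_funs f g"
  unfolding per_funs_def by (auto dest: dvd_mult_left)

lemma per_funs_dist_rel: "p > 0 \<Longrightarrow> x \<in> per_funs f (g * p) \<Longrightarrow> dist_rel p x \<in> per_funs f g"
proof -
  assume *: "p > 0" "x \<in> per_funs f (g * p)"
  have "x - (\<lambda>k. x (int p * k)) \<in> per_funs f g"
    using per_funs_diff[OF per_funs_mono[OF *(2)] per_funs_shift[OF *]] .
  moreover have "x - (\<lambda>k. x (int p * k)) = dist_rel p x" by (simp add: fun_eq_iff dist_rel_def)
  ultimately show ?thesis by simp
qed

interpretation per: koszul_levels refl_fun dist_rel "per_funs f" "{p. p > 0}" for f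
  by unfold_locales
    (auto simp: per_funs_0 per_funs_add per_funs_minus per_funs_refl per_funs_dist_rel)

lemma delta_per_funs: "int g dvd c \<Longrightarrow> int g dvd f \<Longrightarrow> delta f c \<in> per_funs f g"
proof -
  assume *: "int g dvd c" "int g dvd f"
  have "int g dvd k" if "[k = c] (mod f)" for k
    using cong_dvd_iff[OF cong_dvd_modulus[OF that *(2)]] *(1) by simp
  thus ?thesis by (auto simp: per_funs_def delta_def cong_def)
qed

lemma per_funs_decompose:
  assumes "f > 0" "y \<in> per_funs f g"
  shows "y k = (\<Sum>c\<in>{0..<f}. y c * delta f c k)"
proof -
  have "(\<Sum>c\<in>{0..<f}. y c * delta f c k) = (\<Sum>c\<in>{k mod f}. y c * delta f c k)"
    using assms(1) by (intro sum.mono_neutral_right) (auto simp: delta_def cong_def)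
  also have "\<dots> = y (k mod f)" by (simp add: delta_def cong_def)
  also have "\<dots> = y k" by (rule per_funs_cong[OF assms(2)]) (simp add: cong_def)
  finally show ?thesis by simp
qed

lemma per_funs_induct:
  assumes f: "f > 0" and y: "y \<in> per_funs f g" and 0: "P 0" and add: "\<And>x z. P x \<Longrightarrow> P z \<Longrightarrow> P (x + z)"
    and delta: "\<And>c. \<lbrakk>0 \<le> c; c < f; y c \<noteq> 0\<rbrakk> \<Longrightarrow> P (\<lambda>k. y c * delta f c k)"
  shows "P y"
proof -
  have "C \<subseteq> {0..<f} \<Longrightarrow> P (\<lambda>k. \<Sum>c\<in>C. y c * delta f c k)" if "finite C" for C
    using that
  proof (induction C rule: finite_induct)
    case empty
    then show ?case using 0 by (simp add: zero_fun_def)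
  next
    case (insert c C)
    have "P (\<lambda>k. y c * delta f c k)"
    proof (cases "y c = 0")
      case True
      then show ?thesis using 0 by (simp add: zero_fun_def)
    qed (use insert delta in auto)
    moreover have "P (\<lambda>k. \<Sum>c\<in>C. y c * delta f c k)" using insert by auto
    ultimately have "P ((\<lambda>k. y c * delta f c k) + (\<lambda>k. \<Sum>c\<in>C. y c * delta f c k))" by (rule add)
    moreover have "(\<lambda>k. y c * delta f c k) + (\<lambda>k. \<Sum>c\<in>C. y c * delta f c k) = (\<lambda>k. \<Sum>c\<in>insert c C. y c * delta f c k)"
      using insert by (simp add: fun_eq_iff)
    ultimately show ?case by (simp only:)
  qed
  from this[of "{0..<f}"] have "P (\<lambda>k. \<Sum>c\<in>{0..<f}. y c * delta f c k)" by simp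
  moreover have "(\<lambda>k. \<Sum>c\<in>{0..<f}. y c * delta f c k) = y" using per_funs_decompose[OF f y] by (intro ext) (rule sym)
  ultimately show ?thesis by (simp only:)
qed

text \<open>The image of the Koszul differential in the component of the empty subset, that is, the
  relations at the primes in the list. The recursive form fits inductions along the Koszul
  cones.\<close>

fun rel_sub :: "int \<Rightarrow> nat list \<Rightarrow> nat \<Rightarrow> (int \<Rightarrow> int) set" where
  "rel_sub f [] g = {0}"
| "rel_sub f (p # ps) g = {dist_rel p u + \<rho> | u \<rho>. u \<in> per_funs f (g * p) \<and> \<rho> \<in> rel_sub f ps g}"

lemma rel_sub_ConsI:
  "u \<in> per_funs f (g * p) \<Longrightarrow> \<rho> \<in> rel_sub f ps g \<Longrightarrow> x = dist_rel p u + \<rho> \<Longrightarrow> x \<in> rel_sub f (p # ps) g"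
  by auto

lemma rel_sub_ConsE:
  assumes "x \<in> rel_sub f (p # ps) g"
  obtains u \<rho> where "u \<in> per_funs f (g * p)" "\<rho> \<in> rel_sub f ps g" "x = dist_rel p u + \<rho>"
  using assms by auto

declare rel_sub.simps(2) [simp del]

lemma rel_sub_0: "0 \<in> rel_sub f ps g"
proof (induction ps)
  case (Cons p ps)
  show ?case by (rule rel_sub_ConsI[OF per_funs_0 Cons]) (simp only: dist.r_0 add_0_right)
qed (simp only: rel_sub.simps(1) singleton_iff)

text \<open>To be used for multiplication of the argument by a unit modulo f, which preserves a
  level g only when g divides f; hence the divisibility assumptions.\<close>

lemma rel_sub_map:
  assumes add: "\<And>x y. h (x + y) = h x + h y" and comm: "\<And>p x. h (dist_rel p x) = dist_rel p (h x)"
    and closed: "\<And>g x. x \<in> per_funs f g \<Longrightarrow> int g dvd f \<Longrightarrow> h x \<in> per_funs f g"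
    and "int (g * prod_list ps) dvd f" "\<rho> \<in> rel_sub f ps g"
  shows "h \<rho> \<in> rel_sub f ps g"
  using assms(4,5)
proof (induction ps arbitrary: \<rho>)
  case Nil
  have "h 0 = 0" using add[of 0 0] by (simp only: add_0_left add_cancel_right_right)
  moreover have "\<rho> = 0" using Nil by simp
  ultimately show ?case by (simp only: rel_sub.simps singleton_iff)
next
  case (Cons p ps)
  obtain u \<rho>' where u: "u \<in> per_funs f (g * p)" "\<rho>' \<in> rel_sub f ps g" "\<rho> = dist_rel p u + \<rho>'"
    using Cons.prems(2) by (rule rel_sub_ConsE)
  have "g * p dvd g * prod_list (p # ps)" "g * prod_list ps dvd g * prod_list (p # ps)" by simp_all
  hence d: "int (g * p) dvd f" "int (g * prod_list ps) dvd f"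
    using Cons.prems(1) by (meson dvd_trans of_nat_dvd_iff)+
  show ?case
    by (rule rel_sub_ConsI[OF closed[OF u(1) d(1)] Cons.IH[OF d(2) u(2)]]) (simp only: u(3) add comm)
qed

lemma rel_sub_add: "x \<in> rel_sub f ps g \<Longrightarrow> y \<in> rel_sub f ps g \<Longrightarrow> x + y \<in> rel_sub f ps g"
proof (induction ps arbitrary: x y)
  case (Cons p ps)
  obtain u \<rho> where u: "u \<in> per_funs f (g * p)" "\<rho> \<in> rel_sub f ps g" "x = dist_rel p u + \<rho>"
    using Cons.prems(1) by (rule rel_sub_ConsE)
  obtain v \<rho>' where v: "v \<in> per_funs f (g * p)" "\<rho>' \<in> rel_sub f ps g" "y = dist_rel p v + \<rho>'"
    using Cons.prems(2) by (rule rel_sub_ConsE)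
  show ?case
    by (rule rel_sub_ConsI[OF per_funs_add[OF u(1) v(1)] Cons.IH[OF u(2) v(2)]])
      (simp only: u(3) v(3) dist.r_add ac_simps)
qed simp

lemma rel_sub_minus: "x \<in> rel_sub f ps g \<Longrightarrow> - x \<in> rel_sub f ps g"
proof (induction ps arbitrary: x)
  case (Cons p ps)
  obtain u \<rho> where u: "u \<in> per_funs f (g * p)" "\<rho> \<in> rel_sub f ps g" "x = dist_rel p u + \<rho>"
    using Cons.prems by (rule rel_sub_ConsE)
  show ?case
    by (rule rel_sub_ConsI[OF per_funs_minus[OF u(1)] Cons.IH[OF u(2)]])
      (simp only: u(3) dist.r_minus minus_add_distrib)
qed simp

lemma rel_sub_diff: "x \<in> rel_sub f ps g \<Longrightarrow> y \<in> rel_sub f ps g \<Longrightarrow> x - y \<in> rel_sub f ps g"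
  using rel_sub_add[OF _ rel_sub_minus] by (metis add_uminus_conv_diff)

lemma rel_sub_scale: "x \<in> rel_sub f ps g \<Longrightarrow> (\<lambda>k. m * x k) \<in> rel_sub f ps g"
proof (induction ps arbitrary: x)
  case Nil
  then show ?case by (simp add: zero_fun_def)
next
  case (Cons p ps)
  obtain u \<rho> where u: "u \<in> per_funs f (g * p)" "\<rho> \<in> rel_sub f ps g" "x = dist_rel p u + \<rho>"
    using Cons.prems by (rule rel_sub_ConsE)
  show ?case
    by (rule rel_sub_ConsI[OF per_funs_scale[OF u(1), of m] Cons.IH[OF u(2)]])
      (simp add: u(3) fun_eq_iff dist_rel_def algebra_simps)
qed

lemma rel_sub_refl: "x \<in> rel_sub f ps g \<Longrightarrow> refl_fun x \<in> rel_sub f ps g"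
proof (induction ps arbitrary: x)
  case (Cons p ps)
  obtain u \<rho> where u: "u \<in> per_funs f (g * p)" "\<rho> \<in> rel_sub f ps g" "x = dist_rel p u + \<rho>"
    using Cons.prems by (rule rel_sub_ConsE)
  show ?case
    by (rule rel_sub_ConsI[OF per_funs_refl[OF u(1)] Cons.IH[OF u(2)]])
      (simp only: u(3) dist.\<gamma>_add dist.r_\<gamma>)
qed simp

lemma rel_sub_dist_rel: "q > 0 \<Longrightarrow> x \<in> rel_sub f ps (g * q) \<Longrightarrow> dist_rel q x \<in> rel_sub f ps g"
proof (induction ps arbitrary: x)
  case (Cons p ps)
  obtain u \<rho> where u: "u \<in> per_funs f (g * q * p)" "\<rho> \<in> rel_sub f ps (g * q)" "x = dist_rel p u + \<rho>"
    using Cons.prems(2) by (rule rel_sub_ConsE)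
  have "g * q * p = g * p * q" by (simp only: ac_simps)
  hence "u \<in> per_funs f (g * p * q)" using u(1) by (simp only:)
  hence "dist_rel q u \<in> per_funs f (g * p)" by (rule per_funs_dist_rel[OF Cons.prems(1)])
  thus ?case
    by (rule rel_sub_ConsI[OF _ Cons.IH[OF Cons.prems(1) u(2)]]) (simp only: u(3) dist.r_add dist.rr[of q p])
qed simp

lemma rel_sub_gen: "q \<in> set ps \<Longrightarrow> u \<in> per_funs f (g * q) \<Longrightarrow> dist_rel q u \<in> rel_sub f ps g"
proof (induction ps)
  case (Cons p ps)
  show ?case
  proof (cases "q = p")
    case True
    show ?thesis by (rule rel_sub_ConsI[OF _ rel_sub_0]) (use True Cons.prems in auto)
  next
    case False
    hence "dist_rel q u \<in> rel_sub f ps g" using Cons by simp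
    thus ?thesis by (rule rel_sub_ConsI[OF per_funs_0]) (simp only: dist.r_0 add_0_left)
  qed
qed simp

lemma rel_sub_per_funs: "0 \<notin> set ps \<Longrightarrow> x \<in> rel_sub f ps g \<Longrightarrow> x \<in> per_funs f g"
proof (induction ps arbitrary: x)
  case Nil
  then show ?case by (simp only: rel_sub.simps singleton_iff per_funs_0)
next
  case (Cons p ps)
  obtain u \<rho> where u: "u \<in> per_funs f (g * p)" "\<rho> \<in> rel_sub f ps g" "x = dist_rel p u + \<rho>"
    using Cons.prems(2) by (rule rel_sub_ConsE)
  show ?case unfolding u(3) using Cons u by (intro per_funs_add per_funs_dist_rel) auto
qed

text \<open>Rewriting \<open>[b]\<close>, for \<open>b\<close> with leading digit one at \<open>q\<close>, by the relation at \<open>[q b]\<close>, lowers the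
  weight; this leads to a normal form modulo the relations.\<close>

lemma digit_weight_bounded: "\<exists>w. \<forall>k. digit_weight f k < w"
proof (intro exI allI)
  fix k
  have "nat (f - gcd k f) \<le> nat f" by (intro nat_mono) simp
  hence "nat (f - gcd k f) * (card (prime_factors f) + 1) \<le> nat f * (card (prime_factors f) + 1)" by (rule mult_le_mono1)
  moreover have "card {q \<in> prime_factors f. digit_one f q k} \<le> card (prime_factors f)" by (intro card_mono) auto
  ultimately show "digit_weight f k < nat f * (card (prime_factors f) + 1) + card (prime_factors f) + 1"
    unfolding digit_weight_def by linarith
qed

lemma normal_form:
  assumes f: "f > 0" and S: "\<And>q. q \<in> set ps \<Longrightarrow> int q \<in> prime_factors f \<and> int (g * q) dvd f" and g: "int g dvd f"
    and y: "y \<in> per_funs f g" and w: "\<And>k. y k \<noteq> 0 \<Longrightarrow> digit_weight f k < w"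
  shows "\<exists>\<rho>\<in>rel_sub f ps g. \<forall>k. y k \<noteq> \<rho> k \<longrightarrow> digit_weight f k < w \<and> (\<forall>q\<in>set ps. \<not> digit_one f (int q) k)"
  using y w
proof (induction w arbitrary: y)
  case 0
  then show ?case by (intro bexI[OF _ rel_sub_0]) auto
next
  case (Suc w)
  let ?NF = "\<lambda>y. \<exists>\<rho>\<in>rel_sub f ps g. \<forall>k. y k \<noteq> \<rho> k \<longrightarrow> digit_weight f k < Suc w \<and> (\<forall>q\<in>set ps. \<not> digit_one f (int q) k)"
  show ?case
  proof (rule per_funs_induct[OF f Suc.prems(1), of ?NF])
    show "?NF 0" by (intro bexI[OF _ rel_sub_0]) auto
  next
    fix x z assume "?NF x" "?NF z"
    then obtain \<rho> \<rho>' where r: "\<rho> \<in> rel_sub f ps g" "\<forall>k. x k \<noteq> \<rho> k \<longrightarrow> digit_weight f k < Suc w \<and> (\<forall>q\<in>set ps. \<not> digit_one f (int q) k)"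
      "\<rho>' \<in> rel_sub f ps g" "\<forall>k. z k \<noteq> \<rho>' k \<longrightarrow> digit_weight f k < Suc w \<and> (\<forall>q\<in>set ps. \<not> digit_one f (int q) k)"
      by blast
    show "?NF (x + z)"
    proof (intro bexI allI impI)
      show "\<rho> + \<rho>' \<in> rel_sub f ps g" using r by (intro rel_sub_add)
      fix k assume "(x + z) k \<noteq> (\<rho> + \<rho>') k"
      hence "x k \<noteq> \<rho> k \<or> z k \<noteq> \<rho>' k" by auto
      thus "digit_weight f k < Suc w \<and> (\<forall>q\<in>set ps. \<not> digit_one f (int q) k)" using r by blast
    qed
  next
    fix c assume c: "0 \<le> c" "c < f" "y c \<noteq> 0"
    have gc: "int g dvd c" using per_funs_support[OF Suc.prems(1) c(3)] .
    have wc: "digit_weight f c < Suc w" using Suc.prems(2)[OF c(3)] .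
    have "?NF (delta f c)"
    proof (cases "\<exists>q\<in>set ps. digit_one f (int q) c")
      case False
      show ?thesis
      proof (intro bexI[OF _ rel_sub_0] allI impI)
        fix k assume "delta f c k \<noteq> 0 k"
        hence k: "[k = c] (mod f)" by (auto simp: delta_def split: if_splits)
        show "digit_weight f k < Suc w \<and> (\<forall>q\<in>set ps. \<not> digit_one f (int q) k)"
          using digit_weight_cong[OF f k] digit_one_cong'[OF f k] wc False by simp
      qed
    next
      case True
      then obtain q where q: "q \<in> set ps" "digit_one f (int q) c" by blast
      have qf: "int q \<in> prime_factors f" "int (g * q) dvd f" using S q by auto
      let ?d = "delta f (int q * c)"
      have d: "?d \<in> per_funs f (g * q)" using gc qf by (intro delta_per_funs) (auto simp: mult.commute)
      have \<rho>: "dist_rel q ?d \<in> rel_sub f ps g" by (rule rel_sub_gen[OF q(1) d])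
      \<comment> \<open>The relation replaces c by q c and by minus the other members of the fibre
        through c, all of smaller weight, so the outer induction applies to the result.\<close>
      let ?z = "delta f c + dist_rel q ?d"
      have q0: "q > 0" using qf(1) by (auto simp: in_prime_factors_iff intro: gr0I)
      have z: "?z \<in> per_funs f g"
        using delta_per_funs[OF gc g] per_funs_dist_rel[OF q0 d] by (rule per_funs_add)
      have zw: "digit_weight f k < w" if "?z k \<noteq> 0" for k
      proof -
        have "[k = int q * c] (mod f) \<or> ([int q * k = int q * c] (mod f) \<and> \<not> [k = c] (mod f))"
        proof (rule ccontr)
          assume n: "\<not> ?thesis"
          have "[k = c] (mod f) \<longleftrightarrow> [int q * k = int q * c] (mod f)" using n cong_scalar_left by blast
          hence "?z k = 0" using n by (simp add: delta_def dist_rel_def)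
          thus False using that by simp
        qed
        hence "digit_weight f k < digit_weight f c"
          using digit_weight_cong[OF f, of k "int q * c"] digit_weight_mult_less[OF f qf(1) q(2)]
            digit_weight_less[OF f qf(1) q(2)] by auto
        thus ?thesis using wc by simp
      qed
      obtain \<rho>' where \<rho>': "\<rho>' \<in> rel_sub f ps g"
        "\<forall>k. ?z k \<noteq> \<rho>' k \<longrightarrow> digit_weight f k < w \<and> (\<forall>q\<in>set ps. \<not> digit_one f (int q) k)"
        using Suc.IH[OF z zw] by blast
      show ?thesis
      proof (intro bexI allI impI)
        show "\<rho>' - dist_rel q ?d \<in> rel_sub f ps g" by (rule rel_sub_diff[OF \<rho>'(1) \<rho>])
        fix k assume "delta f c k \<noteq> (\<rho>' - dist_rel q ?d) k"
        hence "?z k \<noteq> \<rho>' k" by auto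
        thus "digit_weight f k < Suc w \<and> (\<forall>q\<in>set ps. \<not> digit_one f (int q) k)" using \<rho>'(2) by force
      qed
    qed
    then obtain \<rho> where \<rho>: "\<rho> \<in> rel_sub f ps g"
      "\<forall>k. delta f c k \<noteq> \<rho> k \<longrightarrow> digit_weight f k < Suc w \<and> (\<forall>q\<in>set ps. \<not> digit_one f (int q) k)" by blast
    show "?NF (\<lambda>k. y c * delta f c k)"
    proof (intro bexI allI impI)
      show "(\<lambda>k. y c * \<rho> k) \<in> rel_sub f ps g" by (rule rel_sub_scale[OF \<rho>(1)])
      fix k assume "y c * delta f c k \<noteq> y c * \<rho> k"
      hence "delta f c k \<noteq> \<rho> k" by auto
      thus "digit_weight f k < Suc w \<and> (\<forall>q\<in>set ps. \<not> digit_one f (int q) k)" using \<rho>(2) by blast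
    qed
  qed
qed

text \<open>Multiplication by a unit modulo f is an automorphism preserving all levels and commuting
  with the relations, so the normal form may be transported along it.\<close>

lemma twisted_normal_form:
  assumes f: "f > 0" and S: "\<And>q. q \<in> set ps \<Longrightarrow> int q \<in> prime_factors f" and d: "int (g * prod_list ps) dvd f"
    and y: "y \<in> per_funs f g" and uv: "[u * v = 1] (mod f)"
  shows "\<exists>\<rho>\<in>rel_sub f ps g. \<forall>k. y k \<noteq> \<rho> k \<longrightarrow> (\<forall>q\<in>set ps. \<not> digit_one f (int q) (u * k))"
proof -
  have scale: "(\<lambda>k. x (s * k)) \<in> per_funs f g" if x: "x \<in> per_funs f g" and st: "[s * t = 1] (mod f)" and g: "int g dvd f" for x s t g
  proof -
    have "x (s * (k + f)) = x (s * k)" for k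
      by (rule per_funs_cong[OF x]) (simp add: cong_iff_dvd_diff algebra_simps)
    moreover have "int g dvd k" if "x (s * k) \<noteq> 0" for k
    proof -
      have "int g dvd s * k" by (rule per_funs_support[OF x that])
      moreover have "coprime s (int g)" using st g
        by (metis cong_dvd_modulus cong_imp_coprime cong_sym coprime_1_left coprime_mult_left_iff)
      ultimately show ?thesis by (metis coprime_commute coprime_dvd_mult_right_iff)
    qed
    ultimately show ?thesis by (simp add: per_funs_def)
  qed
  have vu: "[v * u = 1] (mod f)" using uv by (simp add: mult.commute)
  have gf: "int g dvd f" using d by (metis dvd_mult_left of_nat_mult)
  have gq: "int (g * q) dvd f" if "q \<in> set ps" for q
  proof -
    have "q dvd prod_list ps" using that by (induction ps) (auto simp: dvd_mult)
    hence "g * q dvd g * prod_list ps" by simp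
    thus ?thesis using d by (meson dvd_trans of_nat_dvd_iff)
  qed
  define y' where "y' k = y (v * k)" for k
  have y': "y' \<in> per_funs f g" using scale[OF y vu gf] by (simp add: y'_def[abs_def])
  have "\<exists>w. \<forall>k. y' k \<noteq> 0 \<longrightarrow> digit_weight f k < w" using digit_weight_bounded by blast
  then obtain w where w: "\<And>k. y' k \<noteq> 0 \<Longrightarrow> digit_weight f k < w" by blast
  obtain \<rho> where \<rho>: "\<rho> \<in> rel_sub f ps g" "\<forall>k. y' k \<noteq> \<rho> k \<longrightarrow> (\<forall>q\<in>set ps. \<not> digit_one f (int q) k)"
    using normal_form[OF f _ gf y' w, of ps] S gq by blast
  show ?thesis
  proof (intro bexI allI impI)
    show "(\<lambda>k. \<rho> (u * k)) \<in> rel_sub f ps g"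
      by (rule rel_sub_map[of "\<lambda>x k. x (u * k)", OF _ _ _ d \<rho>(1)])
        (use scale[OF _ uv] in \<open>auto simp: fun_eq_iff dist_rel_def mult.left_commute\<close>)
    fix k assume "y k \<noteq> \<rho> (u * k)"
    moreover have "[v * (u * k) = k] (mod f)"
      using cong_mult[OF vu cong_refl[of k]] by (simp add: mult.assoc)
    hence "y' (u * k) = y k" unfolding y'_def by (rule per_funs_cong[OF y])
    ultimately show "\<forall>q\<in>set ps. \<not> digit_one f (int q) (u * k)" using \<rho>(2) by metis
  qed
qed

text \<open>The core of the resolution. Modulo the relations at ps, x is replaced by a form y that
  is normal after multiplication by u. If y is not zero, take b of maximal weight with digit one at
  p and \<open>y (p * b) \<noteq> 0\<close>. The part of \<open>dist_rel p y\<close> of top weight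
  at such residues is already normal for ps, and normalizing the rest only produces smaller weights.
  Uniqueness for ps then shows that \<open>dist_rel p x + \<rho>\<close> does not vanish at b,
  against its normality at p.\<close>

lemma dist_rel_normal_imp_rel_sub:
  assumes f: "f > 0" and P: "\<And>q. q \<in> set (p # ps) \<Longrightarrow> int q \<in> prime_factors f" and dist: "p \<notin> set ps"
    and d: "int (g * prod_list (p # ps)) dvd f"
    and unique: "\<And>n. n \<in> rel_sub f ps g \<Longrightarrow> (\<And>k q. n k \<noteq> 0 \<Longrightarrow> q \<in> set ps \<Longrightarrow> \<not> digit_one f (int q) k) \<Longrightarrow> n = 0"
    and x: "x \<in> per_funs f (g * p)" and \<rho>: "\<rho> \<in> rel_sub f ps g"
    and n: "\<And>k q. (dist_rel p x + \<rho>) k \<noteq> 0 \<Longrightarrow> q \<in> set (p # ps) \<Longrightarrow> \<not> digit_one f (int q) k"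
  shows "x \<in> rel_sub f ps (g * p)"
proof -
  have pf: "int p \<in> prime_factors f" using P by simp
  have p0: "p > 0" using pf by (auto simp: in_prime_factors_iff intro: gr0I)
  have dp: "int (g * p * prod_list ps) dvd f" using d by (simp add: mult.assoc)
  have ps0: "0 \<notin> set ps" using P[of 0] by (auto simp: in_prime_factors_iff)
  obtain u v where uv: "[u * v = 1] (mod f)"
    and ud: "\<And>q k. q \<in> prime_factors f \<Longrightarrow> q \<noteq> int p \<Longrightarrow> digit_one f q (u * (int p * k)) = digit_one f q k"
    using unit_inverting_prime[OF f pf] by blast
  obtain \<rho>1 where \<rho>1: "\<rho>1 \<in> rel_sub f ps (g * p)"
    "\<And>k q. x k \<noteq> \<rho>1 k \<Longrightarrow> q \<in> set ps \<Longrightarrow> \<not> digit_one f (int q) (u * k)"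
    using twisted_normal_form[OF f _ dp x uv] P by (metis list.set_intros(2))
  define y where "y = x - \<rho>1"
  have y: "y \<in> per_funs f (g * p)" unfolding y_def by (intro per_funs_diff x rel_sub_per_funs[OF ps0 \<rho>1(1)])
  have yk: "\<not> digit_one f (int q) (u * k)" if "y k \<noteq> 0" "q \<in> set ps" for k q
    using \<rho>1(2)[of k q] that by (auto simp: y_def)
  have lift: "\<exists>b. [int p * b = c] (mod f) \<and> digit_one f (int p) b \<and> y (int p * b) \<noteq> 0" if "y c \<noteq> 0" for c
  proof -
    have "int p dvd c" using per_funs_support[OF y that] by (simp add: dvd_mult_right)
    then obtain b where "[int p * b = c] (mod f)" "digit_one f (int p) b" by (rule digit_one_lift[OF f pf])
    thus ?thesis using per_funs_cong[OF y] that by metis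
  qed
  have "y = 0"
  proof (rule ccontr)
    assume "y \<noteq> 0"
    then obtain c0 where "y c0 \<noteq> 0" by (auto simp: fun_eq_iff)
    \<comment> \<open>The candidates for leading terms of \<open>dist_rel p y\<close>: the members
      with digit one of fibres over the support of y.\<close>
    define W where "W b \<longleftrightarrow> digit_one f (int p) b \<and> y (int p * b) \<noteq> 0" for b
    obtain b0 where "W b0" using lift[OF \<open>y c0 \<noteq> 0\<close>] by (auto simp: W_def)
    obtain w0 where "\<And>k. digit_weight f k < w0" using digit_weight_bounded by blast
    hence "\<forall>b. W b \<longrightarrow> digit_weight f b < w0" by simp
    from ex_has_greatest_nat[OF \<open>W b0\<close> this]
    obtain b where b: "W b" "\<And>b'. W b' \<Longrightarrow> digit_weight f b' \<le> digit_weight f b" by (elim exE conjE) simp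
    let ?w = "digit_weight f b"
    define z where "z = dist_rel p y"
    have z: "z \<in> per_funs f g" unfolding z_def by (rule per_funs_dist_rel[OF p0 y])
    \<comment> \<open>A support point of y is congruent to p b' for some b' in W, so its weight is
      below that of b' and hence below the maximum. In particular y vanishes at b itself.\<close>
    have small: "digit_weight f k < ?w" if yk0: "y k \<noteq> 0" for k
    proof -
      obtain b' where b': "[int p * b' = k] (mod f)" "W b'" using lift[OF yk0] by (auto simp: W_def)
      have "digit_weight f k = digit_weight f (int p * b')" using digit_weight_cong[OF f b'(1)] by simp
      also have "\<dots> < digit_weight f b'" using digit_weight_mult_less[OF f pf] b'(2) by (simp add: W_def)
      finally show ?thesis using b(2)[OF b'(2)] by simp
    qed
    have zb: "z b \<noteq> 0" using small[of b] b(1) by (auto simp: z_def dist_rel_def W_def)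
    have zk: "W k \<or> digit_weight f k < ?w" if "z k \<noteq> 0" for k
    proof (cases "y k \<noteq> 0")
      case False
      hence yp: "y (int p * k) \<noteq> 0" using that by (auto simp: z_def dist_rel_def)
      then obtain b' where b': "[int p * b' = int p * k] (mod f)" "digit_one f (int p) b'" "W b'"
        using lift[OF yp] by (auto simp: W_def)
      show ?thesis
      proof (cases "digit_one f (int p) k")
        case False
        hence "\<not> [k = b'] (mod f)" using digit_one_cong'[OF f] b'(2) by blast
        hence "digit_weight f k < digit_weight f b'" using digit_weight_less[OF f pf b'(2) cong_sym[OF b'(1)]] by simp
        thus ?thesis using b(2)[OF b'(3)] by simp
      qed (use yp W_def in auto)
    qed (use small in auto)
    \<comment> \<open>The part of z of maximal weight; the remainder has strictly smaller weight,
      and \<open>normal_form\<close> keeps it so.\<close>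
    define zt where "zt k = (if W k \<and> digit_weight f k = ?w then z k else 0)" for k
    have W_cong: "W (k + f) = W k" for k
    proof -
      have "[k + f = k] (mod f)" by (simp add: cong_iff_dvd_diff)
      moreover have "[int p * (k + f) = int p * k] (mod f)" by (simp add: cong_iff_dvd_diff algebra_simps)
      ultimately show ?thesis using digit_one_cong'[OF f] per_funs_cong[OF y] unfolding W_def by metis
    qed
    have zt: "zt \<in> per_funs f g"
    proof -
      have "zt (k + f) = zt k" for k
      proof -
        have "[k + f = k] (mod f)" by (simp add: cong_iff_dvd_diff)
        thus ?thesis using W_cong digit_weight_cong[OF f] per_funs_cong[OF z] unfolding zt_def by metis
      qed
      moreover have "int g dvd k" if "zt k \<noteq> 0" for k
        using that per_funs_support[OF z] by (auto simp: zt_def split: if_splits)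
      ultimately show ?thesis by (simp add: per_funs_def)
    qed
    have zl: "digit_weight f k < ?w" if "(z - zt) k \<noteq> 0" for k
      using that zk[of k] b(2)[of k] by (auto simp: zt_def split: if_splits)
    have gq: "int q \<in> prime_factors f \<and> int (g * q) dvd f" if "q \<in> set ps" for q
    proof -
      have "q dvd prod_list ps" using that by (induction ps) (auto simp: dvd_mult)
      hence "q dvd prod_list (p # ps)" by (simp add: dvd_mult)
      hence "g * q dvd g * prod_list (p # ps)" by (intro mult_dvd_mono) auto
      thus ?thesis using d P that by (meson dvd_trans of_nat_dvd_iff list.set_intros(2))
    qed
    have gf: "int g dvd f" using d by (metis dvd_mult_left of_nat_mult)
    obtain \<rho>2 where \<rho>2: "\<rho>2 \<in> rel_sub f ps g"
      "\<And>k. (z - zt) k \<noteq> \<rho>2 k \<Longrightarrow> digit_weight f k < ?w \<and> (\<forall>q\<in>set ps. \<not> digit_one f (int q) k)"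
      using normal_form[OF f gq gf per_funs_diff[OF z zt] zl] by blast
    \<comment> \<open>A relation among ps that is, up to sign, a combination of three functions that
      are normal for ps: the given one, the top part, and the normalized remainder. So it vanishes
      by uniqueness.\<close>
    define m where "m = \<rho>2 + dist_rel p \<rho>1 + \<rho>"
    have m: "m \<in> rel_sub f ps g"
      unfolding m_def by (intro rel_sub_add \<rho>2(1) \<rho> rel_sub_dist_rel[OF p0 \<rho>1(1)])
    have mk: "m k = (dist_rel p x + \<rho>) k - zt k - ((z - zt) k - \<rho>2 k)" for k
      by (simp add: m_def z_def y_def dist_rel_def)
    have "m = 0"
    proof (rule unique[OF m])
      fix k q assume "m k \<noteq> 0" and q: "q \<in> set ps"
      then consider "(dist_rel p x + \<rho>) k \<noteq> 0" | "zt k \<noteq> 0" | "(z - zt) k \<noteq> \<rho>2 k" using mk[of k] by fastforce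
      thus "\<not> digit_one f (int q) k"
      proof cases
        case 1
        thus ?thesis using n[of k q] q by simp
      next
        case 2
        hence "y (int p * k) \<noteq> 0" by (auto simp: zt_def W_def split: if_splits)
        \<comment> \<open>Here the twist by u pays off: y is normal in terms of u times its
          argument, and the digit at q of u p k is that of k.\<close>
        hence "\<not> digit_one f (int q) (u * (int p * k))" using yk q by blast
        moreover have "int q \<noteq> int p" using dist q by auto
        ultimately show ?thesis using ud[of "int q" k] P q by simp
      next
        case 3
        thus ?thesis using \<rho>2(2) q by blast
      qed
    qed
    hence "(dist_rel p x + \<rho>) b = zt b + ((z - zt) b - \<rho>2 b)" using mk[of b] by (simp only: zero_fun_apply)
    moreover have "(z - zt) b = \<rho>2 b" using \<rho>2(2)[of b] by auto
    moreover have "zt b = z b" using b(1) by (simp add: zt_def)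
    ultimately have "(dist_rel p x + \<rho>) b \<noteq> 0" using zb by simp
    hence "\<not> digit_one f (int p) b" using n[of b p] by simp
    thus False using b(1) by (simp add: W_def)
  qed
  hence "x = \<rho>1" unfolding y_def by (simp only: right_minus_eq)
  thus ?thesis using \<rho>1(1) by simp
qed

text \<open>Uniqueness of normal forms by induction on the list: for a normal element
  \<open>dist_rel p x + \<rho>\<close> the preceding lemma makes x a relation among ps, so the
  element itself is one, and the induction hypothesis applies.\<close>

lemma rel_sub_normal_imp_zero:
  assumes f: "f > 0" and "\<And>q. q \<in> set ps \<Longrightarrow> int q \<in> prime_factors f" "distinct ps" "int (g * prod_list ps) dvd f"
    and "n \<in> rel_sub f ps g" "\<And>k q. n k \<noteq> 0 \<Longrightarrow> q \<in> set ps \<Longrightarrow> \<not> digit_one f (int q) k"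
  shows "n = 0"
  using assms(2-)
proof (induction ps arbitrary: n)
  case Nil
  then show ?case by simp
next
  case (Cons p ps)
  have "g * prod_list ps dvd g * prod_list (p # ps)" by simp
  hence d: "int (g * prod_list ps) dvd f" using Cons.prems(3) by (meson dvd_trans of_nat_dvd_iff)
  have IH: "n = 0" if "n \<in> rel_sub f ps g" "\<And>k q. n k \<noteq> 0 \<Longrightarrow> q \<in> set ps \<Longrightarrow> \<not> digit_one f (int q) k" for n
    using Cons.IH[OF _ _ d that(1)] Cons.prems(1,2) that(2) by (meson distinct.simps(2) list.set_intros(2))
  obtain x \<rho> where x: "x \<in> per_funs f (g * p)" "\<rho> \<in> rel_sub f ps g" "n = dist_rel p x + \<rho>"
    using Cons.prems(4) by (rule rel_sub_ConsE)
  have pd: "p \<notin> set ps" using Cons.prems(2) by simp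
  have "x \<in> rel_sub f ps (g * p)"
    by (rule dist_rel_normal_imp_rel_sub[OF f Cons.prems(1) pd Cons.prems(3) IH x(1,2)])
      (use Cons.prems(5) x(3) in blast)+
  moreover have "p > 0" using Cons.prems(1)[of p] by (auto simp: in_prime_factors_iff intro: gr0I)
  ultimately have "n \<in> rel_sub f ps g" unfolding x(3) by (intro rel_sub_add rel_sub_dist_rel x(2))
  thus ?case using IH Cons.prems(5) by (meson list.set_intros(2))
qed

text \<open>The operators form a regular sequence in this graded sense. The zero function is
  trivially normal, so \<open>dist_rel_normal_imp_rel_sub\<close> applies with \<rho> the negative
  of \<open>dist_rel p x\<close>.\<close>

lemma dist_rel_injective_mod_rel_sub:
  assumes f: "f > 0" and P: "\<And>q. q \<in> set (p # ps) \<Longrightarrow> int q \<in> prime_factors f" and dist: "distinct (p # ps)"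
    and d: "int (g * prod_list (p # ps)) dvd f"
    and x: "x \<in> per_funs f (g * p)" and \<rho>: "dist_rel p x \<in> rel_sub f ps g"
  shows "x \<in> rel_sub f ps (g * p)"
proof -
  have "g * prod_list ps dvd g * prod_list (p # ps)" by simp
  hence d': "int (g * prod_list ps) dvd f" using d by (meson dvd_trans of_nat_dvd_iff)
  show ?thesis
  proof (rule dist_rel_normal_imp_rel_sub[OF f P _ d _ x rel_sub_minus[OF \<rho>]])
    show "p \<notin> set ps" using dist by simp
    fix n assume n: "n \<in> rel_sub f ps g" "\<And>k q. n k \<noteq> 0 \<Longrightarrow> q \<in> set ps \<Longrightarrow> \<not> digit_one f (int q) k"
    show "n = 0"
      by (rule rel_sub_normal_imp_zero[OF f _ _ d' n(1)]) (use P dist n(2) in auto)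
  qed simp_all
qed

section \<open>The Koszul complex resolves the universal distribution\<close>

abbreviation zero_bits :: "nat list \<Rightarrow> bool list" where "zero_bits ps \<equiv> map (\<lambda>_. False) ps"

definition zero_chain :: "nat list \<Rightarrow> 'v \<Rightarrow> bool list \<Rightarrow> 'v::zero" where
  "zero_chain ps u b = (if b = zero_bits ps then u else 0)"

lemma chains_zero_bits: "x \<in> koszul_chains A ps g \<Longrightarrow> x (zero_bits ps) \<in> A g"
  by (induction ps arbitrary: x) auto

context koszul begin

lemma tate_bd_add: "tate_bd \<gamma> n (u + v) = tate_bd \<gamma> n u + tate_bd \<gamma> n v"
  by (simp add: tate_bd_def \<gamma>_add)

lemma tate_bd_r: "tate_bd \<gamma> n (r p u) = r p (tate_bd \<gamma> n u)"
  by (simp add: tate_bd_def r_add r_diff r_\<gamma>)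

lemma tate_bd_tate_bd: "tate_bd \<gamma> (n - 1) (tate_bd \<gamma> n u) = 0"
  by (simp add: tate_bd_def \<gamma>_add \<gamma>_diff \<gamma>\<gamma>)

lemma D_zero_chain: "D ps n (zero_chain ps u) b = zero_chain ps (tate_bd \<gamma> n u) b"
proof (induction ps arbitrary: n b)
  case Nil
  then show ?case by (cases b) (simp_all add: zero_chain_def)
next
  case (Cons p ps)
  have 1: "(\<lambda>b. zero_chain (p # ps) u (False # b)) = zero_chain ps u" for u
    by (auto simp: zero_chain_def fun_eq_iff)
  have 2: "zero_chain (p # ps) u (True # b) = 0" for u b by (simp add: zero_chain_def)
  have 3: "zero_chain (p # ps) u [] = 0" for u by (simp add: zero_chain_def)
  show ?case
  proof (cases b)
    case Nil
    then show ?thesis by (simp add: 3)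
  next
    case (Cons c b')
    then show ?thesis using Cons.IH[of n b'] fun_cong[OF 1, of "tate_bd \<gamma> n u" b']
      by (cases c) (simp_all add: 1 2)
  qed
qed

end

lemma (in koszul_levels) zero_chain_in: "u \<in> A g \<Longrightarrow> zero_chain ps u \<in> koszul_chains A ps g"
proof (induction ps)
  case (Cons p ps)
  have "(\<lambda>b. zero_chain (p # ps) u (False # b)) = zero_chain ps u" "(\<lambda>b. zero_chain (p # ps) u (True # b)) = (\<lambda>b. 0)"
    by (auto simp: zero_chain_def fun_eq_iff)
  thus ?case using Cons chains_0 by (simp add: zero_chain_def[of "p # ps"])
qed (auto simp: zero_chain_def)

lemma rel_sub_tate_bd: "x \<in> rel_sub f ps g \<Longrightarrow> tate_bd refl_fun n x \<in> rel_sub f ps g"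
  unfolding tate_bd_def by (auto intro: rel_sub_add rel_sub_diff rel_sub_refl)

text \<open>Modulo the relations, the empty-subset component sees only the Tate differential, so it
  defines a chain map to the Tate complex of the quotient.\<close>

lemma koszul_bd_zero_bits:
  assumes "0 \<notin> set ps" "x \<in> koszul_chains (per_funs f) ps g"
  shows "\<exists>\<rho>\<in>rel_sub f ps g. koszul_bd refl_fun dist_rel ps n x (zero_bits ps) = tate_bd refl_fun n (x (zero_bits ps)) + \<rho>"
  using assms
proof (induction ps arbitrary: x)
  case Nil
  then show ?case by (intro bexI[of _ 0]) (simp_all only: rel_sub.simps singleton_iff koszul_bd.simps list.map add_0_right)
next
  case (Cons p ps)
  have c: "(\<lambda>b. x (False # b)) \<in> koszul_chains (per_funs f) ps g" "(\<lambda>b. x (True # b)) \<in> koszul_chains (per_funs f) ps (g * p)"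
    using Cons.prems by auto
  have "0 \<notin> set ps" using Cons.prems(1) by simp
  from Cons.IH[OF this c(1)] obtain \<rho> where \<rho>: "\<rho> \<in> rel_sub f ps g"
    "koszul_bd refl_fun dist_rel ps n (\<lambda>b. x (False # b)) (zero_bits ps) = tate_bd refl_fun n (x (False # zero_bits ps)) + \<rho>"
    by (elim bexE)
  have "x (True # zero_bits ps) \<in> per_funs f (g * p)" using chains_zero_bits[OF c(2)] .
  hence "dist_rel p (x (True # zero_bits ps)) + \<rho> \<in> rel_sub f (p # ps) g"
    using \<rho>(1) by (rule rel_sub_ConsI[OF _ _ refl])
  thus ?case by (rule bexI[rotated]) (simp only: koszul_bd.simps list.map \<rho>(2) ac_simps)
qed

text \<open>The kernel of the projection to the Tate complex of the quotient is acyclic. For p # ps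
  one first moves the empty-subset component of the \<open>False\<close> half from the relations at
  p # ps into those at ps; injectivity modulo relations then puts the \<open>True\<close> half into
  the kernel complex for ps, and the induction hypothesis applies to both halves.\<close>

lemma koszul_resolution_acyclic:
  assumes f: "f > 0" and "\<And>q. q \<in> set ps \<Longrightarrow> int q \<in> prime_factors f" "distinct ps" "int (g * prod_list ps) dvd f"
    and "x \<in> koszul_chains (per_funs f) ps g" "\<And>b. koszul_bd refl_fun dist_rel ps n x b = 0"
    and "x (zero_bits ps) \<in> rel_sub f ps g"
  shows "\<exists>z\<in>koszul_chains (per_funs f) ps g. koszul_bd refl_fun dist_rel ps (n + 1) z = x \<and> z (zero_bits ps) \<in> rel_sub f ps g"
  using assms(2-)
proof (induction ps arbitrary: g x n)
  case Nil
  have "x b = 0" for b using Nil by (cases "b = []") auto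
  hence "x = (\<lambda>b. 0)" by auto
  moreover have "koszul_bd refl_fun dist_rel [] (n + 1) (\<lambda>b. 0) = (\<lambda>b. 0)" by (rule ext) (rule dist.D_0)
  ultimately show ?case using per.chains_0[of f "[]" g] rel_sub_0[of f "[]" g]
    by (intro bexI[of _ "\<lambda>b. 0"]) (simp_all only: simp_thms)
next
  case (Cons p ps)
  let ?D = "koszul_bd refl_fun dist_rel" and ?zs = "zero_bits ps" and ?t = "tate_bd refl_fun"
  have P: "\<And>q. q \<in> set ps \<Longrightarrow> int q \<in> prime_factors f" and dist: "distinct ps" using Cons.prems by auto
  have "0 \<notin> set (p # ps)"
  proof
    assume "0 \<in> set (p # ps)"
    hence "int 0 \<in> prime_factors f" by (rule Cons.prems(1))
    thus False by (simp add: in_prime_factors_iff)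
  qed
  hence p0: "p > 0" and ps0: "0 \<notin> set ps" by (metis gr0I list.set_intros(1), metis list.set_intros(2))
  have "g * prod_list ps dvd g * prod_list (p # ps)" by simp
  hence d0: "int (g * prod_list ps) dvd f" using Cons.prems(3) by (meson dvd_trans of_nat_dvd_iff)
  have d1: "int (g * p * prod_list ps) dvd f" using Cons.prems(3) by (simp add: mult.assoc)
  define x0 where "x0 = (\<lambda>b. x (False # b))"
  define x1 where "x1 = (\<lambda>b. x (True # b))"
  have c: "x0 \<in> koszul_chains (per_funs f) ps g" "x1 \<in> koszul_chains (per_funs f) ps (g * p)" "x [] = 0"
    using Cons.prems(4) by (simp_all add: x0_def x1_def)
  have D0: "?D ps n x0 b + dist_rel p (x1 b) = 0" for b
    using Cons.prems(5)[of "False # b"] by (simp only: koszul_bd.simps x0_def x1_def)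
  have D1: "?D ps (n - 1) x1 b = 0" for b
    using Cons.prems(5)[of "True # b"] by (simp only: koszul_bd.simps x1_def neg_equal_0_iff_equal)
  obtain u \<rho> where u: "u \<in> per_funs f (g * p)" "\<rho> \<in> rel_sub f ps g" "x0 ?zs = dist_rel p u + \<rho>"
    using Cons.prems(6) unfolding x0_def by (auto elim: rel_sub_ConsE)
  obtain \<rho>' where \<rho>': "\<rho>' \<in> rel_sub f ps g" "?D ps n x0 ?zs = ?t n (x0 ?zs) + \<rho>'"
    using koszul_bd_zero_bits[OF ps0 c(1)] by blast
  have tu: "?t n u \<in> per_funs f (g * p)"
    unfolding tate_bd_def using u(1) by (auto intro: per_funs_add per_funs_diff per_funs_refl)
  have "dist_rel p (?t n u + x1 ?zs) = - (?t n \<rho> + \<rho>')"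
  proof -
    have "?t n (dist_rel p u + \<rho>) + \<rho>' + dist_rel p (x1 ?zs) = 0"
      using D0[of ?zs] unfolding \<rho>'(2) u(3) .
    hence "dist_rel p (?t n u) + dist_rel p (x1 ?zs) + (?t n \<rho> + \<rho>') = 0"
      by (simp only: dist.tate_bd_add dist.tate_bd_r ac_simps)
    thus ?thesis by (simp only: dist.r_add eq_neg_iff_add_eq_0)
  qed
  \<comment> \<open>The cycle equation in the empty-subset component shows that this element becomes
    a relation among ps after \<open>dist_rel p\<close>; by injectivity it is one already at level g
    * p.\<close>
  hence dr: "dist_rel p (?t n u + x1 ?zs) \<in> rel_sub f ps g"
    using rel_sub_minus[OF rel_sub_add[OF rel_sub_tate_bd[OF u(2)] \<rho>'(1)]] by (simp only:)
  have r1: "?t n u + x1 ?zs \<in> rel_sub f ps (g * p)"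
    by (rule dist_rel_injective_mod_rel_sub[OF f Cons.prems(1-3) per_funs_add[OF tu chains_zero_bits[OF c(2)]] dr])
  \<comment> \<open>The \<open>True\<close> half after the correction by u: a cycle, now with its
    empty-subset component among the relations.\<close>
  define y where "y b = zero_chain ps (?t n u) b + x1 b" for b
  have y: "y \<in> koszul_chains (per_funs f) ps (g * p)"
    using per.chains_add[OF per.zero_chain_in[OF tu] c(2)] by (simp only: y_def[abs_def])
  have "?D ps (n - 1) y b = 0" for b
  proof -
    have "?D ps (n - 1) y b = ?D ps (n - 1) (zero_chain ps (?t n u)) b + ?D ps (n - 1) x1 b"
      unfolding y_def[abs_def] by (rule dist.D_add)
    also have "\<dots> = 0" unfolding dist.D_zero_chain D1 dist.tate_bd_tate_bd
      by (simp only: zero_chain_def if_cancel add_0_right)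
    finally show ?thesis .
  qed
  moreover have "y ?zs \<in> rel_sub f ps (g * p)" using r1 by (simp only: y_def zero_chain_def simp_thms if_True)
  ultimately obtain z1' where z1': "z1' \<in> koszul_chains (per_funs f) ps (g * p)" "?D ps (n - 1 + 1) z1' = y" "z1' ?zs \<in> rel_sub f ps (g * p)"
    using Cons.IH[OF P dist d1 y] by blast
  define z1 where "z1 b = zero_chain ps u b - z1' b" for b
  have z1: "z1 \<in> koszul_chains (per_funs f) ps (g * p)"
    using per.chains_diff[OF per.zero_chain_in[OF u(1)] z1'(1)] by (simp only: z1_def[abs_def])
  have Dz1: "?D ps n z1 b = - x1 b" for b
  proof -
    have "?D ps n z1 b = ?D ps n (zero_chain ps u) b - ?D ps n z1' b"
      unfolding z1_def[abs_def] by (rule dist.D_diff)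
    also have "?D ps n z1' b = y b" using z1'(2) by simp
    finally show ?thesis unfolding dist.D_zero_chain y_def by (simp add: fun_eq_iff)
  qed
  \<comment> \<open>What is left of the \<open>False\<close> half once z1 is chosen as the
    \<open>True\<close> half of the bounding chain; the summand u inside z1 cancels the multiple of
    the relation at p.\<close>
  define w where "w b = x0 b - dist_rel p (z1 b)" for b
  have w: "w \<in> koszul_chains (per_funs f) ps g"
    unfolding w_def[abs_def] by (rule per.chains_diff[OF c(1) per.chains_r[OF _ z1]]) (use p0 in simp)
  have "?D ps n w b = 0" for b
  proof -
    have "?D ps n w b = ?D ps n x0 b - dist_rel p (?D ps n z1 b)"
      unfolding w_def[abs_def] dist.D_diff dist.D_r ..
    thus ?thesis using D0[of b] by (simp only: Dz1 dist.r_minus diff_minus_eq_add)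
  qed
  moreover have "w ?zs \<in> rel_sub f ps g"
  proof -
    have "w ?zs = \<rho> + dist_rel p (z1' ?zs)"
      unfolding w_def u(3) z1_def by (simp only: zero_chain_def simp_thms if_True dist.r_diff) (simp add: algebra_simps)
    thus ?thesis using rel_sub_add[OF u(2) rel_sub_dist_rel[OF p0 z1'(3)]] by (simp only:)
  qed
  ultimately obtain z0 where z0: "z0 \<in> koszul_chains (per_funs f) ps g" "?D ps (n + 1) z0 = w" "z0 ?zs \<in> rel_sub f ps g"
    using Cons.IH[OF P dist d0 w] by blast
  show ?case
  proof (intro bexI conjI)
    show "chain_cons z0 z1 \<in> koszul_chains (per_funs f) (p # ps) g" using z0 z1 by simp
    show "?D (p # ps) (n + 1) (chain_cons z0 z1) = x"
    proof (rule bits_eqI)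
      show "?D (p # ps) (n + 1) (chain_cons z0 z1) [] = x []" using c(3) by simp
      fix b
      show "?D (p # ps) (n + 1) (chain_cons z0 z1) (False # b) = x (False # b)"
        by (simp add: z0(2) w_def) (simp add: x0_def)
      show "?D (p # ps) (n + 1) (chain_cons z0 z1) (True # b) = x (True # b)"
        by (simp add: Dz1) (simp add: x1_def)
    qed
    show "chain_cons z0 z1 (zero_bits (p # ps)) \<in> rel_sub f (p # ps) g"
      using rel_sub_ConsI[OF per_funs_0 z0(3), of "z0 ?zs" p] by (simp only: list.map chain_cons_simps dist.r_0 add_0_left simp_thms)
  qed
qed

section \<open>Functions vanishing at zero\<close>

text \<open>The condition \<open>f dvd 2 * k\<close> singles out the residues fixed by negation: 0
  and, for even f, f / 2.\<close>

definition free_funs :: "int \<Rightarrow> nat \<Rightarrow> (int \<Rightarrow> int) set" where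
  "free_funs f g = {x \<in> per_funs f g. \<forall>k. f dvd 2 * k \<longrightarrow> x k = 0}"

definition zero_funs :: "int \<Rightarrow> nat \<Rightarrow> (int \<Rightarrow> int) set" where
  "zero_funs f g = {x \<in> per_funs f g. x 0 = 0}"

interpretation free: koszul_levels refl_fun dist_rel "free_funs f" "{p. p > 0}" for f
proof unfold_locales
  fix p x g assume "p \<in> {p. p > 0}" "x \<in> free_funs f (g * p)"
  moreover have "f dvd 2 * (int p * k)" if "f dvd 2 * k" for k p
    using dvd_mult[OF that, of "int p"] by (simp add: ac_simps)
  ultimately show "dist_rel p x \<in> free_funs f g"
    by (auto simp: free_funs_def per_funs_dist_rel) (simp add: dist_rel_def)
qed (auto simp: free_funs_def per_funs_0 per_funs_add per_funs_minus per_funs_refl, simp_all add: refl_fun_def)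

interpretation zero: koszul_levels refl_fun dist_rel "zero_funs f" "{p. p > 0}" for f
  by unfold_locales
    (auto simp: zero_funs_def per_funs_0 per_funs_add per_funs_minus per_funs_refl per_funs_dist_rel, simp_all add: refl_fun_def dist_rel_def)

text \<open>Off the fixed points of \<open>k \<mapsto> -k\<close> the involution permutes a basis freely, with the residues in
  the lower half as representatives.\<close>

lemma free_acyclic_Nil:
  assumes f: "f > 0"
  shows "free.acyclic f [] g"
  unfolding free.acyclic_def
proof (intro allI ballI impI)
  fix n x assume x: "x \<in> koszul_chains (free_funs f) [] g" and D: "\<forall>b. koszul_bd refl_fun dist_rel [] n x b = 0"
  define y where "y = x []"
  have y: "y \<in> per_funs f g" and y0: "\<And>k. f dvd 2 * k \<Longrightarrow> y k = 0" using x by (auto simp: y_def free_funs_def)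
  have t: "tate_bd refl_fun n y = 0" using D[rule_format, of "[]"] by (simp only: koszul_bd.simps y_def)
  have tk: "(if even n then y k + y (- k) else y k - y (- k)) = 0" for k
    using fun_cong[OF t, of k] by (simp add: tate_bd_def refl_fun_def split: if_splits)
  define z where "z k = (if 2 * (k mod f) < f then y k else 0)" for k
  have z: "z \<in> free_funs f g"
    using y y0 by (auto simp: z_def per_funs_def free_funs_def)
  have zz: "tate_bd refl_fun (n + 1) z k = y k" for k
  proof (cases "f dvd 2 * k")
    case True
    hence "f dvd 2 * (- k)" by simp
    thus ?thesis using y0[OF True] y0[of "- k"] by (simp add: tate_bd_def refl_fun_def z_def)
  next
    case False
    have "k mod f \<noteq> 0" using False by (auto simp: dvd_eq_mod_eq_0[symmetric])
    hence m: "(- k) mod f = f - k mod f" by (simp add: zmod_zminus1_eq_if)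
    have "2 * (k mod f) \<noteq> f"
    proof
      assume "2 * (k mod f) = f"
      hence "2 * k = f + f * (2 * (k div f))" by (metis mult_div_mod_eq add.commute distrib_left mult.left_commute)
      hence "f dvd 2 * k" by (metis dvd_add dvd_refl dvd_triv_left)
      thus False using False by simp
    qed
    thus ?thesis using tk[of k] by (auto simp: tate_bd_def refl_fun_def z_def m split: if_splits)
  qed
  show "\<exists>z\<in>koszul_chains (free_funs f) [] g. koszul_bd refl_fun dist_rel [] (n + 1) z = x"
  proof
    show "zero_chain [] z \<in> koszul_chains (free_funs f) [] g" by (rule free.zero_chain_in[OF z])
    show "koszul_bd refl_fun dist_rel [] (n + 1) (zero_chain [] z) = x"
    proof
      fix b
      have "tate_bd refl_fun (n + 1) z = x []" using zz by (auto simp: y_def)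
      thus "koszul_bd refl_fun dist_rel [] (n + 1) (zero_chain [] z) b = x b"
        unfolding dist.D_zero_chain using x by (auto simp: zero_chain_def)
    qed
  qed
qed

lemma free_acyclic:
  assumes "f > 0" "0 \<notin> set ps"
  shows "free.acyclic f ps g"
  using assms(2)
  by (induction ps arbitrary: g) (auto intro!: free_acyclic_Nil free.acyclic_Cons assms(1))

text \<open>For odd f the only residue fixed by negation is 0, so the two kinds of functions
  coincide.\<close>

lemma zero_acyclic_odd:
  assumes "f > 0" "odd f" "0 \<notin> set ps"
  shows "zero.acyclic f ps g"
proof -
  have "zero_funs f g = free_funs f g" for g
  proof -
    have "x k = 0" if x: "x \<in> per_funs f g" "x 0 = 0" and k: "f dvd 2 * k" for x k
    proof -
      have "coprime f 2" using assms(2) by (simp add: coprime_right_2_iff_odd)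
      hence "f dvd k" using k by (simp add: coprime_dvd_mult_right_iff)
      hence "[k = 0] (mod f)" by (simp add: cong_0_iff)
      thus ?thesis using per_funs_cong[OF x(1)] x(2) by metis
    qed
    thus ?thesis by (auto simp: zero_funs_def free_funs_def)
  qed
  hence "zero_funs f = free_funs f" by (rule ext)
  thus ?thesis using free_acyclic[OF assms(1,3)] by simp
qed

text \<open>The symbol \<open>1/2\<close> is fixed by the involution, but the relation at \<open>2\<close> cancels its contribution
  because \<open>1/4\<close> is a symbol, too.\<close>

lemma zero_acyclic_two:
  assumes f: "f > 0" and g: "int (4 * g) dvd f"
  shows "zero.acyclic f [2] g"
  unfolding zero.acyclic_def
proof (intro allI ballI impI)
  let ?D = "koszul_bd refl_fun dist_rel"
  fix n x assume x: "x \<in> koszul_chains (zero_funs f) [2] g" and D: "\<forall>b. ?D [2] n x b = 0"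
  obtain h where h: "f = 4 * int g * h" using g by auto
  define m where "m = f div 2"
  have m: "f = 2 * m" "m = 2 * int g * h" using h by (simp_all add: m_def)
  have m0: "0 < m" "m < f" using f m by auto
  have half: "[k = m] (mod f) \<longleftrightarrow> f dvd 2 * k \<and> \<not> f dvd k" for k
  proof -
    have "f dvd 2 * k \<longleftrightarrow> m dvd k" using m(1) by simp
    moreover have "f dvd k - m \<longleftrightarrow> m dvd k \<and> \<not> f dvd k"
    proof
      assume *: "f dvd k - m"
      have "m dvd f" using m(1) by simp
      hence "m dvd k - m" using * by (rule dvd_trans)
      hence "m dvd k" using dvd_add[of m "k - m" m] by simp
      moreover have "\<not> f dvd k"
      proof
        assume "f dvd k"
        hence "f dvd m" using dvd_diff[OF _ *, of k] by simp
        thus False using m0 by (simp add: zdvd_not_zless)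
      qed
      ultimately show "m dvd k \<and> \<not> f dvd k" by simp
    next
      assume *: "m dvd k \<and> \<not> f dvd k"
      then obtain l where l: "k = m * l" by blast
      hence "odd l" using * m(1) by auto
      then obtain l' where "l = 2 * l' + 1" by (rule oddE)
      hence "k - m = f * l'" using l m(1) by (simp add: algebra_simps)
      thus "f dvd k - m" by simp
    qed
    ultimately show ?thesis by (simp add: cong_iff_dvd_diff)
  qed
  define x0 where "x0 = x [False]"
  define x1 where "x1 = x [True]"
  have x0: "x0 \<in> per_funs f g" "x0 0 = 0" and x1: "x1 \<in> per_funs f (g * 2)" "x1 0 = 0"
    using x by (auto simp: x0_def x1_def zero_funs_def)
  have cong_m: "y (- m) = y m" "y (2 * m) = y 0" if "y \<in> per_funs f g'" for y g'
    using per_funs_cong[OF that] m(1) by (auto simp: cong_iff_dvd_diff)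
  have D0: "tate_bd refl_fun n x0 + dist_rel 2 x1 = 0"
    using D[rule_format, of "[False]"] by (simp only: koszul_bd.simps x0_def x1_def)
  have D1: "tate_bd refl_fun (n - 1) x1 = 0"
    using D[rule_format, of "[True]"] by (simp only: koszul_bd.simps x1_def neg_equal_0_iff_equal)
  define c where "c = x0 m"
  \<comment> \<open>At m = f / 2 the first cycle equation has no contribution from
    \<open>x1 (2 * m) = x1 0 = 0\<close>, so the value c of x0 at m determines the value of x1
    there.\<close>
  have c1: "x1 m + (if even n then 2 * c else 0) = 0"
    using fun_cong[OF D0, of m] fun_cong[OF D1, of m] cong_m[OF x0(1)] cong_m[OF x1(1)] x1(2)
    by (simp add: tate_bd_def refl_fun_def dist_rel_def c_def split: if_splits)
  \<comment> \<open>Placed in the \<open>True\<close> component, w has a boundary that agrees with x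
    at m in both components. It has the required level because 4 g divides f, so that m is a
    multiple of 2 g.\<close>
  define w where "w k = c * delta f m k" for k
  have "int (g * 2) dvd m" "int (g * 2) dvd f" using m by (auto simp: h mult.commute)
  hence w: "w \<in> per_funs f (g * 2)" unfolding w_def[abs_def] by (intro per_funs_scale delta_per_funs)
  have w0: "w 0 = 0" "w m = c" using half[of 0] m0 by (auto simp: w_def delta_def)
  have wz: "w \<in> zero_funs f (g * 2)" using w w0 by (simp add: zero_funs_def)
  define Z where "Z = chain_cons (\<lambda>b. 0) (zero_chain [] w)"
  have Z: "Z \<in> koszul_chains (zero_funs f) [2] g"
    using zero.zero_chain_in[OF wz, of "[]"] zero.A_0[of f g] by (simp add: Z_def)
  define y where "y b = x b - ?D [2] (n + 1) Z b" for b
  have "?D [2] (n + 1) Z \<in> koszul_chains (zero_funs f) [2] g" by (rule zero.chains_D[OF _ Z]) simp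
  hence yz: "y \<in> koszul_chains (zero_funs f) [2] g"
    unfolding y_def[abs_def] by (rule zero.chains_diff[OF x])
  have vanish: "v k = 0" if v: "v \<in> per_funs f g'" "v 0 = 0" "v m = 0" and k: "f dvd 2 * k" for v g' k
  proof (cases "f dvd k")
    case True
    hence "[k = 0] (mod f)" by (simp add: cong_0_iff)
    thus ?thesis using per_funs_cong[OF v(1)] v(2) by metis
  next
    case False
    hence "[k = m] (mod f)" using half k by simp
    thus ?thesis using per_funs_cong[OF v(1)] v(3) by metis
  qed
  have yF: "y [False] m = 0"
    using cong_m[OF w] w0 by (simp add: y_def Z_def x0_def[symmetric] c_def[symmetric] dist_rel_def zero_chain_def tate_bd_def refl_fun_def)
  have yT: "y [True] m = 0"
    using c1 cong_m[OF w] w0 by (auto simp: y_def Z_def x1_def[symmetric] zero_chain_def tate_bd_def refl_fun_def split: if_splits)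
  have yf: "y \<in> koszul_chains (free_funs f) [2] g"
    using yz yF yT by (auto simp: zero_funs_def free_funs_def intro: vanish)
  have Dy: "?D [2] n y b = 0" for b
  proof -
    have "?D [2] n y b = ?D [2] n x b - ?D [2] n (?D [2] (n + 1) Z) b" unfolding y_def[abs_def] by (rule dist.D_diff)
    thus ?thesis using D dist.DD1[of "[2]" n Z b] by (simp only: diff_0_right)
  qed
  have "free.acyclic f [2] g" by (rule free_acyclic[OF f]) simp
  from this[unfolded free.acyclic_def, rule_format, OF yf Dy]
  obtain z where z: "z \<in> koszul_chains (free_funs f) [2] g" "?D [2] (n + 1) z = y" by (elim bexE)
  have zz: "z \<in> koszul_chains (zero_funs f) [2] g"
    using z(1) by (auto simp: zero_funs_def free_funs_def)
  show "\<exists>z\<in>koszul_chains (zero_funs f) [2] g. ?D [2] (n + 1) z = x"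
  proof
    show "(\<lambda>b. z b + Z b) \<in> koszul_chains (zero_funs f) [2] g" by (rule zero.chains_add[OF zz Z])
    show "?D [2] (n + 1) (\<lambda>b. z b + Z b) = x"
    proof
      fix b
      have "?D [2] (n + 1) (\<lambda>b. z b + Z b) b = ?D [2] (n + 1) z b + ?D [2] (n + 1) Z b" by (rule dist.D_add)
      thus "?D [2] (n + 1) (\<lambda>b. z b + Z b) b = x b" by (simp only: z(2) y_def diff_add_cancel)
    qed
  qed
qed

text \<open>The complex for 2 alone is the base of the induction and the other primes are added as
  cones. Therefore 2 must come last in the list, and 4 g must divide f at every level g
  reached.\<close>

lemma zero_acyclic_even:
  assumes f: "f > 0" and "0 \<notin> set ps" "int (4 * g * prod_list ps) dvd f"
  shows "zero.acyclic f (ps @ [2]) g"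
  using assms(2,3)
proof (induction ps arbitrary: g)
  case Nil
  then show ?case using zero_acyclic_two[OF f, of g] by simp
next
  case (Cons p ps)
  have "4 * g * prod_list ps dvd 4 * g * prod_list (p # ps)" by simp
  hence "int (4 * g * prod_list ps) dvd f" using Cons.prems(2) by (meson dvd_trans of_nat_dvd_iff)
  moreover have "int (4 * (g * p) * prod_list ps) dvd f" using Cons.prems(2) by (simp add: mult.assoc)
  ultimately show ?case using Cons by (auto intro!: zero.acyclic_Cons)
qed

section \<open>Sign homology of the universal distribution\<close>

definition symbol :: "nat \<Rightarrow> int \<Rightarrow> rat set" where
  "symbol f k = qmodz (of_int k / of_nat f)"

text \<open>The passage from periodic functions to the free abelian group on symbols; on
  \<open>per_funs f 1\<close> it is bijective onto the carrier.\<close>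

definition symbol_sum :: "nat \<Rightarrow> (int \<Rightarrow> int) \<Rightarrow> rat set \<Rightarrow>\<^sub>0 int" where
  "symbol_sum f x = (\<Sum>k\<in>{0..<int f}. frag_cmul (x k) (frag_of (symbol f k)))"

lemma qmodz_eq_iff: "qmodz a = qmodz b \<longleftrightarrow> a - b \<in> \<int>"
proof
  assume "qmodz a = qmodz b"
  moreover have "a \<in> qmodz a" by (auto simp: qmodz_def intro: image_eqI[of _ _ 0])
  ultimately show "a - b \<in> \<int>" by (auto simp: qmodz_def)
next
  assume *: "a - b \<in> \<int>"
  hence **: "b - a \<in> \<int>" using Ints_minus by fastforce
  have sub: "qmodz a \<subseteq> qmodz b" if "a - b \<in> \<int>" for a b
  proof
    fix c assume "c \<in> qmodz a"
    then obtain i where i: "i \<in> \<int>" "c = a + i" by (auto simp: qmodz_def)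
    hence "c = b + ((a - b) + i)" "(a - b) + i \<in> \<int>" using that by auto
    thus "c \<in> qmodz b" unfolding qmodz_def by blast
  qed
  show "qmodz a = qmodz b" using sub[OF *] sub[OF **] by blast
qed

context
  fixes f :: nat assumes f: "f > 0"
begin

lemma symbol_eq_iff: "symbol f k = symbol f l \<longleftrightarrow> [k = l] (mod int f)"
proof -
  have "of_int k / of_nat f - of_int l / (of_nat f :: rat) = of_int (k - l) / of_int (int f)"
    by (simp add: diff_divide_distrib)
  also have "\<dots> \<in> \<int> \<longleftrightarrow> int f dvd k - l" using f by (subst of_int_div_of_int_in_Ints_iff) auto
  finally show ?thesis by (simp add: symbol_def qmodz_eq_iff cong_iff_dvd_diff)
qed

lemma dist_symbols_eq: "dist_symbols f = range (symbol f)"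
  by (auto simp: dist_symbols_def symbol_def)

lemma lookup_frag_symbol: "poly_mapping.lookup (frag_of (symbol f c)) (symbol f l) = delta (int f) c l"
  by (auto simp: lookup_frag_of symbol_eq_iff delta_def cong_sym_eq)

lemma lookup_symbol_sum: "x \<in> per_funs (int f) g \<Longrightarrow> poly_mapping.lookup (symbol_sum f x) (symbol f l) = x l"
  using per_funs_decompose[of "int f" x g l] f by (simp add: symbol_sum_def lookup_sum lookup_frag_symbol del: lookup_frag_of)

lemma keys_sum_frag: "finite K \<Longrightarrow> Poly_Mapping.keys (\<Sum>k\<in>K. frag_cmul (x k) (frag_of (symbol f (h k)))) \<subseteq> dist_symbols f"
proof (induction K rule: finite_induct)
  case (insert k K)
  have "Poly_Mapping.keys (frag_cmul (x k) (frag_of (symbol f (h k)))) \<subseteq> dist_symbols f"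
    using keys_cmul[of "x k" "frag_of (symbol f (h k))"] by (auto simp: keys_frag_of dist_symbols_eq)
  thus ?case using insert Poly_Mapping.keys_add[of "frag_cmul (x k) (frag_of (symbol f (h k)))"] by auto
qed simp

lemma keys_symbol_sum: "Poly_Mapping.keys (symbol_sum f x) \<subseteq> dist_symbols f"
  unfolding symbol_sum_def by (rule keys_sum_frag) simp

lemma symbol_sum_eqI:
  assumes "x \<in> per_funs (int f) g" "Poly_Mapping.keys y \<subseteq> dist_symbols f" "\<And>l. poly_mapping.lookup y (symbol f l) = x l"
  shows "symbol_sum f x = y"
proof (rule poly_mapping_eqI)
  fix s
  show "poly_mapping.lookup (symbol_sum f x) s = poly_mapping.lookup y s"
  proof (cases "s \<in> dist_symbols f")
    case True
    then obtain l where "s = symbol f l" by (auto simp: dist_symbols_eq)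
    thus ?thesis using lookup_symbol_sum[OF assms(1)] assms(3) by simp
  next
    case False
    thus ?thesis using assms(2) keys_symbol_sum[of x] by (metis in_keys_iff subsetD)
  qed
qed

lemma symbol_sum_add: "symbol_sum f (x + y) = symbol_sum f x + symbol_sum f y"
  by (simp add: symbol_sum_def frag_cmul_distrib sum.distrib)

lemma symbol_sum_0: "symbol_sum f 0 = 0"
  by (simp add: symbol_sum_def)

lemma symbol_sum_minus: "symbol_sum f (- x) = - symbol_sum f x"
  using symbol_sum_add[of x "- x"] by (simp add: symbol_sum_0 eq_neg_iff_add_eq_0 add.commute)

lemma symbol_sum_scale: "symbol_sum f (\<lambda>k. m * x k) = frag_cmul m (symbol_sum f x)"
  by (simp add: symbol_sum_def frag_cmul_sum o_def)

lemma symbol_sum_surj: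
  assumes "Poly_Mapping.keys y \<subseteq> dist_symbols f"
  shows "\<exists>x\<in>per_funs (int f) 1. symbol_sum f x = y"
proof
  have "symbol f (k + int f) = symbol f k" for k by (simp add: symbol_eq_iff cong_iff_dvd_diff)
  thus x: "(\<lambda>k. poly_mapping.lookup y (symbol f k)) \<in> per_funs (int f) 1" by (simp add: per_funs_def)
  show "symbol_sum f (\<lambda>k. poly_mapping.lookup y (symbol f k)) = y" by (rule symbol_sum_eqI[OF x assms]) simp
qed

lemma symbol_negate: "(\<lambda>x. of_int (- 1) * x) ` symbol f k = symbol f (- k)"
proof -
  have "(\<lambda>x. of_int (- 1) * x) ` symbol f k = (+) (- (of_int k / of_nat f)) ` (uminus ` \<int>)"
    by (auto simp: symbol_def qmodz_def image_image)
  also have "uminus ` \<int> = (\<int> :: rat set)"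
    by (auto simp: image_iff) (metis Ints_minus minus_minus)
  finally show ?thesis by (simp add: symbol_def qmodz_def)
qed

lemma symbol_sum_refl:
  assumes "x \<in> per_funs (int f) g"
  shows "frag_extend (\<lambda>s. frag_of ((\<lambda>x. of_int (- 1) * x) ` s)) (symbol_sum f x) = symbol_sum f (refl_fun x)"
proof -
  have e: "frag_extend (\<lambda>s. frag_of ((\<lambda>x. of_int (- 1) * x) ` s)) (symbol_sum f x)
      = (\<Sum>k\<in>{0..<int f}. frag_cmul (x k) (frag_of (symbol f (- k))))"
    unfolding symbol_sum_def by (simp only: frag_extend_sum finite_atLeastLessThan_int frag_extend_cmul frag_extend_of symbol_negate o_def)
  show ?thesis unfolding e
  proof (rule symbol_sum_eqI[symmetric, OF per_funs_refl[OF assms] keys_sum_frag])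
    fix l
    have "delta (int f) (- k) l = delta (int f) k (- l)" for k
      using cong_minus_minus_iff[of l "- k" "int f"] by (simp add: delta_def)
    thus "poly_mapping.lookup (\<Sum>k\<in>{0..<int f}. frag_cmul (x k) (frag_of (symbol f (- k)))) (symbol f l) = refl_fun x l"
      using per_funs_decompose[OF _ assms, of "- l"] f by (simp add: lookup_sum lookup_frag_symbol refl_fun_def del: lookup_frag_of)
  qed simp
qed

text \<open>With h = f / g, the symbols (a + i) / g correspond to the residues k + i h for i < g,
  which are exactly the solutions l of g l = g k modulo f.\<close>

lemma symbol_sum_relation:
  assumes g: "g > 0" "g dvd f" and a: "a = of_int k * (of_nat g / of_nat f)"
  shows "frag_of (qmodz a) - (\<Sum>i<g. frag_of (qmodz ((a + of_nat i) / of_nat g)))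
    = symbol_sum f (dist_rel g (delta (int f) (int g * k)))"
proof -
  obtain h where h: "f = g * h" using g by blast
  have h0: "h > 0" using f h by (simp add: gr0I)
  have s0: "qmodz a = symbol f (int g * k)" by (simp add: symbol_def a mult.commute)
  have si: "qmodz ((a + of_nat i) / of_nat g) = symbol f (k + int i * int h)" for i
  proof -
    have "(a + of_nat i) / of_nat g = of_int (k + int i * int h) / of_nat f"
      using g(1) h0 by (simp add: a h field_simps)
    thus ?thesis by (simp add: symbol_def)
  qed
  have d: "delta (int f) (int g * k) \<in> per_funs (int f) (1 * g)"
    using g by (intro delta_per_funs) auto
  have count: "(\<Sum>i<g. delta (int f) (k + int i * int h) l) = delta (int f) (int g * k) (int g * l)" for l
  proof (cases "int h dvd l - k")
    case True
    then obtain m where m: "l = k + int h * m" by (metis add.commute diff_add_cancel dvdE)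
    have "[l = k + int i * int h] (mod int f) \<longleftrightarrow> i = nat (m mod int g)" if "i < g" for i
    proof -
      have "[l = k + int i * int h] (mod int f) \<longleftrightarrow> int h * int g dvd int h * (m - int i)"
        by (simp add: cong_iff_dvd_diff m h algebra_simps)
      also have "\<dots> \<longleftrightarrow> int g dvd m - int i" using h0 by simp
      also have "\<dots> \<longleftrightarrow> m mod int g = int i mod int g" by (simp add: mod_eq_dvd_iff)
      also have "\<dots> \<longleftrightarrow> i = nat (m mod int g)" using that by auto
      finally show ?thesis .
    qed
    hence "(\<Sum>i<g. delta (int f) (k + int i * int h) l) = (\<Sum>i<g. if i = nat (m mod int g) then 1 else 0)"
      by (intro sum.cong) (auto simp: delta_def)
    also have "\<dots> = 1" using g(1) by (simp add: nat_less_iff)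
    also have "[int g * l = int g * k] (mod int f)" by (simp add: cong_iff_dvd_diff m h algebra_simps)
    hence "1 = delta (int f) (int g * k) (int g * l)" by (simp add: delta_def)
    finally show ?thesis .
  next
    case False
    have "\<not> [l = k + int i * int h] (mod int f)" for i
    proof
      assume "[l = k + int i * int h] (mod int f)"
      hence "[l = k + int i * int h] (mod int h)" by (rule cong_dvd_modulus) (simp add: h)
      hence "int h dvd (l - k) - int i * int h" by (simp add: cong_iff_dvd_diff diff_diff_eq)
      thus False using False by (metis diff_add_cancel dvd_add dvd_triv_right)
    qed
    moreover have "\<not> [int g * l = int g * k] (mod int f)"
    proof
      assume "[int g * l = int g * k] (mod int f)"
      hence "int g * int h dvd int g * (l - k)" by (simp add: cong_iff_dvd_diff h algebra_simps)
      thus False using False g(1) by simp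
    qed
    ultimately show ?thesis by (simp add: delta_def)
  qed
  have keys_sum: "Poly_Mapping.keys (\<Sum>i<g. frag_of (symbol f (k + int i * int h))) \<subseteq> dist_symbols f"
    using keys_sum_frag[of "{..<g}" "\<lambda>_. 1" "\<lambda>i. k + int i * int h"] by simp
  show ?thesis unfolding s0 si
  proof (rule symbol_sum_eqI[symmetric, OF per_funs_dist_rel[OF g(1) d]])
    show "Poly_Mapping.keys (frag_of (symbol f (int g * k)) - (\<Sum>i<g. frag_of (symbol f (k + int i * int h)))) \<subseteq> dist_symbols f"
      using keys_diff[of "frag_of (symbol f (int g * k))" "\<Sum>i<g. frag_of (symbol f (k + int i * int h))"] keys_sum
      by (auto simp: keys_frag_of dist_symbols_eq)
    fix l
    show "poly_mapping.lookup (frag_of (symbol f (int g * k)) - (\<Sum>i<g. frag_of (symbol f (k + int i * int h)))) (symbol f l) =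
      dist_rel g (delta (int f) (int g * k)) l"
      by (simp add: lookup_minus lookup_sum lookup_frag_symbol count dist_rel_def del: lookup_frag_of)
  qed
qed

abbreviation "F \<equiv> free_Abelian_group (dist_symbols f)"

lemma dist_relations_sub: "dist_relations f \<subseteq> carrier F"
  using symbol_sum_relation keys_symbol_sum unfolding dist_relations_def by fastforce

lemma subgroup_dist_relation_sub: "subgroup (dist_relation_sub f) F"
  unfolding dist_relation_sub_def by (rule group.generate_is_subgroup[OF group_free_Abelian_group dist_relations_sub])

context
  fixes ps :: "nat list" assumes ps: "set ps = {p. Factorial_Ring.prime p \<and> p dvd f}"
begin

text \<open>The defining relations are indexed by all divisors g. For g = h p the difference x(k) -
  x(g k) is the sum of x(k) - x(p k) and x(p k) - x(h p k), so the relations at primes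
  suffice.\<close>

lemma dist_rel_in_rel_sub:
  "g > 0 \<Longrightarrow> g dvd f \<Longrightarrow> x \<in> per_funs (int f) g \<Longrightarrow> dist_rel g x \<in> rel_sub (int f) ps 1"
proof (induction g arbitrary: x rule: less_induct)
  case (less g)
  show ?case
  proof (cases "g = 1")
    case True
    have "dist_rel g x = 0" by (simp add: True dist_rel_def fun_eq_iff)
    thus ?thesis using rel_sub_0[of "int f" ps 1] by (simp only:)
  next
    case False
    then obtain p where p: "Factorial_Ring.prime p" "p dvd g" using prime_factor_nat by blast
    then obtain h where h: "g = h * p" by (metis dvdE mult.commute)
    have p0: "p > 1" using prime_gt_1_nat[OF p(1)] .
    have h0: "h > 0" "h < g" "h dvd f" using less.prems h p0 by (auto intro: gr0I dest: dvd_mult_left)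
    have pps: "p \<in> set ps" using p less.prems(2) ps by (auto intro: dvd_trans)
    have x: "x \<in> per_funs (int f) (h * p)" using less.prems(3) h by simp
    have xp: "(\<lambda>k. x (int p * k)) \<in> per_funs (int f) h" using per_funs_shift[OF _ x] p0 by simp
    have "x \<in> per_funs (int f) (1 * p)" using per_funs_mono[of x "int f" p h] x by (simp add: mult.commute)
    hence "dist_rel p x \<in> rel_sub (int f) ps 1" by (rule rel_sub_gen[OF pps])
    hence "dist_rel p x + dist_rel h (\<lambda>k. x (int p * k)) \<in> rel_sub (int f) ps 1"
      using less.IH[OF h0(2,1,3) xp] by (rule rel_sub_add)
    moreover have "dist_rel p x + dist_rel h (\<lambda>k. x (int p * k)) = dist_rel g x"
      by (simp add: fun_eq_iff dist_rel_def h ac_simps)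
    ultimately show ?thesis by (simp only:)
  qed
qed

lemma symbol_sum_rel_sub:
  assumes "\<rho> \<in> rel_sub (int f) qs 1" "set qs \<subseteq> set ps"
  shows "symbol_sum f \<rho> \<in> dist_relation_sub f"
  using assms
proof (induction qs arbitrary: \<rho>)
  case Nil
  hence "symbol_sum f \<rho> = \<one>\<^bsub>F\<^esub>" by (simp add: symbol_sum_0)
  thus ?case using subgroup.one_closed[OF subgroup_dist_relation_sub] by simp
next
  case (Cons p qs)
  obtain u \<rho>' where u: "u \<in> per_funs (int f) (1 * p)" "\<rho>' \<in> rel_sub (int f) qs 1" "\<rho> = dist_rel p u + \<rho>'"
    using Cons.prems(1) by (rule rel_sub_ConsE)
  have p: "p > 0" "p dvd f" using Cons.prems(2) ps by (auto intro: prime_gt_0_nat)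
  have "symbol_sum f (dist_rel p u) \<in> dist_relation_sub f"
  proof (rule per_funs_induct[OF _ u(1), of "\<lambda>u. symbol_sum f (dist_rel p u) \<in> dist_relation_sub f"])
    show "int f > 0" using f by simp
    show "symbol_sum f (dist_rel p 0) \<in> dist_relation_sub f"
      using subgroup.one_closed[OF subgroup_dist_relation_sub] by (simp only: dist.r_0 symbol_sum_0 one_free_Abelian_group)
  next
    fix x z assume "symbol_sum f (dist_rel p x) \<in> dist_relation_sub f" "symbol_sum f (dist_rel p z) \<in> dist_relation_sub f"
    thus "symbol_sum f (dist_rel p (x + z)) \<in> dist_relation_sub f"
      using subgroup.m_closed[OF subgroup_dist_relation_sub] by (simp only: dist.r_add symbol_sum_add mult_free_Abelian_group)
  next
    fix c assume "u c \<noteq> 0"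
    hence "int p dvd c" using per_funs_support[OF u(1)] by simp
    then obtain k where k: "c = int p * k" ..
    have "frag_of (qmodz (of_int k * (of_nat p / of_nat f))) - (\<Sum>i<p. frag_of (qmodz ((of_int k * (of_nat p / of_nat f) + of_nat i) / of_nat p)))
        \<in> dist_relations f"
      unfolding dist_relations_def using p by blast
    hence "symbol_sum f (dist_rel p (delta (int f) c)) \<in> dist_relations f"
      by (simp only: symbol_sum_relation[OF p refl] k)
    hence s: "symbol_sum f (dist_rel p (delta (int f) c)) \<in> dist_relation_sub f"
      unfolding dist_relation_sub_def by (rule generate.incl)
    have "dist_rel p (\<lambda>k. u c * delta (int f) c k) = (\<lambda>k. u c * dist_rel p (delta (int f) c) k)"
      by (simp add: fun_eq_iff dist_rel_def algebra_simps)
    hence "symbol_sum f (dist_rel p (\<lambda>k. u c * delta (int f) c k)) = frag_cmul (u c) (symbol_sum f (dist_rel p (delta (int f) c)))"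
      by (simp only: symbol_sum_scale)
    also have "\<dots> = symbol_sum f (dist_rel p (delta (int f) c)) [^]\<^bsub>F\<^esub> u c"
      using keys_symbol_sum by simp
    also have "\<dots> \<in> dist_relation_sub f"
      by (rule group.subgroup_int_pow_closed[OF group_free_Abelian_group subgroup_dist_relation_sub s])
    finally show "symbol_sum f (dist_rel p (\<lambda>k. u c * delta (int f) c k)) \<in> dist_relation_sub f" .
  qed
  moreover have "symbol_sum f \<rho>' \<in> dist_relation_sub f" using Cons.IH[OF u(2)] Cons.prems(2) by simp
  ultimately show ?case unfolding u(3) symbol_sum_add
    using subgroup.m_closed[OF subgroup_dist_relation_sub] by (simp only: mult_free_Abelian_group)
qed

text \<open>Both directions go through generators: each relation at a divisor is a combination of
  relations at primes, and relations at primes applied to arbitrary functions reduce to delta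
  functions.\<close>

lemma symbol_sum_in_relations_iff:
  assumes x: "x \<in> per_funs (int f) 1"
  shows "symbol_sum f x \<in> dist_relation_sub f \<longleftrightarrow> x \<in> rel_sub (int f) ps 1"
proof
  assume "x \<in> rel_sub (int f) ps 1"
  thus "symbol_sum f x \<in> dist_relation_sub f" by (rule symbol_sum_rel_sub) simp
next
  have gen: "\<exists>\<rho>\<in>rel_sub (int f) ps 1. y = symbol_sum f \<rho>" if y: "y \<in> dist_relations f" for y
  proof -
    obtain g a k where gak: "g > 0" "g dvd f" "a = of_int k * (of_nat g / of_nat f)"
      "y = frag_of (qmodz a) - (\<Sum>i<g. frag_of (qmodz ((a + of_nat i) / of_nat g)))"
      using y unfolding dist_relations_def by blast
    have "delta (int f) (int g * k) \<in> per_funs (int f) g"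
      using gak(2) by (intro delta_per_funs) auto
    thus ?thesis using dist_rel_in_rel_sub[OF gak(1,2)] symbol_sum_relation[OF gak(1-3)] gak(4) by blast
  qed
  have all: "\<exists>\<rho>\<in>rel_sub (int f) ps 1. y = symbol_sum f \<rho>" if "y \<in> generate F (dist_relations f)" for y
    using that
  proof (induction rule: generate.induct)
    case one
    show ?case by (rule bexI[OF _ rel_sub_0]) (simp only: symbol_sum_0 one_free_Abelian_group)
  next
    case (incl h)
    then show ?case using gen by simp
  next
    case (inv h)
    then obtain \<rho> where \<rho>: "\<rho> \<in> rel_sub (int f) ps 1" "h = symbol_sum f \<rho>" using gen by blast
    have "inv\<^bsub>F\<^esub> h = symbol_sum f (- \<rho>)"
      unfolding \<rho>(2) symbol_sum_minus by (rule inv_free_Abelian_group[OF keys_symbol_sum])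
    then show ?case using rel_sub_minus[OF \<rho>(1)] by blast
  next
    case (eng h1 h2)
    then obtain \<rho>1 \<rho>2 where "\<rho>1 \<in> rel_sub (int f) ps 1" "h1 = symbol_sum f \<rho>1"
      "\<rho>2 \<in> rel_sub (int f) ps 1" "h2 = symbol_sum f \<rho>2" by blast
    moreover from this have "h1 \<otimes>\<^bsub>F\<^esub> h2 = symbol_sum f (\<rho>1 + \<rho>2)"
      by (simp only: symbol_sum_add mult_free_Abelian_group)
    ultimately show ?case using rel_sub_add by blast
  qed
  assume "symbol_sum f x \<in> dist_relation_sub f"
  hence "\<exists>\<rho>\<in>rel_sub (int f) ps 1. symbol_sum f x = symbol_sum f \<rho>"
    unfolding dist_relation_sub_def by (rule all)
  then obtain \<rho> where \<rho>: "\<rho> \<in> rel_sub (int f) ps 1" "symbol_sum f x = symbol_sum f \<rho>" by blast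
  have "0 \<notin> set ps" using ps by (auto simp: not_prime_0)
  hence "\<rho> \<in> per_funs (int f) 1" using rel_sub_per_funs \<rho>(1) by blast
  hence "x = \<rho>" using lookup_symbol_sum[OF x] lookup_symbol_sum[of \<rho> 1] \<rho>(2) by (intro ext) metis
  thus "x \<in> rel_sub (int f) ps 1" using \<rho>(1) by simp
qed

end

end

lemma group_chain_homology:
  assumes C: "\<And>n. comm_group (C n)" and d: "\<And>n. d n \<in> hom (C n) (C (n - 1))"
    and dd: "\<And>n x. x \<in> carrier (C n) \<Longrightarrow> d (n - 1) (d n x) = \<one>\<^bsub>C (n - 2)\<^esub>"
  shows "group (chain_homology C d n)"
proof -
  have Cg: "group (C n)" for n using C by (auto simp: comm_group_def)
  have dg: "group_hom (C n) (C (n - 1)) (d n)" for n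
    using Cg d by (auto simp: group_hom_def group_hom_axioms_def)
  have dg1: "group_hom (C (n + 1)) (C n) (d (n + 1))" using dg[of "n + 1"] by auto
  interpret dn: group_hom "C n" "C (n - 1)" "d n" by (rule dg)
  interpret d1: group_hom "C (n + 1)" "C n" "d (n + 1)" by (rule dg1)
  let ?Z = "kernel (C n) (C (n - 1)) (d n)"
  have Z: "subgroup ?Z (C n)" by (rule dn.subgroup_kernel)
  have B: "subgroup (boundaries C d n) (C n)" unfolding boundaries_def by (rule d1.img_is_subgroup)
  have BZ: "boundaries C d n \<subseteq> ?Z" unfolding boundaries_def kernel_def using dd[of _ "n + 1"] by auto
  interpret G: comm_group "(C n)\<lparr>carrier := ?Z\<rparr>" by (rule comm_group_imp_comm_group_subgroup[OF C Z])
  show ?thesis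
    unfolding chain_homology_def
    by (rule normal.factorgroup_is_group[OF G.subgroup_imp_normal[OF dn.G.subgroup_incl[OF B Z BZ]]])
qed

text \<open>Together with \<open>triv_rel\<close>, the operators that remain at the symbol [0] on
  one side and on coinvariants on the other: the identity and zero. The resulting complex is where
  the two sides meet.\<close>

definition triv_inv :: "int \<Rightarrow> int" where "triv_inv x = x"

definition triv_rel :: "nat \<Rightarrow> int \<Rightarrow> int" where "triv_rel p x = 0"

interpretation triv: koszul_levels triv_inv triv_rel "\<lambda>g. UNIV" UNIV
  by unfold_locales (simp_all add: triv_inv_def triv_rel_def)

text \<open>A section of evaluation at 0. The delta function at 0 has level g only because g divides
  f, as every product of distinct primes dividing f does.\<close>

lemma koszul_chains_delta:
  "y \<in> koszul_chains (\<lambda>g. UNIV) qs g \<Longrightarrow> int (g * prod_list qs) dvd f \<Longrightarrow>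
    (\<lambda>b k. y b * delta f 0 k) \<in> koszul_chains (per_funs f) qs g"
proof (induction qs arbitrary: y g)
  case Nil
  then show ?case by (auto intro!: per_funs_scale delta_per_funs simp: fun_eq_iff)
next
  case (Cons q qs)
  have "g * prod_list qs dvd g * prod_list (q # qs)" by simp
  hence "int (g * prod_list qs) dvd f" using Cons.prems(2) by (meson dvd_trans of_nat_dvd_iff)
  moreover have "int (g * q * prod_list qs) dvd f" using Cons.prems(2) by (simp add: mult.assoc)
  ultimately show ?case using Cons by (auto simp: fun_eq_iff)
qed

lemma coprime_prod_list: "(\<And>r. r \<in> set qs \<Longrightarrow> coprime q r) \<Longrightarrow> coprime q (prod_list qs)" for q :: nat
  by (induction qs) (simp_all add: coprime_mult_right_iff)

text \<open>The order of the primes is fixed only as far as 2 comes last, in the form required by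
  \<open>zero_acyclic_even\<close>.\<close>

locale level =
  fixes f :: nat and ps :: "nat list"
  assumes f: "f > 0" and f4: "f mod 4 \<noteq> 2" and distinct_ps: "distinct ps"
    and ps: "set ps = {p. Factorial_Ring.prime p \<and> p dvd f}"
    and two_last: "even f \<Longrightarrow> \<exists>qs. ps = qs @ [2]"
begin

lemma primes: "q \<in> set ps \<Longrightarrow> int q \<in> prime_factors (int f)"
  using ps f by (auto simp: in_prime_factors_iff)

lemma pos_ps: "set ps \<subseteq> {p. p > 0}"
  using ps by (auto intro: prime_gt_0_nat)

lemma prod_list_dvd: "distinct qs \<Longrightarrow> set qs \<subseteq> set ps \<Longrightarrow> prod_list qs dvd f"
proof (induction qs)
  case (Cons q qs)
  have "coprime q (prod_list qs)"
  proof -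
    have "coprime q r" if "r \<in> set qs" for r
      using that Cons.prems ps by (intro primes_coprime) auto
    thus ?thesis by (rule coprime_prod_list)
  qed
  moreover have "q dvd f" using Cons.prems ps by auto
  ultimately show ?case using Cons by (auto intro: divides_mult)
qed simp

lemma zero_acyclic: "zero.acyclic (int f) ps 1"
proof (cases "even f")
  case False
  thus ?thesis using f pos_ps by (intro zero_acyclic_odd) auto
next
  case True
  then obtain qs where qs: "ps = qs @ [2]" using two_last by blast
  \<comment> \<open>The only use of f mod 4 \<noteq> 2: for even f the prime 2 divides f at least
    twice.\<close>
  have "4 dvd f" using True f4 by presburger
  moreover have "prod_list qs dvd f" using distinct_ps qs by (intro prod_list_dvd) auto
  moreover have "coprime 4 (prod_list qs)"
  proof -
    have "odd r" if "r \<in> set qs" for r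
    proof
      assume "even r"
      moreover have "Factorial_Ring.prime r" using that qs ps by auto
      ultimately have "r = 2" by (metis primes_dvd_imp_eq two_is_prime_nat)
      thus False using that distinct_ps qs by simp
    qed
    hence "odd (prod_list qs)" by (induction qs) auto
    hence "coprime (2 ^ 2) (prod_list qs)" by (simp only: coprime_power_left_iff coprime_left_2_iff_odd simp_thms)
    thus ?thesis by simp
  qed
  ultimately have "4 * prod_list qs dvd f" by (intro divides_mult)
  hence "int (4 * 1 * prod_list qs) dvd int f" by (simp only: of_nat_dvd_iff mult_1_right)
  thus ?thesis unfolding qs using f pos_ps qs by (intro zero_acyclic_even) auto
qed

definition dist_class :: "(int \<Rightarrow> int) \<Rightarrow> (rat set \<Rightarrow>\<^sub>0 int) set" where
  "dist_class v = dist_relation_sub f #>\<^bsub>free_Abelian_group (dist_symbols f)\<^esub> symbol_sum f v"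

abbreviation "FA \<equiv> free_Abelian_group (dist_symbols f)"

lemma symbol_sum_carrier: "symbol_sum f v \<in> carrier FA"
  using keys_symbol_sum[OF f] by simp

lemma comm_group_univ_dist: "comm_group (univ_dist f)"
  using comm_group.abelian_FactGroup[OF abelian_free_Abelian_group subgroup_dist_relation_sub[OF f]]
  by (simp add: univ_dist_def)

lemma carrier_univ_dist: "carrier (univ_dist f) = dist_class ` per_funs (int f) 1"
proof -
  have "carrier FA = symbol_sum f ` per_funs (int f) 1"
  proof
    show "carrier FA \<subseteq> symbol_sum f ` per_funs (int f) 1"
    proof
      fix y assume "y \<in> carrier FA"
      hence "Poly_Mapping.keys y \<subseteq> dist_symbols f" by simp
      from symbol_sum_surj[OF f this] show "y \<in> symbol_sum f ` per_funs (int f) 1" by blast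
    qed
    show "symbol_sum f ` per_funs (int f) 1 \<subseteq> carrier FA" using symbol_sum_carrier by blast
  qed
  moreover have "carrier (univ_dist f) = (\<lambda>y. dist_relation_sub f #>\<^bsub>FA\<^esub> y) ` carrier FA"
    by (auto simp: univ_dist_def FactGroup_def RCOSETS_def simp del: carrier_free_Abelian_group_iff)
  ultimately show ?thesis by (auto simp: dist_class_def)
qed

lemma dist_class_carrier: "v \<in> per_funs (int f) 1 \<Longrightarrow> dist_class v \<in> carrier (univ_dist f)"
  by (simp add: carrier_univ_dist)

lemma dist_class_add: "dist_class (u + v) = dist_class u \<otimes>\<^bsub>univ_dist f\<^esub> dist_class v"
proof -
  have "dist_relation_sub f \<lhd> FA"
    by (rule comm_group.subgroup_imp_normal[OF abelian_free_Abelian_group subgroup_dist_relation_sub[OF f]])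
  from normal.rcos_sum[OF this symbol_sum_carrier[of u] symbol_sum_carrier[of v]]
  show ?thesis by (simp add: dist_class_def univ_dist_def FactGroup_def symbol_sum_add[OF f])
qed

lemma dist_class_one_iff:
  assumes "v \<in> per_funs (int f) 1"
  shows "dist_class v = \<one>\<^bsub>univ_dist f\<^esub> \<longleftrightarrow> v \<in> rel_sub (int f) ps 1"
proof -
  have "dist_relation_sub f #>\<^bsub>FA\<^esub> symbol_sum f v = dist_relation_sub f \<longleftrightarrow> symbol_sum f v \<in> dist_relation_sub f"
    using group.coset_join2[OF group_free_Abelian_group symbol_sum_carrier subgroup_dist_relation_sub[OF f]]
      group.rcos_self[OF group_free_Abelian_group symbol_sum_carrier subgroup_dist_relation_sub[OF f]] by metis
  thus ?thesis using symbol_sum_in_relations_iff[OF f ps assms]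
    by (simp add: dist_class_def univ_dist_def FactGroup_def)
qed

lemma dist_class_minus:
  assumes "v \<in> per_funs (int f) 1"
  shows "dist_class (- v) = inv\<^bsub>univ_dist f\<^esub> (dist_class v)"
proof -
  interpret U: comm_group "univ_dist f" by (rule comm_group_univ_dist)
  have "v + (- v) = 0" by simp
  hence "dist_class v \<otimes>\<^bsub>univ_dist f\<^esub> dist_class (- v) = dist_class 0" using dist_class_add[of v "- v"] by (simp only:)
  also have "\<dots> = \<one>\<^bsub>univ_dist f\<^esub>" using dist_class_one_iff[OF per_funs_0] rel_sub_0 by blast
  finally show ?thesis
    using U.inv_equality[of "dist_class (- v)" "dist_class v"] dist_class_carrier[OF assms]
      dist_class_carrier[OF per_funs_minus[OF assms]] by (simp add: U.m_comm)
qed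

lemma dist_class_refl:
  assumes v: "v \<in> per_funs (int f) 1"
  shows "act (univ_dist f) (- 1) (dist_class v) = dist_class (refl_fun v)"
proof -
  let ?h = "frag_extend (\<lambda>s. frag_of ((\<lambda>x. of_int (- 1) * x) ` s) :: rat set \<Rightarrow>\<^sub>0 int)"
  have sur: "\<exists>x\<in>per_funs (int f) 1. symbol_sum f x = y" if "y \<in> carrier FA" for y
    using symbol_sum_surj[OF f] that by simp
  have "?h \<in> hom FA FA"
  proof (rule homI)
    fix y assume "y \<in> carrier FA"
    then obtain x where "x \<in> per_funs (int f) 1" "y = symbol_sum f x" using sur by blast
    thus "?h y \<in> carrier FA" using symbol_sum_refl[OF f] symbol_sum_carrier by (simp only:)
  qed (simp add: frag_extend_add)
  moreover have "?h ` dist_relation_sub f \<subseteq> dist_relation_sub f"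
  proof
    fix z assume "z \<in> ?h ` dist_relation_sub f"
    then obtain y where y: "y \<in> dist_relation_sub f" "z = ?h y" by blast
    then obtain x where x: "x \<in> per_funs (int f) 1" "y = symbol_sum f x"
      using sur subgroup.mem_carrier[OF subgroup_dist_relation_sub[OF f]] by blast
    hence "refl_fun x \<in> rel_sub (int f) ps 1"
      using y symbol_sum_in_relations_iff[OF f ps x(1)] rel_sub_refl by blast
    hence "symbol_sum f (refl_fun x) \<in> dist_relation_sub f" using symbol_sum_rel_sub[OF f ps] by blast
    thus "z \<in> dist_relation_sub f" using y(2) x symbol_sum_refl[OF f] by (simp only:)
  qed
  ultimately have "quot_map FA (dist_relation_sub f) ?h (dist_relation_sub f #>\<^bsub>FA\<^esub> symbol_sum f v)
      = dist_relation_sub f #>\<^bsub>FA\<^esub> ?h (symbol_sum f v)"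
    using subgroup_dist_relation_sub[OF f] symbol_sum_carrier by (intro quot_map_coset) auto
  thus ?thesis unfolding symbol_sum_refl[OF f v] by (simp add: univ_dist_def dist_class_def)
qed

lemma sign_bd_dist_class:
  assumes v: "v \<in> per_funs (int f) 1"
  shows "sign_bd (univ_dist f) n (dist_class v) = dist_class (tate_bd refl_fun n v)"
proof -
  have "dist_class (v - refl_fun v) = dist_class (v + (- refl_fun v))" by (simp only: add_uminus_conv_diff)
  thus ?thesis
    by (simp only: sign_bd_def tate_bd_def dist_class_refl[OF v] dist_class_add dist_class_minus[OF per_funs_refl[OF v]] split: if_split) simp
qed

lemma homology_chains_iso_sign_homology:
  "chain_homology (\<lambda>_. per.chain_group (int f) ps 1) (koszul_bd refl_fun dist_rel ps) n \<cong> sign_homology (univ_dist f) n"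
  unfolding sign_homology_def
proof (rule chain_homology_iso_of_acyclic_kernel[where h = "\<lambda>n x. dist_class (x (zero_bits ps))"])
  let ?D = "koszul_bd refl_fun dist_rel ps" and ?zs = "zero_bits ps"
  interpret U: comm_group "univ_dist f" by (rule comm_group_univ_dist)
  have ps0: "0 \<notin> set ps" using pos_ps by auto
  have tate: "tate_bd refl_fun n v \<in> per_funs (int f) 1" if "v \<in> per_funs (int f) 1" for n v
    unfolding tate_bd_def using that by (auto intro: per_funs_add per_funs_diff per_funs_refl)
  have zs: "x ?zs \<in> per_funs (int f) 1" if "x \<in> koszul_chains (per_funs (int f)) ps 1" for x
    using chains_zero_bits[OF that] .
  have d: "sign_bd (univ_dist f) n (dist_class v) = dist_class (tate_bd refl_fun n v)" if "v \<in> per_funs (int f) 1" for n v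
    by (rule sign_bd_dist_class[OF that])
  show "comm_group (per.chain_group (int f) ps 1)" by (rule per.comm_group_chain_group)
  show "comm_group (univ_dist f)" by (rule comm_group_univ_dist)
  show "?D n \<in> hom (per.chain_group (int f) ps 1) (per.chain_group (int f) ps 1)" for n by (rule per.D_hom[OF pos_ps])
  show "sign_bd (univ_dist f) n \<in> hom (univ_dist f) (univ_dist f)" for n
  proof (rule homI)
    fix u assume "u \<in> carrier (univ_dist f)"
    then obtain v where v: "v \<in> per_funs (int f) 1" "u = dist_class v" unfolding carrier_univ_dist by blast
    thus "sign_bd (univ_dist f) n u \<in> carrier (univ_dist f)" using d[OF v(1)] dist_class_carrier[OF tate[OF v(1)]] by simp
    fix u' assume "u' \<in> carrier (univ_dist f)"
    then obtain v' where v': "v' \<in> per_funs (int f) 1" "u' = dist_class v'" unfolding carrier_univ_dist by blast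
    show "sign_bd (univ_dist f) n (u \<otimes>\<^bsub>univ_dist f\<^esub> u') = sign_bd (univ_dist f) n u \<otimes>\<^bsub>univ_dist f\<^esub> sign_bd (univ_dist f) n u'"
      unfolding v(2) v'(2) dist_class_add[symmetric] d[OF v(1)] d[OF v'(1)] d[OF per_funs_add[OF v(1) v'(1)]]
      by (simp only: dist.tate_bd_add)
  qed
  show "?D (n - 1) (?D n x) = \<one>\<^bsub>per.chain_group (int f) ps 1\<^esub>" for n x
    by (simp only: per.chain_group_simps) (rule ext, rule dist.DD)
  show "sign_bd (univ_dist f) (n - 1) (sign_bd (univ_dist f) n u) = \<one>\<^bsub>univ_dist f\<^esub>" if u: "u \<in> carrier (univ_dist f)" for n u
  proof -
    obtain v where v: "v \<in> per_funs (int f) 1" "u = dist_class v" using u unfolding carrier_univ_dist by blast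
    show ?thesis unfolding v(2) d[OF v(1)] d[OF tate[OF v(1)]] dist.tate_bd_tate_bd
      using dist_class_one_iff[OF per_funs_0] rel_sub_0 by blast
  qed
  show "(\<lambda>x. dist_class (x ?zs)) \<in> hom (per.chain_group (int f) ps 1) (univ_dist f)"
    by (rule homI) (simp_all only: per.chain_group_simps zs dist_class_carrier dist_class_add)
  show "dist_class (?D n x ?zs) = sign_bd (univ_dist f) n (dist_class (x ?zs))" if "x \<in> carrier (per.chain_group (int f) ps 1)" for n x
  proof -
    have x: "x \<in> koszul_chains (per_funs (int f)) ps 1" using that by (simp only: per.chain_group_simps)
    obtain \<rho> where \<rho>: "\<rho> \<in> rel_sub (int f) ps 1" "?D n x ?zs = tate_bd refl_fun n (x ?zs) + \<rho>"
      using koszul_bd_zero_bits[OF ps0 x] by blast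
    have "dist_class \<rho> = \<one>\<^bsub>univ_dist f\<^esub>"
      using dist_class_one_iff[OF rel_sub_per_funs[OF ps0 \<rho>(1)]] \<rho>(1) by simp
    thus ?thesis unfolding \<rho>(2) d[OF zs[OF x]] dist_class_add using dist_class_carrier[OF tate[OF zs[OF x]]] by simp
  qed
  show "(\<lambda>x. dist_class (x ?zs)) ` carrier (per.chain_group (int f) ps 1) = carrier (univ_dist f)"
  proof
    show "(\<lambda>x. dist_class (x ?zs)) ` carrier (per.chain_group (int f) ps 1) \<subseteq> carrier (univ_dist f)"
      using zs dist_class_carrier by (auto simp only: per.chain_group_simps)
    show "carrier (univ_dist f) \<subseteq> (\<lambda>x. dist_class (x ?zs)) ` carrier (per.chain_group (int f) ps 1)"
    proof
      fix u assume "u \<in> carrier (univ_dist f)"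
      then obtain v where v: "v \<in> per_funs (int f) 1" "u = dist_class v" unfolding carrier_univ_dist by blast
      show "u \<in> (\<lambda>x. dist_class (x ?zs)) ` carrier (per.chain_group (int f) ps 1)"
      proof (rule image_eqI)
        show "u = dist_class (zero_chain ps v ?zs)" unfolding zero_chain_def v(2) by simp
        show "zero_chain ps v \<in> carrier (per.chain_group (int f) ps 1)"
          using per.zero_chain_in[OF v(1), of ps] by (simp only: per.chain_group_simps)
      qed
    qed
  qed
  fix n x assume *: "x \<in> carrier (per.chain_group (int f) ps 1)" "?D n x = \<one>\<^bsub>per.chain_group (int f) ps 1\<^esub>"
    "dist_class (x ?zs) = \<one>\<^bsub>univ_dist f\<^esub>"
  have x: "x \<in> koszul_chains (per_funs (int f)) ps 1" using *(1) by (simp only: per.chain_group_simps)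
  have Dx: "?D n x b = 0" for b using *(2) by (simp only: per.chain_group_simps)
  have "x ?zs \<in> rel_sub (int f) ps 1" using *(3) dist_class_one_iff[OF zs[OF x]] by simp
  moreover have "int (1 * prod_list ps) dvd int f"
    using prod_list_dvd[OF distinct_ps] by (simp only: of_nat_dvd_iff mult_1 subset_refl)
  moreover have "int f > 0" using f by simp
  ultimately obtain z where z: "z \<in> koszul_chains (per_funs (int f)) ps 1" "?D (n + 1) z = x" "z ?zs \<in> rel_sub (int f) ps 1"
    using koszul_resolution_acyclic[OF _ primes distinct_ps _ x Dx] by blast
  thus "\<exists>y\<in>carrier (per.chain_group (int f) ps 1). ?D (n + 1) y = x \<and> dist_class (y ?zs) = \<one>\<^bsub>univ_dist f\<^esub>"
    using dist_class_one_iff[OF zs[OF z(1)]] by (simp only: per.chain_group_simps) blast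
qed

text \<open>Evaluation at 0 turns reflection into the identity and every relation operator into
  zero, because 0 is fixed by negation and by multiplication with p; its kernel is the complex
  treated in \<open>zero_acyclic\<close>.\<close>

lemma homology_chains_iso_trivial:
  "chain_homology (\<lambda>_. per.chain_group (int f) ps 1) (koszul_bd refl_fun dist_rel ps) n \<cong>
   chain_homology (\<lambda>_. triv.chain_group ps 1) (koszul_bd triv_inv triv_rel ps) n"
proof (rule chain_homology_iso_of_acyclic_kernel[where h = "\<lambda>n x b. x b 0"])
  let ?D = "koszul_bd refl_fun dist_rel ps" and ?E = "koszul_bd triv_inv triv_rel ps"
  show "comm_group (per.chain_group (int f) ps 1)" by (rule per.comm_group_chain_group)
  show "comm_group (triv.chain_group ps 1)" by (rule triv.comm_group_chain_group)
  show "?D n \<in> hom (per.chain_group (int f) ps 1) (per.chain_group (int f) ps 1)" for n by (rule per.D_hom[OF pos_ps])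
  show "?E n \<in> hom (triv.chain_group ps 1) (triv.chain_group ps 1)" for n by (rule triv.D_hom) simp
  show "?D (n - 1) (?D n x) = \<one>\<^bsub>per.chain_group (int f) ps 1\<^esub>" for n x
    by (simp only: per.chain_group_simps) (rule ext, rule dist.DD)
  show "?E (n - 1) (?E n x) = \<one>\<^bsub>triv.chain_group ps 1\<^esub>" for n x
    by (simp only: triv.chain_group_simps) (rule ext, rule triv.DD)
  show "(\<lambda>x b. x b 0) \<in> hom (per.chain_group (int f) ps 1) (triv.chain_group ps 1)"
  proof (rule homI)
    fix x assume "x \<in> carrier (per.chain_group (int f) ps 1)"
    hence x: "x \<in> koszul_chains (per_funs (int f)) ps 1" by (simp only: per.chain_group_simps)
    have "(\<lambda>b. x b 0) \<in> koszul_chains (\<lambda>g. UNIV) ps 1"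
      by (rule chains_map[OF x, of "\<lambda>v. v 0"]) auto
    thus "(\<lambda>b. x b 0) \<in> carrier (triv.chain_group ps 1)" by (simp only: triv.chain_group_simps)
  qed (simp only: per.chain_group_simps triv.chain_group_simps plus_fun_apply)
  show "(\<lambda>b. ?D n x b 0) = ?E n (\<lambda>b. x b 0)" if "x \<in> carrier (per.chain_group (int f) ps 1)" for n x
  proof
    fix b
    have x: "x \<in> koszul_chains (per_funs (int f)) ps 1" using that by (simp only: per.chain_group_simps)
    show "?D n x b 0 = ?E n (\<lambda>b. x b 0) b"
      by (rule koszul_bd_natural[OF x pos_ps per.koszul_levels_axioms triv.koszul_axioms, of "\<lambda>v. v 0", symmetric])
        (auto simp: refl_fun_def dist_rel_def triv_inv_def triv_rel_def)
  qed
  show "(\<lambda>x b. x b 0) ` carrier (per.chain_group (int f) ps 1) = carrier (triv.chain_group ps 1)"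
  proof
    show "(\<lambda>x b. x b 0) ` carrier (per.chain_group (int f) ps 1) \<subseteq> carrier (triv.chain_group ps 1)"
    proof
      fix y assume "y \<in> (\<lambda>x b. x b 0) ` carrier (per.chain_group (int f) ps 1)"
      then obtain x where x: "x \<in> koszul_chains (per_funs (int f)) ps 1" "y = (\<lambda>b. x b 0)" by (auto simp only: per.chain_group_simps)
      have "(\<lambda>b. x b 0) \<in> koszul_chains (\<lambda>g. UNIV) ps 1"
        by (rule chains_map[OF x(1), of "\<lambda>v. v 0"]) auto
      thus "y \<in> carrier (triv.chain_group ps 1)" by (simp only: triv.chain_group_simps x(2))
    qed
    show "carrier (triv.chain_group ps 1) \<subseteq> (\<lambda>x b. x b 0) ` carrier (per.chain_group (int f) ps 1)"
    proof
      fix y assume "y \<in> carrier (triv.chain_group ps 1)"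
      hence y: "y \<in> koszul_chains (\<lambda>g. UNIV) ps 1" by (simp only: triv.chain_group_simps)
      have "int (1 * prod_list ps) dvd int f"
        using prod_list_dvd[OF distinct_ps] by (simp only: of_nat_dvd_iff mult_1 subset_refl)
      hence "(\<lambda>b k. y b * delta (int f) 0 k) \<in> koszul_chains (per_funs (int f)) ps 1"
        by (rule koszul_chains_delta[OF y])
      moreover have "y = (\<lambda>b. y b * delta (int f) 0 0)" by (simp add: delta_def)
      ultimately show "y \<in> (\<lambda>x b. x b 0) ` carrier (per.chain_group (int f) ps 1)"
        by (simp only: per.chain_group_simps) (rule image_eqI[rotated])
    qed
  qed
  fix n x assume *: "x \<in> carrier (per.chain_group (int f) ps 1)" "?D n x = \<one>\<^bsub>per.chain_group (int f) ps 1\<^esub>"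
    "(\<lambda>b. x b 0) = \<one>\<^bsub>triv.chain_group ps 1\<^esub>"
  have x: "x \<in> koszul_chains (per_funs (int f)) ps 1" using *(1) by (simp only: per.chain_group_simps)
  have Dx: "?D n x b = 0" for b using *(2) by (simp only: per.chain_group_simps)
  have x0: "x b 0 = 0" for b using fun_cong[OF *(3), of b] by (simp only: triv.chain_group_simps)
  have "x \<in> koszul_chains (zero_funs (int f)) ps g" if "x \<in> koszul_chains (per_funs (int f)) ps g" "\<And>b. x b 0 = 0" for g ps x
    using that by (induction ps arbitrary: x g) (auto simp: zero_funs_def)
  hence "x \<in> koszul_chains (zero_funs (int f)) ps 1" using x x0 by blast
  then obtain z where z: "z \<in> koszul_chains (zero_funs (int f)) ps 1" "?D (n + 1) z = x"
    using zero_acyclic Dx unfolding zero.acyclic_def by blast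
  have zp: "z \<in> koszul_chains (per_funs (int f)) ps g" if "z \<in> koszul_chains (zero_funs (int f)) ps g" for g ps z
    using that by (induction ps arbitrary: z g) (auto simp: zero_funs_def)
  have z0: "z b 0 = 0" if "z \<in> koszul_chains (zero_funs (int f)) ps g" for g ps z b
    using that
  proof (induction ps arbitrary: z g b)
    case Nil
    then show ?case by (cases "b = []") (auto simp: zero_funs_def)
  next
    case (Cons p ps)
    then show ?case by (cases b; cases "hd b") auto
  qed
  show "\<exists>y\<in>carrier (per.chain_group (int f) ps 1). ?D (n + 1) y = x \<and> (\<lambda>b. y b 0) = \<one>\<^bsub>triv.chain_group ps 1\<^esub>"
  proof (intro bexI conjI)
    show "?D (n + 1) z = x" by (rule z(2))
    show "(\<lambda>b. z b 0) = \<one>\<^bsub>triv.chain_group ps 1\<^esub>" using z0[OF z(1)] by (simp only: triv.chain_group_simps)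
    show "z \<in> carrier (per.chain_group (int f) ps 1)" using zp[OF z(1)] by (simp only: per.chain_group_simps)
  qed
qed

lemma sign_homology_iso_trivial:
  "sign_homology (univ_dist f) n \<cong> chain_homology (\<lambda>_. triv.chain_group ps 1) (koszul_bd triv_inv triv_rel ps) n"
proof -
  have "group (chain_homology (\<lambda>_. per.chain_group (int f) ps 1) (koszul_bd refl_fun dist_rel ps) n)"
    by (rule group_chain_homology[OF per.comm_group_chain_group per.D_hom[OF pos_ps]])
      (simp only: per.chain_group_simps, rule ext, rule dist.DD)
  from group.iso_sym[OF this homology_chains_iso_sign_homology]
  show ?thesis using homology_chains_iso_trivial by (rule iso_trans)
qed

end

section \<open>Exponents of primes in rational numbers\<close>

definition rat_val :: "nat \<Rightarrow> rat \<Rightarrow> int" where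
  "rat_val q u = int (multiplicity (int q) (fst (quotient_of u))) - int (multiplicity (int q) (snd (quotient_of u)))"

lemma rat_val_frac:
  assumes q: "Factorial_Ring.prime q" and "a \<noteq> 0" "b \<noteq> 0"
  shows "rat_val q (of_int a / of_int b) = int (multiplicity (int q) a) - int (multiplicity (int q) b)"
proof -
  obtain n d where nd: "quotient_of (of_int a / of_int b) = (n, d)" by fastforce
  have d: "d > 0" using quotient_of_denom_pos[OF nd] .
  have "of_int a / of_int b = (of_int n / of_int d :: rat)" using quotient_of_div[OF nd] .
  hence "(of_int (a * d) :: rat) = of_int (n * b)" using assms d by (simp add: field_simps)
  hence eq: "a * d = n * b" by (simp only: of_int_eq_iff)
  have n: "n \<noteq> 0" using eq assms d by auto
  have p: "prime_elem (int q)" using q by simp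
  have "multiplicity (int q) a + multiplicity (int q) d = multiplicity (int q) n + multiplicity (int q) b"
    using prime_elem_multiplicity_mult_distrib[OF p, of a d] prime_elem_multiplicity_mult_distrib[OF p, of n b] eq n d assms by simp
  thus ?thesis by (simp add: rat_val_def nd)
qed

lemma rat_frac_cases:
  fixes u :: rat
  assumes "u \<noteq> 0"
  obtains a b :: int where "u = of_int a / of_int b" "a \<noteq> 0" "b \<noteq> 0"
proof -
  obtain n d where nd: "quotient_of u = (n, d)" by fastforce
  have "u = of_int n / of_int d" "d > 0" using quotient_of_div[OF nd] quotient_of_denom_pos[OF nd] by auto
  thus thesis using that[of n d] assms by auto
qed

lemma rat_val_mult:
  assumes q: "Factorial_Ring.prime q" and "u \<noteq> 0" "w \<noteq> 0"
  shows "rat_val q (u * w) = rat_val q u + rat_val q w"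
proof -
  obtain a b where u: "u = of_int a / of_int b" "a \<noteq> 0" "b \<noteq> 0" by (rule rat_frac_cases[OF assms(2)])
  obtain c d where w: "w = of_int c / of_int d" "c \<noteq> 0" "d \<noteq> 0" by (rule rat_frac_cases[OF assms(3)])
  have p: "prime_elem (int q)" using q by simp
  have "u * w = of_int (a * c) / of_int (b * d)" by (simp add: u w)
  thus ?thesis using rat_val_frac[OF q, of "a * c" "b * d"] rat_val_frac[OF q u(2,3)] rat_val_frac[OF q w(2,3)] u w
    by (simp add: prime_elem_multiplicity_mult_distrib[OF p])
qed

lemma rat_val_prime:
  assumes "Factorial_Ring.prime q" "Factorial_Ring.prime r"
  shows "rat_val q (of_nat r) = (if q = r then 1 else 0)"
proof -
  have "multiplicity (int q) (int r) = (if q = r then 1 else 0)"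
    using assms by (auto simp: prime_multiplicity_other)
  thus ?thesis by (simp add: rat_val_def)
qed

definition drop_prime :: "nat \<Rightarrow> rat \<Rightarrow> rat" where
  "drop_prime p u = u * of_nat p powi (- rat_val p u)"

text \<open>Forgets the sign and the powers of the listed primes. It is 1 on all of \<Gamma> when
  the list contains every generating prime, so pushing forward along it becomes the
  augmentation.\<close>

fun drop_primes :: "nat list \<Rightarrow> rat \<Rightarrow> rat" where
  "drop_primes [] u = \<bar>u\<bar>"
| "drop_primes (p # ps) u = drop_prime p (drop_primes ps u)"

lemma drop_prime_mult:
  assumes "Factorial_Ring.prime p" "u \<noteq> 0" "w \<noteq> 0"
  shows "drop_prime p (u * w) = drop_prime p u * drop_prime p w"
  using assms prime_gt_0_nat[OF assms(1)]
  by (simp add: drop_prime_def rat_val_mult power_int_add power_int_diff divide_simps power_int_minus)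

lemma drop_prime_prime:
  assumes "Factorial_Ring.prime p" "Factorial_Ring.prime q"
  shows "drop_prime p (of_nat q) = (if p = q then 1 else of_nat q)"
  using assms prime_gt_0_nat[OF assms(1)] by (simp add: drop_prime_def rat_val_prime)

lemma drop_prime_nonzero: "Factorial_Ring.prime p \<Longrightarrow> u \<noteq> 0 \<Longrightarrow> drop_prime p u \<noteq> 0"
  using prime_gt_0_nat by (auto simp: drop_prime_def)

lemma drop_primes_nonzero: "\<forall>p\<in>set ps. Factorial_Ring.prime p \<Longrightarrow> u \<noteq> 0 \<Longrightarrow> drop_primes ps u \<noteq> 0"
  by (induction ps) (auto simp: drop_prime_nonzero)

lemma drop_primes_mult:
  "\<forall>p\<in>set ps. Factorial_Ring.prime p \<Longrightarrow> u \<noteq> 0 \<Longrightarrow> w \<noteq> 0 \<Longrightarrow> drop_primes ps (u * w) = drop_primes ps u * drop_primes ps w"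
  by (induction ps) (auto simp: abs_mult drop_prime_mult drop_primes_nonzero)

lemma drop_prime_one: "drop_prime p 1 = 1"
  by (simp add: drop_prime_def rat_val_def)

lemma drop_primes_prime:
  "\<forall>p\<in>set ps. Factorial_Ring.prime p \<Longrightarrow> Factorial_Ring.prime q \<Longrightarrow> drop_primes ps (of_nat q) = (if q \<in> set ps then 1 else of_nat q)"
  by (induction ps) (auto simp: drop_prime_prime drop_prime_one)

lemma drop_primes_uminus: "drop_primes ps (- u) = drop_primes ps u"
  by (induction ps) auto

section \<open>Chain operators on a free module with basis \<open>\<Gamma>\<close>\<close>

definition push :: "('a \<Rightarrow> 'b) \<Rightarrow> ('a \<Rightarrow>\<^sub>0 int) \<Rightarrow> 'b \<Rightarrow>\<^sub>0 int" where
  "push h = frag_extend (\<lambda>u. frag_of (h u))"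

lemma push_of [simp]: "push h (frag_of u) = frag_of (h u)" by (simp add: push_def)
lemma push_0 [simp]: "push h 0 = 0" by (simp add: push_def)
lemma push_add: "push h (x + y) = push h x + push h y" by (simp add: push_def frag_extend_add)
lemma push_diff: "push h (x - y) = push h x - push h y" by (simp add: push_def frag_extend_diff)
lemma push_push: "push h (push k x) = push (\<lambda>u. h (k u)) x"
  using frag_extend_compose[of "\<lambda>u. frag_of (h u)" k x] by (simp add: push_def o_def)

lemma keys_push: "Poly_Mapping.keys (push h x) \<subseteq> h ` Poly_Mapping.keys x"
  using keys_frag_extend[of "\<lambda>u. frag_of (h u)" x] by (auto simp: push_def keys_frag_of)

text \<open>Compatibility with differences is enough for \<open>frag_induction\<close>, so
  identities between additive operators need checking only on basis elements.\<close>

lemma frag_additive_eq: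
  fixes F H :: "('a \<Rightarrow>\<^sub>0 int) \<Rightarrow> 'b::ab_group_add"
  assumes "Poly_Mapping.keys x \<subseteq> S" "\<And>x y. F (x - y) = F x - F y" "\<And>x y. H (x - y) = H x - H y"
    "\<And>u. u \<in> S \<Longrightarrow> F (frag_of u) = H (frag_of u)"
  shows "F x = H x"
  using assms(1)
proof (induction x rule: frag_induction)
  case zero
  show ?case using assms(2)[of 0 0] assms(3)[of 0 0] by simp
qed (use assms in auto)

lemma keys_frag_extend_subset:
  assumes "Poly_Mapping.keys x \<subseteq> S" "\<And>u. u \<in> S \<Longrightarrow> Poly_Mapping.keys (k u) \<subseteq> S'"
  shows "Poly_Mapping.keys (frag_extend k x) \<subseteq> S'"
  using keys_frag_extend[of k x] assms by blast

definition grp_neg :: "(rat \<Rightarrow>\<^sub>0 int) \<Rightarrow> rat \<Rightarrow>\<^sub>0 int" where "grp_neg = push uminus"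

definition grp_rel :: "nat \<Rightarrow> (rat \<Rightarrow>\<^sub>0 int) \<Rightarrow> rat \<Rightarrow>\<^sub>0 int" where
  "grp_rel p x = x - push (\<lambda>u. of_nat p * u) x"

interpretation grp: koszul grp_neg grp_rel
proof
  show "grp_neg (x + y) = grp_neg x + grp_neg y" for x y by (simp add: grp_neg_def push_add)
  show "grp_rel p (x + y) = grp_rel p x + grp_rel p y" for p x y by (simp add: grp_rel_def push_add)
  show "grp_neg (grp_neg x) = x" for x
    using frag_expansion[of x] by (simp add: grp_neg_def push_push) (simp add: push_def)
  show "grp_rel p (grp_neg x) = grp_neg (grp_rel p x)" for p x by (simp add: grp_rel_def grp_neg_def push_push push_diff)
  show "grp_rel p (grp_rel q x) = grp_rel q (grp_rel p x)" for p q x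
    by (simp add: grp_rel_def push_push push_diff mult.left_commute)
qed

definition pos_part :: "(rat \<Rightarrow>\<^sub>0 int) \<Rightarrow> rat \<Rightarrow>\<^sub>0 int" where
  "pos_part = frag_extend (\<lambda>u. if u > 0 then frag_of u else 0)"

definition neg_part :: "(rat \<Rightarrow>\<^sub>0 int) \<Rightarrow> rat \<Rightarrow>\<^sub>0 int" where
  "neg_part = frag_extend (\<lambda>u. if u > 0 then 0 else frag_of u)"

text \<open>A contraction of the Tate complex of -1: positive numbers represent the orbits {u, -u},
  and the even and odd degrees keep the two complementary halves.\<close>

definition tate_con :: "int \<Rightarrow> (rat \<Rightarrow>\<^sub>0 int) \<Rightarrow> rat \<Rightarrow>\<^sub>0 int" where
  "tate_con n x = (if even n then neg_part x else pos_part x)"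

lemma tate_con_diff: "tate_con n (x - y) = tate_con n x - tate_con n y"
  by (simp add: tate_con_def pos_part_def neg_part_def frag_extend_diff)

lemma tate_con_of: "tate_con n (frag_of u) = (if even n = (u > 0) then 0 else frag_of u)"
  by (simp add: tate_con_def pos_part_def neg_part_def)

lemma tate_bd_grp_diff: "tate_bd grp_neg n (x - y) = tate_bd grp_neg n x - tate_bd grp_neg n y"
  by (simp add: tate_bd_def grp.\<gamma>_diff)

lemma tate_con_0 [simp]: "tate_con n 0 = 0" using tate_con_diff[of n 0 0] by simp

lemma tate_con_contraction:
  assumes "Poly_Mapping.keys x \<subseteq> UNIV - {0}"
  shows "tate_bd grp_neg (n + 1) (tate_con n x) + tate_con (n - 1) (tate_bd grp_neg n x) = x"
proof (rule frag_additive_eq[OF assms])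
  fix u :: rat assume "u \<in> UNIV - {0}"
  hence "u > 0 \<or> u < 0" by auto
  thus "tate_bd grp_neg (n + 1) (tate_con n (frag_of u)) + tate_con (n - 1) (tate_bd grp_neg n (frag_of u)) = frag_of u"
    by (auto simp: tate_con_def pos_part_def neg_part_def tate_bd_def grp_neg_def frag_extend_diff frag_extend_add)
qed (simp_all add: tate_con_diff tate_bd_grp_diff)

text \<open>After truncation at degree 0 nothing comes from below, and the contraction fails there
  exactly by identifying u with its absolute value.\<close>

lemma tate_con_contraction_0:
  assumes "Poly_Mapping.keys x \<subseteq> UNIV - {0}"
  shows "tate_bd grp_neg 1 (tate_con 0 x) = x - push abs x"
proof (rule frag_additive_eq[OF assms])
  fix u :: rat assume "u \<in> UNIV - {0}"
  hence "u > 0 \<or> u < 0" by auto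
  thus "tate_bd grp_neg 1 (tate_con 0 (frag_of u)) = frag_of u - push abs (frag_of u)"
    by (auto simp: tate_con_def neg_part_def tate_bd_def grp_neg_def)
qed (simp_all add: tate_con_diff tate_bd_grp_diff push_diff)

lemma tate_con_rel:
  assumes "q > 0"
  shows "tate_con n (grp_rel q x) = grp_rel q (tate_con n x)"
proof (rule frag_additive_eq[of x UNIV])
  fix u :: rat
  show "tate_con n (grp_rel q (frag_of u)) = grp_rel q (tate_con n (frag_of u))"
    using assms by (simp add: grp_rel_def tate_con_diff tate_con_of zero_less_mult_iff)
qed (simp_all add: tate_con_diff grp.r_diff)

text \<open>The sum \<open>g k + \<dots> + g (-1)\<close>, to be read as \<open>- g 0 - \<dots> - g (k - 1)\<close> for \<open>k \<ge> 0\<close>.\<close>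

definition int_sum :: "(int \<Rightarrow> 'v) \<Rightarrow> int \<Rightarrow> 'v::ab_group_add" where
  "int_sum g k = (\<Sum>i\<in>{k..<0}. g i) - (\<Sum>i\<in>{0..<k}. g i)"

lemma int_sum_0 [simp]: "int_sum g 0 = 0" by (simp add: int_sum_def)

lemma int_sum_step: "int_sum g (k + 1) = int_sum g k - g k"
proof (cases "k \<ge> 0")
  case True
  have "{0..<k + 1} = insert k {0..<k}" using True by auto
  thus ?thesis using True by (simp add: int_sum_def)
next
  case False
  have "{k..<0} = insert k {k + 1..<0}" using False by auto
  thus ?thesis using False by (simp add: int_sum_def)
qed

text \<open>Write u = p^k w with w prime to p. The geometric sum from w to u is a preimage of u - w
  under 1 - p, so this contracts the two-term complex of 1 - p onto numbers prime to p.\<close>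

definition prime_con :: "nat \<Rightarrow> (rat \<Rightarrow>\<^sub>0 int) \<Rightarrow> rat \<Rightarrow>\<^sub>0 int" where
  "prime_con p = frag_extend (\<lambda>u. int_sum (\<lambda>i. frag_of (of_nat p powi i * drop_prime p u)) (rat_val p u))"

lemma prime_con_diff: "prime_con p (x - y) = prime_con p x - prime_con p y"
  by (simp add: prime_con_def frag_extend_diff)

lemma grp_rel_prime_con:
  assumes p: "Factorial_Ring.prime p" and x: "Poly_Mapping.keys x \<subseteq> UNIV - {0}"
  shows "grp_rel p (prime_con p x) = x - push (drop_prime p) x"
proof (rule frag_additive_eq[OF x])
  fix u :: rat assume u: "u \<in> UNIV - {0}"
  have p0: "(of_nat p :: rat) \<noteq> 0" using prime_gt_0_nat[OF p] by simp
  define g where "g i = frag_of (of_nat p powi i * drop_prime p u)" for i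
  have step: "grp_rel p (g i) = g i - g (i + 1)" for i
    using p0 by (simp add: g_def grp_rel_def power_int_add mult_ac)
  have "grp_rel p (int_sum g k) = g k - g 0" for k
  proof (induction k rule: int_induct[where k = 0])
    case (step1 i)
    thus ?case by (simp add: int_sum_step grp.r_diff step)
  next
    case (step2 i)
    have "int_sum g (i - 1) = int_sum g i + g (i - 1)" using int_sum_step[of g "i - 1"] by simp
    thus ?case using step2 step[of "i - 1"] by (simp add: grp.r_add)
  qed simp
  moreover have "of_nat p powi rat_val p u * drop_prime p u = u" using p0 by (simp add: drop_prime_def power_int_minus field_simps)
  hence "g (rat_val p u) = frag_of u" by (simp add: g_def)
  ultimately show "grp_rel p (prime_con p (frag_of u)) = frag_of u - push (drop_prime p) (frag_of u)"
    by (simp add: prime_con_def g_def[abs_def])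
qed (simp_all add: prime_con_diff grp.r_diff push_diff)

lemma prime_con_grp_rel:
  assumes p: "Factorial_Ring.prime p" and x: "Poly_Mapping.keys x \<subseteq> UNIV - {0}"
  shows "prime_con p (grp_rel p x) = x"
proof (rule frag_additive_eq[OF x])
  fix u :: rat assume u: "u \<in> UNIV - {0}"
  have p0: "(of_nat p :: rat) \<noteq> 0" using prime_gt_0_nat[OF p] by simp
  have "rat_val p (of_nat p * u) = rat_val p u + 1" using u p p0 by (simp add: rat_val_mult rat_val_prime)
  moreover have "drop_prime p (of_nat p * u) = drop_prime p u"
    using u p p0 by (simp add: drop_prime_mult drop_prime_prime)
  moreover have "of_nat p powi rat_val p u * drop_prime p u = u" using p0 by (simp add: drop_prime_def power_int_minus)
  ultimately show "prime_con p (grp_rel p (frag_of u)) = frag_of u"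
    by (simp add: grp_rel_def prime_con_diff) (simp add: prime_con_def int_sum_step)
qed (simp_all add: prime_con_diff grp.r_diff)

lemma push_int_sum: "push h (int_sum g k) = int_sum (\<lambda>i. push h (g i)) k"
  by (simp add: int_sum_def push_diff) (simp add: push_def frag_extend_sum o_def)

text \<open>Multiplication by another prime q leaves the exponent of p alone and commutes with
  removing it; for q = p this fails, hence the condition.\<close>

lemma prime_con_rel:
  assumes p: "Factorial_Ring.prime p" and q: "Factorial_Ring.prime q" "p \<noteq> q" and x: "Poly_Mapping.keys x \<subseteq> UNIV - {0}"
  shows "prime_con p (grp_rel q x) = grp_rel q (prime_con p x)"
proof (rule frag_additive_eq[OF x])
  fix u :: rat assume u: "u \<in> UNIV - {0}"
  have q0: "(of_nat q :: rat) \<noteq> 0" using prime_gt_0_nat[OF q(1)] by simp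
  have "rat_val p (of_nat q * u) = rat_val p u" using u p q q0 by (simp add: rat_val_mult rat_val_prime)
  moreover have "drop_prime p (of_nat q * u) = of_nat q * drop_prime p u"
    using u p q q0 by (simp add: drop_prime_mult drop_prime_prime)
  ultimately show "prime_con p (grp_rel q (frag_of u)) = grp_rel q (prime_con p (frag_of u))"
    by (simp add: grp_rel_def prime_con_diff) (simp add: prime_con_def push_int_sum mult.left_commute)
qed (simp_all add: prime_con_diff grp.r_diff)

text \<open>The full complex is contracted in the Tate direction alone, componentwise, since
  \<open>tate_con\<close> commutes with the Koszul operators; the sign follows that of the
  cone.\<close>

fun cpl_con :: "nat list \<Rightarrow> int \<Rightarrow> (bool list \<Rightarrow> rat \<Rightarrow>\<^sub>0 int) \<Rightarrow> bool list \<Rightarrow> rat \<Rightarrow>\<^sub>0 int" where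
  "cpl_con [] n y [] = tate_con n (y [])"
| "cpl_con (p # ps) n y (False # b) = cpl_con ps n (\<lambda>b. y (False # b)) b"
| "cpl_con (p # ps) n y (True # b) = - cpl_con ps (n - 1) (\<lambda>b. y (True # b)) b"
| "cpl_con _ n y _ = 0"

text \<open>For the truncated complex the Tate direction leaves a Koszul complex in Tate degree 0.
  It is contracted one prime at a time: the extra term applies \<open>prime_con p\<close> to what
  remains after the sign and the primes in the tail have been collapsed.\<close>

fun res_con :: "nat list \<Rightarrow> int \<Rightarrow> (bool list \<Rightarrow> rat \<Rightarrow>\<^sub>0 int) \<Rightarrow> bool list \<Rightarrow> rat \<Rightarrow>\<^sub>0 int" where
  "res_con [] n y [] = (if n \<ge> 0 then tate_con n (y []) else 0)"
| "res_con (p # ps) n y (False # b) = res_con ps n (\<lambda>b. y (False # b)) b"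
| "res_con (p # ps) n y (True # b) = - res_con ps (n - 1) (\<lambda>b. y (True # b)) b +
     (if n = 0 \<and> b = zero_bits ps then prime_con p (push (drop_primes ps) (y (False # zero_bits ps))) else 0)"
| "res_con _ n y _ = 0"

definition weight :: "bool list \<Rightarrow> int" where "weight b = int (length (filter id b))"

lemma weight_simps [simp]: "weight [] = 0" "weight (False # b) = weight b" "weight (True # b) = weight b + 1"
  by (simp_all add: weight_def)

lemma weight_nonneg: "weight b \<ge> 0" by (simp add: weight_def)

lemma weight_zero_bits [simp]: "weight (zero_bits ps) = 0" by (induction ps) auto

text \<open>In total degree n the component at a subset of size k has Tate degree n - k, so this
  keeps the components of nonnegative Tate degree.\<close>

definition trunc :: "int \<Rightarrow> (bool list \<Rightarrow> 'v) \<Rightarrow> bool list \<Rightarrow> 'v::zero" where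
  "trunc n x b = (if weight b \<le> n then x b else 0)"

lemma cpl_con_diff: "cpl_con ps n (\<lambda>b. x b - y b) b = cpl_con ps n x b - cpl_con ps n y b"
proof (induction ps arbitrary: n x y b)
  case Nil
  then show ?case by (cases b) (simp_all add: tate_con_diff)
next
  case (Cons p ps)
  then show ?case by (cases b; cases "hd b") auto
qed

lemma res_con_diff: "res_con ps n (\<lambda>b. x b - y b) b = res_con ps n x b - res_con ps n y b"
proof (induction ps arbitrary: n x y b)
  case Nil
  then show ?case by (cases b) (simp_all add: tate_con_diff)
next
  case (Cons p ps)
  then show ?case by (cases b; cases "hd b") (auto simp: prime_con_diff push_diff)
qed

lemma cpl_con_0 [simp]: "cpl_con ps n (\<lambda>b. 0) b = 0" using cpl_con_diff[of ps n "\<lambda>b. 0" "\<lambda>b. 0" b] by simp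
lemma res_con_0 [simp]: "res_con ps n (\<lambda>b. 0) b = 0" using res_con_diff[of ps n "\<lambda>b. 0" "\<lambda>b. 0" b] by simp
lemma cpl_con_minus: "cpl_con ps n (\<lambda>b. - y b) b = - cpl_con ps n y b" using cpl_con_diff[of ps n "\<lambda>b. 0" y b] by simp
lemma res_con_minus: "res_con ps n (\<lambda>b. - y b) b = - res_con ps n y b" using res_con_diff[of ps n "\<lambda>b. 0" y b] by simp
lemma cpl_con_add: "cpl_con ps n (\<lambda>b. x b + y b) b = cpl_con ps n x b + cpl_con ps n y b"
  using cpl_con_diff[of ps n x "\<lambda>b. - y b" b] by (simp add: cpl_con_minus)
lemma res_con_add: "res_con ps n (\<lambda>b. x b + y b) b = res_con ps n x b + res_con ps n y b"
  using res_con_diff[of ps n x "\<lambda>b. - y b" b] by (simp add: res_con_minus)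

lemma cpl_con_rel: "q > 0 \<Longrightarrow> cpl_con ps n (\<lambda>b. grp_rel q (y b)) b = grp_rel q (cpl_con ps n y b)"
proof (induction ps arbitrary: n y b)
  case Nil
  then show ?case by (cases b) (simp_all add: tate_con_rel)
next
  case (Cons p ps)
  then show ?case by (cases b; cases "hd b") auto
qed

locale basis_set =
  fixes K :: "rat set" and R :: "nat set"
  assumes K_nonzero: "0 \<notin> K" and K_uminus: "u \<in> K \<Longrightarrow> - u \<in> K"
    and K_powi: "p \<in> R \<Longrightarrow> u \<in> K \<Longrightarrow> of_nat p powi i * u \<in> K" and R: "p \<in> R \<Longrightarrow> Factorial_Ring.prime p"
begin

definition free_on :: "nat \<Rightarrow> (rat \<Rightarrow>\<^sub>0 int) set" where "free_on g = {x. Poly_Mapping.keys x \<subseteq> K}"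

abbreviation "KC ps \<equiv> koszul_chains free_on ps 1"

lemma free_on_extend: "x \<in> free_on g \<Longrightarrow> (\<And>u. u \<in> K \<Longrightarrow> Poly_Mapping.keys (k u) \<subseteq> K) \<Longrightarrow> frag_extend k x \<in> free_on g'"
  unfolding free_on_def using keys_frag_extend_subset[of x K k K] by simp

lemma K_mult: "p \<in> R \<Longrightarrow> u \<in> K \<Longrightarrow> of_nat p * u \<in> K"
  using K_powi[of p u 1] by simp

sublocale koszul_levels grp_neg grp_rel free_on R
proof unfold_locales
  show "0 \<in> free_on g" for g by (simp add: free_on_def)
  show "x + y \<in> free_on g" if "x \<in> free_on g" "y \<in> free_on g" for x y g
    using that Poly_Mapping.keys_add[of x y] by (auto simp: free_on_def)
  show "- x \<in> free_on g" if "x \<in> free_on g" for x g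
    using that by (simp add: free_on_def)
  show "grp_neg x \<in> free_on g" if "x \<in> free_on g" for x g
    unfolding grp_neg_def push_def using that K_uminus by (intro free_on_extend[OF that]) (auto simp: keys_frag_of)
  show "grp_rel p x \<in> free_on g" if "p \<in> R" "x \<in> free_on (g * p)" for x p g
  proof -
    have "push (\<lambda>u. of_nat p * u) x \<in> free_on g"
      unfolding push_def using K_mult[OF that(1)] by (intro free_on_extend[OF that(2)]) (auto simp: keys_frag_of)
    thus ?thesis using that(2) keys_diff[of x "push (\<lambda>u. of_nat p * u) x"] by (auto simp: grp_rel_def free_on_def)
  qed
qed

lemma free_on_nonzero: "x \<in> free_on g \<Longrightarrow> Poly_Mapping.keys x \<subseteq> UNIV - {0}"
  using K_nonzero by (auto simp: free_on_def)

lemma tate_con_free_on: "x \<in> free_on g \<Longrightarrow> tate_con n x \<in> free_on g"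
  unfolding tate_con_def pos_part_def neg_part_def by (auto intro!: free_on_extend simp: keys_frag_of split: if_splits)

lemma drop_prime_K: "p \<in> R \<Longrightarrow> u \<in> K \<Longrightarrow> drop_prime p u \<in> K"
  using K_powi by (simp add: drop_prime_def mult.commute)

lemma drop_primes_K: "set ps \<subseteq> R \<Longrightarrow> u \<in> K \<Longrightarrow> drop_primes ps u \<in> K"
  by (induction ps) (auto simp: abs_if K_uminus drop_prime_K)

lemma push_drop_primes: "set ps \<subseteq> R \<Longrightarrow> x \<in> free_on g \<Longrightarrow> push (drop_primes ps) x \<in> free_on g'"
  unfolding push_def by (rule free_on_extend) (auto simp: keys_frag_of drop_primes_K)

lemma prime_con_free_on:
  assumes "p \<in> R" "x \<in> free_on g"
  shows "prime_con p x \<in> free_on g"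
  unfolding prime_con_def
proof (rule free_on_extend[OF assms(2)])
  fix u assume u: "u \<in> K"
  have s: "Poly_Mapping.keys (\<Sum>i\<in>I. frag_of (of_nat p powi i * drop_prime p u)) \<subseteq> K" for I :: "int set"
    using keys_sum[of "\<lambda>i. frag_of (of_nat p powi i * drop_prime p u)" I] K_powi[OF assms(1) drop_prime_K[OF assms(1) u]]
    by (auto simp: keys_frag_of)
  show "Poly_Mapping.keys (int_sum (\<lambda>i. frag_of (of_nat p powi i * drop_prime p u)) (rat_val p u)) \<subseteq> K"
    unfolding int_sum_def using keys_diff s by (meson Un_least order_trans)
qed

lemma cpl_con_KC: "x \<in> koszul_chains free_on ps g \<Longrightarrow> cpl_con ps n x \<in> koszul_chains free_on ps g"
proof (induction ps arbitrary: x n g)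
  case Nil
  then show ?case by (auto simp: tate_con_free_on neq_Nil_conv)
next
  case (Cons p ps)
  then show ?case by (auto intro!: chains_minus)
qed

lemma res_con_KC: "set ps \<subseteq> R \<Longrightarrow> x \<in> koszul_chains free_on ps g \<Longrightarrow> res_con ps n x \<in> koszul_chains free_on ps g"
proof (induction ps arbitrary: x n g)
  case Nil
  then show ?case by (auto simp: tate_con_free_on A_0 neq_Nil_conv)
next
  case (Cons p ps)
  let ?w = "prime_con p (push (drop_primes ps) (x (False # zero_bits ps)))"
  have "x (False # zero_bits ps) \<in> free_on g" using Cons.prems chains_zero_bits[of "\<lambda>b. x (False # b)" free_on ps g] by simp
  hence "?w \<in> free_on (g * p)" using Cons.prems by (intro prime_con_free_on push_drop_primes[where g = g]) auto
  hence "(\<lambda>b. if n = 0 \<and> b = zero_bits ps then ?w else 0) \<in> koszul_chains free_on ps (g * p)"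
    using zero_chain_in[of ?w "g * p" ps] chains_0[of ps "g * p"] by (cases "n = 0") (simp_all add: zero_chain_def[abs_def])
  moreover have "(\<lambda>b. - res_con ps (n - 1) (\<lambda>b. x (True # b)) b) \<in> koszul_chains free_on ps (g * p)"
    using Cons by (intro chains_minus) auto
  ultimately have "(\<lambda>b. - res_con ps (n - 1) (\<lambda>b. x (True # b)) b + (if n = 0 \<and> b = zero_bits ps then ?w else 0)) \<in> koszul_chains free_on ps (g * p)"
    by (rule chains_add[rotated])
  thus ?case using Cons by simp
qed

lemma cpl_contraction:
  assumes "set ps \<subseteq> R" "x \<in> koszul_chains free_on ps g"
  shows "grp.D ps (n + 1) (cpl_con ps n x) b + cpl_con ps (n - 1) (grp.D ps n x) b = x b"
  using assms
proof (induction ps arbitrary: x n b g)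
  case Nil
  then show ?case using tate_con_contraction[OF free_on_nonzero, of "x []" g n] by (cases b) auto
next
  case (Cons p ps)
  have p: "p > 0" using R[of p] Cons.prems by (auto intro: prime_gt_0_nat)
  have c: "(\<lambda>b. x (False # b)) \<in> koszul_chains free_on ps g" "(\<lambda>b. x (True # b)) \<in> koszul_chains free_on ps (g * p)" "x [] = 0"
    using Cons.prems by auto
  have ps: "set ps \<subseteq> R" using Cons.prems by simp
  show ?case
  proof (cases b)
    case Nil
    then show ?thesis using c by simp
  next
    case b: (Cons d b')
    show ?thesis
    proof (cases d)
      case True
      show ?thesis using Cons.IH[OF ps c(2), of "n - 1" b'] b True by (simp add: grp.D_minus cpl_con_minus)
    next
      case False
      show ?thesis using Cons.IH[OF ps c(1), of n b'] b False p by (simp add: cpl_con_add cpl_con_rel)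
    qed
  qed
qed

end

lemma trunc_simps [simp]: "trunc n x (False # b) = trunc n (\<lambda>b. x (False # b)) b"
  "trunc n x (True # b) = trunc (n - 1) (\<lambda>b. x (True # b)) b"
  by (auto simp: trunc_def)

lemma push_drop_primes_grp_neg: "push (drop_primes ps) (grp_neg x) = push (drop_primes ps) x"
  by (simp add: grp_neg_def push_push drop_primes_uminus)

lemma push_drop_primes_grp_rel:
  assumes ps: "\<forall>p\<in>set ps. Factorial_Ring.prime p" and q: "Factorial_Ring.prime q" and x: "Poly_Mapping.keys x \<subseteq> UNIV - {0}"
  shows "push (drop_primes ps) (grp_rel q x) = (if q \<in> set ps then 0 else grp_rel q (push (drop_primes ps) x))"
proof (rule frag_additive_eq[OF x])
  fix u :: rat assume u: "u \<in> UNIV - {0}"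
  have "(of_nat q :: rat) \<noteq> 0" using prime_gt_0_nat[OF q] by simp
  thus "push (drop_primes ps) (grp_rel q (frag_of u)) = (if q \<in> set ps then 0 else grp_rel q (push (drop_primes ps) (frag_of u)))"
    using u by (simp add: grp_rel_def push_diff drop_primes_mult[OF ps] drop_primes_prime[OF ps q])
qed (simp_all add: push_diff grp.r_diff)

context basis_set
begin

lemma R_primes: "set ps \<subseteq> R \<Longrightarrow> \<forall>p\<in>set ps. Factorial_Ring.prime p"
  using R by auto

text \<open>Needed when passing to a cone; q outside ps is required since \<open>prime_con p\<close>
  commutes with 1 - q only for distinct primes.\<close>

lemma res_con_rel:
  assumes "q \<in> R" "q \<notin> set ps" "set ps \<subseteq> R" "y \<in> koszul_chains free_on ps g"
  shows "res_con ps n (\<lambda>b. grp_rel q (y b)) b = grp_rel q (res_con ps n y b)"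
  using assms
proof (induction ps arbitrary: n y b g)
  case Nil
  then show ?case using tate_con_rel[of q n] prime_gt_0_nat[OF R[of q]] by (cases b) simp_all
next
  case (Cons p ps)
  have c: "(\<lambda>b. y (False # b)) \<in> koszul_chains free_on ps g" "(\<lambda>b. y (True # b)) \<in> koszul_chains free_on ps (g * p)"
    using Cons.prems by auto
  have q: "q \<notin> set ps" "q \<noteq> p" "set ps \<subseteq> R" "Factorial_Ring.prime q" "Factorial_Ring.prime p" using Cons.prems R by auto
  have y0: "y (False # zero_bits ps) \<in> free_on g" using chains_zero_bits[OF c(1)] .
  have "prime_con p (push (drop_primes ps) (grp_rel q (y (False # zero_bits ps)))) = grp_rel q (prime_con p (push (drop_primes ps) (y (False # zero_bits ps))))"
    using push_drop_primes_grp_rel[OF R_primes[OF q(3)] q(4) free_on_nonzero[OF y0]] q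
      prime_con_rel[OF q(5,4) q(2)[symmetric] free_on_nonzero[OF push_drop_primes[OF q(3) y0]]] by simp
  thus ?case using Cons.IH[OF Cons.prems(1) q(1,3) c(1)] Cons.IH[OF Cons.prems(1) q(1,3) c(2)]
    by (cases b; cases "hd b") (auto simp: grp.r_add grp.r_diff)
qed

text \<open>Boundaries arriving in degree 0 are killed by the collapse: u and -u have the same
  image, and so do u and p u for a listed prime p.\<close>

lemma push_drop_primes_D:
  assumes "set qs \<subseteq> R" "set ps \<subseteq> set qs" "y \<in> koszul_chains free_on ps g"
  shows "push (drop_primes qs) (grp.D ps 1 y (zero_bits ps)) = 0"
  using assms
proof (induction ps arbitrary: y)
  case Nil
  then show ?case by (simp add: tate_bd_def push_diff push_drop_primes_grp_neg)
next
  case (Cons p ps)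
  have c: "(\<lambda>b. y (False # b)) \<in> koszul_chains free_on ps g" "(\<lambda>b. y (True # b)) \<in> koszul_chains free_on ps (g * p)"
    using Cons.prems by auto
  have "push (drop_primes qs) (grp_rel p (y (True # zero_bits ps))) = 0"
    using push_drop_primes_grp_rel[OF R_primes[OF Cons.prems(1)] R free_on_nonzero[OF chains_zero_bits[OF c(2)]], of p] Cons.prems
    by auto
  thus ?case using Cons.IH[OF _ _ c(1)] Cons.prems by (simp add: push_add)
qed

end

lemma trunc_res_con:
  assumes "trunc n y = y"
  shows "trunc (n + 1) (res_con ps n y) = res_con ps n y"
  using assms
proof (induction ps arbitrary: n y)
  case Nil
  show ?case
  proof (rule ext)
    fix b show "trunc (n + 1) (res_con [] n y) b = res_con [] n y b" by (cases b) (auto simp: trunc_def)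
  qed
next
  case (Cons p ps)
  have t: "trunc n (\<lambda>b. y (False # b)) = (\<lambda>b. y (False # b))" "trunc (n - 1) (\<lambda>b. y (True # b)) = (\<lambda>b. y (True # b))"
    using fun_cong[OF Cons.prems, of "False # b" for b] fun_cong[OF Cons.prems, of "True # b" for b] by (auto simp: fun_eq_iff)
  have w: "w \<le> n \<or> res_con ps (n - 1) (\<lambda>b. y (True # b)) b = 0" if "weight b = w" for b w
    using fun_cong[OF Cons.IH[OF t(2)], of b] that by (auto simp: trunc_def split: if_splits)
  show ?case
  proof (rule bits_eqI)
    show "trunc (n + 1) (res_con (p # ps) n y) (False # b) = res_con (p # ps) n y (False # b)" for b
      using fun_cong[OF Cons.IH[OF t(1)], of b] by (auto simp: trunc_def split: if_splits)
    show "trunc (n + 1) (res_con (p # ps) n y) (True # b) = res_con (p # ps) n y (True # b)" for b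
      using w[OF refl, of b] by (auto simp: trunc_def)
  qed (simp add: trunc_def)
qed

text \<open>The components of negative Tate degree form a subcomplex, because the differential never
  raises Tate degree; truncation is the projection to the quotient.\<close>

lemma trunc_trunc_bd:
  "trunc (n - 1) (grp.D ps n (trunc n x)) b = trunc (n - 1) (grp.D ps n x) b"
proof (induction ps arbitrary: n x b)
  case Nil
  then show ?case by (cases b) (auto simp: trunc_def)
next
  case (Cons p ps)
  have e: "(\<lambda>b. trunc n x (False # b)) = trunc n (\<lambda>b. x (False # b))" "(\<lambda>b. trunc n x (True # b)) = trunc (n - 1) (\<lambda>b. x (True # b))"
    by (simp_all add: fun_eq_iff)
  show ?case
  proof (cases b)
    case b: (Cons d b')
    show ?thesis
    proof (cases d)
      case True
      show ?thesis using Cons.IH[of "n - 1" "\<lambda>b. x (True # b)" b'] b True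
        by (cases "weight b' \<le> n - 2") (simp_all add: trunc_def[of "n - 1"] trunc_def[of "n - 2"] e)
    next
      case False
      have "trunc (n - 1) (trunc (n - 1) (\<lambda>b. x (True # b))) b' = trunc (n - 1) (\<lambda>b. x (True # b)) b'" by (simp add: trunc_def)
      thus ?thesis using Cons.IH[of n "\<lambda>b. x (False # b)" b'] b False
        by (cases "weight b' \<le> n - 1") (simp_all add: trunc_def e[unfolded trunc_def])
    qed
  qed (simp add: trunc_def)
qed

text \<open>Induction along the cones. The error in degree 0 is the collapse along the primes
  treated so far; each new prime uses its extra term in \<open>res_con\<close> to replace the error
  for ps by the one for p # ps.\<close>

lemma (in basis_set) res_contraction:
  assumes "distinct ps" "set ps \<subseteq> R" "y \<in> koszul_chains free_on ps g" "trunc n y = y"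
  shows "trunc n (grp.D ps (n + 1) (res_con ps n y)) b + res_con ps (n - 1) (trunc (n - 1) (grp.D ps n y)) b
    = y b - (if n = 0 \<and> b = zero_bits ps then push (drop_primes ps) (y (zero_bits ps)) else 0)"
  using assms
proof (induction ps arbitrary: y n b g)
  case Nil
  have y: "Poly_Mapping.keys (y []) \<subseteq> UNIV - {0}" using Nil.prems by (intro free_on_nonzero[of _ g]) simp
  have dp: "drop_primes [] = abs" by (simp add: fun_eq_iff)
  have "y [] = 0" if "n < 0" using fun_cong[OF Nil.prems(4), of "[]"] that by (simp add: trunc_def)
  moreover have "y b = 0" if "b \<noteq> []" using Nil.prems that by simp
  ultimately show ?case using tate_con_contraction[OF y, of n] tate_con_contraction_0[OF y]
    by (cases b) (auto simp: trunc_def dp not_le)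
next
  case (Cons p ps)
  define y0 where "y0 = (\<lambda>b. y (False # b))"
  define y1 where "y1 = (\<lambda>b. y (True # b))"
  have c: "y0 \<in> koszul_chains free_on ps g" "y1 \<in> koszul_chains free_on ps (g * p)" "y [] = 0"
    using Cons.prems by (auto simp: y0_def y1_def)
  have p: "p \<in> R" "p \<notin> set ps" "distinct ps" "set ps \<subseteq> R" "Factorial_Ring.prime p" using Cons.prems R by auto
  have t: "trunc n y0 = y0" "trunc (n - 1) y1 = y1"
    using fun_cong[OF Cons.prems(4), of "False # b" for b] fun_cong[OF Cons.prems(4), of "True # b" for b] by (auto simp: fun_eq_iff y0_def y1_def)
  let ?E = "push (drop_primes ps)" and ?z = "zero_bits ps"
  note IH0 = Cons.IH[OF p(3,4) c(1) t(1)] and IH1 = Cons.IH[OF p(3,4) c(2) t(2)]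
  \<comment> \<open>The extra term for p. In the \<open>False\<close> half
    \<open>grp_rel p w\<close> turns the collapse along ps into the collapse along p # ps.\<close>
  define w where "w b = (if n = 0 \<and> b = ?z then prime_con p (?E (y0 ?z)) else 0)" for b
  have S: "res_con (p # ps) n y (False # b) = res_con ps n y0 b"
    "res_con (p # ps) n y (True # b) = - res_con ps (n - 1) y1 b + w b" for b
    by (simp_all add: y0_def y1_def w_def)
  have dy: "grp.D (p # ps) n y (False # b) = grp.D ps n y0 b + grp_rel p (y1 b)"
     "grp.D (p # ps) n y (True # b) = - grp.D ps (n - 1) y1 b" for b
    by (simp_all add: y0_def y1_def)
  show ?case
  proof (cases b)
    case Nil
    thus ?thesis by (simp add: trunc_def c(3))
  next
    case b: (Cons d b')
    show ?thesis
    proof (cases d)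
      case False
      hence d: "d = False" by simp
      have tr: "weight b' \<le> n \<or> res_con ps (n - 1) y1 b' = 0"
        using fun_cong[OF trunc_res_con[OF t(2), of ps], of b'] by (auto simp: trunc_def split: if_splits)
      have w0: "weight b' \<le> n \<or> w b' = 0" by (auto simp: w_def)
      have A: "trunc n (grp.D (p # ps) (n + 1) (res_con (p # ps) n y)) b
          = trunc n (grp.D ps (n + 1) (res_con ps n y0)) b' + (grp_rel p (w b') - grp_rel p (res_con ps (n - 1) y1 b'))"
        using tr w0 unfolding b d trunc_simps koszul_bd.simps S
        by (auto simp: trunc_def grp.r_diff)
      have "(\<lambda>b. trunc (n - 1) (grp.D (p # ps) n y) (False # b)) = (\<lambda>b. trunc (n - 1) (grp.D ps n y0) b + grp_rel p (y1 b))"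
      proof
        fix b
        have "y1 b = trunc (n - 1) y1 b" by (simp add: t(2))
        thus "trunc (n - 1) (grp.D (p # ps) n y) (False # b) = trunc (n - 1) (grp.D ps n y0) b + grp_rel p (y1 b)"
          unfolding trunc_simps dy by (auto simp: trunc_def split: if_splits)
      qed
      hence B: "res_con (p # ps) (n - 1) (trunc (n - 1) (grp.D (p # ps) n y)) b
          = res_con ps (n - 1) (trunc (n - 1) (grp.D ps n y0)) b' + grp_rel p (res_con ps (n - 1) y1 b')"
        unfolding b d res_con.simps by (simp only: res_con_add res_con_rel[OF p(1,2,4) c(2)])
      have dps: "drop_primes (p # ps) = (\<lambda>u. drop_prime p (drop_primes ps u))" by (simp add: fun_eq_iff)
      have "grp_rel p (w b') = (if n = 0 \<and> b' = ?z then ?E (y0 ?z) - push (drop_primes (p # ps)) (y0 ?z) else 0)"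
        using grp_rel_prime_con[OF p(5) free_on_nonzero[OF push_drop_primes[OF p(4) chains_zero_bits[OF c(1)]]]]
        by (simp add: w_def push_push dps)
      thus ?thesis using IH0[of b'] unfolding A B by (auto simp: b d y0_def dps algebra_simps)
    next
      case True
      hence d: "d = True" by simp
      have w0: "weight b' \<le> n - 1 \<Longrightarrow> w = (\<lambda>b. 0)" using weight_nonneg[of b'] by (auto simp: w_def fun_eq_iff)
      have nn: "n - 1 + 1 = n" "n + 1 - 1 = n" by simp_all
      have "(\<lambda>b. res_con (p # ps) n y (True # b)) = (\<lambda>b. w b - res_con ps (n - 1) y1 b)" unfolding S by simp
      hence A: "trunc n (grp.D (p # ps) (n + 1) (res_con (p # ps) n y)) b = trunc (n - 1) (grp.D ps n (res_con ps (n - 1) y1)) b'"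
        using w0 unfolding b d trunc_simps koszul_bd.simps
        by (simp only: trunc_def nn) (simp add: grp.D_minus)
      have "(\<lambda>b. trunc (n - 1) (grp.D (p # ps) n y) (True # b)) = (\<lambda>b. - trunc (n - 1 - 1) (grp.D ps (n - 1) y1) b)"
        unfolding trunc_simps dy by (auto simp: trunc_def)
      \<comment> \<open>In degree 1 the extra term meets the boundary of y: its part from the
        \<open>False\<close> half collapses to zero and \<open>prime_con p\<close> undoes 1 - p on
        the rest. What remains cancels the error of the induction hypothesis for the
        \<open>True\<close> half, which sits in degree n - 1 = 0.\<close>
      moreover have "?E (trunc (n - 1) (grp.D (p # ps) n y) (False # ?z)) = grp_rel p (?E (y1 ?z))" if "n = 1"
        unfolding trunc_simps dy using that push_drop_primes_D[OF p(4) order_refl c(1)] p(2)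
          push_drop_primes_grp_rel[OF R_primes[OF p(4)] p(5) free_on_nonzero[OF chains_zero_bits[OF c(2)]]]
        by (simp add: trunc_def push_add)
      moreover have "prime_con p (grp_rel p (?E (y1 ?z))) = ?E (y1 ?z)"
        by (rule prime_con_grp_rel[OF p(5) free_on_nonzero[OF push_drop_primes[OF p(4) chains_zero_bits[OF c(2)]]]])
      ultimately have B: "res_con (p # ps) (n - 1) (trunc (n - 1) (grp.D (p # ps) n y)) b
          = res_con ps (n - 1 - 1) (trunc (n - 1 - 1) (grp.D ps (n - 1) y1)) b' + (if n = 1 \<and> b' = ?z then ?E (y1 ?z) else 0)"
        unfolding b d res_con.simps by (auto simp only: res_con_minus) auto
      show ?thesis using IH1[of b'] unfolding A B nn by (auto simp: b d y1_def algebra_simps)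
    qed
  qed
qed

section \<open>A free model of the completed resolution\<close>

lemma comm_group_rat_mult: "comm_group rat_mult_group"
proof (rule comm_groupI)
  fix x assume "x \<in> carrier rat_mult_group"
  thus "\<exists>y\<in>carrier rat_mult_group. y \<otimes>\<^bsub>rat_mult_group\<^esub> x = \<one>\<^bsub>rat_mult_group\<^esub>"
    by (intro bexI[of _ "inverse x"]) (auto simp: rat_mult_group_def)
qed (auto simp: rat_mult_group_def)

lemma inv_rat_mult: "x \<noteq> 0 \<Longrightarrow> inv\<^bsub>rat_mult_group\<^esub> x = inverse x"
  by (rule group.inv_equality) (use comm_group_rat_mult in \<open>auto simp: comm_group_def rat_mult_group_def\<close>)

text \<open>The terms of the model consist of combinations of pairs of a rational and a coded bit
  list, the concrete type that the existence claim of the theorem refers to. Slicing passes to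
  chains in the sense of \<open>koszul_bd\<close>.\<close>

definition slice :: "((rat \<times> nat) \<Rightarrow>\<^sub>0 int) \<Rightarrow> bool list \<Rightarrow> rat \<Rightarrow>\<^sub>0 int" where
  "slice y b = frag_extend (\<lambda>(u, k). if k = to_nat b then frag_of u else 0) y"

definition bits :: "nat list \<Rightarrow> bool list set" where "bits ps = {b. length b = length ps}"

definition unslice :: "nat list \<Rightarrow> (bool list \<Rightarrow> rat \<Rightarrow>\<^sub>0 int) \<Rightarrow> (rat \<times> nat) \<Rightarrow>\<^sub>0 int" where
  "unslice ps x = (\<Sum>b\<in>bits ps. push (\<lambda>u. (u, to_nat b)) (x b))"

lemma finite_bits: "finite (bits ps)"
  using finite_lists_length_eq[of "UNIV :: bool set" "length ps"] by (simp add: bits_def)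

lemma slice_add: "slice (x + y) b = slice x b + slice y b" by (simp add: slice_def frag_extend_add)
lemma slice_diff: "slice (x - y) b = slice x b - slice y b" by (simp add: slice_def frag_extend_diff)
lemma slice_0 [simp]: "slice 0 b = 0" by (simp add: slice_def)
lemma slice_of: "slice (frag_of (u, k)) b = (if k = to_nat b then frag_of u else 0)" by (simp add: slice_def)

lemma slice_sum: "slice (\<Sum>i\<in>I. y i) b = (\<Sum>i\<in>I. slice (y i) b)"
  by (induction I rule: infinite_finite_induct) (auto simp: slice_add)

lemma slice_push: "slice (push (\<lambda>u. (u, to_nat b')) v) b = (if b = b' then v else 0)"
  by (rule frag_additive_eq[of v UNIV]) (auto simp: push_diff slice_diff slice_of)

lemma slice_unslice: "slice (unslice ps x) b = (if b \<in> bits ps then x b else 0)"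
  by (simp add: unslice_def slice_sum slice_push finite_bits)

lemma unslice_add: "unslice ps (\<lambda>b. x b + y b) = unslice ps x + unslice ps y"
  by (simp add: unslice_def push_add sum.distrib)
lemma unslice_diff: "unslice ps (\<lambda>b. x b - y b) = unslice ps x - unslice ps y"
  by (simp add: unslice_def push_diff sum_subtractf)
lemma unslice_0 [simp]: "unslice ps (\<lambda>b. 0) = 0" by (simp add: unslice_def)
lemma unslice_slice:
  assumes "Poly_Mapping.keys y \<subseteq> UNIV \<times> to_nat ` bits ps"
  shows "unslice ps (slice y) = y"
proof (rule frag_additive_eq[OF assms, of "\<lambda>y. unslice ps (slice y)" "\<lambda>y. y"])
  fix s :: "rat \<times> nat" assume "s \<in> UNIV \<times> to_nat ` bits ps"
  then obtain u b where s: "s = (u, to_nat b)" "b \<in> bits ps" by auto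
  have "unslice ps (slice (frag_of s)) = (\<Sum>b'\<in>bits ps. if b = b' then frag_of s else 0)"
    unfolding unslice_def by (rule sum.cong) (auto simp: s slice_of)
  thus "unslice ps (slice (frag_of s)) = frag_of s" using s by (simp add: finite_bits)
next
  fix x y :: "(rat \<times> nat) \<Rightarrow>\<^sub>0 int"
  have "slice (x - y) = (\<lambda>b. slice x b - slice y b)" by (simp add: fun_eq_iff slice_diff)
  thus "unslice ps (slice (x - y)) = unslice ps (slice x) - unslice ps (slice y)" by (simp add: unslice_diff)
qed simp

definition scale :: "rat \<Rightarrow> ((rat \<times> nat) \<Rightarrow>\<^sub>0 int) \<Rightarrow> (rat \<times> nat) \<Rightarrow>\<^sub>0 int" where
  "scale g = push (\<lambda>(u, k). (g * u, k))"

lemma slice_scale: "slice (scale g y) b = push ((*) g) (slice y b)"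
  by (rule frag_additive_eq[of y UNIV]) (auto simp: scale_def push_diff slice_diff slice_of)

lemma scale_unslice: "unslice ps (\<lambda>b. push ((*) g) (x b)) = scale g (unslice ps x)"
proof -
  have "scale g (\<Sum>b\<in>I. y b) = (\<Sum>b\<in>I. scale g (y b))" for I :: "bool list set" and y
    by (induction I rule: infinite_finite_induct) (auto simp: scale_def push_add)
  moreover have "scale g (push (\<lambda>u. (u, k)) v) = push (\<lambda>u. (u, k)) (push ((*) g) v)" for k v
    by (simp add: scale_def push_push)
  ultimately show ?thesis by (simp add: unslice_def)
qed

definition free_mod :: "rat set \<Rightarrow> bool list set \<Rightarrow> (rat, (rat \<times> nat) \<Rightarrow>\<^sub>0 int) gmod" where
  "free_mod K B = with_action (free_Abelian_group (K \<times> to_nat ` B)) scale"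

lemma free_mod_simps [simp]:
  "y \<in> carrier (free_mod K B) \<longleftrightarrow> Poly_Mapping.keys y \<subseteq> K \<times> to_nat ` B"
  "x \<otimes>\<^bsub>free_mod K B\<^esub> y = x + y" "\<one>\<^bsub>free_mod K B\<^esub> = 0" "act (free_mod K B) = scale"
  by (simp_all add: free_mod_def)

lemma comm_group_free_mod: "comm_group (free_mod K B)"
  by (simp add: free_mod_def abelian_free_Abelian_group)

lemma inv_free_mod: "y \<in> carrier (free_mod K B) \<Longrightarrow> inv\<^bsub>free_mod K B\<^esub> y = - y"
  by (simp add: free_mod_def)

definition chains_on :: "rat set \<Rightarrow> bool list set \<Rightarrow> (bool list \<Rightarrow> rat \<Rightarrow>\<^sub>0 int) set" where
  "chains_on K B = {x. \<forall>b. Poly_Mapping.keys (x b) \<subseteq> K \<and> (b \<notin> B \<longrightarrow> x b = 0)}"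

lemma slice_chains_on:
  assumes "y \<in> carrier (free_mod K B)"
  shows "slice y \<in> chains_on K B"
proof -
  have y: "Poly_Mapping.keys y \<subseteq> K \<times> to_nat ` B" using assms by simp
  have "Poly_Mapping.keys (slice y b) \<subseteq> K" for b
    unfolding slice_def by (rule keys_frag_extend_subset[OF y]) (auto split: if_splits)
  moreover have "slice y b = 0" if "b \<notin> B" for b
    by (rule frag_additive_eq[OF y, of "\<lambda>y. slice y b" "\<lambda>y. 0"]) (use that in \<open>auto simp: slice_diff slice_of\<close>)
  ultimately show ?thesis by (simp add: chains_on_def)
qed

lemma unslice_carrier:
  assumes "x \<in> chains_on K B" "B \<subseteq> bits ps"
  shows "unslice ps x \<in> carrier (free_mod K B)"
proof -
  have "Poly_Mapping.keys (push (\<lambda>u. (u, to_nat b)) (x b)) \<subseteq> K \<times> to_nat ` B" for b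
  proof (cases "b \<in> B")
    case True
    have "Poly_Mapping.keys (x b) \<subseteq> K" using assms(1) by (simp add: chains_on_def)
    thus ?thesis using True keys_push[of "\<lambda>u. (u, to_nat b)" "x b"] by blast
  qed (use assms in \<open>simp add: chains_on_def\<close>)
  thus ?thesis
    using keys_sum[of "\<lambda>b. push (\<lambda>u. (u, to_nat b)) (x b)" "bits ps"] by (force simp: unslice_def)
qed

lemma slice_unslice_chains: "x \<in> chains_on K B \<Longrightarrow> B \<subseteq> bits ps \<Longrightarrow> slice (unslice ps x) = x"
  by (auto simp: fun_eq_iff slice_unslice chains_on_def)

lemma unslice_slice_carrier: "y \<in> carrier (free_mod K B) \<Longrightarrow> B \<subseteq> bits ps \<Longrightarrow> unslice ps (slice y) = y"
  by (rule unslice_slice) auto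

text \<open>Transports an operator on chains to the coded modules, where homomorphisms and complexes
  are formed.\<close>

definition lift_op :: "nat list \<Rightarrow> ((bool list \<Rightarrow> rat \<Rightarrow>\<^sub>0 int) \<Rightarrow> bool list \<Rightarrow> rat \<Rightarrow>\<^sub>0 int)
    \<Rightarrow> ((rat \<times> nat) \<Rightarrow>\<^sub>0 int) \<Rightarrow> (rat \<times> nat) \<Rightarrow>\<^sub>0 int" where
  "lift_op ps T y = unslice ps (T (slice y))"

definition additive_op :: "((bool list \<Rightarrow> rat \<Rightarrow>\<^sub>0 int) \<Rightarrow> bool list \<Rightarrow> rat \<Rightarrow>\<^sub>0 int) \<Rightarrow> bool" where
  "additive_op T \<longleftrightarrow> (\<forall>x y b. T (\<lambda>b. x b + y b) b = T x b + T y b)"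

lemma lift_op_add:
  assumes "additive_op T"
  shows "lift_op ps T (x + y) = lift_op ps T x + lift_op ps T y"
proof -
  have "slice (x + y) = (\<lambda>b. slice x b + slice y b)" by (simp add: fun_eq_iff slice_add)
  moreover have "T (\<lambda>b. slice x b + slice y b) = (\<lambda>b. T (slice x) b + T (slice y) b)"
    by (rule ext) (use assms in \<open>simp add: additive_op_def\<close>)
  ultimately show ?thesis by (simp add: lift_op_def unslice_add)
qed

lemma lift_op_0: "additive_op T \<Longrightarrow> lift_op ps T 0 = 0"
  using lift_op_add[of T ps 0 0] by simp

lemma lift_op_minus: "additive_op T \<Longrightarrow> lift_op ps T (- x) = - lift_op ps T x"
  using lift_op_add[of T ps x "- x"] lift_op_0[of T ps] by (simp add: eq_neg_iff_add_eq_0 add.commute)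

lemma lift_op_hom:
  assumes "additive_op T" "\<And>x. x \<in> chains_on K B \<Longrightarrow> T x \<in> chains_on K B'" "B' \<subseteq> bits ps"
  shows "lift_op ps T \<in> hom (free_mod K B) (free_mod K B')"
proof (rule homI)
  show "lift_op ps T x \<in> carrier (free_mod K B')" if "x \<in> carrier (free_mod K B)" for x
    unfolding lift_op_def by (rule unslice_carrier[OF assms(2)[OF slice_chains_on[OF that]] assms(3)])
qed (simp add: lift_op_add[OF assms(1)])

lemma slice_lift_op:
  assumes "T (slice y) \<in> chains_on K B" "B \<subseteq> bits ps"
  shows "slice (lift_op ps T y) = T (slice y)"
  unfolding lift_op_def by (rule slice_unslice_chains[OF assms])

lemma lift_op_ghom:
  assumes "lift_op ps T \<in> hom (free_mod K B) (free_mod K B')"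
    "\<And>g x. g \<in> carrier G \<Longrightarrow> x \<in> chains_on K B \<Longrightarrow> T (\<lambda>b. push ((*) g) (x b)) = (\<lambda>b. push ((*) g) (T x b))"
  shows "lift_op ps T \<in> ghom G (free_mod K B) (free_mod K B')"
proof -
  have "lift_op ps T (scale g y) = scale g (lift_op ps T y)" if "g \<in> carrier G" "y \<in> carrier (free_mod K B)" for g y
  proof -
    have "slice (scale g y) = (\<lambda>b. push ((*) g) (slice y b))" by (simp add: fun_eq_iff slice_scale)
    thus ?thesis using assms(2)[OF that(1) slice_chains_on[OF that(2)]] by (simp add: lift_op_def scale_unslice)
  qed
  thus ?thesis using assms(1) unfolding ghom_def by simp
qed

locale rat_subgroup =
  fixes \<Gamma> :: "rat monoid"
  assumes comm_group_\<Gamma>: "comm_group \<Gamma>" and mult_\<Gamma>: "x \<otimes>\<^bsub>\<Gamma>\<^esub> y = x * y" and one_\<Gamma>: "\<one>\<^bsub>\<Gamma>\<^esub> = 1"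
    and inv_\<Gamma>: "x \<in> carrier \<Gamma> \<Longrightarrow> inv\<^bsub>\<Gamma>\<^esub> x = inverse x" and \<Gamma>_nonzero: "0 \<notin> carrier \<Gamma>"
begin

lemma group_\<Gamma>: "group \<Gamma>" using comm_group_\<Gamma> by (simp add: comm_group_def)

lemma \<Gamma>_mult: "x \<in> carrier \<Gamma> \<Longrightarrow> y \<in> carrier \<Gamma> \<Longrightarrow> x * y \<in> carrier \<Gamma>"
  using monoid.m_closed[OF group.is_monoid[OF group_\<Gamma>]] mult_\<Gamma> by metis

lemma \<Gamma>_one: "1 \<in> carrier \<Gamma>" using monoid.one_closed[OF group.is_monoid[OF group_\<Gamma>]] one_\<Gamma> by simp

lemma \<Gamma>_inverse: "x \<in> carrier \<Gamma> \<Longrightarrow> inverse x \<in> carrier \<Gamma>"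
  using group.inv_closed[OF group_\<Gamma>, of x] inv_\<Gamma> by simp

lemma gmodule_free_mod: "gmodule \<Gamma> (free_mod (carrier \<Gamma>) B)"
proof -
  interpret G: group \<Gamma> by (rule group_\<Gamma>)
  interpret M: comm_group "free_mod (carrier \<Gamma>) B" by (rule comm_group_free_mod)
  have "scale g x \<in> carrier (free_mod (carrier \<Gamma>) B)" if "g \<in> carrier \<Gamma>" "x \<in> carrier (free_mod (carrier \<Gamma>) B)" for g x
    using that keys_push[of "\<lambda>(u, k). (g * u, k)" x] \<Gamma>_mult by (fastforce simp: scale_def)
  hence "scale g \<in> hom (free_mod (carrier \<Gamma>) B) (free_mod (carrier \<Gamma>) B)" if "g \<in> carrier \<Gamma>" for g
    using that by (intro homI) (simp_all add: scale_def push_add)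
  moreover have "scale 1 x = x" for x
    by (rule frag_additive_eq[of x UNIV]) (auto simp: scale_def push_diff)
  ultimately show ?thesis
    by unfold_locales (simp_all add: mult_\<Gamma> one_\<Gamma>, simp add: scale_def push_push case_prod_unfold mult.assoc)
qed

text \<open>The value at h of the function on \<Gamma> corresponding to y, moved to the base point 1
  so that all values lie in the same group.\<close>

definition fibre :: "((rat \<times> nat) \<Rightarrow>\<^sub>0 int) \<Rightarrow> rat \<Rightarrow> (rat \<times> nat) \<Rightarrow>\<^sub>0 int" where
  "fibre y h = frag_extend (\<lambda>(u, k). if u = h then frag_of (1, k) else 0) y"

lemma fibre_diff: "fibre (x - y) h = fibre x h - fibre y h" by (simp add: fibre_def frag_extend_diff)
lemma fibre_add: "fibre (x + y) h = fibre x h + fibre y h" by (simp add: fibre_def frag_extend_add)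

lemma fibre_of: "fibre (frag_of (u, k)) h = (if u = h then frag_of (1, k) else 0)" by (simp add: fibre_def)

lemma lookup_fibre: "poly_mapping.lookup (fibre y h) (1, k) = poly_mapping.lookup y (h, k)"
  by (rule frag_additive_eq[of y UNIV "\<lambda>y. poly_mapping.lookup (fibre y h) (1, k)" "\<lambda>y. poly_mapping.lookup y (h, k)"])
    (auto simp: fibre_diff lookup_minus fibre_of split: if_splits)

lemma keys_fibre: "Poly_Mapping.keys y \<subseteq> A \<times> B \<Longrightarrow> Poly_Mapping.keys (fibre y h) \<subseteq> {1} \<times> B"
  unfolding fibre_def by (rule keys_frag_extend_subset) (auto split: if_splits)

text \<open>The free module on K times B is itself induced from the free abelian group on B, so a
  trivial complement M' suffices.\<close>

lemma relatively_projective_free_mod: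
  fixes B :: "bool list set"
  shows "relatively_projective \<Gamma> (free_mod (carrier \<Gamma>) B)"
proof -
  define N :: "((rat \<times> nat) \<Rightarrow>\<^sub>0 int) monoid" where "N = free_Abelian_group ({1} \<times> to_nat ` B)"
  define M' :: "(rat, rat \<Rightarrow> (rat \<times> nat) \<Rightarrow>\<^sub>0 int) gmod" where "M' = with_action (singleton_group undefined) (\<lambda>g x. x)"
  let ?M = "free_mod (carrier \<Gamma>) B" and ?I = "induced_gmod \<Gamma> N"
  interpret G: group \<Gamma> by (rule group_\<Gamma>)
  have N: "comm_group N" unfolding N_def by (rule abelian_free_Abelian_group)
  hence gN: "group N" by (simp add: comm_group_def)
  have cI: "carrier ?I = {x \<in> carrier \<Gamma> \<rightarrow>\<^sub>E carrier N. finite {h \<in> carrier \<Gamma>. x h \<noteq> 0}}"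
    using carrier_sum_group[of "carrier \<Gamma>" "\<lambda>_. N", OF gN] by (simp add: induced_gmod_def N_def)
  have M': "gmodule \<Gamma> M'"
  proof -
    interpret M': comm_group M' by (simp add: M'_def)
    show ?thesis by unfold_locales (auto simp: M'_def hom_def)
  qed
  define \<psi> where "\<psi> = (\<lambda>(y, m :: rat \<Rightarrow> (rat \<times> nat) \<Rightarrow>\<^sub>0 int). \<lambda>h\<in>carrier \<Gamma>. fibre y h)"
  have \<psi>c: "\<psi> (y, m) \<in> carrier ?I" if "y \<in> carrier ?M" for y m
  proof -
    have y: "Poly_Mapping.keys y \<subseteq> carrier \<Gamma> \<times> to_nat ` B" using that by simp
    have "fibre y h = 0" if "h \<notin> fst ` Poly_Mapping.keys y" for h
      by (rule frag_additive_eq[of y "Poly_Mapping.keys y" "\<lambda>y. fibre y h" "\<lambda>y. 0"])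
        (use that in \<open>auto simp: fibre_diff fibre_of image_iff\<close>)
    hence "{h \<in> carrier \<Gamma>. \<psi> (y, m) h \<noteq> 0} \<subseteq> fst ` Poly_Mapping.keys y" by (auto simp: \<psi>_def)
    moreover have "finite (fst ` Poly_Mapping.keys y)" by simp
    ultimately have "finite {h \<in> carrier \<Gamma>. \<psi> (y, m) h \<noteq> 0}" by (rule finite_subset)
    moreover have "\<psi> (y, m) \<in> carrier \<Gamma> \<rightarrow>\<^sub>E carrier N" using keys_fibre[OF y] by (simp add: \<psi>_def N_def)
    ultimately show ?thesis unfolding cI by simp
  qed
  have hom: "\<psi> \<in> hom (gmod_prod ?M M') ?I"
    using \<psi>c by (intro homI) (auto simp: gmod_prod_def \<psi>_def induced_gmod_def fibre_add N_def intro!: restrict_ext)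
  have inj: "inj_on \<psi> (carrier (gmod_prod ?M M'))"
  proof (rule inj_onI, clarify)
    fix y m y' m' assume a: "(y, m) \<in> carrier (gmod_prod ?M M')" "(y', m') \<in> carrier (gmod_prod ?M M')" "\<psi> (y, m) = \<psi> (y', m')"
    have "poly_mapping.lookup y (h, k) = poly_mapping.lookup y' (h, k)" for h k
    proof (cases "h \<in> carrier \<Gamma>")
      case True
      hence "fibre y h = fibre y' h" using fun_cong[OF a(3), of h] by (simp add: \<psi>_def)
      thus ?thesis using lookup_fibre by metis
    next
      case False
      hence "(h, k) \<notin> Poly_Mapping.keys y" "(h, k) \<notin> Poly_Mapping.keys y'" using a(1,2) by (auto simp: gmod_prod_def)
      thus ?thesis by (simp add: in_keys_iff)
    qed
    hence "y = y'" by (intro poly_mapping_eqI) auto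
    thus "y = y' \<and> m = m'" using a(1,2) by (auto simp: gmod_prod_def M'_def)
  qed
  have surj: "carrier ?I \<subseteq> \<psi> ` carrier (gmod_prod ?M M')"
  proof
    fix z assume z: "z \<in> carrier ?I"
    have zk: "Poly_Mapping.keys (z h) \<subseteq> {1} \<times> to_nat ` B" if "h \<in> carrier \<Gamma>" for h
    proof -
      have "z h \<in> carrier N" using z that unfolding cI by (simp add: PiE_iff)
      thus ?thesis by (simp add: N_def)
    qed
    define y0 where "y0 = (\<lambda>(h, k). if h \<in> carrier \<Gamma> then poly_mapping.lookup (z h) (1 :: rat, k) else 0)"
    have y0: "h \<in> carrier \<Gamma>" "(1, k) \<in> Poly_Mapping.keys (z h)" if "y0 (h, k) \<noteq> 0" for h k
      using that by (auto simp: y0_def in_keys_iff split: if_splits)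
    have sub: "{s. y0 s \<noteq> 0} \<subseteq> (SIGMA h:{h \<in> carrier \<Gamma>. z h \<noteq> 0}. snd ` Poly_Mapping.keys (z h))"
    proof
      fix s assume "s \<in> {s. y0 s \<noteq> 0}"
      moreover obtain h k where s: "s = (h, k)" by fastforce
      ultimately have "y0 (h, k) \<noteq> 0" by simp
      from y0[OF this] show "s \<in> (SIGMA h:{h \<in> carrier \<Gamma>. z h \<noteq> 0}. snd ` Poly_Mapping.keys (z h))"
        by (auto simp: s intro: rev_image_eqI)
    qed
    have "finite {s. y0 s \<noteq> 0}"
      by (rule finite_subset[OF sub], rule finite_SigmaI) (use z cI in auto)
    hence ly: "poly_mapping.lookup (Abs_poly_mapping y0) = y0" by simp
    define y where "y = Abs_poly_mapping y0"
    have lyy: "poly_mapping.lookup y = y0" by (simp add: y_def ly)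
    have yk: "Poly_Mapping.keys y \<subseteq> carrier \<Gamma> \<times> to_nat ` B"
    proof
      fix s assume "s \<in> Poly_Mapping.keys y"
      moreover obtain h k where s: "s = (h, k)" by fastforce
      ultimately have "y0 (h, k) \<noteq> 0" by (simp add: in_keys_iff lyy)
      from y0[OF this] show "s \<in> carrier \<Gamma> \<times> to_nat ` B" using zk[of h] s by blast
    qed
    have "\<psi> (y, undefined) = z"
    proof
      fix h
      show "\<psi> (y, undefined) h = z h"
      proof (cases "h \<in> carrier \<Gamma>")
        case True
        have "fibre y h = z h"
        proof (rule poly_mapping_eqI)
          fix s :: "rat \<times> nat"
          obtain v k where s: "s = (v, k)" by fastforce
          show "poly_mapping.lookup (fibre y h) s = poly_mapping.lookup (z h) s"
          proof (cases "v = 1")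
            case True
            thus ?thesis using \<open>h \<in> carrier \<Gamma>\<close> by (simp add: s lookup_fibre lyy y0_def)
          next
            case False
            hence "s \<notin> Poly_Mapping.keys (fibre y h)" "s \<notin> Poly_Mapping.keys (z h)"
              using keys_fibre[OF yk] zk[OF \<open>h \<in> carrier \<Gamma>\<close>] s by auto
            thus ?thesis by (simp add: in_keys_iff)
          qed
        qed
        thus ?thesis using True by (simp add: \<psi>_def)
      next
        case False
        thus ?thesis using z unfolding cI by (simp add: \<psi>_def PiE_iff extensional_def)
      qed
    qed
    moreover have "(y, undefined) \<in> carrier (gmod_prod ?M M')" using yk by (simp add: gmod_prod_def M'_def)
    ultimately show "z \<in> \<psi> ` carrier (gmod_prod ?M M')" by (metis imageI)
  qed
  have "\<psi> ` carrier (gmod_prod ?M M') \<subseteq> carrier ?I" using hom by (auto simp: hom_def)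
  hence "bij_betw \<psi> (carrier (gmod_prod ?M M')) (carrier ?I)"
    using inj surj by (simp add: bij_betw_def subset_antisym)
  moreover have "\<psi> (act (gmod_prod ?M M') g s) = act ?I g (\<psi> s)" if g: "g \<in> carrier \<Gamma>" and s: "s \<in> carrier (gmod_prod ?M M')" for g s
  proof -
    have g0: "g \<noteq> 0" using g \<Gamma>_nonzero by auto
    have "fibre (scale g y) h = fibre y (inverse g * h)" for y h
    proof (rule frag_additive_eq[of y UNIV])
      fix s :: "rat \<times> nat"
      obtain u k where s: "s = (u, k)" by fastforce
      have "g * u = h \<longleftrightarrow> u = inverse g * h" using g0 by (auto simp: field_simps)
      thus "fibre (scale g (frag_of s)) h = fibre (frag_of s) (inverse g * h)" by (simp add: s scale_def fibre_def)
    qed (simp_all add: fibre_diff scale_def push_diff)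
    thus ?thesis using g \<Gamma>_mult[OF \<Gamma>_inverse[OF g]]
      by (cases s) (auto simp: gmod_prod_def \<psi>_def induced_gmod_def mult_\<Gamma> inv_\<Gamma> intro!: restrict_ext)
  qed
  ultimately have "\<psi> \<in> giso \<Gamma> (gmod_prod ?M M') ?I"
    using hom unfolding giso_def ghom_def iso_def by blast
  thus ?thesis unfolding relatively_projective_def using gmodule_free_mod N M' by blast
qed

end

definition aug :: "('a \<Rightarrow>\<^sub>0 int) \<Rightarrow> int" where "aug x = poly_mapping.lookup (push (\<lambda>_. ()) x) ()"

lemma aug_of [simp]: "aug (frag_of u) = 1" by (simp add: aug_def)
lemma aug_0 [simp]: "aug 0 = 0" by (simp add: aug_def)
lemma aug_add: "aug (x + y) = aug x + aug y" by (simp add: aug_def push_add lookup_add)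
lemma aug_diff: "aug (x - y) = aug x - aug y" by (simp add: aug_def push_diff lookup_minus)
lemma aug_push: "aug (push h x) = aug x" by (simp add: aug_def push_push)
lemma aug_cmul: "aug (frag_cmul m (frag_of u)) = m"
  by (simp add: aug_def push_def frag_extend_cmul)

lemma push_const:
  assumes "Poly_Mapping.keys x \<subseteq> S" "\<And>u. u \<in> S \<Longrightarrow> h u = c"
  shows "push h x = frag_cmul (aug x) (frag_of c)"
  by (rule frag_additive_eq[OF assms(1)]) (use assms(2) in \<open>auto simp: push_diff aug_diff frag_cmul_diff_distrib\<close>)

lemma aug_grp_rel: "aug (grp_rel p x) = 0" by (simp add: grp_rel_def aug_diff aug_push)
lemma aug_grp_neg: "aug (grp_neg x) = aug x" by (simp add: grp_neg_def aug_push)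

lemma trunc_add: "trunc n (\<lambda>b. x b + y b) b = trunc n x b + trunc n y (b :: bool list) "
  for x y :: "bool list \<Rightarrow> 'v::monoid_add"
  by (simp add: trunc_def)

lemma additive_ops: "additive_op (grp.D ps n)" "additive_op (trunc n)" "additive_op (cpl_con ps n)" "additive_op (res_con ps n)"
  "additive_op (\<lambda>x. trunc m (grp.D ps n x))"
  by (simp_all add: additive_op_def grp.D_add trunc_add cpl_con_add res_con_add) (simp add: trunc_def grp.D_add)

section \<open>The truncated and the full total complex as resolution and completion\<close>

locale gamma_model = rat_subgroup \<Gamma> + basis_set "carrier \<Gamma>" R for \<Gamma> R +
  fixes ps :: "nat list"
  assumes psR: "set ps \<subseteq> R" and distinct_ps: "distinct ps"
    and drop_primes_\<Gamma>: "u \<in> carrier \<Gamma> \<Longrightarrow> drop_primes ps u = 1"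
begin

abbreviation "K \<equiv> carrier \<Gamma>"
abbreviation "low n \<equiv> {b \<in> bits ps. weight b \<le> n}"

lemma chains_iff: "x \<in> koszul_chains free_on qs g \<longleftrightarrow> x \<in> chains_on K (bits qs)"
proof (induction qs arbitrary: x g)
  case Nil
  show ?case by (simp add: chains_on_def bits_def free_on_def) (metis keys_zero empty_subsetI)
next
  case (Cons q qs)
  note split = all_bits[of "\<lambda>b. Poly_Mapping.keys (x b) \<subseteq> K \<and> (b \<notin> bits (q # qs) \<longrightarrow> x b = 0)"]
  show ?case unfolding chains_on_def mem_Collect_eq split
    by (simp add: Cons.IH chains_on_def) (auto simp: bits_def)
qed

lemma chains_low: "x \<in> chains_on K (low n) \<longleftrightarrow> x \<in> chains_on K (bits ps) \<and> trunc n x = x"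
  by (auto simp: chains_on_def trunc_def fun_eq_iff)

lemma trunc_low: "x \<in> chains_on K (bits ps) \<Longrightarrow> trunc n x \<in> chains_on K (low n)"
  by (auto simp: chains_on_def trunc_def)

lemma D_chains: "x \<in> chains_on K (bits ps) \<Longrightarrow> grp.D ps n x \<in> chains_on K (bits ps)"
  using chains_D[OF psR, of x 1] by (simp add: chains_iff)

lemma D_push:
  assumes "x \<in> chains_on K (bits ps)"
  shows "grp.D ps n (\<lambda>b. push ((*) g) (x b)) = (\<lambda>b. push ((*) g) (grp.D ps n x b))"
proof
  fix b
  have x: "x \<in> koszul_chains free_on ps 1" using assms by (simp add: chains_iff)
  show "grp.D ps n (\<lambda>b. push ((*) g) (x b)) b = push ((*) g) (grp.D ps n x b)"
    by (rule koszul_bd_natural[OF x psR koszul_levels_axioms grp.koszul_axioms])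
      (simp_all add: push_add grp_neg_def grp_rel_def push_diff push_push mult.left_commute)
qed

lemma trunc_push: "trunc n (\<lambda>b. push h (x b)) = (\<lambda>b. push h (trunc n x b))"
  by (auto simp: trunc_def fun_eq_iff)

definition cpl :: "(rat, (rat \<times> nat) \<Rightarrow>\<^sub>0 int) gcomplex" where
  "cpl = \<lparr>obj = (\<lambda>n. free_mod K (bits ps)), bd = (\<lambda>n. lift_op ps (grp.D ps n))\<rparr>"

text \<open>A quotient of the full complex rather than a subcomplex, so that truncation can serve as
  the map from the completion to the resolution.\<close>

definition res :: "(rat, (rat \<times> nat) \<Rightarrow>\<^sub>0 int) gcomplex" where
  "res = \<lparr>obj = (\<lambda>n. free_mod K (low n)), bd = (\<lambda>n. lift_op ps (\<lambda>x. trunc (n - 1) (grp.D ps n x)))\<rparr>"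

definition res_aug :: "int \<Rightarrow> ((rat \<times> nat) \<Rightarrow>\<^sub>0 int) \<Rightarrow> int" where
  "res_aug n y = (if n = 0 then aug (slice y (zero_bits ps)) else 0)"

definition cpl_res :: "int \<Rightarrow> ((rat \<times> nat) \<Rightarrow>\<^sub>0 int) \<Rightarrow> (rat \<times> nat) \<Rightarrow>\<^sub>0 int" where
  "cpl_res n = lift_op ps (trunc n)"

lemma cpl_simps [simp]: "obj cpl n = free_mod K (bits ps)" "bd cpl n = lift_op ps (grp.D ps n)"
  by (simp_all add: cpl_def)

lemma res_simps [simp]: "obj res n = free_mod K (low n)" "bd res n = lift_op ps (\<lambda>x. trunc (n - 1) (grp.D ps n x))"
  by (simp_all add: res_def)

lemma slice_cpl_bd:
  assumes "y \<in> carrier (free_mod K (bits ps))"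
  shows "slice (lift_op ps (grp.D ps n) y) = grp.D ps n (slice y)"
  by (rule slice_lift_op[where T = "grp.D ps n", OF D_chains[OF slice_chains_on[OF assms]]]) simp

lemma low_bits: "x \<in> chains_on K (low n) \<Longrightarrow> x \<in> chains_on K (bits ps)" by (simp add: chains_low)

lemma slice_res_bd:
  assumes "y \<in> carrier (free_mod K (low n))"
  shows "slice (lift_op ps (\<lambda>x. trunc (n - 1) (grp.D ps n x)) y) = trunc (n - 1) (grp.D ps n (slice y))"
  by (rule slice_lift_op[where T = "\<lambda>x. trunc (n - 1) (grp.D ps n x)", OF trunc_low[OF D_chains[OF low_bits[OF slice_chains_on[OF assms]]]]]) auto

lemma is_gcomplex_cpl: "is_gcomplex \<Gamma> cpl"
  unfolding is_gcomplex_def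
proof (intro allI conjI ballI)
  fix n
  show "gmodule \<Gamma> (obj cpl n)" by (simp add: gmodule_free_mod)
  show "bd cpl n \<in> ghom \<Gamma> (obj cpl n) (obj cpl (n - 1))"
    unfolding cpl_simps by (rule lift_op_ghom[OF lift_op_hom[OF additive_ops(1) D_chains order_refl] D_push])
  fix y assume y: "y \<in> carrier (obj cpl n)"
  have "grp.D ps (n - 1) (grp.D ps n (slice y)) = (\<lambda>b. 0)" by (rule ext) (rule grp.DD)
  thus "bd cpl (n - 1) (bd cpl n y) = \<one>\<^bsub>obj cpl (n - 2)\<^esub>"
    using slice_cpl_bd[of y n] y by (simp add: lift_op_def[of ps "grp.D ps (n - 1)"])
qed

lemma is_gcomplex_res: "is_gcomplex \<Gamma> res"
  unfolding is_gcomplex_def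
proof (intro allI conjI ballI)
  fix n
  show "gmodule \<Gamma> (obj res n)" by (simp add: gmodule_free_mod)
  have "lift_op ps (\<lambda>x. trunc (n - 1) (grp.D ps n x)) \<in> hom (free_mod K (low n)) (free_mod K (low (n - 1)))"
    by (rule lift_op_hom[OF additive_ops(5) trunc_low[OF D_chains[OF low_bits]]]) auto
  thus "bd res n \<in> ghom \<Gamma> (obj res n) (obj res (n - 1))"
    unfolding res_simps by (rule lift_op_ghom) (simp add: D_push[OF low_bits] trunc_push)
  fix y assume y: "y \<in> carrier (obj res n)"
  have "trunc (n - 1 - 1) (grp.D ps (n - 1) (trunc (n - 1) (grp.D ps n (slice y)))) = (\<lambda>b. 0)"
  proof
    fix b
    have "grp.D ps (n - 1) (grp.D ps n (slice y)) = (\<lambda>b. 0)" by (rule ext) (rule grp.DD)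
    thus "trunc (n - 1 - 1) (grp.D ps (n - 1) (trunc (n - 1) (grp.D ps n (slice y)))) b = 0"
      unfolding trunc_trunc_bd by (simp add: trunc_def)
  qed
  thus "bd res (n - 1) (bd res n y) = \<one>\<^bsub>obj res (n - 2)\<^esub>"
    using slice_res_bd[of y n] y
    by (simp only: lift_op_def[of ps "\<lambda>x. trunc (n - 1 - 1) (grp.D ps (n - 1) x)"] res_simps unslice_0 free_mod_simps)
qed

lemma contractible_cpl: "contractible_ab (obj cpl) (bd cpl)"
  unfolding contractible_ab_def
proof (intro exI[of _ "\<lambda>n. lift_op ps (cpl_con ps n)"] allI conjI ballI)
  fix n
  have c: "cpl_con ps n x \<in> chains_on K (bits ps)" if "x \<in> chains_on K (bits ps)" for n x
    using cpl_con_KC[of x ps 1 n] that by (simp add: chains_iff)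
  show "lift_op ps (cpl_con ps n) \<in> hom (obj cpl n) (obj cpl (n + 1))"
    unfolding cpl_simps by (rule lift_op_hom[OF additive_ops(3) c order_refl])
  fix y assume "y \<in> carrier (obj cpl n)"
  hence y: "y \<in> carrier (free_mod K (bits ps))" by simp
  have sy: "slice y \<in> koszul_chains free_on ps 1" using slice_chains_on[OF y] by (simp add: chains_iff)
  have s: "slice (lift_op ps (cpl_con ps n) y) = cpl_con ps n (slice y)"
    by (rule slice_lift_op[where T = "cpl_con ps n", OF c[OF slice_chains_on[OF y]]]) simp
  have "lift_op ps (grp.D ps (n + 1)) (lift_op ps (cpl_con ps n) y) + lift_op ps (cpl_con ps (n - 1)) (lift_op ps (grp.D ps n) y)
     = unslice ps (\<lambda>b. grp.D ps (n + 1) (cpl_con ps n (slice y)) b + cpl_con ps (n - 1) (grp.D ps n (slice y)) b)"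
    unfolding unslice_add by (simp only: lift_op_def[of ps "grp.D ps (n + 1)"] lift_op_def[of ps "cpl_con ps (n - 1)"] s slice_cpl_bd[OF y])
  also have "\<dots> = y" unfolding cpl_contraction[OF psR sy] by (rule unslice_slice_carrier[OF y order_refl])
  finally show "bd cpl (n + 1) (lift_op ps (cpl_con ps n) y) \<otimes>\<^bsub>obj cpl n\<^esub> lift_op ps (cpl_con ps (n - 1)) (bd cpl n y) = y"
    by (simp only: cpl_simps free_mod_simps)
qed

lemma slice_cpl_res:
  assumes "y \<in> carrier (free_mod K (bits ps))"
  shows "slice (cpl_res n y) = trunc n (slice y)"
  unfolding cpl_res_def by (rule slice_lift_op[where T = "trunc n", OF trunc_low[OF slice_chains_on[OF assms]]]) auto

lemma cpl_res_ghom: "cpl_res n \<in> ghom \<Gamma> (free_mod K (bits ps)) (free_mod K (low n))"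
proof -
  have "cpl_res n \<in> hom (free_mod K (bits ps)) (free_mod K (low n))"
    unfolding cpl_res_def by (rule lift_op_hom[OF additive_ops(2) trunc_low]) auto
  thus ?thesis unfolding cpl_res_def by (rule lift_op_ghom) (rule trunc_push)
qed

lemma gchain_map_cpl_res: "gchain_map \<Gamma> cpl res cpl_res"
  unfolding gchain_map_def
proof (intro allI conjI ballI)
  fix n
  show "cpl_res n \<in> ghom \<Gamma> (obj cpl n) (obj res n)" using cpl_res_ghom by simp
  fix y assume "y \<in> carrier (obj cpl n)"
  hence y: "y \<in> carrier (free_mod K (bits ps))" by simp
  have "trunc (n - 1) (grp.D ps n (slice y)) = trunc (n - 1) (grp.D ps n (trunc n (slice y)))"
    by (rule ext) (rule trunc_trunc_bd[symmetric])
  thus "cpl_res (n - 1) (bd cpl n y) = bd res n (cpl_res n y)"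
    unfolding cpl_simps res_simps cpl_res_def[of "n - 1"] lift_op_def[of ps "trunc (n - 1)"] slice_cpl_bd[OF y]
      lift_op_def[of ps "\<lambda>x. trunc (n - 1) (grp.D ps n x)"] slice_cpl_res[OF y] by simp
qed

lemma weight_le: "weight b \<le> int (length b)" by (simp add: weight_def)

text \<open>A subset has at most \<open>length ps\<close> elements, so from that degree on no
  component is cut off.\<close>

lemma cpl_res_giso:
  assumes "n \<ge> int (length ps)"
  shows "cpl_res n \<in> giso \<Gamma> (free_mod K (bits ps)) (free_mod K (low n))"
proof -
  have "weight b \<le> n" if "b \<in> bits ps" for b using weight_le[of b] that assms by (simp add: bits_def)
  hence l: "low n = bits ps" by auto
  have "cpl_res n y = y" if y: "y \<in> carrier (free_mod K (bits ps))" for y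
  proof -
    have "slice y \<in> chains_on K (low n)" using slice_chains_on[OF y] by (simp only: l)
    hence "trunc n (slice y) = slice y" by (simp add: chains_low)
    thus ?thesis using unslice_slice_carrier[OF y order_refl] by (simp add: cpl_res_def lift_op_def)
  qed
  hence "bij_betw (cpl_res n) (carrier (free_mod K (bits ps))) (carrier (free_mod K (bits ps)))"
    using bij_betw_cong[of "carrier (free_mod K (bits ps))" "cpl_res n" id] by simp
  thus ?thesis using cpl_res_ghom[of n] unfolding l giso_def iso_def ghom_def by simp
qed

lemma completion_cpl: "completion \<Gamma> res cpl cpl_res"
  unfolding completion_def
  using is_gcomplex_cpl relatively_projective_free_mod contractible_cpl gchain_map_cpl_res cpl_res_giso by auto

lemma low_neg: "n < 0 \<Longrightarrow> low n = {}"
  using weight_nonneg by (auto simp: not_le intro: less_le_trans)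

lemma aug_D:
  assumes "x \<in> chains_on K (bits ps)"
  shows "aug (grp.D ps 1 x (zero_bits ps)) = 0"
proof -
  have "aug (push (drop_primes ps) (grp.D ps 1 x (zero_bits ps))) = aug (0 :: rat \<Rightarrow>\<^sub>0 int)"
    using push_drop_primes_D[OF psR order_refl, of x 1] assms by (simp add: chains_iff)
  thus ?thesis by (simp add: aug_push)
qed

lemma gchain_map_res_aug: "gchain_map \<Gamma> res (in_degree_0 (trivial_gmod integer_group)) res_aug"
  unfolding gchain_map_def
proof (intro allI conjI ballI)
  fix n
  show "res_aug n \<in> ghom \<Gamma> (obj res n) (obj (in_degree_0 (trivial_gmod integer_group)) n)"
    unfolding ghom_def by (auto simp: res_aug_def trivial_gmod_def slice_add aug_add slice_scale aug_push intro!: homI)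
  fix y assume "y \<in> carrier (obj res n)"
  hence y: "y \<in> carrier (free_mod K (low n))" by simp
  have "res_aug (n - 1) (bd res n y) = 0"
    using slice_res_bd[OF y] aug_D[OF low_bits[OF slice_chains_on[OF y]]] by (auto simp: res_aug_def trunc_def)
  thus "res_aug (n - 1) (bd res n y) = bd (in_degree_0 (trivial_gmod integer_group)) n (res_aug n y)"
    by (simp add: trivial_gmod_def)
qed

text \<open>An additive section of the augmentation, placed at the group element 1 in the
  empty-subset component. It is not equivariant, which is harmless as the cone need only be
  contractible as a complex of groups.\<close>

definition unit :: "int \<Rightarrow> (rat \<times> nat) \<Rightarrow>\<^sub>0 int" where
  "unit m = unslice ps (zero_chain ps (frag_cmul m (frag_of 1)))"

lemma unit_chains: "zero_chain ps (frag_cmul m (frag_of 1)) \<in> chains_on K (low 0)"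
  using \<Gamma>_one by (auto simp: chains_on_def zero_chain_def bits_def keys_frag_of dest: subsetD[OF keys_cmul])

lemma unit_carrier: "unit m \<in> carrier (free_mod K (low 0))"
  unfolding unit_def by (rule unslice_carrier[OF unit_chains]) auto

lemma slice_unit: "slice (unit m) = zero_chain ps (frag_cmul m (frag_of 1))"
  unfolding unit_def by (rule slice_unslice_chains[OF unit_chains]) auto

lemma unit_add: "unit (l + m) = unit l + unit m"
proof -
  have "zero_chain ps (frag_cmul (l + m) (frag_of 1)) = (\<lambda>b. zero_chain ps (frag_cmul l (frag_of 1)) b + zero_chain ps (frag_cmul m (frag_of 1)) b)"
    by (auto simp: zero_chain_def frag_cmul_distrib)
  thus ?thesis unfolding unit_def unslice_add[symmetric] by (rule arg_cong)
qed

lemma res_bd_carrier: "y \<in> carrier (free_mod K (low n)) \<Longrightarrow> bd res n y \<in> carrier (free_mod K (low (n - 1)))"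
  using ghom_closed[OF gcomplexD(2)[OF is_gcomplex_res], of y n] by (simp only: res_simps)

lemma res_con_low:
  assumes "x \<in> chains_on K (low n)"
  shows "res_con ps n x \<in> chains_on K (low (n + 1))"
  using assms res_con_KC[OF psR, of x 1 n] trunc_res_con[of n x ps] by (simp add: chains_low chains_iff)

lemma free_mod_minus: "y \<in> carrier (free_mod K B) \<Longrightarrow> - y \<in> carrier (free_mod K B)" by simp

lemma free_mod_add: "y \<in> carrier (free_mod K B) \<Longrightarrow> z \<in> carrier (free_mod K B) \<Longrightarrow> z + y \<in> carrier (free_mod K B)"
  using Poly_Mapping.keys_add[of z y] by auto

text \<open>The homotopy \<open>res_con\<close> and the section \<open>unit\<close> combined; the
  negative sign compensates the sign of the cone differential.\<close>

definition cone_con :: "int \<Rightarrow> ((rat \<times> nat) \<Rightarrow>\<^sub>0 int) \<times> int \<Rightarrow> ((rat \<times> nat) \<Rightarrow>\<^sub>0 int) \<times> int" where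
  "cone_con n = (\<lambda>(x, m). (- lift_op ps (res_con ps (n - 1)) x + (if n = 0 then unit m else 0), 0))"

lemma res_con_hom: "lift_op ps (res_con ps (n - 1)) \<in> hom (free_mod K (low (n - 1))) (free_mod K (low n))"
  by (rule lift_op_hom[OF additive_ops(4)]) (use res_con_low[of _ "n - 1"] in auto)

text \<open>On \<Gamma> the collapse in \<open>res_contraction\<close> sends every element to 1, so
  the error there is the augmentation followed by \<open>unit\<close>.\<close>

lemma res_homotopy:
  assumes x: "x \<in> carrier (free_mod K (low k))"
  shows "bd res (k + 1) (lift_op ps (res_con ps k) x) + lift_op ps (res_con ps (k - 1)) (bd res k x)
    + (if k = 0 then unit (res_aug 0 x) else 0) = x"
proof -
  have sx: "slice x \<in> chains_on K (low k)" by (rule slice_chains_on[OF x])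
  have c: "slice x \<in> koszul_chains free_on ps 1" "trunc k (slice x) = slice x" using sx by (simp_all add: chains_low chains_iff)
  have e: "push (drop_primes ps) (slice x (zero_bits ps)) = frag_cmul (aug (slice x (zero_bits ps))) (frag_of 1)"
    by (rule push_const[of _ K]) (use sx drop_primes_\<Gamma> in \<open>auto simp: chains_on_def\<close>)
  have s: "slice (lift_op ps (res_con ps k) x) = res_con ps k (slice x)"
    by (rule slice_lift_op[where T = "res_con ps k", OF res_con_low[OF sx]]) auto
  have "bd res (k + 1) (lift_op ps (res_con ps k) x) + lift_op ps (res_con ps (k - 1)) (bd res k x)
     = unslice ps (\<lambda>b. trunc k (grp.D ps (k + 1) (res_con ps k (slice x))) b + res_con ps (k - 1) (trunc (k - 1) (grp.D ps k (slice x))) b)"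
    unfolding unslice_add res_simps slice_res_bd[OF x] s
      lift_op_def[of ps "\<lambda>x. trunc (k + 1 - 1) (grp.D ps (k + 1) x)"] lift_op_def[of ps "res_con ps (k - 1)"] by simp
  also have "\<dots> = unslice ps (\<lambda>b. slice x b - (if k = 0 then zero_chain ps (frag_cmul (aug (slice x (zero_bits ps))) (frag_of 1)) b else 0))"
    unfolding res_contraction[OF distinct_ps psR c] e by (rule arg_cong[of _ _ "unslice ps"]) (auto simp: zero_chain_def)
  also have "\<dots> = x - (if k = 0 then unit (res_aug 0 x) else 0)"
    using unslice_slice_carrier[OF x] by (auto simp: unslice_diff unit_def res_aug_def)
  finally show ?thesis by simp
qed

lemma contractible_cone:
  "contractible_ab (cone_obj (obj res) (obj (in_degree_0 (trivial_gmod integer_group))))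
     (cone_bd (obj res) (bd res) (obj (in_degree_0 (trivial_gmod integer_group))) (bd (in_degree_0 (trivial_gmod integer_group))) res_aug)"
  (is "contractible_ab ?C ?d")
  unfolding contractible_ab_def
proof (intro exI[of _ cone_con] allI conjI ballI)
  fix n :: int
  note M = trivial_gmod_def
  have car: "carrier (?C n) = carrier (free_mod K (low (n - 1))) \<times> (if n = 0 then UNIV else {0})" for n
    by (simp add: cone_obj_def M)
  have mult: "(x, m) \<otimes>\<^bsub>?C n\<^esub> (y, l) = (x + y, m + l)" for n x y m l by (simp add: cone_obj_def M)
  have con: "- lift_op ps (res_con ps (n - 1)) x + (if n = 0 then unit m else 0) \<in> carrier (free_mod K (low n))"
    if "x \<in> carrier (free_mod K (low (n - 1)))" for x m
  proof (cases "n = 0")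
    case True
    show ?thesis using free_mod_add[OF unit_carrier free_mod_minus[OF hom_in_carrier[OF res_con_hom that, unfolded True]], of m]
      unfolding True by (simp only: if_True refl)
  next
    case False
    show ?thesis using free_mod_minus[OF hom_in_carrier[OF res_con_hom that]] False
      by (simp only: if_False add_0_right)
  qed
  show "cone_con n \<in> hom (?C n) (?C (n + 1))"
  proof (rule homI, unfold car)
    fix z assume "z \<in> carrier (free_mod K (low (n - 1))) \<times> (if n = 0 then UNIV else {0 :: int})"
    thus "cone_con n z \<in> carrier (free_mod K (low (n + 1 - 1))) \<times> (if n + 1 = 0 then UNIV else {0})"
      using con by (cases z) (auto simp: cone_con_def simp del: free_mod_simps)
  next
    fix z w :: "((rat \<times> nat) \<Rightarrow>\<^sub>0 int) \<times> int"
    show "cone_con n (z \<otimes>\<^bsub>?C n\<^esub> w) = cone_con n z \<otimes>\<^bsub>?C (n + 1)\<^esub> cone_con n w"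
      by (cases z; cases w) (simp add: mult cone_con_def lift_op_add[OF additive_ops(4)] unit_add algebra_simps)
  qed
  fix z assume "z \<in> carrier (?C n)"
  then obtain x m where z: "z = (x, m)" "x \<in> carrier (free_mod K (low (n - 1)))" "n \<noteq> 0 \<Longrightarrow> m = 0"
    unfolding car by (auto split: if_splits simp del: free_mod_simps)
  define s where "s = lift_op ps (res_con ps (n - 1)) x"
  define u where "u = (if n = 0 then unit m else 0)"
  have sc: "s \<in> carrier (free_mod K (low n))" unfolding s_def by (rule hom_in_carrier[OF res_con_hom z(2)])
  have bdu: "bd res n u = 0"
  proof (cases "n = 0")
    case True
    have "bd res 0 (unit m) \<in> carrier (free_mod K (low (0 - 1)))" by (rule res_bd_carrier[OF unit_carrier])
    thus ?thesis using True low_neg[of "- 1"] by (simp add: u_def)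
  qed (simp add: u_def lift_op_0[OF additive_ops(5)])
  have bds: "bd res n s \<in> carrier (free_mod K (low (n - 1)))" by (rule res_bd_carrier[OF sc])
  have bdx: "bd res (n - 1) x \<in> carrier (free_mod K (low (n - 2)))" using res_bd_carrier[OF z(2)] by simp
  have "bd res n (- s + u) = - bd res n s"
    using bdu by (simp only: res_simps lift_op_add[OF additive_ops(5)] lift_op_minus[OF additive_ops(5)]) simp
  hence 1: "inv\<^bsub>obj res (n - 1)\<^esub> (bd res n (- s + u)) = bd res n s"
    using inv_free_mod[OF free_mod_minus[OF bds]] by (simp only: res_simps minus_minus)
  have 2: "res_aug n (- s + u) = m"
  proof (cases "n = 0")
    case True
    hence "x = 0" using z(2) low_neg[of "- 1"] by simp
    hence "s = 0" using True by (simp add: s_def lift_op_0[OF additive_ops(4)])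
    thus ?thesis using True by (simp add: u_def res_aug_def slice_unit zero_chain_def aug_cmul)
  qed (use z in \<open>simp add: res_aug_def\<close>)
  have 3: "?d n z = (- bd res (n - 1) x, res_aug (n - 1) x)"
    using inv_free_mod[OF bdx] by (simp add: z(1) cone_bd_def M del: free_mod_simps)
  have "?d (n + 1) (cone_con n z) = (bd res n s, m)"
    using 1 2 by (simp add: z(1) cone_con_def s_def[symmetric] u_def[symmetric] cone_bd_def M del: free_mod_simps)
  moreover have "cone_con (n - 1) (?d n z) = (lift_op ps (res_con ps (n - 2)) (bd res (n - 1) x) + (if n = 1 then unit (res_aug 0 x) else 0), 0)"
    unfolding 3 by (simp add: cone_con_def lift_op_minus[OF additive_ops(4)])
  moreover have "bd res n s + (lift_op ps (res_con ps (n - 2)) (bd res (n - 1) x) + (if n = 1 then unit (res_aug 0 x) else 0)) = x"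
    using res_homotopy[OF z(2)] by (simp add: s_def add.assoc)
  ultimately show "?d (n + 1) (cone_con n z) \<otimes>\<^bsub>?C n\<^esub> cone_con (n - 1) (?d n z) = z"
    by (simp only: mult z(1)) simp
qed

lemma completed_resolution_cpl: "completed_resolution \<Gamma> (trivial_gmod integer_group) res res_aug cpl cpl_res"
proof -
  have "gmodule \<Gamma> (trivial_gmod integer_group)"
  proof -
    interpret G: group \<Gamma> by (rule group_\<Gamma>)
    interpret M: comm_group "trivial_gmod integer_group" by (simp add: trivial_gmod_def abelian_integer_group) 
    show ?thesis by unfold_locales (auto simp: trivial_gmod_def hom_def)
  qed
  moreover have "carrier (obj res n) = {\<one>\<^bsub>obj res n\<^esub>}" if "n < 0" for n
    unfolding res_simps low_neg[OF that] by auto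
  ultimately have "resolution \<Gamma> (trivial_gmod integer_group) res res_aug"
    unfolding resolution_def
    using is_gcomplex_res relatively_projective_free_mod gchain_map_res_aug contractible_cone by simp
  thus ?thesis using completion_cpl by (simp add: completed_resolution_def)
qed

end

lemma triv_chains_iff: "x \<in> koszul_chains (\<lambda>g. UNIV) qs g \<longleftrightarrow> (\<forall>b. b \<notin> bits qs \<longrightarrow> x b = 0)"
proof (induction qs arbitrary: x g)
  case Nil
  show ?case by (auto simp: bits_def)
next
  case (Cons q qs)
  note split = all_bits[of "\<lambda>b. b \<notin> bits (q # qs) \<longrightarrow> x b = 0"]
  show ?case unfolding split by (simp add: Cons.IH) (auto simp: bits_def)
qed

section \<open>Coinvariants of the model\<close>

context gamma_model
begin

definition slice_aug :: "((rat \<times> nat) \<Rightarrow>\<^sub>0 int) \<Rightarrow> bool list \<Rightarrow> int" where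
  "slice_aug y b = aug (slice y b)"

lemma slice_aug_hom: "slice_aug \<in> hom (free_mod K (bits ps)) (triv.chain_group ps 1)"
proof (rule homI)
  fix y assume "y \<in> carrier (free_mod K (bits ps))"
  from slice_chains_on[OF this] show "slice_aug y \<in> carrier (triv.chain_group ps 1)"
    by (simp add: triv_chains_iff slice_aug_def chains_on_def)
qed (simp add: slice_aug_def slice_add aug_add fun_eq_iff)

lemma slice_aug_surj: "slice_aug ` carrier (free_mod K (bits ps)) = carrier (triv.chain_group ps 1)"
proof
  show "slice_aug ` carrier (free_mod K (bits ps)) \<subseteq> carrier (triv.chain_group ps 1)"
    using slice_aug_hom by (auto simp only: hom_def)
  show "carrier (triv.chain_group ps 1) \<subseteq> slice_aug ` carrier (free_mod K (bits ps))"
  proof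
    fix x assume "x \<in> carrier (triv.chain_group ps 1)"
    hence x: "x b = 0" if "b \<notin> bits ps" for b using that by (simp add: triv_chains_iff)
    have c: "(\<lambda>b. frag_cmul (x b) (frag_of 1)) \<in> chains_on K (bits ps)"
      using \<Gamma>_one x by (auto simp: chains_on_def keys_frag_of dest: subsetD[OF keys_cmul])
    have "slice_aug (unslice ps (\<lambda>b. frag_cmul (x b) (frag_of 1))) = x"
      by (simp add: slice_aug_def slice_unslice_chains[OF c order_refl] aug_cmul fun_eq_iff)
    thus "x \<in> slice_aug ` carrier (free_mod K (bits ps))"
      using unslice_carrier[OF c order_refl] by (metis imageI)
  qed
qed

lemma group_hom_slice_aug: "group_hom (free_mod K (bits ps)) (triv.chain_group ps 1) slice_aug"
  using slice_aug_hom comm_group_free_mod[of K "bits ps"] triv.comm_group_chain_group[of ps 1]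
  by (simp add: group_hom_def group_hom_axioms_def comm_group_def)

text \<open>Replacing every group element by 1 changes y only by an element of
  \<open>coinv_sub\<close>, and the result is determined by the augmentations of the slices.\<close>

lemma kernel_slice_aug:
  "kernel (free_mod K (bits ps)) (triv.chain_group ps 1) slice_aug = coinv_sub \<Gamma> (free_mod K (bits ps))"
proof
  let ?M = "free_mod K (bits ps)"
  interpret a: group_hom ?M "triv.chain_group ps 1" slice_aug by (rule group_hom_slice_aug)
  have L: "subgroup (coinv_sub \<Gamma> ?M) ?M" by (rule subgroup_coinv_sub[OF gmodule_free_mod])
  define collapse where "collapse = push (\<lambda>(u :: rat, k :: nat). (1 :: rat, k))"
  have *: "y - collapse y \<in> coinv_sub \<Gamma> ?M" if "Poly_Mapping.keys y \<subseteq> K \<times> to_nat ` bits ps" for y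
    using that
  proof (induction y rule: frag_induction)
    case zero
    show ?case using subgroup.one_closed[OF L] by (simp add: collapse_def)
  next
    case (one s)
    then obtain u k where s: "s = (u, k)" "u \<in> K" "k \<in> to_nat ` bits ps" by auto
    have 1: "frag_of (1, k) \<in> carrier ?M" using s \<Gamma>_one by (auto simp: keys_frag_of)
    have "act ?M u (frag_of (1, k)) \<otimes>\<^bsub>?M\<^esub> inv\<^bsub>?M\<^esub> frag_of (1, k) = frag_of s - collapse (frag_of s)"
      using inv_free_mod[OF 1] by (simp add: s scale_def collapse_def)
    hence "frag_of s - collapse (frag_of s) \<in> {act ?M g x \<otimes>\<^bsub>?M\<^esub> inv\<^bsub>?M\<^esub> x | g x. g \<in> K \<and> x \<in> carrier ?M}"
      using 1 s(2) by (metis (mono_tags, lifting) mem_Collect_eq)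
    thus ?case unfolding coinv_sub_def by (rule generate.incl)
  next
    case (diff x y)
    have c: "x - collapse x \<in> carrier ?M" "y - collapse y \<in> carrier ?M"
      using diff subgroup.mem_carrier[OF L] by blast+
    have "(x - collapse x) \<otimes>\<^bsub>?M\<^esub> inv\<^bsub>?M\<^esub> (y - collapse y) \<in> coinv_sub \<Gamma> ?M"
      using diff by (intro subgroup.m_closed[OF L] subgroup.m_inv_closed[OF L])
    thus ?case unfolding inv_free_mod[OF c(2)] by (simp add: collapse_def push_diff algebra_simps)
  qed
  show "kernel ?M (triv.chain_group ps 1) slice_aug \<subseteq> coinv_sub \<Gamma> ?M"
  proof
    fix y assume "y \<in> kernel ?M (triv.chain_group ps 1) slice_aug"
    hence y: "y \<in> carrier ?M" and a: "aug (slice y b) = 0" for b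
      by (auto simp: kernel_def slice_aug_def fun_eq_iff)
    have "slice (collapse y) b = push (\<lambda>_. 1) (slice y b)" for b
      by (rule frag_additive_eq[of y UNIV]) (auto simp: collapse_def push_diff slice_diff slice_of)
    also have "push (\<lambda>_. 1) (slice y b) = 0" for b
      using push_const[of "slice y b" UNIV "\<lambda>_. 1" 1] a[of b] by simp
    finally have "slice (collapse y) = (\<lambda>b. 0)" by (simp add: fun_eq_iff)
    moreover have "Poly_Mapping.keys (collapse y) \<subseteq> UNIV \<times> to_nat ` bits ps"
      using keys_push[of "\<lambda>(u, k). (1, k)" y] y by (fastforce simp: collapse_def)
    ultimately have "collapse y = 0" using unslice_slice[of "collapse y" ps] by simp
    thus "y \<in> coinv_sub \<Gamma> ?M" using *[of y] y by simp
  qed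
  have "act ?M g x \<otimes>\<^bsub>?M\<^esub> inv\<^bsub>?M\<^esub> x \<in> kernel ?M (triv.chain_group ps 1) slice_aug"
    if "g \<in> K" "x \<in> carrier ?M" for g x
  proof -
    have c: "act ?M g x \<in> carrier ?M" by (rule hom_in_carrier[OF gmodule.act_hom[OF gmodule_free_mod that(1)] that(2)])
    hence "act ?M g x \<otimes>\<^bsub>?M\<^esub> inv\<^bsub>?M\<^esub> x \<in> carrier ?M" using that(2) by (intro a.G.m_closed a.G.inv_closed)
    thus ?thesis unfolding kernel_def
      using inv_free_mod[OF that(2)] by (simp add: slice_aug_def slice_diff slice_scale aug_diff aug_push fun_eq_iff)
  qed
  thus "coinv_sub \<Gamma> ?M \<subseteq> kernel ?M (triv.chain_group ps 1) slice_aug"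
    unfolding coinv_sub_def by (intro a.G.generate_subgroup_incl a.subgroup_kernel) blast
qed

lemma slice_aug_bd:
  assumes "y \<in> carrier (free_mod K (bits ps))"
  shows "slice_aug (bd cpl n y) = koszul_bd triv_inv triv_rel ps n (slice_aug y)"
proof
  fix b
  have s: "slice y \<in> koszul_chains free_on ps 1" using slice_chains_on[OF assms] by (simp add: chains_iff)
  have "koszul_bd triv_inv triv_rel ps n (\<lambda>b. aug (slice y b)) b = aug (grp.D ps n (slice y) b)"
    by (rule koszul_bd_natural[OF s psR koszul_levels_axioms triv.koszul_axioms])
      (simp_all add: aug_add aug_grp_neg triv_inv_def aug_grp_rel triv_rel_def)
  thus "slice_aug (bd cpl n y) b = koszul_bd triv_inv triv_rel ps n (slice_aug y) b"
    using slice_cpl_bd[OF assms, of n] by (simp add: slice_aug_def[abs_def])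
qed

text \<open>The augmentation of slices is already an isomorphism from each group of coinvariants, so
  \<open>chain_homology_iso_of_acyclic_kernel\<close> applies with a trivial kernel.\<close>

lemma trivial_iso_coinv_homology_cpl:
  "chain_homology (\<lambda>_. triv.chain_group ps 1) (koszul_bd triv_inv triv_rel ps) n \<cong> coinv_homology \<Gamma> cpl n"
proof -
  let ?O = "coinv_obj \<Gamma> cpl"
  let ?M = "free_mod K (bits ps)" and ?T = "triv.chain_group ps 1"
  interpret X: gcomplex \<Gamma> cpl by unfold_locales (rule is_gcomplex_cpl)
  interpret a: group_hom ?M ?T slice_aug by (rule group_hom_slice_aug)
  define h where "h c = the_elem (slice_aug ` c)" for c
  have iso: "h \<in> iso (?O n) ?T" for n
    using a.FactGroup_iso_set[OF slice_aug_surj]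
    unfolding kernel_slice_aug by (simp only: coinv_obj_def coinvariants_def cpl_simps h_def[abs_def])
  have h: "h (X.L n #>\<^bsub>?M\<^esub> y) = slice_aug y" if y: "y \<in> carrier ?M" for y n
  proof -
    have "slice_aug z = slice_aug y" if zin: "z \<in> X.L n #>\<^bsub>?M\<^esub> y" for z
    proof -
      obtain l where z: "z = l \<otimes>\<^bsub>?M\<^esub> y" "l \<in> X.L n" using zin unfolding r_coset_def by blast
      have l: "l \<in> carrier ?M" "slice_aug l = \<one>\<^bsub>?T\<^esub>"
        using z(2) unfolding cpl_simps kernel_slice_aug[symmetric] kernel_def by blast+
      show ?thesis unfolding z(1) using a.hom_mult[OF l(1) y] a.hom_closed[OF y] l(2) by (simp only: a.H.l_one)
    qed
    moreover have "X.L n #>\<^bsub>?M\<^esub> y \<noteq> {}"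
      using a.G.rcos_self[OF y X.L[of n, unfolded cpl_simps]] unfolding cpl_simps by blast
    ultimately show ?thesis unfolding h_def by (rule the_elem_image_unique[rotated])
  qed
  have coset: "\<exists>y\<in>carrier ?M. c = X.L n #>\<^bsub>?M\<^esub> y" if "c \<in> carrier (?O n)" for c n
    using that unfolding X.carrier_coinv_obj by (auto simp del: free_mod_simps)
  have bdc: "bd cpl n y \<in> carrier ?M" if "y \<in> carrier ?M" for y n
    using ghom_closed[OF gcomplexD(2)[OF is_gcomplex_cpl], of y n] that by (simp only: cpl_simps)
  have bd1: "coinv_bd \<Gamma> cpl n (X.L n #>\<^bsub>?M\<^esub> y) = X.L (n - 1) #>\<^bsub>?M\<^esub> bd cpl n y" if "y \<in> carrier ?M" for y n
    using X.coinv_bd_coset[of y n] that by (simp only: cpl_simps)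
  have dd: "coinv_bd \<Gamma> cpl (n - 1) (coinv_bd \<Gamma> cpl n c) = \<one>\<^bsub>coinv_obj \<Gamma> cpl (n - 2)\<^esub>"
    if c: "c \<in> carrier (?O n)" for c n
  proof -
    obtain y where y: "y \<in> carrier ?M" "c = X.L n #>\<^bsub>?M\<^esub> y" using coset[OF c] by blast
    have "bd cpl (n - 1) (bd cpl n y) = \<one>\<^bsub>?M\<^esub>" using is_gcomplex_cpl y(1) unfolding is_gcomplex_def by (simp only: cpl_simps)
    hence "coinv_bd \<Gamma> cpl (n - 1) (coinv_bd \<Gamma> cpl n c) = X.L (n - 2) #>\<^bsub>?M\<^esub> \<one>\<^bsub>?M\<^esub>"
      unfolding y(2) bd1[OF y(1)] using bd1[OF bdc[OF y(1)], of "n - 1" n] by (simp only:) simp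
    also have "\<dots> = X.L (n - 2)"
      using a.G.coset_join2[OF a.G.one_closed X.L[of "n - 2", unfolded cpl_simps] subgroup.one_closed[OF X.L[of "n - 2", unfolded cpl_simps]]]
      by (simp only: cpl_simps)
    finally show ?thesis by (simp only: X.one_coinv_obj)
  qed
  have hom: "h \<in> hom (?O n) ?T" and inj: "inj_on h (carrier (?O n))"
    and surj: "h ` carrier (?O n) = carrier ?T" for n
    using iso[of n] by (auto simp only: iso_def bij_betw_def)
  have T: "comm_group ?T" by (rule triv.comm_group_chain_group)
  have gc: "group (?O n)" and gT: "group ?T" for n
    using X.comm_coinv T by (auto simp: comm_group_def)
  have acyclic: "\<exists>y\<in>carrier (coinv_obj \<Gamma> cpl (n + 1)). coinv_bd \<Gamma> cpl (n + 1) y = x \<and> h y = \<one>\<^bsub>?T\<^esub>"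
    if "x \<in> carrier (?O n)" "h x = \<one>\<^bsub>?T\<^esub>" for x n
  proof
    have one: "h \<one>\<^bsub>coinv_obj \<Gamma> cpl n\<^esub> = \<one>\<^bsub>?T\<^esub>" for n by (rule hom_one[OF hom gc gT])
    hence "x = \<one>\<^bsub>coinv_obj \<Gamma> cpl n\<^esub>" using inj_onD[OF inj, of x "\<one>\<^bsub>coinv_obj \<Gamma> cpl n\<^esub>" n] that monoid.one_closed[OF group.is_monoid[OF gc]] by metis
    moreover have "coinv_bd \<Gamma> cpl (n + 1) \<one>\<^bsub>coinv_obj \<Gamma> cpl (n + 1)\<^esub> = \<one>\<^bsub>coinv_obj \<Gamma> cpl (n + 1 - 1)\<^esub>"
      by (rule hom_one[OF X.coinv_bd_hom gc gc])
    ultimately show "coinv_bd \<Gamma> cpl (n + 1) \<one>\<^bsub>coinv_obj \<Gamma> cpl (n + 1)\<^esub> = x \<and> h \<one>\<^bsub>coinv_obj \<Gamma> cpl (n + 1)\<^esub> = \<one>\<^bsub>?T\<^esub>"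
      using one by simp
    show "\<one>\<^bsub>coinv_obj \<Gamma> cpl (n + 1)\<^esub> \<in> carrier (coinv_obj \<Gamma> cpl (n + 1))" by (rule monoid.one_closed[OF group.is_monoid[OF gc]])
  qed
  have nat: "h (coinv_bd \<Gamma> cpl n c) = koszul_bd triv_inv triv_rel ps n (h c)" if c: "c \<in> carrier (?O n)" for c n
  proof -
    obtain y where y: "y \<in> carrier ?M" "c = X.L n #>\<^bsub>?M\<^esub> y" using coset[OF c] by blast
    show ?thesis unfolding y(2) bd1[OF y(1)] h[OF y(1)] h[OF bdc[OF y(1)]] by (rule slice_aug_bd[OF y(1)])
  qed
  have Tdd: "koszul_bd triv_inv triv_rel ps (n - 1) (koszul_bd triv_inv triv_rel ps n x) = \<one>\<^bsub>?T\<^esub>" for n x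
    unfolding triv.chain_group_simps by (rule ext) (rule triv.DD)
  have "coinv_homology \<Gamma> cpl n \<cong> chain_homology (\<lambda>_. ?T) (koszul_bd triv_inv triv_rel ps) n"
    unfolding coinv_homology_def
    by (rule chain_homology_iso_of_acyclic_kernel[where h = "\<lambda>_. h", OF X.comm_coinv T X.coinv_bd_hom triv.D_hom[OF subset_UNIV] dd Tdd hom nat surj acyclic])
  moreover have "group (coinv_homology \<Gamma> cpl n)"
    unfolding coinv_homology_def by (rule group_chain_homology[OF X.comm_coinv X.coinv_bd_hom dd])
  ultimately show ?thesis by (rule group.iso_sym[rotated])
qed

end

section \<open>The canonical isomorphism\<close>

context level
begin

abbreviation "\<Gamma> \<equiv> Gamma_group f"
abbreviation "prime_gens \<equiv> {of_nat p :: rat | p :: nat. Factorial_Ring.prime p \<and> p dvd f}"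
abbreviation "gens \<equiv> insert (- 1) prime_gens"

lemma gens_nonzero: "gens \<subseteq> carrier rat_mult_group"
  using prime_gt_0_nat by (force simp: rat_mult_group_def)

lemma carrier_Gamma: "carrier \<Gamma> = generate rat_mult_group gens"
  using gens_nonzero by (simp add: Gamma_group_def carrier_subgroup_generated Int_absorb1)

lemma rat_group: "group rat_mult_group" using comm_group_rat_mult by (simp add: comm_group_def)

lemma Gamma_nonzero: "u \<in> carrier \<Gamma> \<Longrightarrow> u \<noteq> 0"
  using group.carrier_subgroup_generated_subset[OF rat_group, of gens] by (auto simp: Gamma_group_def rat_mult_group_def)

lemma gens_Gamma: "gens \<subseteq> carrier \<Gamma>"
  unfolding carrier_Gamma by (auto intro: generate.incl)

lemma Gamma_simps: "x \<otimes>\<^bsub>\<Gamma>\<^esub> y = x * y" "\<one>\<^bsub>\<Gamma>\<^esub> = 1"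
  by (simp_all add: Gamma_group_def rat_mult_group_def)

sublocale \<Gamma>: rat_subgroup \<Gamma>
proof (rule rat_subgroup.intro)
  show "comm_group \<Gamma>"
    unfolding Gamma_group_def by (rule group.abelian_subgroup_generated[OF rat_group comm_group_rat_mult])
  show "inv\<^bsub>\<Gamma>\<^esub> x = inverse x" if "x \<in> carrier \<Gamma>" for x
    using group.inv_subgroup_generated[OF rat_group, of x gens] that inv_rat_mult[OF Gamma_nonzero[OF that]]
    by (simp add: Gamma_group_def)
  show "0 \<notin> carrier \<Gamma>" using Gamma_nonzero by auto
qed (simp_all add: Gamma_simps)

lemma drop_primes_Gamma:
  assumes "u \<in> carrier \<Gamma>"
  shows "drop_primes ps u = 1"
proof -
  have P: "\<forall>p\<in>set ps. Factorial_Ring.prime p" using ps by simp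
  have one: "drop_primes qs 1 = 1" for qs by (induction qs) (simp_all add: drop_prime_one)
  have nz: "u \<noteq> 0" if "u \<in> generate rat_mult_group gens" for u using that Gamma_nonzero by (simp add: carrier_Gamma)
  have g: "drop_primes ps u = 1" if "u \<in> gens" for u
  proof -
    from that consider "u = - 1" | p where "u = of_nat p" "Factorial_Ring.prime p" "p dvd f" by blast
    thus ?thesis
    proof cases
      case 1
      thus ?thesis by (simp only: drop_primes_uminus one)
    next
      case 2
      thus ?thesis using drop_primes_prime[OF P 2(2)] ps by simp
    qed
  qed
  have "u \<in> generate rat_mult_group gens" using assms by (simp add: carrier_Gamma)
  thus ?thesis
  proof (induction rule: generate.induct)
    case one
    show ?case using \<open>\<And>qs. drop_primes qs 1 = 1\<close> by (simp add: rat_mult_group_def)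
  next
    case (incl h)
    thus ?case by (rule g)
  next
    case (inv h)
    have h: "h \<noteq> 0" using inv gens_nonzero by (auto simp: rat_mult_group_def)
    have "drop_primes ps (h * inverse h) = drop_primes ps h * drop_primes ps (inverse h)"
      by (rule drop_primes_mult[OF P h]) (use h in simp)
    thus ?case using g[OF inv] h one by (simp add: inv_rat_mult)
  next
    case (eng h1 h2)
    thus ?case using drop_primes_mult[OF P nz nz] by (simp add: rat_mult_group_def)
  qed
qed

sublocale \<Gamma>: gamma_model \<Gamma> "set ps" ps
proof
  show "0 \<notin> carrier \<Gamma>" by (rule \<Gamma>.\<Gamma>_nonzero)
  show "- u \<in> carrier \<Gamma>" if "u \<in> carrier \<Gamma>" for u
    using \<Gamma>.\<Gamma>_mult[of "- 1" u] gens_Gamma that by simp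
  show "of_nat p powi i * u \<in> carrier \<Gamma>" if "p \<in> set ps" "u \<in> carrier \<Gamma>" for p u i
  proof -
    have p: "of_nat p \<in> carrier \<Gamma>" using that(1) gens_Gamma ps by auto
    have pow: "x ^ n \<in> carrier \<Gamma>" if "x \<in> carrier \<Gamma>" for x n
      by (induction n) (use that \<Gamma>.\<Gamma>_one \<Gamma>.\<Gamma>_mult in auto)
    have "of_nat p powi i \<in> carrier \<Gamma>" unfolding power_int_def using pow p \<Gamma>.\<Gamma>_inverse by simp
    thus ?thesis using that(2) by (rule \<Gamma>.\<Gamma>_mult)
  qed
qed (use ps distinct_ps drop_primes_Gamma in auto)

text \<open>The generators are rational numbers while \<open>rat_val\<close> expects a natural
  prime; \<open>nat\<close> of the floor recovers it. Positivity selects one element of each coset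
  of {1, -1} and is unaffected by multiplication with primes.\<close>

sublocale \<Gamma>: signed_free_abelian \<Gamma> "prime_gens" "- 1" "\<lambda>t. rat_val (nat \<lfloor>t\<rfloor>)" "{u. u > 0}"
proof (intro signed_free_abelian.intro \<Gamma>.comm_group_\<Gamma> signed_free_abelian_axioms.intro)
  have "prime_gens = (of_nat ` set ps :: rat set)" by (auto simp: ps)
  thus "finite prime_gens" by simp
  show "prime_gens \<subseteq> carrier \<Gamma>" "- 1 \<in> carrier \<Gamma>" using gens_Gamma by auto
  show "- 1 \<otimes>\<^bsub>\<Gamma>\<^esub> - 1 = \<one>\<^bsub>\<Gamma>\<^esub>" by (simp add: Gamma_simps)
  have "carrier (subgroup_generated \<Gamma> gens) = generate \<Gamma> (carrier \<Gamma> \<inter> gens)" by (rule carrier_subgroup_generated)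
  thus "generate \<Gamma> gens = carrier \<Gamma>"
    using gens_Gamma group.subgroup_generated2[OF rat_group, of gens] by (simp only: Int_absorb1 Gamma_group_def)
  show "rat_val (nat \<lfloor>t\<rfloor>) (g \<otimes>\<^bsub>\<Gamma>\<^esub> h) = rat_val (nat \<lfloor>t\<rfloor>) g + rat_val (nat \<lfloor>t\<rfloor>) h"
    if "t \<in> prime_gens" "g \<in> carrier \<Gamma>" "h \<in> carrier \<Gamma>" for t g h
    using that Gamma_nonzero by (auto simp: Gamma_simps rat_val_mult)
  show "rat_val (nat \<lfloor>t\<rfloor>) s = (if s = t then 1 else 0)"
    if "s \<in> prime_gens" "t \<in> prime_gens" for s t :: rat
    using that by (auto simp: rat_val_prime)
  show "- 1 \<otimes>\<^bsub>\<Gamma>\<^esub> g \<in> {u. u > 0} \<longleftrightarrow> g \<notin> {u. u > 0}" if "g \<in> carrier \<Gamma>" for g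
    using Gamma_nonzero[OF that] by (auto simp: Gamma_simps)
  show "t \<otimes>\<^bsub>\<Gamma>\<^esub> g \<in> {u. u > 0} \<longleftrightarrow> g \<in> {u. u > 0}"
    if "t \<in> prime_gens" "g \<in> carrier \<Gamma>" for t g
    using that prime_gt_0_nat by (auto simp: Gamma_simps zero_less_mult_iff)
qed

lemma sign_homology_iso_coinv_homology: "sign_homology (univ_dist f) n \<cong> coinv_homology \<Gamma> \<Gamma>.cpl n"
  by (rule iso_trans[OF sign_homology_iso_trivial \<Gamma>.trivial_iso_coinv_homology_cpl])

text \<open>One isomorphism onto the homology of the model is fixed in each degree and transported
  along a comparison with the model. Compatibility holds because a comparison composed with the
  chosen one is again a comparison from the model, and all of these agree on homology.\<close>

lemma canonical_isomorphism:
  "\<exists>\<Phi>. (\<forall>(P :: (rat, 'p) gcomplex) \<epsilon> (X :: (rat, 'x) gcomplex) \<kappa>.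
           completed_resolution \<Gamma> (trivial_gmod integer_group) P \<epsilon> X \<kappa> \<longrightarrow>
           (\<forall>n. \<Phi> P \<epsilon> X \<kappa> n \<in> iso (sign_homology (univ_dist f) n) (coinv_homology \<Gamma> X n))) \<and>
        (\<forall>P \<epsilon> X \<kappa> Q \<epsilon>' Y \<kappa>' \<phi> \<theta>.
           completed_resolution \<Gamma> (trivial_gmod integer_group) P \<epsilon> X \<kappa> \<and>
           completed_resolution \<Gamma> (trivial_gmod integer_group) Q \<epsilon>' Y \<kappa>' \<and>
           comparison \<Gamma> P \<epsilon> X \<kappa> Q \<epsilon>' Y \<kappa>' \<phi> \<theta> \<longrightarrow>
           (\<forall>n. \<forall>c\<in>carrier (sign_homology (univ_dist f) n).
              coinv_homology_map \<Gamma> Y \<theta> n (\<Phi> P \<epsilon> X \<kappa> n c) = \<Phi> Q \<epsilon>' Y \<kappa>' n c))"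
proof -
  let ?M = "trivial_gmod integer_group :: (rat, int) gmod"
  note R0 = \<Gamma>.completed_resolution_cpl
  define \<iota> where "\<iota> n = (SOME h. h \<in> iso (sign_homology (univ_dist f) n) (coinv_homology \<Gamma> \<Gamma>.cpl n))" for n
  have \<iota>: "\<iota> n \<in> iso (sign_homology (univ_dist f) n) (coinv_homology \<Gamma> \<Gamma>.cpl n)" for n
  proof -
    have "\<exists>h. h \<in> iso (sign_homology (univ_dist f) n) (coinv_homology \<Gamma> \<Gamma>.cpl n)"
      using sign_homology_iso_coinv_homology[of n] by (simp only: is_iso_def ex_in_conv simp_thms)
    thus ?thesis unfolding \<iota>_def by (rule someI_ex)
  qed
  \<comment> \<open>The choice is immaterial by \<open>comparison_homology_unique\<close>; it only
    serves to make \<Phi> a function of the completed resolution.\<close>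
  define \<Theta> where "\<Theta> P \<epsilon> X \<kappa> = (SOME \<theta>. \<exists>\<phi>. comparison \<Gamma> \<Gamma>.res \<Gamma>.res_aug \<Gamma>.cpl \<Gamma>.cpl_res P \<epsilon> X \<kappa> \<phi> \<theta>)"
    for P :: "(rat, 'p) gcomplex" and \<epsilon> :: "int \<Rightarrow> 'p \<Rightarrow> int" and X :: "(rat, 'x) gcomplex" and \<kappa>
  have \<Theta>: "\<exists>\<phi>. comparison \<Gamma> \<Gamma>.res \<Gamma>.res_aug \<Gamma>.cpl \<Gamma>.cpl_res P \<epsilon> X \<kappa> \<phi> (\<Theta> P \<epsilon> X \<kappa>)"
    if cr: "completed_resolution \<Gamma> ?M P \<epsilon> X \<kappa>"
    for P :: "(rat, 'p) gcomplex" and \<epsilon> and X :: "(rat, 'x) gcomplex" and \<kappa>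
  proof -
    have "\<exists>\<theta> \<phi>. comparison \<Gamma> \<Gamma>.res \<Gamma>.res_aug \<Gamma>.cpl \<Gamma>.cpl_res P \<epsilon> X \<kappa> \<phi> \<theta>"
      using \<Gamma>.comparison_exists[OF R0 cr] by blast
    thus ?thesis unfolding \<Theta>_def by (rule someI_ex)
  qed
  define \<Phi> where "\<Phi> P \<epsilon> X \<kappa> n = coinv_homology_map \<Gamma> X (\<Theta> P \<epsilon> X \<kappa>) n \<circ> \<iota> n"
    for P :: "(rat, 'p) gcomplex" and \<epsilon> and X :: "(rat, 'x) gcomplex" and \<kappa> and n
  have "\<Phi> P \<epsilon> X \<kappa> n \<in> iso (sign_homology (univ_dist f) n) (coinv_homology \<Gamma> X n)"
    if cr: "completed_resolution \<Gamma> ?M P \<epsilon> X \<kappa>"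
    for P :: "(rat, 'p) gcomplex" and \<epsilon> and X :: "(rat, 'x) gcomplex" and \<kappa> n
  proof -
    obtain \<phi> where c: "comparison \<Gamma> \<Gamma>.res \<Gamma>.res_aug \<Gamma>.cpl \<Gamma>.cpl_res P \<epsilon> X \<kappa> \<phi> (\<Theta> P \<epsilon> X \<kappa>)" using \<Theta>[OF cr] by blast
    show ?thesis unfolding \<Phi>_def by (rule iso_set_trans[OF \<iota> \<Gamma>.comparison_homology_iso[OF R0 cr c]])
  qed
  moreover have "coinv_homology_map \<Gamma> Y \<theta> n (\<Phi> P \<epsilon> X \<kappa> n c) = \<Phi> Q \<epsilon>' Y \<kappa>' n c"
    if cr1: "completed_resolution \<Gamma> ?M P \<epsilon> X \<kappa>" and cr2: "completed_resolution \<Gamma> ?M Q \<epsilon>' Y \<kappa>'"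
      and \<theta>: "comparison \<Gamma> P \<epsilon> X \<kappa> Q \<epsilon>' Y \<kappa>' \<phi> \<theta>" and c: "c \<in> carrier (sign_homology (univ_dist f) n)"
    for P Q :: "(rat, 'p) gcomplex" and \<epsilon> \<epsilon>' and X Y :: "(rat, 'x) gcomplex" and \<kappa> \<kappa>' \<phi> \<theta> n c
  proof -
    obtain \<phi>1 where 1: "comparison \<Gamma> \<Gamma>.res \<Gamma>.res_aug \<Gamma>.cpl \<Gamma>.cpl_res P \<epsilon> X \<kappa> \<phi>1 (\<Theta> P \<epsilon> X \<kappa>)" using \<Theta>[OF cr1] by blast
    obtain \<phi>2 where 2: "comparison \<Gamma> \<Gamma>.res \<Gamma>.res_aug \<Gamma>.cpl \<Gamma>.cpl_res Q \<epsilon>' Y \<kappa>' \<phi>2 (\<Theta> Q \<epsilon>' Y \<kappa>')" using \<Theta>[OF cr2] by blast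
    have cl: "\<iota> n c \<in> carrier (coinv_homology \<Gamma> \<Gamma>.cpl n)" using \<iota>[of n] c by (auto simp: iso_def hom_def)
    have X: "is_gcomplex \<Gamma> X" "is_gcomplex \<Gamma> Y" using cr1 cr2 by (auto simp: completed_resolution_def completion_def)
    have maps: "gchain_map \<Gamma> \<Gamma>.cpl X (\<Theta> P \<epsilon> X \<kappa>)" "gchain_map \<Gamma> X Y \<theta>" using 1 \<theta> by (auto simp: comparison_def)
    have "coinv_homology_map \<Gamma> Y \<theta> n (coinv_homology_map \<Gamma> X (\<Theta> P \<epsilon> X \<kappa>) n (\<iota> n c))
        = coinv_homology_map \<Gamma> Y (\<lambda>n x. \<theta> n (\<Theta> P \<epsilon> X \<kappa> n x)) n (\<iota> n c)"
      by (rule coinv_homology_map_comp[OF \<Gamma>.is_gcomplex_cpl X maps cl])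
    also have "\<dots> = coinv_homology_map \<Gamma> Y (\<Theta> Q \<epsilon>' Y \<kappa>') n (\<iota> n c)"
      by (rule \<Gamma>.comparison_homology_unique[OF R0 cr2 \<Gamma>.comparison_comp[OF 1 \<theta> \<Gamma>.gchain_map_cpl_res] 2 cl])
    finally show ?thesis by (simp add: \<Phi>_def)
  qed
  ultimately show ?thesis by (intro exI[of _ \<Phi>]) blast
qed

end

theorem mainTheorem2:
  fixes f :: nat
  assumes "f > 0" and "f mod 4 \<noteq> 2"
  shows
    "(\<exists>(P :: (rat, (rat \<times> nat) \<Rightarrow>\<^sub>0 int) gcomplex) \<epsilon>
        (X :: (rat, (rat \<times> nat) \<Rightarrow>\<^sub>0 int) gcomplex) \<kappa>.
        completed_resolution (Gamma_group f) (trivial_gmod integer_group) P \<epsilon> X \<kappa>) \<and>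
     (\<exists>\<Phi>.
        (\<forall>(P :: (rat, 'p) gcomplex) \<epsilon> (X :: (rat, 'x) gcomplex) \<kappa>.
           completed_resolution (Gamma_group f) (trivial_gmod integer_group) P \<epsilon> X \<kappa> \<longrightarrow>
           (\<forall>n. \<Phi> P \<epsilon> X \<kappa> n \<in>
              iso (sign_homology (univ_dist f) n) (coinv_homology (Gamma_group f) X n))) \<and>
        (\<forall>P \<epsilon> X \<kappa> Q \<epsilon>' Y \<kappa>' \<phi> \<theta>.
           completed_resolution (Gamma_group f) (trivial_gmod integer_group) P \<epsilon> X \<kappa> \<and>
           completed_resolution (Gamma_group f) (trivial_gmod integer_group) Q \<epsilon>' Y \<kappa>' \<and>
           comparison (Gamma_group f) P \<epsilon> X \<kappa> Q \<epsilon>' Y \<kappa>' \<phi> \<theta> \<longrightarrow>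
           (\<forall>n. \<forall>c\<in>carrier (sign_homology (univ_dist f) n).
              coinv_homology_map (Gamma_group f) Y \<theta> n (\<Phi> P \<epsilon> X \<kappa> n c) = \<Phi> Q \<epsilon>' Y \<kappa>' n c)))"
proof -
  let ?P = "{p. Factorial_Ring.prime p \<and> p dvd f}"
  have fin: "finite ?P" by (rule finite_subset[of _ "{..f}"]) (use assms(1) in \<open>auto dest: dvd_imp_le\<close>)
  define qs where "qs = sorted_list_of_set (?P - {2})"
  \<comment> \<open>The prime 2 is put last, as required by \<open>two_last\<close>; for odd f it
    does not occur.\<close>
  define ps where "ps = (if even f then qs @ [2] else qs)"
  have qs: "set qs = ?P - {2}" "distinct qs" using fin by (simp_all add: qs_def)
  interpret level f ps
  proof
    show "set ps = ?P" using qs two_is_prime_nat by (auto simp: ps_def)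
    show "distinct ps" using qs by (simp add: ps_def)
    show "even f \<Longrightarrow> \<exists>qs. ps = qs @ [2]" by (simp add: ps_def)
  qed (use assms in auto)
  show ?thesis by (rule conjI, intro exI, rule \<Gamma>.completed_resolution_cpl, rule canonical_isomorphism)
qed

end
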